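(* Let $\mu$ be a Borel probability measure on the configuration space $\Upsilon=\Upsilon(\mathbb R^n)$. Consider the properties: (a) $\mu$ is tail trivial; (b) $\bar{\mathsf d}^{\mu}_{\Upsilon}(A,B)<\infty$ whenever $A\subset\Upsilon$ is $\mu$-measurable, $B\subset\Upsilon$ is Borel and $\mu(A)\mu(B)>0$; (c) $(\mathcal E^{\Upsilon,\mu},\mathcal F^{\Upsilon,\mu})$ is irreducible. Then: (1) (b) implies (a); (2) if $\mu$ is number rigid (R), then (a) implies (b). Suppose in addition that $\mu$ satisfies (CAC') and (CC), let $(\mathcal E^{\Upsilon,\mu},\mathcal D(\mathcal E^{\Upsilon,\mu}))$ be the monotone limit form (constructed from a fixed system of cores), and let $\mathcal F^{\Upsilon,\mu}\subset\mathcal D(\mathcal E^{\Upsilon,\mu})$ be any closed Markovian subspace. Then: (3) if (CI), (QR) for $\mathcal F^{\Upsilon,\mu}$, and (R) hold, then (b) implies (c); (4) if $(\mathsf{Rad}_{\bar{\mathsf d}_\Upsilon,\mu})$ holds for $\mathcal F^{\Upsilon,\mu}$, then (c) implies (b).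
   Context: **Configuration space.** $\mathsf d$ is the Euclidean distance and $\mathsf m$ the Lebesgue measure on $\mathbb R^n$. $\Upsilon=\Upsilon(\mathbb R^n)$ is the set of locally finite point measures $\gamma=\sum_{i=1}^N\delta_{x_i}$, $N\in\mathbb N_0\cup\{\infty\}$ (multiplicities allowed), with the vague topology $\tau_{\mathrm v}$ (duality with continuous compactly supported functions) and its Borel $\sigma$-algebra; "$\mu$-measurable" means measurable for the $\mu$-completion. $(B_r)_{r\in\mathbb N}$ is a fixed increasing sequence of compact convex sets with non-empty interior (convex compact domains) with $\bigcup_rB_r=\mathbb R^n$; $\mathsf m_r=\mathsf m|_{B_r}$. For Borel $E\subset\mathbb R^n$: $\gamma_E$ is the restriction of $\gamma$ to $E$, $\mathrm{pr}_E(\gamma)=\gamma_E$, $\Upsilon(E)$ is the configuration space over $E$, $\Upsilon^k(E)=\{\gamma\in\Upsilon(E):\gamma(E)=k\}\cong E^{\times k}/\mathfrak S_k$ with quotient map $\mathsf P_k$. **Distances.** $\mathsf d_\Upsilon(\gamma,\eta)=\inf_q\big(\int\mathsf d^2(x,y)\,dq(x,y)\big)^{1/2}\in[0,\infty]$, infimum over Radon measures $q$ on $\mathbb R^n\times\mathbb R^n$ with marginals $\gamma,\eta$ ($\inf\varnothing=+\infty$); the same formula is used on $\Upsilon(B_r)$. $\bar{\mathsf d}_\Upsilon(\gamma,\eta)=\mathsf d_\Upsilon(\gamma,\eta)$ if $\gamma_{B_r^c}=\eta_{B_r^c}$ for some $r$, and $+\infty$ otherwise. For $\mu$-measurable $\Xi$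 and Borel $\Lambda$: $\bar{\mathsf d}^\mu_\Upsilon(\Xi,\Lambda)=\mu\text{-}\operatorname{essinf}_{\gamma\in\Xi}\inf_{\eta\in\Lambda}\bar{\mathsf d}_\Upsilon(\gamma,\eta)$. For an extended distance $\rho$ (possibly $+\infty$), $u$ is $\rho$-Lipschitz if $|u(x)-u(y)|\le L\rho(x,y)$ for all $x,y$; $\mathrm{Lip}_\rho(u)$ is the smallest such $L$. $\mathrm{Lip}_b(\bar{\mathsf d}_\Upsilon,\mu)$ is the set of bounded $\mu$-measurable $\bar{\mathsf d}_\Upsilon$-Lipschitz functions on $\Upsilon$. **Tail triviality.** $\mu(\Xi)\in\{0,1\}$ for every $\Xi\in\bigcap_{r\in\mathbb N}\sigma(\mathrm{pr}_{B_r^c})$. **Number rigidity (R).** For every bounded Borel $E\subset\mathbb R^n$ there is $\Omega\subset\Upsilon$ with $\mu(\Omega)=1$ such that for all $\gamma,\eta\in\Omega$: $\gamma_{E^c}=\eta_{E^c}$ implies $\gamma(E)=\eta(E)$. **Conditional measures.** For $\eta\in\Upsilon$, $\mu_r^\eta=(\mathrm{pr}_{B_r})_\#\mu(\,\cdot\mid\mathrm{pr}_{B_r^c}(\cdot)=\eta_{B_r^c})$ (regular conditional probability given $\sigma(\mathrm{pr}_{B_r^c})$), a probability on $\Upsilon(B_r)$; $\mu_r^{\eta,k}$ is its restriction to $\Upsilon^k(B_r)$; $\mathcal K_r^\eta=\{k\in\mathbb N_0:\mu_r^\eta(\Upsilon^k(B_r))>0\}$. $\pi_{\mathsf m_r}$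 is the Poisson measure on $\Upsilon(B_r)$ with intensity $\mathsf m_r$. For $u:\Upsilon\to\mathbb R$, $u_r^\eta(\gamma)=u(\gamma+\eta_{B_r^c})$, $\gamma\in\Upsilon(B_r)$. **(CAC')**: for every $r\in\mathbb N$, $\mu$-a.e. $\eta$, every $k\in\mathcal K_r^\eta$, $\mu_r^{\eta,k}$ and $\pi_{\mathsf m_r}|_{\Upsilon^k(B_r)}$ are mutually absolutely continuous. **Conditioned forms, (CC), (CI).** $\nabla^{\odot k}$ is the weak gradient on $\Upsilon^k(B_r)$ induced through $\mathsf P_k$ by the weak gradient on $B_r^{\times k}$ acting on symmetric functions. $\Gamma^{\Upsilon(B_r)}(u,v)=\sum_{k\ge0}\langle\nabla^{\odot k}u|_{\Upsilon^k(B_r)},\nabla^{\odot k}v|_{\Upsilon^k(B_r)}\rangle$ (on $\Upsilon^k(B_r)$ only the $k$-th term is present), $\Gamma^{\Upsilon(B_r)}(u)=\Gamma^{\Upsilon(B_r)}(u,u)$, and $\mathcal E^{\Upsilon(B_r),\mu_r^\eta}(u)=\int\Gamma^{\Upsilon(B_r)}(u)\,d\mu_r^\eta$. (CC): for every $r$ and $\mu$-a.e. $\eta$, this form, defined on bounded $u:\Upsilon(B_r)\to\mathbb R$ with $u|_{\Upsilon^k(B_r)}$ being $\mathsf d_\Upsilon$-Lipschitz for every $k$ and $\mathcal E^{\Upsilon(B_r),\mu_r^\eta}(u)<\infty$, is closable on $L^2(\mu_r^\eta)$; its closure has domain $\mathcal D(\mathcal E^{\Upsilon(B_r),\mu_r^\eta})$.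 (CI): for every $r$, $\mu$-a.e. $\eta$ and $k\in\mathcal K_r^\eta$: if $u\in\mathcal D(\mathcal E^{\Upsilon(B_r),\mu_r^\eta})$ and $\mathcal E^{\Upsilon(B_r),\mu_r^\eta}(u)=0$, then $u|_{\Upsilon^k(B_r)}$ is $\mu_r^{\eta,k}$-a.e. equal to a constant. **Cores and truncated forms.** For $x\in\gamma$, $\mathcal U_{\gamma,x}(u)(y)=u(\mathbf 1_{\mathbb R^n\setminus\{x\}}\gamma+\delta_y)-u(\mathbf 1_{\mathbb R^n\setminus\{x\}}\gamma)$, and $\Gamma_r^\Upsilon(u)(\gamma)=\sum_{x\in\gamma_{B_r}}|\nabla\,\mathcal U_{\gamma,x}(u)|^2(x)$ ($\nabla$ the weak gradient on $B_r$). Fix algebras $\{\mathcal C_r\}_{r\in\mathbb N}$ of $\mu$-classes of measurable functions with $\mathcal C_r\supset\mathcal C_{r'}$ for $r\le r'$ and, for every $r$: $\mathcal C_r\subset L^\infty(\mu)$ is dense in $L^2(\mu)$; $\Gamma^\Upsilon_r(u)$ is well defined $\mu$-a.e. for $u\in\mathcal C_r$; for $u\in\mathcal C_r$, $u_r^\eta\in\mathcal D(\mathcal E^{\Upsilon(B_r),\mu_r^\eta})$ for $\mu$-a.e. $\eta$ and $\mathcal E_r^{\Upsilon,\mu}(u):=\int_\Upsilon\mathcal E^{\Upsilon(B_r),\mu_r^\eta}(u_r^\eta)\,d\mu(\eta)<\infty$; and $(\mathcal E_r^{\Upsilon,\mu},\mathcal C_r)$ is Markovian. Under (CAC') and (CC)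 this form is closable; $(\mathcal E_r^{\Upsilon,\mu},\mathcal D(\mathcal E_r^{\Upsilon,\mu}))$ is its closure, and $\Gamma_r^\Upsilon$ extends to $\mathcal D(\mathcal E_r^{\Upsilon,\mu})$. **Limit form.** The truncated forms increase in $r$ (domains decrease). $\mathcal D(\mathcal E^{\Upsilon,\mu})=\{u\in\bigcap_r\mathcal D(\mathcal E_r^{\Upsilon,\mu}):\lim_r\mathcal E_r^{\Upsilon,\mu}(u)<\infty\}$, $\mathcal E^{\Upsilon,\mu}(u)=\lim_r\mathcal E_r^{\Upsilon,\mu}(u)$, $\Gamma^\Upsilon(u)=\lim_r\Gamma_r^\Upsilon(u)$. **Subspaces.** A closed Markovian subspace $\mathcal F^{\Upsilon,\mu}$ is a linear subspace of $\mathcal D(\mathcal E^{\Upsilon,\mu})$, closed for the norm $(\mathcal E^{\Upsilon,\mu}(\cdot)+\|\cdot\|_{L^2(\mu)}^2)^{1/2}$, with $u_0:=0\vee u\wedge1\in\mathcal F^{\Upsilon,\mu}$ and $\mathcal E^{\Upsilon,\mu}(u_0)\le\mathcal E^{\Upsilon,\mu}(u)$ for $u\in\mathcal F^{\Upsilon,\mu}$. (QR): $(\mathcal E^{\Upsilon,\mu},\mathcal F^{\Upsilon,\mu})$ is a quasi-regular Dirichlet form on $L^2(\mu)$ with respect to $\tau_{\mathrm v}$ (in the standard sense of Ma–Röckner: existence of a compact nest; a dense subspace of the domain whose elements have quasi-continuous versions; countably many elements of the domain whose quasi-continuous versions separate points outside an exceptional set). $(\mathsf{Rad}_{\bar{\mathsf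 d}_\Upsilon,\mu})$: $\mathrm{Lip}_b(\bar{\mathsf d}_\Upsilon,\mu)\subset\mathcal F^{\Upsilon,\mu}$ and $\Gamma^\Upsilon(u)\le\mathrm{Lip}_{\bar{\mathsf d}_\Upsilon}(u)^2$ $\mu$-a.e. for $u\in\mathrm{Lip}_b(\bar{\mathsf d}_\Upsilon,\mu)$. Irreducible: $u\in\mathcal F^{\Upsilon,\mu}$ and $\mathcal E^{\Upsilon,\mu}(u)=0$ imply that $u$ is $\mu$-a.e. constant. *)

theory Defs
  imports "HOL-Probability.Probability"
begin

section \<open>Configuration space\<close>

text \<open>A point measure \<open>\<Sum>i\<in>I. \<delta>(x i)\<close> with \<open>I \<subseteq> \<nat>\<close> is the image of the counting measure on \<open>I\<close>
  under \<open>x\<close>; repeated points give multiplicities.\<close>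

definition point_measure_of :: "nat set \<Rightarrow> (nat \<Rightarrow> 'a) \<Rightarrow> 'a::euclidean_space measure" where
  "point_measure_of I x = distr (count_space I) borel x"

typedef (overloaded) 'a config =
  "{\<gamma> :: 'a::euclidean_space measure.
      (\<exists>I x. \<gamma> = point_measure_of I x) \<and> (\<forall>K. compact K \<longrightarrow> emeasure \<gamma> K < \<infinity>)}"
  morphisms meas_of Config
proof
  show "point_measure_of {} (\<lambda>_. 0) \<in> {\<gamma> :: 'a measure.
      (\<exists>I x. \<gamma> = point_measure_of I x) \<and> (\<forall>K. compact K \<longrightarrow> emeasure \<gamma> K < \<infinity>)}"
    by (auto simp: point_measure_of_def emeasure_distr compact_imp_closed borel_closed)
qed

instantiation config :: (euclidean_space) topological_space
begin

definition open_config :: "'a config set \<Rightarrow> bool" where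
  "open_config = generate_topology
     {{\<gamma>. (\<integral>x. f x \<partial>meas_of \<gamma>) \<in> U} | (f :: 'a \<Rightarrow> real) U.
        continuous_on UNIV f \<and> compact (closure {x. f x \<noteq> 0}) \<and> open U}"

instance
  by standard (auto simp: open_config_def intro: generate_topology.intros)

end

definition restr :: "'a set \<Rightarrow> 'a config \<Rightarrow> 'a::euclidean_space config" where
  "restr E \<gamma> = Config (density (meas_of \<gamma>) (indicator E))"

definition config_add :: "'a config \<Rightarrow> 'a config \<Rightarrow> 'a::euclidean_space config" where
  "config_add \<gamma> \<eta> =
     Config (measure_of UNIV (sets borel) (\<lambda>A. emeasure (meas_of \<gamma>) A + emeasure (meas_of \<eta>) A))"

text \<open>The quotient map \<open>(x\<^sub>0, \<dots>, x\<^sub>k\<^sub>-\<^sub>1) \<mapsto> \<delta>(x\<^sub>0) + \<dots> + \<delta>(x\<^sub>k\<^sub>-\<^sub>1)\<close>.\<close>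

definition pts :: "nat \<Rightarrow> (nat \<Rightarrow> 'a) \<Rightarrow> 'a::euclidean_space config" where
  "pts k x = Config (point_measure_of {..<k} x)"

definition dirac :: "'a \<Rightarrow> 'a::euclidean_space config" where
  "dirac y = pts 1 (\<lambda>_. y)"

text \<open>The configuration space over \<open>E\<close> is identified with the configurations that do not charge
  the complement of \<open>E\<close>. Accordingly, measures on it are measures on \<^type>\<open>config\<close>, and functions on it
  are functions on \<^type>\<open>config\<close> whose values elsewhere are irrelevant.\<close>

definition configs :: "'a set \<Rightarrow> 'a::euclidean_space config set" where
  "configs E = {\<gamma>. emeasure (meas_of \<gamma>) (- E) = 0}"

definition kconfigs :: "'a set \<Rightarrow> nat \<Rightarrow> 'a::euclidean_space config set" where
  "kconfigs E k = {\<gamma> \<in> configs E. emeasure (meas_of \<gamma>) E = of_nat k}"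

definition exhaustion :: "(nat \<Rightarrow> 'a::euclidean_space set) \<Rightarrow> bool" where
  "exhaustion B \<longleftrightarrow> incseq B \<and> (\<Union>r. B r) = UNIV \<and>
     (\<forall>r. compact (B r) \<and> convex (B r) \<and> interior (B r) \<noteq> {})"

subsection \<open>The operations as operations on measures\<close>

lemma meas_of_props:
  shows "\<exists>I x. meas_of \<gamma> = point_measure_of I x"
    and "compact K \<Longrightarrow> emeasure (meas_of \<gamma>) K < \<infinity>"
    and "sets (meas_of \<gamma>) = sets borel"
  using meas_of[of \<gamma>] by (auto simp: point_measure_of_def)

lemma emeasure_point_measure_of:
  "A \<in> sets borel \<Longrightarrow>
     emeasure (point_measure_of I x) A = emeasure (count_space UNIV) {i \<in> I. x i \<in> A}"
  by (simp add: point_measure_of_def emeasure_distr emeasure_count_space vimage_def Int_def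
      conj_commute)

lemma meas_of_restr:
  assumes E: "E \<in> sets borel"
  shows "meas_of (restr E \<gamma>) = density (meas_of \<gamma>) (indicator E)"
proof -
  obtain I x where Ix: "meas_of \<gamma> = point_measure_of I x"
    using meas_of_props(1) by blast
  have dens: "emeasure (density (meas_of \<gamma>) (indicator E)) A = emeasure (meas_of \<gamma>) (E \<inter> A)"
    if "A \<in> sets borel" for A
    using that E by (subst emeasure_density)
      (auto simp: meas_of_props(3) indicator_inter_arith[symmetric]
        intro!: borel_measurable_indicator)
  have "density (meas_of \<gamma>) (indicator E) = point_measure_of {i \<in> I. x i \<in> E} x"
  proof (rule measure_eqI)
    fix A assume "A \<in> sets (density (meas_of \<gamma>) (indicator E))"
    then have A: "A \<in> sets borel" by (simp add: meas_of_props(3))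
    then show "emeasure (density (meas_of \<gamma>) (indicator E)) A =
        emeasure (point_measure_of {i \<in> I. x i \<in> E} x) A"
      using E dens[OF A] by (simp add: Ix emeasure_point_measure_of conj_assoc del: emeasure_count_space)
  qed (simp add: meas_of_props(3) point_measure_of_def)
  moreover have "emeasure (density (meas_of \<gamma>) (indicator E)) K < \<infinity>" if "compact K" for K
  proof -
    have K: "K \<in> sets borel" using that by (simp add: compact_imp_closed borel_closed)
    have "emeasure (meas_of \<gamma>) (E \<inter> K) \<le> emeasure (meas_of \<gamma>) K"
      by (rule emeasure_mono) (auto simp: K meas_of_props(3))
    then show ?thesis using meas_of_props(2)[OF that, of \<gamma>] dens[OF K] by (simp add: order_le_less_trans)
  qed
  ultimately show ?thesis
    unfolding restr_def by (intro Config_inverse) blast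
qed

lemma meas_of_pts: "meas_of (pts k x) = point_measure_of {..<k} x"
  unfolding pts_def
proof (rule Config_inverse, intro CollectI conjI allI impI)
  fix K :: "'a set" assume "compact K"
  then have "K \<in> sets borel" by (simp add: compact_imp_closed borel_closed)
  then show "emeasure (point_measure_of {..<k} x) K < \<infinity>"
    by (simp add: emeasure_point_measure_of of_nat_less_top)
qed blast

lemma emeasure_config_add:
  assumes "A \<in> sets borel"
  shows "emeasure (meas_of (config_add \<gamma> \<eta>)) A = emeasure (meas_of \<gamma>) A + emeasure (meas_of \<eta>) A"
proof -
  let ?M = "measure_of UNIV (sets borel) (\<lambda>A. emeasure (meas_of \<gamma>) A + emeasure (meas_of \<eta>) A)"
  have sM: "sets ?M = sets borel"
    using sets.sets_measure_of_eq[of "borel :: 'a measure"] by simp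
  have em: "emeasure ?M A = emeasure (meas_of \<gamma>) A + emeasure (meas_of \<eta>) A"
    if "A \<in> sets borel" for A
  proof (rule emeasure_measure_of[of _ UNIV "sets borel"])
    show "countably_additive (sets ?M) (\<lambda>A. emeasure (meas_of \<gamma>) A + emeasure (meas_of \<eta>) A)"
      unfolding sM countably_additive_def
      by (auto simp: suminf_add[symmetric] suminf_emeasure meas_of_props(3))
  qed (use that in \<open>auto simp: positive_def sM\<close>)
  obtain I x where Ix: "meas_of \<gamma> = point_measure_of I x"
    using meas_of_props(1) by blast
  obtain J y where Jy: "meas_of \<eta> = point_measure_of J y"
    using meas_of_props(1) by blast
  define K where "K = (\<lambda>i. 2 * i) ` I \<union> (\<lambda>i. 2 * i + 1) ` J"
  define z where "z i = (if even i then x (i div 2) else y (i div 2))" for i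
  have "?M = point_measure_of K z"
  proof (rule measure_eqI)
    fix A assume "A \<in> sets ?M"
    then have A: "A \<in> sets borel" using sM by simp
    have split: "{i \<in> K. z i \<in> A} = (\<lambda>i. 2 * i) ` {i \<in> I. x i \<in> A} \<union> (\<lambda>i. 2 * i + 1) ` {i \<in> J. y i \<in> A}"
      by (auto simp: K_def z_def)
    have img: "emeasure (count_space UNIV) (f ` S) = emeasure (count_space UNIV) S"
      if "inj f" for f :: "nat \<Rightarrow> nat" and S
      using that by (auto simp: emeasure_count_space card_image finite_image_iff inj_on_subset)
    have "emeasure (count_space UNIV) {i \<in> K. z i \<in> A} =
        emeasure (count_space UNIV) ((\<lambda>i. 2 * i) ` {i \<in> I. x i \<in> A}) +
        emeasure (count_space UNIV) ((\<lambda>i. 2 * i + 1) ` {i \<in> J. y i \<in> A})"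
      unfolding split by (subst plus_emeasure) (auto, presburger)
    also have "\<dots> = emeasure (count_space UNIV) {i \<in> I. x i \<in> A} +
        emeasure (count_space UNIV) {i \<in> J. y i \<in> A}"
      by (subst (1 2) img) (auto intro: injI)
    finally show "emeasure ?M A = emeasure (point_measure_of K z) A"
      using A em[OF A] by (simp only: Ix Jy emeasure_point_measure_of)
  qed (simp add: sM point_measure_of_def)
  moreover have "emeasure ?M K < \<infinity>" if "compact K" for K
    using that by (subst em) (auto simp: compact_imp_closed borel_closed meas_of_props(2)[simplified])
  ultimately have "meas_of (config_add \<gamma> \<eta>) = ?M"
    unfolding config_add_def by (intro Config_inverse) blast
  then show ?thesis using em[OF assms] by simp
qed

section \<open>Distances\<close>

definition ennreal_sqrt :: "ennreal \<Rightarrow> ennreal" where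
  "ennreal_sqrt c = (if c = \<infinity> then \<infinity> else ennreal (sqrt (enn2real c)))"

definition couplings :: "'a config \<Rightarrow> 'a config \<Rightarrow> ('a \<times> 'a::euclidean_space) measure set" where
  "couplings \<gamma> \<eta> = {q. sets q = sets borel \<and> (\<forall>K. compact K \<longrightarrow> emeasure q K < \<infinity>) \<and>
     distr q borel fst = meas_of \<gamma> \<and> distr q borel snd = meas_of \<eta>}"

definition d_config :: "'a config \<Rightarrow> 'a::euclidean_space config \<Rightarrow> ennreal" where
  "d_config \<gamma> \<eta> =
     (INF q \<in> couplings \<gamma> \<eta>. ennreal_sqrt (\<integral>\<^sup>+ z. ennreal ((dist (fst z) (snd z))\<^sup>2) \<partial>q))"

definition dbar_config ::
  "(nat \<Rightarrow> 'a set) \<Rightarrow> 'a config \<Rightarrow> 'a::euclidean_space config \<Rightarrow> ennreal" where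
  "dbar_config B \<gamma> \<eta> =
     (if \<exists>r. restr (- B r) \<gamma> = restr (- B r) \<eta> then d_config \<gamma> \<eta> else \<infinity>)"

text \<open>The supremum below is the essential infimum over \<open>\<Xi>\<close> of the distance to \<open>\<Lambda>\<close>; in this form
  no measurability of the distance is presupposed.\<close>

definition dbar_sets ::
  "(nat \<Rightarrow> 'a set) \<Rightarrow> 'a config measure \<Rightarrow> 'a config set \<Rightarrow> 'a::euclidean_space config set \<Rightarrow> ennreal" where
  "dbar_sets B \<mu> \<Xi> \<Lambda> =
     Sup {c. AE \<gamma> in \<mu>. \<gamma> \<in> \<Xi> \<longrightarrow> c \<le> (INF \<eta> \<in> \<Lambda>. dbar_config B \<gamma> \<eta>)}"

text \<open>With \<open>L \<cdot> \<infinity> = \<infinity>\<close> also for \<open>L = 0\<close>, pairs at infinite distance impose no constraint.\<close>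

definition lipschitz_wrt :: "('b \<Rightarrow> 'b \<Rightarrow> ennreal) \<Rightarrow> 'b set \<Rightarrow> real \<Rightarrow> ('b \<Rightarrow> real) \<Rightarrow> bool" where
  "lipschitz_wrt \<rho> S L u \<longleftrightarrow> 0 \<le> L \<and>
     (\<forall>x\<in>S. \<forall>y\<in>S. \<rho> x y \<noteq> \<infinity> \<longrightarrow> \<bar>u x - u y\<bar> \<le> L * enn2real (\<rho> x y))"

definition lip_const :: "('b \<Rightarrow> 'b \<Rightarrow> ennreal) \<Rightarrow> ('b \<Rightarrow> real) \<Rightarrow> real" where
  "lip_const \<rho> u = Inf {L. lipschitz_wrt \<rho> UNIV L u}"

definition lip_b ::
  "(nat \<Rightarrow> 'a set) \<Rightarrow> 'a config measure \<Rightarrow> ('a::euclidean_space config \<Rightarrow> real) set" where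
  "lip_b B \<mu> = {u \<in> borel_measurable (completion \<mu>).
     (\<exists>c. \<forall>\<gamma>. \<bar>u \<gamma>\<bar> \<le> c) \<and> (\<exists>L. lipschitz_wrt (dbar_config B) UNIV L u)}"

section \<open>Properties of the measure\<close>

definition outside_algebra :: "(nat \<Rightarrow> 'a set) \<Rightarrow> nat \<Rightarrow> 'a::euclidean_space config measure" where
  "outside_algebra B r = vimage_algebra UNIV (restr (- B r)) borel"

definition tail_trivial :: "(nat \<Rightarrow> 'a set) \<Rightarrow> 'a::euclidean_space config measure \<Rightarrow> bool" where
  "tail_trivial B \<mu> \<longleftrightarrow>
     (\<forall>\<Xi> \<in> (\<Inter>r. sets (outside_algebra B r)). emeasure \<mu> \<Xi> = 0 \<or> emeasure \<mu> \<Xi> = 1)"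

definition positive_sets_finite_distance ::
  "(nat \<Rightarrow> 'a set) \<Rightarrow> 'a::euclidean_space config measure \<Rightarrow> bool" where
  "positive_sets_finite_distance B \<mu> \<longleftrightarrow>
     (\<forall>\<Xi> \<in> sets (completion \<mu>). \<forall>\<Lambda> \<in> sets borel.
        emeasure (completion \<mu>) \<Xi> * emeasure \<mu> \<Lambda> > 0 \<longrightarrow> dbar_sets B \<mu> \<Xi> \<Lambda> < \<infinity>)"

definition number_rigid :: "'a::euclidean_space config measure \<Rightarrow> bool" where
  "number_rigid \<mu> \<longleftrightarrow>
     (\<forall>E \<in> sets borel. bounded E \<longrightarrow>
        (\<exists>\<Omega> \<in> sets \<mu>. emeasure \<mu> \<Omega> = 1 \<and>
           (\<forall>\<gamma>\<in>\<Omega>. \<forall>\<eta>\<in>\<Omega>. restr (- E) \<gamma> = restr (- E) \<eta> \<longrightarrow>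
              emeasure (meas_of \<gamma>) E = emeasure (meas_of \<eta>) E)))"

text \<open>\<open>\<kappa> r\<close> is a version of the regular conditional probability of \<open>\<mu>\<close> given the configuration outside
  \<open>B r\<close>. Versions agree for almost every \<open>\<eta>\<close>, and all conditions below are of almost-everywhere type.\<close>

definition cond_prob_kernels ::
  "(nat \<Rightarrow> 'a set) \<Rightarrow> 'a config measure \<Rightarrow>
   (nat \<Rightarrow> 'a config \<Rightarrow> 'a::euclidean_space config measure) \<Rightarrow> bool" where
  "cond_prob_kernels B \<mu> \<kappa> \<longleftrightarrow>
     (\<forall>r. \<kappa> r \<in> outside_algebra B r \<rightarrow>\<^sub>M prob_algebra borel \<and>
        (\<forall>A \<in> sets borel. \<forall>S \<in> sets (outside_algebra B r).
           emeasure \<mu> (A \<inter> S) = (\<integral>\<^sup>+ \<eta>. emeasure (\<kappa> r \<eta>) A * indicator S \<eta> \<partial>\<mu>)))"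

definition cond_meas ::
  "(nat \<Rightarrow> 'a set) \<Rightarrow> (nat \<Rightarrow> 'a config \<Rightarrow> 'a config measure) \<Rightarrow> nat \<Rightarrow> 'a config \<Rightarrow>
   'a::euclidean_space config measure" where
  "cond_meas B \<kappa> r \<eta> = distr (\<kappa> r \<eta>) borel (restr (B r))"

definition restr_k :: "'a config measure \<Rightarrow> 'a set \<Rightarrow> nat \<Rightarrow> 'a::euclidean_space config measure" where
  "restr_k \<nu> E k = density \<nu> (indicator (kconfigs E k))"

definition charged_numbers ::
  "(nat \<Rightarrow> 'a set) \<Rightarrow> (nat \<Rightarrow> 'a config \<Rightarrow> 'a config measure) \<Rightarrow> nat \<Rightarrow>
   'a::euclidean_space config \<Rightarrow> nat set" where
  "charged_numbers B \<kappa> r \<eta> = {k. emeasure (cond_meas B \<kappa> r \<eta>) (kconfigs (B r) k) > 0}"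

definition cond_fun ::
  "(nat \<Rightarrow> 'a set) \<Rightarrow> nat \<Rightarrow> 'a config \<Rightarrow> ('a config \<Rightarrow> real) \<Rightarrow> 'a::euclidean_space config \<Rightarrow> real" where
  "cond_fun B r \<eta> u = (\<lambda>\<gamma>. u (config_add \<gamma> (restr (- B r) \<eta>)))"

definition leb_power :: "'a set \<Rightarrow> nat \<Rightarrow> (nat \<Rightarrow> 'a::euclidean_space) measure" where
  "leb_power E k = PiM {..<k} (\<lambda>_. density lborel (indicator E))"

text \<open>Poisson measure with intensity Lebesgue measure on a set \<open>E\<close> of finite volume: a Poisson number
  of points, independent and uniformly distributed on \<open>E\<close>.\<close>

definition poisson_config :: "'a set \<Rightarrow> 'a::euclidean_space config measure" where
  "poisson_config E = measure_of UNIV (sets borel)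
     (\<lambda>A. \<Sum>k. ennreal (exp (- measure lborel E) / fact k) *
              emeasure (distr (leb_power E k) borel (pts k)) A)"

definition CAC' ::
  "(nat \<Rightarrow> 'a set) \<Rightarrow> 'a config measure \<Rightarrow>
   (nat \<Rightarrow> 'a config \<Rightarrow> 'a::euclidean_space config measure) \<Rightarrow> bool" where
  "CAC' B \<mu> \<kappa> \<longleftrightarrow>
     (\<forall>r. AE \<eta> in \<mu>. \<forall>k \<in> charged_numbers B \<kappa> r \<eta>.
        absolutely_continuous (restr_k (cond_meas B \<kappa> r \<eta>) (B r) k)
                              (restr_k (poisson_config (B r)) (B r) k) \<and>
        absolutely_continuous (restr_k (poisson_config (B r)) (B r) k)
                              (restr_k (cond_meas B \<kappa> r \<eta>) (B r) k))"

section \<open>Weak gradients on finite powers of an open set\<close>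

text \<open>The \<open>k\<close>-fold power of the base space consists of the extensional functions on \<open>{..<k}\<close>, with the
  product topology. A smooth function is one all of whose iterated partial derivatives exist and are
  continuous, i.e. a member of a family of continuous functions closed under partial derivatives.\<close>

definition smooth_power :: "nat \<Rightarrow> ((nat \<Rightarrow> 'a::euclidean_space) \<Rightarrow> real) \<Rightarrow> bool" where
  "smooth_power k \<phi> \<longleftrightarrow>
     (\<exists>S. \<phi> \<in> S \<and> (\<forall>\<psi>\<in>S. continuous_on (PiE {..<k} (\<lambda>_. UNIV)) \<psi> \<and>
        (\<forall>i<k. \<forall>b\<in>Basis. \<exists>\<zeta>\<in>S. \<forall>x \<in> PiE {..<k} (\<lambda>_. UNIV).
           ((\<lambda>t. \<psi> (x(i := x i + t *\<^sub>R b))) has_real_derivative \<zeta> x) (at 0))))"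

definition partial_deriv ::
  "((nat \<Rightarrow> 'a) \<Rightarrow> real) \<Rightarrow> nat \<Rightarrow> 'a \<Rightarrow> (nat \<Rightarrow> 'a::euclidean_space) \<Rightarrow> real" where
  "partial_deriv \<phi> i b x = deriv (\<lambda>t. \<phi> (x(i := x i + t *\<^sub>R b))) 0"

definition test_funs :: "nat \<Rightarrow> 'a set \<Rightarrow> ((nat \<Rightarrow> 'a::euclidean_space) \<Rightarrow> real) set" where
  "test_funs k U = {\<phi>. smooth_power k \<phi> \<and>
     (\<exists>K. compact K \<and> K \<subseteq> PiE {..<k} (\<lambda>_. U) \<and> (\<forall>x \<in> PiE {..<k} (\<lambda>_. UNIV). \<phi> x \<noteq> 0 \<longrightarrow> x \<in> K))}"

definition leb_k :: "nat \<Rightarrow> (nat \<Rightarrow> 'a::euclidean_space) measure" where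
  "leb_k k = completion (PiM {..<k} (\<lambda>_. lborel))"

definition locally_integrable ::
  "nat \<Rightarrow> 'a set \<Rightarrow> ((nat \<Rightarrow> 'a::euclidean_space) \<Rightarrow> 'b::{banach, second_countable_topology}) \<Rightarrow> bool" where
  "locally_integrable k U f \<longleftrightarrow>
     (\<forall>K. compact K \<and> K \<subseteq> U \<longrightarrow> set_integrable (leb_k k) (PiE {..<k} (\<lambda>_. K)) f)"

definition weak_gradient ::
  "nat \<Rightarrow> 'a set \<Rightarrow> ((nat \<Rightarrow> 'a) \<Rightarrow> real) \<Rightarrow> ((nat \<Rightarrow> 'a) \<Rightarrow> nat \<Rightarrow> 'a::euclidean_space) \<Rightarrow> bool" where
  "weak_gradient k U f g \<longleftrightarrow>
     locally_integrable k U f \<and> (\<forall>i<k. locally_integrable k U (\<lambda>x. g x i)) \<and>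
     (\<forall>\<phi> \<in> test_funs k U. \<forall>i<k. \<forall>b\<in>Basis.
        (\<integral>x. f x * partial_deriv \<phi> i b x \<partial>leb_k k) = - (\<integral>x. (g x i \<bullet> b) * \<phi> x \<partial>leb_k k))"

section \<open>Closures of quadratic forms\<close>

text \<open>Elements of \<open>L\<^sup>2(\<nu>)\<close> are represented by functions that are measurable for the completion of
  \<open>\<nu>\<close>. A form is given by its values \<open>E u = E(u,u)\<close> in \<^type>\<open>ennreal\<close>.\<close>

definition l2_sq :: "'b measure \<Rightarrow> ('b \<Rightarrow> real) \<Rightarrow> ennreal" where
  "l2_sq \<nu> u = (\<integral>\<^sup>+ x. ennreal ((u x)\<^sup>2) \<partial>completion \<nu>)"

definition l2_space :: "'b measure \<Rightarrow> ('b \<Rightarrow> real) set" where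
  "l2_space \<nu> = {u \<in> borel_measurable (completion \<nu>). l2_sq \<nu> u < \<infinity>}"

definition l2_dense :: "'b measure \<Rightarrow> ('b \<Rightarrow> real) set \<Rightarrow> bool" where
  "l2_dense \<nu> D \<longleftrightarrow> (\<forall>u \<in> l2_space \<nu>. \<forall>e>0. \<exists>v\<in>D. l2_sq \<nu> (\<lambda>x. u x - v x) < ennreal e)"

definition form_Cauchy :: "(('b \<Rightarrow> real) \<Rightarrow> ennreal) \<Rightarrow> (nat \<Rightarrow> 'b \<Rightarrow> real) \<Rightarrow> bool" where
  "form_Cauchy E un \<longleftrightarrow>
     (\<forall>e>0. \<exists>N. \<forall>m\<ge>N. \<forall>n\<ge>N. E (\<lambda>x. un m x - un n x) < ennreal e)"

definition form_approx ::
  "'b measure \<Rightarrow> (('b \<Rightarrow> real) \<Rightarrow> ennreal) \<Rightarrow> ('b \<Rightarrow> real) set \<Rightarrow> (nat \<Rightarrow> 'b \<Rightarrow> real) \<Rightarrow> ('b \<Rightarrow> real) \<Rightarrow> bool" where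
  "form_approx \<nu> E D un u \<longleftrightarrow>
     (\<forall>n. un n \<in> D) \<and> form_Cauchy E un \<and> (\<lambda>n. l2_sq \<nu> (\<lambda>x. un n x - u x)) \<longlonglongrightarrow> 0"

definition closable_form :: "'b measure \<Rightarrow> (('b \<Rightarrow> real) \<Rightarrow> ennreal) \<Rightarrow> ('b \<Rightarrow> real) set \<Rightarrow> bool" where
  "closable_form \<nu> E D \<longleftrightarrow>
     (\<forall>un. form_approx \<nu> E D un (\<lambda>_. 0) \<longrightarrow> (\<lambda>n. E (un n)) \<longlonglongrightarrow> 0)"

definition closure_dom ::
  "'b measure \<Rightarrow> (('b \<Rightarrow> real) \<Rightarrow> ennreal) \<Rightarrow> ('b \<Rightarrow> real) set \<Rightarrow> ('b \<Rightarrow> real) set" where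
  "closure_dom \<nu> E D = {u \<in> l2_space \<nu>. \<exists>un. form_approx \<nu> E D un u}"

definition closure_form ::
  "'b measure \<Rightarrow> (('b \<Rightarrow> real) \<Rightarrow> ennreal) \<Rightarrow> ('b \<Rightarrow> real) set \<Rightarrow> ('b \<Rightarrow> real) \<Rightarrow> ennreal" where
  "closure_form \<nu> E D u =
     (THE l. \<exists>un. form_approx \<nu> E D un u \<and> (\<lambda>n. E (un n)) \<longlonglongrightarrow> l)"

section \<open>Conditioned forms\<close>

text \<open>\<open>G\<close> is a version of the square field of \<open>u\<close> and \<open>v\<close> on the configuration space over \<open>E\<close>: on the
  \<open>k\<close>-particle component it is, read through \<^const>\<open>pts\<close>, the inner product of the weak gradients of
  the symmetric functions \<open>u \<circ> pts k\<close> and \<open>v \<circ> pts k\<close>. It is unique almost everywhere with respect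
  to the image of Lebesgue measure.\<close>

definition is_square_field ::
  "'a set \<Rightarrow> ('a config \<Rightarrow> real) \<Rightarrow> ('a config \<Rightarrow> real) \<Rightarrow> ('a::euclidean_space config \<Rightarrow> real) \<Rightarrow> bool" where
  "is_square_field E u v G \<longleftrightarrow> G \<in> borel_measurable borel \<and>
     (\<forall>k. \<exists>g h. weak_gradient k (interior E) (u \<circ> pts k) g \<and> weak_gradient k (interior E) (v \<circ> pts k) h \<and>
        (AE x in leb_power E k. G (pts k x) = (\<Sum>i<k. g x i \<bullet> h x i)))"

definition square_field ::
  "'a set \<Rightarrow> ('a config \<Rightarrow> real) \<Rightarrow> ('a config \<Rightarrow> real) \<Rightarrow> 'a::euclidean_space config \<Rightarrow> real" where
  "square_field E u v = (SOME G. is_square_field E u v G)"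

definition pre_form :: "'a set \<Rightarrow> 'a config measure \<Rightarrow> ('a::euclidean_space config \<Rightarrow> real) \<Rightarrow> ennreal" where
  "pre_form E \<nu> u = (\<integral>\<^sup>+ \<gamma>. ennreal (square_field E u u \<gamma>) \<partial>\<nu>)"

definition pre_dom :: "'a set \<Rightarrow> 'a config measure \<Rightarrow> ('a::euclidean_space config \<Rightarrow> real) set" where
  "pre_dom E \<nu> = {u. (\<exists>c. \<forall>\<gamma> \<in> configs E. \<bar>u \<gamma>\<bar> \<le> c) \<and>
     (\<forall>k. \<exists>L. lipschitz_wrt d_config (kconfigs E k) L u) \<and> pre_form E \<nu> u < \<infinity>}"

definition cond_dom :: "'a set \<Rightarrow> 'a config measure \<Rightarrow> ('a::euclidean_space config \<Rightarrow> real) set" where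
  "cond_dom E \<nu> = closure_dom \<nu> (pre_form E \<nu>) (pre_dom E \<nu>)"

definition cond_form :: "'a set \<Rightarrow> 'a config measure \<Rightarrow> ('a::euclidean_space config \<Rightarrow> real) \<Rightarrow> ennreal" where
  "cond_form E \<nu> = closure_form \<nu> (pre_form E \<nu>) (pre_dom E \<nu>)"

definition CC ::
  "(nat \<Rightarrow> 'a set) \<Rightarrow> 'a config measure \<Rightarrow>
   (nat \<Rightarrow> 'a config \<Rightarrow> 'a::euclidean_space config measure) \<Rightarrow> bool" where
  "CC B \<mu> \<kappa> \<longleftrightarrow>
     (\<forall>r. AE \<eta> in \<mu>. closable_form (cond_meas B \<kappa> r \<eta>)
        (pre_form (B r) (cond_meas B \<kappa> r \<eta>)) (pre_dom (B r) (cond_meas B \<kappa> r \<eta>)))"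

definition CI ::
  "(nat \<Rightarrow> 'a set) \<Rightarrow> 'a config measure \<Rightarrow>
   (nat \<Rightarrow> 'a config \<Rightarrow> 'a::euclidean_space config measure) \<Rightarrow> bool" where
  "CI B \<mu> \<kappa> \<longleftrightarrow>
     (\<forall>r. AE \<eta> in \<mu>. \<forall>k \<in> charged_numbers B \<kappa> r \<eta>. \<forall>u \<in> cond_dom (B r) (cond_meas B \<kappa> r \<eta>).
        cond_form (B r) (cond_meas B \<kappa> r \<eta>) u = 0 \<longrightarrow>
        (\<exists>c. AE \<gamma> in restr_k (cond_meas B \<kappa> r \<eta>) (B r) k. u \<gamma> = c))"

section \<open>Truncated forms and their limit\<close>

definition point_variation ::
  "('a config \<Rightarrow> real) \<Rightarrow> 'a config \<Rightarrow> 'a \<Rightarrow> 'a::euclidean_space \<Rightarrow> real" where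
  "point_variation u \<gamma> x y = u (config_add (restr (- {x}) \<gamma>) (dirac y)) - u (restr (- {x}) \<gamma>)"

definition points_in :: "'a set \<Rightarrow> 'a::euclidean_space config \<Rightarrow> 'a set" where
  "points_in E \<gamma> = {x \<in> E. emeasure (meas_of \<gamma>) {x} > 0}"

text \<open>A weak gradient is only defined almost everywhere, so its value at a point of \<open>\<gamma>\<close> has a meaning
  for almost every \<open>\<gamma>\<close> through a version \<open>D \<omega> y\<close> of \<open>\<nabla>(y \<mapsto> u(\<omega> + \<delta>(y)) - u(\<omega>))\<close> that is jointly
  measurable in \<open>\<omega>\<close> (the configuration without the point) and \<open>y\<close>. The weak gradient on the base space
  is the case \<open>k = 1\<close> of \<^const>\<open>weak_gradient\<close>.\<close>

definition is_gradient_version ::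
  "(nat \<Rightarrow> 'a set) \<Rightarrow> 'a config measure \<Rightarrow> nat \<Rightarrow> ('a config \<Rightarrow> real) \<Rightarrow>
   ('a config \<Rightarrow> 'a \<Rightarrow> 'a::euclidean_space) \<Rightarrow> bool" where
  "is_gradient_version B \<mu> r u D \<longleftrightarrow>
     case_prod D \<in> borel_measurable (borel \<Otimes>\<^sub>M borel) \<and>
     (AE \<gamma> in \<mu>. \<forall>x \<in> points_in (B r) \<gamma>.
        weak_gradient 1 (interior (B r)) (\<lambda>y. point_variation u \<gamma> x (y 0))
          (\<lambda>y i. D (restr (- {x}) \<gamma>) (y 0)))"

definition trunc_square_field ::
  "(nat \<Rightarrow> 'a set) \<Rightarrow> 'a config measure \<Rightarrow> nat \<Rightarrow> ('a config \<Rightarrow> real) \<Rightarrow>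
   'a::euclidean_space config \<Rightarrow> real" where
  "trunc_square_field B \<mu> r u \<gamma> =
     (\<Sum>x \<in> points_in (B r) \<gamma>.
        (norm ((SOME D. is_gradient_version B \<mu> r u D) (restr (- {x}) \<gamma>) x))\<^sup>2)"

definition trunc_pre_form ::
  "(nat \<Rightarrow> 'a set) \<Rightarrow> 'a config measure \<Rightarrow> (nat \<Rightarrow> 'a config \<Rightarrow> 'a config measure) \<Rightarrow> nat \<Rightarrow>
   ('a::euclidean_space config \<Rightarrow> real) \<Rightarrow> ennreal" where
  "trunc_pre_form B \<mu> \<kappa> r u =
     (\<integral>\<^sup>+ \<eta>. cond_form (B r) (cond_meas B \<kappa> r \<eta>) (cond_fun B r \<eta> u) \<partial>completion \<mu>)"

text \<open>For a form that need not be closed, the Markov property is stated with smoothed unit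
  contractions (Fukushima); the unit contraction itself is an instance.\<close>

definition markovian_pre_form :: "(('b \<Rightarrow> real) \<Rightarrow> ennreal) \<Rightarrow> ('b \<Rightarrow> real) set \<Rightarrow> bool" where
  "markovian_pre_form E D \<longleftrightarrow>
     (\<forall>e>0. \<exists>\<phi> :: real \<Rightarrow> real.
        (\<forall>t \<in> {0..1}. \<phi> t = t) \<and> (\<forall>t. - e \<le> \<phi> t \<and> \<phi> t \<le> 1 + e) \<and>
        (\<forall>s t. s \<le> t \<longrightarrow> 0 \<le> \<phi> t - \<phi> s \<and> \<phi> t - \<phi> s \<le> t - s) \<and>
        (\<forall>u\<in>D. (\<lambda>x. \<phi> (u x)) \<in> D \<and> E (\<lambda>x. \<phi> (u x)) \<le> E u))"

definition class_saturated :: "'b measure \<Rightarrow> ('b \<Rightarrow> real) set \<Rightarrow> bool" where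
  "class_saturated \<mu> D \<longleftrightarrow> D \<subseteq> borel_measurable (completion \<mu>) \<and>
     (\<forall>u\<in>D. \<forall>v \<in> borel_measurable (completion \<mu>). (AE x in \<mu>. u x = v x) \<longrightarrow> v \<in> D)"

definition linear_subspace :: "('b \<Rightarrow> real) set \<Rightarrow> bool" where
  "linear_subspace D \<longleftrightarrow> (\<lambda>_. 0) \<in> D \<and>
     (\<forall>u\<in>D. \<forall>v\<in>D. (\<lambda>x. u x + v x) \<in> D) \<and> (\<forall>c. \<forall>u\<in>D. (\<lambda>x. c * u x) \<in> D)"

text \<open>The last three conjuncts say that the integral defining the truncated form is meaningful and
  finite, and that the truncated square field is the square field of the truncated form. The latter is
  what makes the square field extend from the core to the domain of the closure.\<close>

definition core_system ::
  "(nat \<Rightarrow> 'a set) \<Rightarrow> 'a config measure \<Rightarrow> (nat \<Rightarrow> 'a config \<Rightarrow> 'a config measure) \<Rightarrow>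
   (nat \<Rightarrow> ('a::euclidean_space config \<Rightarrow> real) set) \<Rightarrow> bool" where
  "core_system B \<mu> \<kappa> C \<longleftrightarrow>
     (\<forall>r r'. r \<le> r' \<longrightarrow> C r' \<subseteq> C r) \<and>
     (\<forall>r. class_saturated \<mu> (C r) \<and> linear_subspace (C r) \<and>
        (\<forall>u\<in>C r. \<forall>v\<in>C r. (\<lambda>\<gamma>. u \<gamma> * v \<gamma>) \<in> C r) \<and>
        (\<forall>u\<in>C r. \<exists>c. AE \<gamma> in \<mu>. \<bar>u \<gamma>\<bar> \<le> c) \<and>
        l2_dense \<mu> (C r) \<and>
        markovian_pre_form (trunc_pre_form B \<mu> \<kappa> r) (C r) \<and>
        (\<forall>u\<in>C r.
           (\<exists>D. is_gradient_version B \<mu> r u D) \<and>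
           (AE \<eta> in \<mu>. cond_fun B r \<eta> u \<in> cond_dom (B r) (cond_meas B \<kappa> r \<eta>)) \<and>
           (\<lambda>\<eta>. cond_form (B r) (cond_meas B \<kappa> r \<eta>) (cond_fun B r \<eta> u))
             \<in> borel_measurable (completion \<mu>) \<and> trunc_pre_form B \<mu> \<kappa> r u < \<infinity> \<and>
           trunc_pre_form B \<mu> \<kappa> r u =
             (\<integral>\<^sup>+ \<gamma>. ennreal (trunc_square_field B \<mu> r u \<gamma>) \<partial>completion \<mu>)))"

definition trunc_dom ::
  "(nat \<Rightarrow> 'a set) \<Rightarrow> 'a config measure \<Rightarrow> (nat \<Rightarrow> 'a config \<Rightarrow> 'a config measure) \<Rightarrow>
   (nat \<Rightarrow> ('a config \<Rightarrow> real) set) \<Rightarrow> nat \<Rightarrow> ('a::euclidean_space config \<Rightarrow> real) set" where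
  "trunc_dom B \<mu> \<kappa> C r = closure_dom \<mu> (trunc_pre_form B \<mu> \<kappa> r) (C r)"

definition trunc_form ::
  "(nat \<Rightarrow> 'a set) \<Rightarrow> 'a config measure \<Rightarrow> (nat \<Rightarrow> 'a config \<Rightarrow> 'a config measure) \<Rightarrow>
   (nat \<Rightarrow> ('a config \<Rightarrow> real) set) \<Rightarrow> nat \<Rightarrow> ('a::euclidean_space config \<Rightarrow> real) \<Rightarrow> ennreal" where
  "trunc_form B \<mu> \<kappa> C r = closure_form \<mu> (trunc_pre_form B \<mu> \<kappa> r) (C r)"

text \<open>Extension of the truncated square field to the domain of the closure by continuity
  into \<open>L\<^sup>1(\<mu>)\<close>.\<close>

definition is_trunc_square_field_ext ::
  "(nat \<Rightarrow> 'a set) \<Rightarrow> 'a config measure \<Rightarrow> (nat \<Rightarrow> 'a config \<Rightarrow> 'a config measure) \<Rightarrow>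
   (nat \<Rightarrow> ('a config \<Rightarrow> real) set) \<Rightarrow> nat \<Rightarrow> ('a config \<Rightarrow> real) \<Rightarrow>
   ('a::euclidean_space config \<Rightarrow> real) \<Rightarrow> bool" where
  "is_trunc_square_field_ext B \<mu> \<kappa> C r u G \<longleftrightarrow> G \<in> borel_measurable (completion \<mu>) \<and>
     (\<exists>un. form_approx \<mu> (trunc_pre_form B \<mu> \<kappa> r) (C r) un u \<and>
        (\<lambda>n. \<integral>\<^sup>+ \<gamma>. ennreal \<bar>trunc_square_field B \<mu> r (un n) \<gamma> - G \<gamma>\<bar> \<partial>completion \<mu>) \<longlonglongrightarrow> 0)"

definition trunc_square_field_ext ::
  "(nat \<Rightarrow> 'a set) \<Rightarrow> 'a config measure \<Rightarrow> (nat \<Rightarrow> 'a config \<Rightarrow> 'a config measure) \<Rightarrow>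
   (nat \<Rightarrow> ('a config \<Rightarrow> real) set) \<Rightarrow> nat \<Rightarrow> ('a config \<Rightarrow> real) \<Rightarrow>
   'a::euclidean_space config \<Rightarrow> real" where
  "trunc_square_field_ext B \<mu> \<kappa> C r u = (SOME G. is_trunc_square_field_ext B \<mu> \<kappa> C r u G)"

definition limit_form ::
  "(nat \<Rightarrow> 'a set) \<Rightarrow> 'a config measure \<Rightarrow> (nat \<Rightarrow> 'a config \<Rightarrow> 'a config measure) \<Rightarrow>
   (nat \<Rightarrow> ('a config \<Rightarrow> real) set) \<Rightarrow> ('a::euclidean_space config \<Rightarrow> real) \<Rightarrow> ennreal" where
  "limit_form B \<mu> \<kappa> C u = lim (\<lambda>r. trunc_form B \<mu> \<kappa> C r u)"

definition limit_dom ::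
  "(nat \<Rightarrow> 'a set) \<Rightarrow> 'a config measure \<Rightarrow> (nat \<Rightarrow> 'a config \<Rightarrow> 'a config measure) \<Rightarrow>
   (nat \<Rightarrow> ('a config \<Rightarrow> real) set) \<Rightarrow> ('a::euclidean_space config \<Rightarrow> real) set" where
  "limit_dom B \<mu> \<kappa> C = {u \<in> (\<Inter>r. trunc_dom B \<mu> \<kappa> C r). limit_form B \<mu> \<kappa> C u < \<infinity>}"

definition limit_square_field ::
  "(nat \<Rightarrow> 'a set) \<Rightarrow> 'a config measure \<Rightarrow> (nat \<Rightarrow> 'a config \<Rightarrow> 'a config measure) \<Rightarrow>
   (nat \<Rightarrow> ('a config \<Rightarrow> real) set) \<Rightarrow> ('a config \<Rightarrow> real) \<Rightarrow>
   'a::euclidean_space config \<Rightarrow> real" where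
  "limit_square_field B \<mu> \<kappa> C u \<gamma> = lim (\<lambda>r. trunc_square_field_ext B \<mu> \<kappa> C r u \<gamma>)"

section \<open>Closed Markovian subspaces and quasi-regularity\<close>

definition form_norm_sq :: "'b measure \<Rightarrow> (('b \<Rightarrow> real) \<Rightarrow> ennreal) \<Rightarrow> ('b \<Rightarrow> real) \<Rightarrow> ennreal" where
  "form_norm_sq \<mu> E u = E u + l2_sq \<mu> u"

definition unit_contractive :: "(('b \<Rightarrow> real) \<Rightarrow> ennreal) \<Rightarrow> ('b \<Rightarrow> real) set \<Rightarrow> bool" where
  "unit_contractive E F \<longleftrightarrow>
     (\<forall>u\<in>F. (\<lambda>x. min (max 0 (u x)) 1) \<in> F \<and> E (\<lambda>x. min (max 0 (u x)) 1) \<le> E u)"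

definition closed_markovian_subspace ::
  "'b measure \<Rightarrow> (('b \<Rightarrow> real) \<Rightarrow> ennreal) \<Rightarrow> ('b \<Rightarrow> real) set \<Rightarrow> ('b \<Rightarrow> real) set \<Rightarrow> bool" where
  "closed_markovian_subspace \<mu> E D F \<longleftrightarrow>
     F \<subseteq> D \<and> class_saturated \<mu> F \<and> linear_subspace F \<and>
     (\<forall>un. \<forall>u\<in>D. (\<forall>n. un n \<in> F) \<and> (\<lambda>n. form_norm_sq \<mu> E (\<lambda>x. un n x - u x)) \<longlonglongrightarrow> 0 \<longrightarrow> u \<in> F) \<and>
     unit_contractive E F"

definition dirichlet_form :: "'b measure \<Rightarrow> (('b \<Rightarrow> real) \<Rightarrow> ennreal) \<Rightarrow> ('b \<Rightarrow> real) set \<Rightarrow> bool" where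
  "dirichlet_form \<mu> E F \<longleftrightarrow>
     F \<subseteq> l2_space \<mu> \<and> class_saturated \<mu> F \<and> linear_subspace F \<and> l2_dense \<mu> F \<and>
     (\<forall>u\<in>F. E u < \<infinity>) \<and>
     (\<forall>u\<in>F. \<forall>v\<in>F. E (\<lambda>x. u x + v x) + E (\<lambda>x. u x - v x) = 2 * E u + 2 * E v) \<and>
     (\<forall>c. \<forall>u\<in>F. E (\<lambda>x. c * u x) = ennreal (c\<^sup>2) * E u) \<and>
     (\<forall>un. (\<forall>n. un n \<in> F) \<and> form_Cauchy (form_norm_sq \<mu> E) un \<longrightarrow>
        (\<exists>u\<in>F. (\<lambda>n. form_norm_sq \<mu> E (\<lambda>x. un n x - u x)) \<longlonglongrightarrow> 0)) \<and>
     unit_contractive E F"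

definition form_dense ::
  "'b measure \<Rightarrow> (('b \<Rightarrow> real) \<Rightarrow> ennreal) \<Rightarrow> ('b \<Rightarrow> real) set \<Rightarrow> ('b \<Rightarrow> real) set \<Rightarrow> bool" where
  "form_dense \<mu> E F S \<longleftrightarrow> S \<subseteq> F \<and>
     (\<forall>u\<in>F. \<forall>e>0. \<exists>v\<in>S. form_norm_sq \<mu> E (\<lambda>x. u x - v x) < ennreal e)"

definition form_nest ::
  "'b::topological_space measure \<Rightarrow> (('b \<Rightarrow> real) \<Rightarrow> ennreal) \<Rightarrow> ('b \<Rightarrow> real) set \<Rightarrow> (nat \<Rightarrow> 'b set) \<Rightarrow> bool" where
  "form_nest \<mu> E F K \<longleftrightarrow> incseq K \<and> (\<forall>n. closed (K n)) \<and>
     form_dense \<mu> E F (\<Union>n. {u \<in> F. AE x in \<mu>. x \<notin> K n \<longrightarrow> u x = 0})"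

definition exceptional ::
  "'b::topological_space measure \<Rightarrow> (('b \<Rightarrow> real) \<Rightarrow> ennreal) \<Rightarrow> ('b \<Rightarrow> real) set \<Rightarrow> 'b set \<Rightarrow> bool" where
  "exceptional \<mu> E F N \<longleftrightarrow> (\<exists>K. form_nest \<mu> E F K \<and> N \<subseteq> (\<Inter>n. - K n))"

definition quasi_continuous ::
  "'b::topological_space measure \<Rightarrow> (('b \<Rightarrow> real) \<Rightarrow> ennreal) \<Rightarrow> ('b \<Rightarrow> real) set \<Rightarrow> ('b \<Rightarrow> real) \<Rightarrow> bool" where
  "quasi_continuous \<mu> E F f \<longleftrightarrow> (\<exists>K. form_nest \<mu> E F K \<and> (\<forall>n. continuous_on (K n) f))"

definition qc_version ::
  "'b::topological_space measure \<Rightarrow> (('b \<Rightarrow> real) \<Rightarrow> ennreal) \<Rightarrow> ('b \<Rightarrow> real) set \<Rightarrow>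
   ('b \<Rightarrow> real) \<Rightarrow> ('b \<Rightarrow> real) \<Rightarrow> bool" where
  "qc_version \<mu> E F u f \<longleftrightarrow> quasi_continuous \<mu> E F f \<and> (AE x in \<mu>. f x = u x)"

definition quasi_regular_dirichlet_form ::
  "'b::topological_space measure \<Rightarrow> (('b \<Rightarrow> real) \<Rightarrow> ennreal) \<Rightarrow> ('b \<Rightarrow> real) set \<Rightarrow> bool" where
  "quasi_regular_dirichlet_form \<mu> E F \<longleftrightarrow> dirichlet_form \<mu> E F \<and>
     (\<exists>K. form_nest \<mu> E F K \<and> (\<forall>n. compact (K n))) \<and>
     (\<exists>S. form_dense \<mu> E F S \<and> (\<forall>u\<in>S. \<exists>f. qc_version \<mu> E F u f)) \<and>
     (\<exists>un fn N. (\<forall>n::nat. un n \<in> F \<and> qc_version \<mu> E F (un n) (fn n)) \<and> exceptional \<mu> E F N \<and>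
        (\<forall>x\<in>- N. \<forall>y\<in>- N. x \<noteq> y \<longrightarrow> (\<exists>n. fn n x \<noteq> fn n y)))"

definition irreducible_form :: "'b measure \<Rightarrow> (('b \<Rightarrow> real) \<Rightarrow> ennreal) \<Rightarrow> ('b \<Rightarrow> real) set \<Rightarrow> bool" where
  "irreducible_form \<mu> E F \<longleftrightarrow> (\<forall>u\<in>F. E u = 0 \<longrightarrow> (\<exists>c. AE x in \<mu>. u x = c))"

definition rademacher ::
  "(nat \<Rightarrow> 'a set) \<Rightarrow> 'a config measure \<Rightarrow> (nat \<Rightarrow> 'a config \<Rightarrow> 'a config measure) \<Rightarrow>
   (nat \<Rightarrow> ('a config \<Rightarrow> real) set) \<Rightarrow> ('a::euclidean_space config \<Rightarrow> real) set \<Rightarrow> bool" where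
  "rademacher B \<mu> \<kappa> C F \<longleftrightarrow> lip_b B \<mu> \<subseteq> F \<and>
     (\<forall>u \<in> lip_b B \<mu>. AE \<gamma> in \<mu>.
        limit_square_field B \<mu> \<kappa> C u \<gamma> \<le> (lip_const (dbar_config B) u)\<^sup>2)"

end

theory Submission
  imports Defs
begin

text \<open>A tail event and its complement are at infinite distance, which gives (1); under rigidity
  tail-equivalent configurations have the same number of points inside, hence finite distance, which
  gives (2). Measurability of saturations comes from compactness: a set of positive measure contains a
  compact set of configurations, and the set of all configurations tail-equivalent to it, or at finite
  distance from it, is \<open>\<sigma>\<close>-compact.

  For (3) and (4), the closed truncated form of \<open>u\<close> is the integral over the outer configuration of
  the closed conditioned forms, and it increases with the ball, because two versions of the point-wise
  gradient agree almost everywhere by (CAC') and Fubini. If the limit form of \<open>u\<close> vanishes, then (CI)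
  and rigidity make \<open>u\<close> constant given the outer configuration, so its level sets are tail events up to
  null sets. Conversely, the indicator of a saturation under finite distance is Lipschitz with constant
  \<open>0\<close> and constant on the components of each conditioned configuration space; hence its energy is \<open>0\<close>.

  That the conditioned pre-forms are quadratic needs a square field for every Lipschitz function. Convex
  combinations of its difference quotients converge almost everywhere (Mazur), with weights that depend
  only on the number of points, which makes the limit a measurable function of the configuration.\<close>

text \<open>The topology on configurations is given only by a subbasis of vague neighbourhoods. What
  makes it workable is that counts are integers: a vague neighbourhood contains every configuration
  with the same counts in finitely many small cells, so counts generate the Borel sets. Saturations
  are projections, in general merely analytic, and for finite distance there is one more obstacle:
  full row sums of a coupling matrix are not a closed condition, since mass may escape to infinity.
  A Chebyshev bound on the escaping mass, available because the cost is bounded, restores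
  closedness. Square fields and closed forms are picked by \<open>SOME\<close> and
  \<open>THE\<close>; hence a Borel square field must exist before anything can be computed, and all
  approximating sequences must give the same limit. Forms are handled through their values on the
  diagonal and through E(u - v) <= (1 + d) E u + (1 + 1/d) E v for all d > 0, which is preserved by
  closure and by integration over the outer configuration. Statement (3) is obtained as (b) implies
  (a) implies (c).\<close>

abbreviation cube :: "nat => 'b set => (nat => 'b) set" where
 "cube k E \<equiv> PiE {..<k} (%_. E)"

abbreviation cnt :: "'a::euclidean_space config => 'a set => ennreal" where
 "cnt \<gamma> A \<equiv> emeasure (meas_of \<gamma>) A"

section \<open>Configurations as locally finite indexed families of points\<close>

definition locfin :: "nat set => (nat => 'a::euclidean_space) => bool" where
 "locfin I x \<longleftrightarrow> (\<forall>K. compact K --> finite {i \<in> I. x i \<in> K})"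

definition cfg :: "nat set => (nat => 'a) => 'a::euclidean_space config" where
 "cfg I x = Config (point_measure_of I x)"

lemma sets_meas_of [simp, measurable_cong]: "sets (meas_of g) = sets borel"
 by (rule meas_of_props(3))

lemma space_meas_of [simp]: "space (meas_of g) = UNIV"
 using sets_eq_imp_space_eq[OF sets_meas_of[of g]] by simp

lemma meas_of_cfg:
 assumes "locfin I x" shows "meas_of (cfg I x) = point_measure_of I x"
 unfolding cfg_def
proof (rule Config_inverse, intro CollectI conjI allI impI)
 fix K :: "'a set" assume K: "compact K"
 then have "finite {i \<in> I. x i \<in> K}" using assms by (auto simp: locfin_def)
 moreover have "K \<in> sets borel" using K by (simp add: compact_imp_closed borel_closed)
 ultimately show "emeasure (point_measure_of I x) K < \<infinity>"
  by (simp add: emeasure_point_measure_of of_nat_less_top)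
qed blast

text \<open>Finite mass on compact sets is local finiteness of the family, because an infinite index
  set has infinite counting measure. All later computations with a configuration are done on such an
  index set \<open>I\<close> and point map \<open>x\<close>.\<close>

lemma config_cases: obtains I x where "locfin I x" "g = cfg I x"
proof -
 obtain I x where Ix: "meas_of g = point_measure_of I x"
  using meas_of_props(1) by blast
 have "finite {i \<in> I. x i \<in> K}" if K: "compact K" for K
 proof (rule ccontr)
  assume inf: "infinite {i \<in> I. x i \<in> K}"
  have "K \<in> sets borel" using K by (simp add: compact_imp_closed borel_closed)
  then have "emeasure (meas_of g) K = \<infinity>" using inf by (simp add: Ix emeasure_point_measure_of)
  then show False using meas_of_props(2)[OF K, of g] by simp
 qed
 moreover have "g = cfg I x" unfolding cfg_def Ix[symmetric] by (simp add: meas_of_inverse)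
 ultimately show thesis using that by (auto simp: locfin_def)
qed

lemma locfin_pts: "locfin {..<k} x"
 by (auto simp: locfin_def)

lemma pts_eq_cfg: "pts k x = cfg {..<k} x"
 by (simp add: pts_def cfg_def)

lemma cnt_cfg:
 assumes "locfin I x" "A \<in> sets borel"
 shows "cnt (cfg I x) A = emeasure (count_space UNIV) {i \<in> I. x i \<in> A}"
 using assms by (simp add: meas_of_cfg emeasure_point_measure_of)

lemma cnt_cfg_suminf:
 assumes "locfin I x" "A \<in> sets borel"
 shows "cnt (cfg I x) A = (\<Sum>i. indicator I i * indicator A (x i))"
proof -
 have "cnt (cfg I x) A = (\<integral>\<^sup>+ i. indicator {i \<in> I. x i \<in> A} i \<partial>count_space UNIV)"
  using assms by (simp add: cnt_cfg)
 also have "\<dots> = (\<Sum>i. indicator {i \<in> I. x i \<in> A} i)"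
  by (rule nn_integral_count_space_nat)
 also have "(%i. indicator {i \<in> I. x i \<in> A} i :: ennreal) = (%i. indicator I i * indicator A (x i))"
  by (auto simp: fun_eq_iff indicator_def)
 finally show ?thesis .
qed

lemma config_eqI:
 assumes "\<And>A. A \<in> sets borel ==> cnt g A = cnt c A" shows "g = c"
proof -
 have "meas_of g = meas_of c" by (rule measure_eqI) (use assms in auto)
 then show ?thesis by (simp add: meas_of_inject)
qed

lemma cnt_bounded_finite:
 assumes "bounded A" shows "cnt g A < \<infinity>"
proof -
 have "compact (closure A)" using assms by simp
 then have "cnt g (closure A) < \<infinity>" by (rule meas_of_props(2))
 moreover have "cnt g A \<le> cnt g (closure A)"
  by (rule emeasure_mono) (auto simp: closure_subset)
 ultimately show ?thesis by (rule order_le_less_trans[rotated])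
qed

lemma cnt_restr:
 assumes "E \<in> sets borel" "A \<in> sets borel" shows "cnt (restr E g) A = cnt g (E \<inter> A)"
 using assms by (simp add: meas_of_restr emeasure_density indicator_inter_arith[symmetric])

lemma restr_restr:
 assumes "E \<in> sets borel" "F \<in> sets borel" shows "restr E (restr F g) = restr (E \<inter> F) g"
 by (rule config_eqI) (use assms in \<open>auto simp: cnt_restr Int_ac\<close>)

lemma config_add_restr:
 assumes "E \<in> sets borel" shows "config_add (restr E g) (restr (- E) g) = g"
proof (rule config_eqI)
 fix A :: "'a set" assume A: "A \<in> sets borel"
 have "A = (E \<inter> A) \<union> (- E \<inter> A)" by auto
 then have "cnt g A = cnt g (E \<inter> A) + cnt g (- E \<inter> A)"
  using A assms by (subst plus_emeasure) (auto simp: Compl_eq_Diff_UNIV)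
 then show "cnt (config_add (restr E g) (restr (- E) g)) A = cnt g A"
  using A assms by (simp add: emeasure_config_add cnt_restr Compl_eq_Diff_UNIV)
qed

lemma cnt_restr_cfg: "locfin I x ==> E \<in> sets borel ==> restr E (cfg I x) = cfg {i \<in> I. x i \<in> E} x"
proof (rule config_eqI)
 fix A :: "'a set" assume "locfin I x" and E: "E \<in> sets borel" and A: "A \<in> sets borel"
 moreover from this have "locfin {i \<in> I. x i \<in> E} x"
  by (auto simp: locfin_def intro: rev_finite_subset)
 ultimately show "cnt (restr E (cfg I x)) A = cnt (cfg {i \<in> I. x i \<in> E} x) A"
  by (simp add: cnt_restr cnt_cfg conj_assoc del: emeasure_count_space)
qed

lemma cfg_reindex:
 assumes "bij_betw h J I" "locfin I x" shows "locfin J (x \<circ> h)" "cfg J (x \<circ> h) = cfg I x"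
proof -
 have bij: "bij_betw h {j \<in> J. x (h j) \<in> A} {i \<in> I. x i \<in> A}" for A
  using assms(1) by (auto simp: bij_betw_def inj_on_def)
 show lf: "locfin J (x \<circ> h)"
  using assms(2) bij_betw_finite[OF bij] by (auto simp: locfin_def)
 show "cfg J (x \<circ> h) = cfg I x"
  using bij_betw_finite[OF bij] bij_betw_same_card[OF bij]
  by (intro config_eqI) (simp add: cnt_cfg lf assms(2) emeasure_count_space)
qed

lemma cfg_cong: "(\<And>i. i \<in> I ==> x i = y i) ==> cfg I x = cfg I y"
 unfolding cfg_def point_measure_of_def by (rule arg_cong[of _ _ Config], rule distr_cong) auto

lemma config_add_pts_cfg:
 fixes x y :: "nat => 'a::euclidean_space" and k N :: nat
 assumes "locfin I y" "k \<le> N"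
 defines "J \<equiv> {..<k} \<union> (+) N ` I" and "z \<equiv> %i. if i < N then x i else y (i - N)"
 shows "locfin J z" "config_add (pts k x) (cfg I y) = cfg J z"
proof -
 have split: "{i \<in> J. z i \<in> A} = {i \<in> {..<k}. x i \<in> A} \<union> (+) N ` {i \<in> I. y i \<in> A}" for A
  using assms(2) by (auto simp: J_def z_def)
 show lf: "locfin J z"
  using assms(1) unfolding locfin_def split by auto
 show "config_add (pts k x) (cfg I y) = cfg J z"
 proof (rule config_eqI)
  fix A :: "'a set" assume A: "A \<in> sets borel"
  have "emeasure (count_space UNIV) {i \<in> J. z i \<in> A} =
    emeasure (count_space UNIV) {i \<in> {..<k}. x i \<in> A} + emeasure (count_space UNIV) ((+) N ` {i \<in> I. y i \<in> A})"
   unfolding split using assms(2) by (subst plus_emeasure) auto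
  also have "emeasure (count_space UNIV) ((+) N ` {i \<in> I. y i \<in> A}) = emeasure (count_space UNIV) {i \<in> I. y i \<in> A}"
   by (simp add: emeasure_count_space card_image finite_image_iff)
  finally show "cnt (config_add (pts k x) (cfg I y)) A = cnt (cfg J z) A"
   using A lf assms(1) locfin_pts[of k x] by (simp only: emeasure_config_add pts_eq_cfg cnt_cfg)
 qed
qed

lemma restr_finite_pts:
 assumes "E \<in> sets borel" "cnt g E < \<infinity>"
 obtains k x where "restr E g = pts k x" "\<And>i. i < k ==> x i \<in> E" "cnt g E = of_nat k"
proof -
 obtain I y where Iy: "locfin I y" "g = cfg I y" by (rule config_cases)
 define J where "J = {i \<in> I. y i \<in> E}"
 have c: "cnt g E = emeasure (count_space UNIV) J"
  using Iy assms(1) by (simp add: cnt_cfg J_def)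
 then have fin: "finite J" using assms(2) by (auto simp: emeasure_count_space split: if_splits)
 then obtain h where h: "bij_betw h {..<card J} J" by (metis bij_betw_from_nat_into_finite)
 have lf: "locfin J y" using fin by (auto simp: locfin_def)
 have "restr E g = cfg J y" using Iy assms(1) by (simp add: cnt_restr_cfg J_def)
 also have "\<dots> = pts (card J) (y \<circ> h)" using cfg_reindex(2)[OF h lf] by (simp add: pts_eq_cfg)
 finally have 1: "restr E g = pts (card J) (y \<circ> h)" .
 have 2: "(y \<circ> h) i \<in> E" if "i < card J" for i
  using h that by (auto simp: bij_betw_def J_def)
 show thesis by (rule that[OF 1 2]) (use c fin in auto)
qed

section \<open>The Borel sets of the configuration space\<close>

definition test_cc :: "('a::euclidean_space => real) => bool" where
 "test_cc f \<longleftrightarrow> continuous_on UNIV f \<and> compact (closure {x. f x \<noteq> 0})"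

lemma open_integral_config: "test_cc f ==> open U ==> open {g. (\<integral>x. f x \<partial>meas_of g) \<in> U}"
 unfolding open_config_def test_cc_def by (intro generate_topology.Basis) blast

lemma continuous_integral_config: "test_cc f ==> continuous_on S (%g. (\<integral>x. f x \<partial>meas_of g))"
 unfolding continuous_on_open_invariant using open_integral_config by (auto simp: vimage_def)

lemma measurable_integral_config:
 "test_cc f ==> (%g. (\<integral>x. f x \<partial>meas_of g)) \<in> borel_measurable borel"
 by (rule borel_measurableI) (auto simp: vimage_def intro: borel_open open_integral_config)

text \<open>Compactly supported continuous functions increasing to the indicator of an open set
  \<open>U\<close>. Boundedness of \<open>U\<close> gives the compact support; it also makes the
  complement nonempty, where the convention \<open>infdist x {} = 0\<close> would give the zero
  function.\<close>

definition bump :: "'a::euclidean_space set => nat => 'a => real" where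
 "bump U n x = min 1 (real n * infdist x (- U))"

lemma bump_outside: "x \<notin> U ==> bump U n x = 0"
 by (simp add: bump_def)

lemma bump_mono: "m \<le> n ==> bump U m x \<le> bump U n x"
 unfolding bump_def by (intro min.mono mult_right_mono) (auto simp: infdist_nonneg)

lemma bump_bounds: "0 \<le> bump U n x" "bump U n x \<le> 1"
 by (auto simp: bump_def infdist_nonneg)

lemma bump_cc: "bounded U ==> test_cc (bump U n)"
proof -
 assume "bounded U"
 moreover have "{x. bump U n x \<noteq> 0} \<subseteq> U"
  using bump_outside by blast
 ultimately have "compact (closure {x. bump U n x \<noteq> 0})"
  using bounded_subset by auto
 then show ?thesis by (auto simp: test_cc_def bump_def intro!: continuous_intros)
qed

lemma nn_integral_bump:
 assumes "bounded U"
 shows "(\<integral>\<^sup>+ x. ennreal (bump U n x) \<partial>meas_of g) = ennreal (\<integral>x. bump U n x \<partial>meas_of g)"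
proof (rule nn_integral_eq_integral)
 have [measurable]: "bump U n \<in> borel_measurable borel"
  using bump_cc[OF assms, of n] by (auto simp: test_cc_def intro: borel_measurable_continuous_onI)
 have "integrable (meas_of g) (%x. indicator (closure U) x :: real)"
  using cnt_bounded_finite[of "closure U" g] assms by (intro integrable_real_indicator) auto
 then show "integrable (meas_of g) (bump U n)"
  by (rule Bochner_Integration.integrable_bound)
   (use closure_subset[of U] in \<open>auto simp: bump_bounds bump_outside indicator_def subset_eq intro!: AE_I2\<close>)
qed (auto simp: bump_bounds)

lemma cnt_open_eq_SUP:
 assumes "bounded U" "open U"
 shows "cnt g U = (SUP n. ennreal (\<integral>x. bump U n x \<partial>meas_of g))"
proof -
 have [measurable]: "bump U n \<in> borel_measurable borel" for n
  using bump_cc[OF assms(1), of n] by (auto simp: test_cc_def intro: borel_measurable_continuous_onI)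
 have ne: "- U \<noteq> {}"
  using assms(1) by (metis Compl_empty_eq double_complement not_bounded_UNIV)
 have sup: "(SUP n. ennreal (bump U n x)) = indicator U x" for x
 proof (cases "x \<in> U")
  case False
  then show ?thesis by (simp add: bump_def)
 next
  case True
  then have "infdist x (- U) \<noteq> 0"
   using ne assms(2) in_closed_iff_infdist_zero[of "- U" x] by (auto simp: closed_Compl)
  then have pos: "infdist x (- U) > 0" using infdist_nonneg[of x "- U"] by linarith
  obtain n :: nat where "1 / infdist x (- U) \<le> real n" using real_arch_simple by blast
  then have "bump U n x = 1" using pos by (simp add: bump_def field_simps)
  then have "1 \<le> (SUP n. ennreal (bump U n x))" by (metis SUP_upper UNIV_I ennreal_1)
  moreover have "(SUP n. ennreal (bump U n x)) \<le> 1" by (rule SUP_least) (simp add: bump_def)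
  ultimately show ?thesis using True by auto
 qed
 have "cnt g U = (\<integral>\<^sup>+ x. (SUP n. ennreal (bump U n x)) \<partial>meas_of g)"
  using assms(2) by (simp add: sup)
 also have "\<dots> = (SUP n. (\<integral>\<^sup>+ x. ennreal (bump U n x) \<partial>meas_of g))"
 proof (rule nn_integral_monotone_convergence_SUP)
  show "incseq (%n x. ennreal (bump U n x))"
   by (auto simp: incseq_def le_fun_def intro!: ennreal_leI bump_mono)
 qed auto
 finally show ?thesis by (simp add: nn_integral_bump[OF assms(1)])
qed

text \<open>Finite intersections of a fixed countable base: intersection stable for Dynkin
  arguments, and still countable, so that countably many bump integrals determine a
  configuration.\<close>

definition open_base :: "'a::euclidean_space set set" where
 "open_base = {\<Inter>F |F. finite F \<and> F \<subseteq> (SOME B. countable B \<and> topological_basis B)}"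

lemma open_base:
 shows "countable (open_base :: 'a::euclidean_space set set)"
  and "U \<in> (open_base :: 'a set set) ==> open U" and "Int_stable (open_base :: 'a set set)"
  and "(UNIV :: 'a set) \<in> open_base" and "sets borel = sigma_sets UNIV (open_base :: 'a set set)"
proof -
 define B where "B = (SOME B :: 'a set set. countable B \<and> topological_basis B)"
 have B: "countable B \<and> topological_basis B" unfolding B_def
  by (rule someI_ex) (use ex_countable_basis in blast)
 have eq: "open_base = {\<Inter>F |F. finite F \<and> F \<subseteq> B}" by (simp add: open_base_def B_def)
 have "open_base = Inter ` {F. finite F \<and> F \<subseteq> B}" unfolding eq by auto
 then show "countable (open_base :: 'a set set)"
  using countable_Collect_finite_subset[of B] B by (metis countable_image)
 show op: "open U" if "U \<in> (open_base :: 'a set set)" for U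
  using that B topological_basis_open[of B] unfolding eq by (auto intro!: open_Inter)
 show "Int_stable (open_base :: 'a set set)"
  unfolding eq Int_stable_def
 proof safe
  fix F G assume "finite F" "F \<subseteq> B" "finite G" "G \<subseteq> B"
  then show "\<exists>H. \<Inter>F \<inter> \<Inter>G = \<Inter>H \<and> finite H \<and> H \<subseteq> B"
   by (intro exI[of _ "F \<union> G"]) auto
 qed
 show "(UNIV :: 'a set) \<in> open_base" unfolding eq by (auto intro!: exI[of _ "{}"])
 have sub: "B \<subseteq> open_base" unfolding eq by (auto intro!: exI[of _ "{_}"])
 have "sets borel = sigma_sets UNIV B"
  using borel_eq_countable_basis[of B] B by (metis Pow_UNIV sets_measure_of subset_UNIV)
 also have "\<dots> \<subseteq> sigma_sets UNIV open_base" using sub by (rule sigma_sets_mono')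
 finally have 1: "sets borel \<subseteq> sigma_sets UNIV (open_base :: 'a set set)" .
 have "sigma_sets UNIV open_base \<subseteq> sets (borel :: 'a measure)"
  using op sets.sigma_sets_subset[of open_base "borel :: 'a measure"] by (auto simp: subset_eq)
 then show "sets borel = sigma_sets UNIV (open_base :: 'a set set)" using 1 by auto
qed

lemma bounded_open_base_ball: "bounded (U \<inter> ball 0 r)" "U \<in> open_base ==> open (U \<inter> ball 0 r)"
 by (auto intro: open_base bounded_subset[OF bounded_ball])

lemma cnt_eq_SUP_ball:
 assumes "A \<in> sets borel" shows "cnt g A = (SUP N. cnt g (A \<inter> ball 0 (real N)))"
proof -
 have "(SUP N. cnt g (A \<inter> ball 0 (real N))) = cnt g (\<Union>N. A \<inter> ball 0 (real N))"
  using assms by (intro SUP_emeasure_incseq) (auto simp: incseq_def)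
 also have "(\<Union>N. A \<inter> ball 0 (real N)) = A" by (auto simp: reals_Archimedean2)
 finally show ?thesis by simp
qed

text \<open>Counts of bounded open sets are suprema of bump integrals, and a Dynkin argument reaches
  all Borel sets. It runs inside a fixed ball because the complement step subtracts masses, which
  must be finite. The source \<open>M\<close> is arbitrary, so that the lemma also serves for
  algebras much coarser than the Borel one.\<close>

lemma measurable_cnt_family:
 fixes f :: "'t => 'a::euclidean_space config"
 assumes "\<And>U N n. U \<in> open_base ==>
  (%t. \<integral>x. bump (U \<inter> ball 0 (real N)) n x \<partial>meas_of (f t)) \<in> borel_measurable M"
  and A: "A \<in> sets borel"
 shows "(%t. cnt (f t) A) \<in> borel_measurable M"
proof -
 have "(%t. cnt (f t) (A \<inter> ball 0 (real N))) \<in> borel_measurable M" for N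
 proof -
  have "open_base \<subseteq> Pow (UNIV :: 'a set)" by simp
  from open_base(3) this A[unfolded open_base(5)] show ?thesis
  proof (induction rule: sigma_sets_induct_disjoint)
   case (basic U)
   then show ?case using assms(1)
    by (subst cnt_open_eq_SUP) (auto simp: bounded_open_base_ball)
  next
   case (compl A)
   then have "A \<in> sets borel" by (simp add: open_base(5))
   moreover have "(UNIV - A) \<inter> ball 0 (real N) = ball 0 (real N) - (A \<inter> ball 0 (real N))" by auto
   ultimately have "cnt (f t) ((UNIV - A) \<inter> ball 0 (real N)) =
     cnt (f t) (UNIV \<inter> ball 0 (real N)) - cnt (f t) (A \<inter> ball 0 (real N))" for t
    using cnt_bounded_finite[of "A \<inter> ball 0 (real N)" "f t"] bounded_open_base_ball(1)[of A "real N"]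
    by (simp, subst emeasure_Diff) auto
   moreover have "(%t. cnt (f t) (UNIV \<inter> ball 0 (real N))) \<in> borel_measurable M"
   proof (subst cnt_open_eq_SUP)
    show "(%t. SUP n. ennreal (\<integral>x. bump (UNIV \<inter> ball 0 (real N)) n x \<partial>meas_of (f t))) \<in> borel_measurable M"
     using assms(1)[OF open_base(4)] by measurable
   qed auto
   ultimately show ?case using compl by simp
  next
   case (union A)
   then have "A i \<in> sets borel" for i by (auto simp: open_base(5))
   moreover have "disjoint_family (%i. A i \<inter> ball 0 (real N))"
    using union by (auto simp: disjoint_family_on_def)
   ultimately have "cnt (f t) ((\<Union>i. A i) \<inter> ball 0 (real N)) = (\<Sum>i. cnt (f t) (A i \<inter> ball 0 (real N)))" for t
    by (subst suminf_emeasure) (auto simp: Int_UN_distrib2)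
   then show ?case using union by simp
  qed simp
 qed
 then show ?thesis by (subst cnt_eq_SUP_ball[OF A]) simp
qed

lemma measurable_cnt [measurable]:
 "A \<in> sets borel ==> (%g. cnt g A) \<in> borel_measurable borel"
 by (rule measurable_cnt_family) (auto intro!: measurable_integral_config bump_cc bounded_open_base_ball)

section \<open>Countable partitions into small cells and measurability by counting\<close>

definition dense_seq :: "nat => 'a::euclidean_space" where
 "dense_seq = (SOME d. closure (range d) = UNIV)"

text \<open>For fixed \<open>m\<close> the balls of radius 1/(m+1) around a dense sequence, made
  disjoint: a countable Borel partition of the whole space into sets of diameter at most
  2/(m+1).\<close>

definition cell :: "nat => nat => 'a::euclidean_space set" where
 "cell m j = ball (dense_seq j) (1 / (real m + 1)) - (\<Union>i<j. ball (dense_seq i) (1 / (real m + 1)))"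

lemma dense_seq: "closure (range (dense_seq :: nat => 'a::euclidean_space)) = UNIV"
 unfolding dense_seq_def
proof (rule someI_ex[where P = "%d :: nat => 'a. closure (range d) = UNIV"])
 obtain D :: "'a set" where D: "countable D" "\<And>X. open X ==> X \<noteq> {} ==> \<exists>d\<in>D. d \<in> X"
  by (rule countable_dense_setE) blast
 then have "D \<noteq> {}" by (metis UNIV_not_empty empty_iff open_UNIV)
 have "x \<in> closure D" for x
  unfolding closure_iff_nhds_not_empty using D(2) by (metis disjoint_iff empty_iff subsetD)
 then have "closure D = UNIV" by blast
 then show "\<exists>d :: nat => 'a. closure (range d) = UNIV"
  using range_from_nat_into[OF \<open>D \<noteq> {}\<close> D(1)] by (intro exI[of _ "from_nat_into D"]) simp
qed

lemma cell_borel [measurable, simp]: "cell m j \<in> sets borel"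
 by (auto simp: cell_def)

lemma ball_dense_seq: assumes "e > 0" obtains j where "dist (dense_seq j) x < e"
proof -
 have "x \<in> closure (range dense_seq)" by (simp add: dense_seq)
 then show thesis using assms that unfolding closure_approachable by blast
qed

lemma cell_cover: "\<exists>j. x \<in> cell m j"
proof -
 define P where "P j \<longleftrightarrow> x \<in> ball (dense_seq j) (1 / (real m + 1))" for j
 obtain j where "P j" using ball_dense_seq[of "1 / (real m + 1)" x] by (auto simp: P_def)
 then obtain k where "P k" "\<And>i. i < k ==> \<not> P i"
  by (metis (no_types) exists_least_iff)
 then have "x \<in> cell m k" by (auto simp: cell_def P_def)
 then show ?thesis by blast
qed

lemma cell_disjoint: "x \<in> cell m i ==> x \<in> cell m j ==> i = j"
 by (rule linorder_cases[of i j]) (auto simp: cell_def)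

lemma cell_dist: "x \<in> cell m j ==> dist (dense_seq j) x < 1 / (real m + 1)"
 by (auto simp: cell_def)

lemma cnt_cell_finite: "cnt g (cell m j) < \<infinity>"
 by (rule cnt_bounded_finite, rule bounded_subset[OF bounded_ball]) (auto simp: cell_def)

text \<open>Finitely many of the balls cover \<open>K\<close>. A cell excludes all earlier balls, so
  a cell that meets \<open>K\<close> cannot come after the last ball of the finite cover.\<close>

lemma cell_compact_finite:
 assumes "compact K" shows "finite {j. cell m j \<inter> K \<noteq> {}}"
proof -
 have "K \<subseteq> (\<Union>j. ball (dense_seq j) (1 / (real m + 1)))"
 proof
  fix x :: 'a show "x \<in> (\<Union>j. ball (dense_seq j) (1 / (real m + 1)))"
   using cell_cover[of x m] cell_dist by (auto simp: mem_ball)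
 qed
 then obtain J where J: "finite J" "K \<subseteq> (\<Union>j\<in>J. ball (dense_seq j) (1 / (real m + 1)))"
  by (rule compactE_image[OF assms, rotated 1]) auto
 have "{j. cell m j \<inter> K \<noteq> {}} \<subseteq> {..Max (insert 0 J)}"
 proof
  fix j assume "j \<in> {j. cell m j \<inter> K \<noteq> {}}"
  then obtain x where x: "x \<in> cell m j" "x \<in> K" by auto
  then obtain i where i: "i \<in> J" "x \<in> ball (dense_seq i) (1 / (real m + 1))" using J by blast
  then have "\<not> i < j" using x(1) by (auto simp: cell_def)
  then have "j \<le> i" by simp
  also have "i \<le> Max (insert 0 J)" using i J by simp
  finally show "j \<in> {..Max (insert 0 J)}" by simp
 qed
 then show ?thesis by (rule finite_subset) simp
qed

definition same_cells :: "nat => 'a::euclidean_space config => 'a config => bool" where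
 "same_cells M g c \<longleftrightarrow> (\<forall>m\<le>M. \<forall>j\<le>M. cnt g (cell m j) = cnt c (cell m j))"

text \<open>A Riemann sum over the cells: its error is the oscillation \<open>v\<close> of
  \<open>f\<close> on a cell times the mass of the cells involved.\<close>

lemma integral_test_step:
 assumes f: "test_cc f" and J: "finite J" and cov: "{x. f x \<noteq> 0} \<subseteq> (\<Union>j\<in>J. cell m j)"
  and small: "\<And>j x. j \<in> J ==> x \<in> cell m j ==> \<bar>f x - c j\<bar> \<le> v"
 shows "\<bar>(\<integral>x. f x \<partial>meas_of w) - (\<Sum>j\<in>J. c j * enn2real (cnt w (cell m j)))\<bar> \<le>
  v * (\<Sum>j\<in>J. enn2real (cnt w (cell m j)))"
proof -
 have fin: "cnt w (cell m j) < \<infinity>" for j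
  by (rule cnt_bounded_finite, rule bounded_subset[OF bounded_ball]) (auto simp: cell_def)
 have int: "integrable (meas_of w) (%x. indicator (cell m j) x :: real)" for j
  using fin by (intro integrable_real_indicator) auto
 have fm [measurable]: "f \<in> borel_measurable borel"
  using f by (auto simp: test_cc_def intro: borel_measurable_continuous_onI)
 have v: "\<bar>f x - (\<Sum>j\<in>J. c j * indicator (cell m j) x)\<bar> \<le> (\<Sum>j\<in>J. v * indicator (cell m j) x)" for x
 proof (cases "\<exists>j\<in>J. x \<in> cell m j")
  case True
  then obtain j where j: "j \<in> J" "x \<in> cell m j" by blast
  have "(\<Sum>i\<in>J. g i * indicator (cell m i) x) = g j" for g :: "nat => real"
  proof -
   have "(\<Sum>i\<in>J. g i * indicator (cell m i) x) = (\<Sum>i\<in>J. if i = j then g i else 0)"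
   proof (rule sum.cong)
    fix i
    show "g i * indicator (cell m i) x = (if i = j then g i else 0)"
     using j(2) cell_disjoint[OF j(2), of i] by (cases "i = j") (auto simp: indicator_def)
   qed simp
   also have "\<dots> = g j" using J j(1) by simp
   finally show ?thesis .
  qed
  then show ?thesis using small[OF j] by simp
 next
  case False
  then have "f x = 0" using cov by blast
  moreover have "(\<Sum>i\<in>J. g i * indicator (cell m i) x) = 0" for g :: "nat => real"
   using False by (intro sum.neutral) auto
  ultimately show ?thesis by simp
 qed
 have int2: "integrable (meas_of w) (%x. (\<Sum>j\<in>J. g j * indicator (cell m j) x) :: real)" for g
  by (intro Bochner_Integration.integrable_sum Bochner_Integration.integrable_mult_right int)
 have intd: "integrable (meas_of w) (%x. f x - (\<Sum>j\<in>J. c j * indicator (cell m j) x))"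
  by (rule Bochner_Integration.integrable_bound[OF int2[of "%_. v"]])
   (use v in \<open>auto intro!: AE_I2 intro: order_trans[OF _ abs_ge_self]\<close>)
 have intf: "integrable (meas_of w) f"
  using Bochner_Integration.integrable_add[OF intd int2[of c]] by simp
 have eq: "(\<integral>x. (\<Sum>j\<in>J. g j * indicator (cell m j) x) \<partial>meas_of w) = (\<Sum>j\<in>J. g j * enn2real (cnt w (cell m j)))" for g
  by (subst Bochner_Integration.integral_sum) (auto intro!: int simp: measure_def)
 have "(\<integral>x. f x \<partial>meas_of w) - (\<Sum>j\<in>J. c j * enn2real (cnt w (cell m j))) =
   (\<integral>x. f x - (\<Sum>j\<in>J. c j * indicator (cell m j) x) \<partial>meas_of w)"
  by (subst Bochner_Integration.integral_diff[OF intf int2]) (simp add: eq)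
 also have "\<bar>\<dots>\<bar> \<le> (\<integral>x. (\<Sum>j\<in>J. v * indicator (cell m j) x) \<partial>meas_of w)"
  by (rule order_trans[OF integral_abs_bound integral_mono])
   (use v intd int2[of "%_. v"] in \<open>auto intro: Bochner_Integration.integrable_abs\<close>)
 also have "\<dots> = v * (\<Sum>j\<in>J. enn2real (cnt w (cell m j)))"
  by (simp add: eq sum_distrib_left)
 finally show ?thesis .
qed

text \<open>This replaces a countable base of the vague topology. By uniform continuity the integral
  of a test function is a Riemann sum over finitely many cells up to a small error, and
  configurations with equal counts in these cells have equal Riemann sums.\<close>

lemma open_contains_same_cells:
 assumes "open S" "g \<in> S" shows "\<exists>M. \<forall>c. same_cells M g c --> c \<in> S"
 using assms(1)[unfolded open_config_def] assms(2)
proof (induction rule: generate_topology.induct)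
 case (Int A B)
 then obtain M N where "\<forall>c. same_cells M g c --> c \<in> A" "\<forall>c. same_cells N g c --> c \<in> B" by blast
 then show ?case by (intro exI[of _ "max M N"]) (auto simp: same_cells_def)
next
 case (UN K)
 then show ?case by blast
next
 case (Basis S)
 from Basis(1) have "\<exists>(f :: 'a => real) U. S = {g. (\<integral>x. f x \<partial>meas_of g) \<in> U} \<and>
  continuous_on UNIV f \<and> compact (closure {x. f x \<noteq> 0}) \<and> open U"
  by (rule CollectD)
 then obtain f :: "'a => real" and U where "S = {g. (\<integral>x. f x \<partial>meas_of g) \<in> U} \<and>
  continuous_on UNIV f \<and> compact (closure {x. f x \<noteq> 0}) \<and> open U" by (elim exE)
 then have S: "S = {g. (\<integral>x. f x \<partial>meas_of g) \<in> U}"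
  and f: "continuous_on UNIV f" "compact (closure {x. f x \<noteq> 0})" and U: "open U"
  by simp_all
 have fcc: "test_cc f" using f by (simp add: test_cc_def)
 obtain e where e: "e > 0" "ball (\<integral>x. f x \<partial>meas_of g) e \<subseteq> U"
  using U Basis S by (auto elim: openE)
 define K where "K = closure {x. f x \<noteq> 0}"
 obtain R where R: "K \<subseteq> ball 0 R"
  using compact_imp_bounded[OF f(2)] bounded_subset_ballD[of _ 0] unfolding K_def by blast
 \<comment> \<open>Cells meeting the support \<open>K\<close> have diameter below 2, so they stay in
   the ball of radius \<open>R + 2\<close>, and \<open>N0\<close> bounds their total mass under
   \<open>g\<close>. The Riemann sums of \<open>g\<close> and \<open>c\<close> each err by at most
   \<open>v * N0\<close>; the value of \<open>v\<close> makes twice this smaller than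
   \<open>e\<close>.\<close>
 define N0 where "N0 = enn2real (cnt g (ball 0 (R + 2)))"
 define v where "v = e / (2 * (N0 + 1))"
 have N0: "N0 \<ge> 0" by (simp add: N0_def)
 have v: "v > 0" using e N0 by (simp add: v_def)
 have "uniformly_continuous_on (cball 0 (R + 3)) f"
  by (rule compact_uniformly_continuous) (auto intro: continuous_on_subset[OF f(1)])
 then obtain d where d: "d > 0"
  "\<And>x y. x \<in> cball 0 (R + 3) ==> y \<in> cball 0 (R + 3) ==> dist y x < d ==> dist (f y) (f x) < v"
  using v unfolding uniformly_continuous_on_def by metis
 obtain m :: nat where m: "1 / (real m + 1) < d"
  using reals_Archimedean[OF d(1)] by (auto simp: inverse_eq_divide add.commute)
 define J where "J = {j. cell m j \<inter> K \<noteq> {}}"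
 have J: "finite J" using cell_compact_finite[OF f(2)] by (simp add: J_def K_def)
 define M where "M = Max (insert m J)"
 have cellJ: "norm (dense_seq j :: 'a) < R + 1" if jJ: "j \<in> J" for j
 proof -
  obtain x where x: "x \<in> cell m j" "x \<in> K" using jJ by (auto simp: J_def)
  have "norm (dense_seq j :: 'a) \<le> norm x + dist (dense_seq j) x"
   by (simp add: dist_norm norm_triangle_sub)
  moreover have "dist (dense_seq j) x < 1" using cell_dist[OF x(1)]
   by (rule order.strict_trans2) (simp add: field_simps)
  ultimately show ?thesis using R x(2) by (auto simp: subset_eq)
 qed
 have cellJ2: "norm x < R + 2" if "j \<in> J" "x \<in> cell m j" for j and x :: 'a
 proof -
  have "norm x \<le> norm (dense_seq j :: 'a) + dist (dense_seq j) x"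
   by (subst dist_commute) (simp add: dist_norm norm_triangle_sub)
  moreover have "dist (dense_seq j) x < 1" using cell_dist[OF that(2)]
   by (rule order.strict_trans2) (simp add: field_simps)
  ultimately show ?thesis using cellJ[OF that(1)] by linarith
 qed
 have small: "\<bar>f x - f (dense_seq j)\<bar> \<le> v" if "j \<in> J" "x \<in> cell m j" for j x
 proof -
  have "dist (f x) (f (dense_seq j)) < v"
   using cellJ[OF that(1)] cellJ2[OF that] cell_dist[OF that(2)] m
   by (intro d(2)) (auto simp: dist_commute)
  then show ?thesis by (simp add: dist_real_def)
 qed
 have cov: "{x. f x \<noteq> 0} \<subseteq> (\<Union>j\<in>J. cell m j)"
 proof
  fix x assume x: "x \<in> {x. f x \<noteq> 0}"
  then have "x \<in> K" using closure_subset[of "{x. f x \<noteq> 0}"] by (auto simp: K_def)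
  then show "x \<in> (\<Union>j\<in>J. cell m j)" using cell_cover[of x m] by (auto simp: J_def)
 qed
 have "(\<Sum>j\<in>J. enn2real (cnt g (cell m j))) = enn2real (\<Sum>j\<in>J. cnt g (cell m j))"
  using cnt_cell_finite[of g m] by (simp add: enn2real_sum less_top)
 also have "(\<Sum>j\<in>J. cnt g (cell m j)) = cnt g (\<Union>j\<in>J. cell m j)"
  using J by (intro sum_emeasure) (auto simp: disjoint_family_on_def dest: cell_disjoint)
 also have "enn2real \<dots> \<le> N0"
  unfolding N0_def using cnt_bounded_finite[of "ball 0 (R + 2)" g]
  by (intro enn2real_mono emeasure_mono) (auto simp: cellJ2)
 finally have sumN0: "(\<Sum>j\<in>J. enn2real (cnt g (cell m j))) \<le> N0" .
 have "c \<in> S" if "same_cells M g c" for c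
 proof -
  have eq: "cnt c (cell m j) = cnt g (cell m j)" if "j \<in> J" for j
  proof -
   have "m \<le> M" "j \<le> M" using that J by (auto simp: M_def)
   then show ?thesis using \<open>same_cells M g c\<close> by (simp add: same_cells_def)
  qed
  have st: "\<bar>(\<integral>x. f x \<partial>meas_of w) - (\<Sum>j\<in>J. f (dense_seq j) * enn2real (cnt w (cell m j)))\<bar> \<le>
    v * (\<Sum>j\<in>J. enn2real (cnt w (cell m j)))" for w
   by (rule integral_test_step[OF fcc J cov small])
  have "v * (\<Sum>j\<in>J. enn2real (cnt g (cell m j))) \<le> v * N0"
   using sumN0 v by (intro mult_left_mono) auto
  then have "\<bar>(\<integral>x. f x \<partial>meas_of g) - (\<integral>x. f x \<partial>meas_of c)\<bar> \<le> 2 * (v * N0)"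
   using st[of g] st[of c] by (simp add: eq cong: sum.cong)
  also have "\<dots> < e" using e N0 by (simp add: v_def field_simps)
  finally have "(\<integral>x. f x \<partial>meas_of c) \<in> ball (\<integral>x. f x \<partial>meas_of g) e" by (simp add: dist_real_def)
  then show ?thesis using e(2) by (auto simp: S)
 qed
 then show ?case by blast
qed simp

text \<open>An open set is the union over \<open>N\<close> of the count patterns on the first cells
  that force membership. Counts of cells are natural numbers, so only countably many patterns exist
  for each \<open>N\<close>.\<close>

lemma measurable_configI:
 fixes f :: "'t => 'a::euclidean_space config"
 assumes cm: "\<And>A. A \<in> sets borel ==> (%t. cnt (f t) A) \<in> borel_measurable M"
 shows "f \<in> borel_measurable M"
proof (rule borel_measurableI)
 fix S :: "'a config set" assume S: "open S"
 define V where "V N g = {t \<in> space M. \<forall>m\<le>N. \<forall>j\<le>N. cnt (f t) (cell m j) = g (m, j)}" for N g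
 define G where "G N = (%c. restrict (%(m, j). cnt c (cell m j)) ({..N} \<times> {..N})) ` {c. \<forall>w. same_cells N c w --> w \<in> S}" for N
 have cnt_nat: "cnt c (cell m j) \<in> range of_nat" for c :: "'a config" and m j
 proof -
  have "cnt c (cell m j) < \<infinity>"
   by (rule cnt_bounded_finite, rule bounded_subset[OF bounded_ball]) (auto simp: cell_def)
  then show ?thesis by (rule restr_finite_pts[OF cell_borel]) auto
 qed
 have "G N \<subseteq> PiE ({..N} \<times> {..N}) (%_. range of_nat)" for N
  using cnt_nat by (auto simp: G_def PiE_def Pi_def simp del: restrict_apply')
 then have cG: "countable (G N)" for N
  by (rule countable_subset) (auto intro!: countable_PiE)
 have "f -` S \<inter> space M = (\<Union>N. \<Union>g\<in>G N. V N g)"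
 proof (intro set_eqI iffI)
  fix t assume "t \<in> f -` S \<inter> space M"
  then have t: "t \<in> space M" "f t \<in> S" by auto
  obtain N where "\<forall>w. same_cells N (f t) w --> w \<in> S"
   using open_contains_same_cells[OF S t(2)] by blast
  then show "t \<in> (\<Union>N. \<Union>g\<in>G N. V N g)"
   using t(1) by (auto simp: G_def V_def intro!: exI[of _ N] bexI[of _ "f t"])
 next
  fix t assume "t \<in> (\<Union>N. \<Union>g\<in>G N. V N g)"
  then obtain N c where 1: "\<forall>w. same_cells N c w --> w \<in> S"
   and 2: "t \<in> V N (restrict (%(m, j). cnt c (cell m j)) ({..N} \<times> {..N}))"
   unfolding G_def by blast
  have "t \<in> space M" "same_cells N c (f t)" using 2 by (auto simp: V_def same_cells_def)
  with 1 show "t \<in> f -` S \<inter> space M" by auto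
 qed
 moreover have "V N g \<in> sets M" for N g
  unfolding V_def using cm by measurable
 ultimately show "f -` S \<inter> space M \<in> sets M"
  using cG by (auto intro!: sets.countable_UN')
qed

lemma measurable_config_family:
 assumes "\<And>U N n. U \<in> open_base ==>
  (%t. \<integral>x. bump (U \<inter> ball 0 (real N)) n x \<partial>meas_of (f t)) \<in> borel_measurable M"
 shows "f \<in> borel_measurable M"
 by (rule measurable_configI, rule measurable_cnt_family) (use assms in auto)

lemma config_eqI_bump:
 fixes g c :: "'a::euclidean_space config"
 assumes "\<And>U N n. U \<in> open_base ==>
  (\<integral>x. bump (U \<inter> ball 0 (real N)) n x \<partial>meas_of g) = (\<integral>x. bump (U \<inter> ball 0 (real N)) n x \<partial>meas_of c)"
 shows "g = c"
proof (rule config_eqI)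
 text \<open>The map swapping \<open>g\<close> and \<open>c\<close> is measurable for the trivial \<open>\<sigma>\<close>-algebra.\<close>
 fix A :: "'a set" assume A: "A \<in> sets borel"
 have "(%t. cnt (if t then g else c) A) \<in> borel_measurable (sigma (UNIV :: bool set) {})"
 proof (rule measurable_cnt_family[OF _ A])
  fix U :: "'a set" and N n assume "U \<in> open_base"
  then have "(%t. \<integral>x. bump (U \<inter> ball 0 (real N)) n x \<partial>meas_of (if t then g else c)) =
    (%t. \<integral>x. bump (U \<inter> ball 0 (real N)) n x \<partial>meas_of g)"
   using assms by auto
  then show "(%t. \<integral>x. bump (U \<inter> ball 0 (real N)) n x \<partial>meas_of (if t then g else c))
    \<in> borel_measurable (sigma UNIV {})" by simp
 qed
 then have "(%t. cnt (if t then g else c) A) -` {cnt g A} \<inter> UNIV \<in> sets (sigma (UNIV :: bool set) {})"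
  by (metis measurable_sets borel_singleton sets.empty_sets space_measure_of_conv sets.insert_in_sets)
 then have "(%t. cnt (if t then g else c) A) -` {cnt g A} \<in> {{}, UNIV}"
  by (simp add: sigma_sets_empty_eq)
 moreover have "True \<in> (%t. cnt (if t then g else c) A) -` {cnt g A}" by simp
 ultimately have "False \<in> (%t. cnt (if t then g else c) A) -` {cnt g A}"
  by (metis UNIV_I empty_iff insertE singletonD)
 then show "cnt g A = cnt c A" by simp
qed

text \<open>In a Hausdorff space compact sets are closed, hence Borel; this is how the saturations
  of compact sets will be measured.\<close>

instance config :: (euclidean_space) t2_space
proof
 fix \<gamma> \<eta> :: "'a config" assume "\<gamma> \<noteq> \<eta>"
 then obtain U :: "'a set" and N n where
  ne: "(\<integral>x. bump (U \<inter> ball 0 (real N)) n x \<partial>meas_of \<gamma>) \<noteq> (\<integral>x. bump (U \<inter> ball 0 (real N)) n x \<partial>meas_of \<eta>)"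
  using config_eqI_bump by blast
 define f where "f = bump (U \<inter> ball 0 (real N)) n"
 have cc: "test_cc f" unfolding f_def by (rule bump_cc) (rule bounded_open_base_ball)
 obtain V W where VW: "open V" "open W" "(\<integral>x. f x \<partial>meas_of \<gamma>) \<in> V" "(\<integral>x. f x \<partial>meas_of \<eta>) \<in> W" "V \<inter> W = {}"
  using hausdorff[OF ne] unfolding f_def by blast
 then show "\<exists>U V. open U \<and> open V \<and> \<gamma> \<in> U \<and> \<eta> \<in> V \<and> U \<inter> V = {}"
  using open_integral_config[OF cc VW(1)] open_integral_config[OF cc VW(2)]
  by (intro exI[of _ "{\<gamma>. (\<integral>x. f x \<partial>meas_of \<gamma>) \<in> V}"] exI[of _ "{\<gamma>. (\<integral>x. f x \<partial>meas_of \<gamma>) \<in> W}"]) auto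
qed

lemma compact_config_borel: "compact (S :: 'a::euclidean_space config set) ==> S \<in> sets borel"
 by (simp add: compact_imp_closed borel_closed)

lemma measurable_cnt' [measurable (raw)]:
 "f \<in> borel_measurable M ==> A \<in> sets borel ==> (%t. cnt (f t) A) \<in> borel_measurable M"
 by (rule measurable_compose[OF _ measurable_cnt])

lemma measurable_restr [measurable]: "E \<in> sets borel ==> restr E \<in> borel_measurable borel"
 by (rule measurable_configI) (simp add: cnt_restr)

lemma measurable_config_add [measurable (raw)]:
 assumes [measurable]: "f \<in> borel_measurable M" "g \<in> borel_measurable M"
 shows "(%t. config_add (f t) (g t)) \<in> borel_measurable M"
 by (rule measurable_configI) (simp add: emeasure_config_add)

lemma measurable_pts [measurable]: "pts k \<in> borel_measurable (PiM {..<k} (%_. borel))"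
proof (rule measurable_configI)
 fix A :: "'a set" assume [measurable]: "A \<in> sets borel"
 have "cnt (pts k x) A = (\<Sum>i<k. indicator A (x i))" for x
 proof -
  have "cnt (pts k x) A = (\<Sum>i. indicator {..<k} i * indicator A (x i))"
   by (simp add: pts_eq_cfg cnt_cfg_suminf locfin_pts)
  also have "\<dots> = (\<Sum>i<k. indicator {..<k} i * indicator A (x i))"
   by (rule suminf_finite) auto
  finally show ?thesis by simp
 qed
 moreover have "(%x. \<Sum>i<k. indicator A (x i) :: ennreal) \<in> borel_measurable (PiM {..<k} (%_. borel))"
  by measurable
 ultimately show "(%x. cnt (pts k x) A) \<in> borel_measurable (PiM {..<k} (%_. borel))" by simp
qed

section \<open>Compact sets of configurations\<close>

text \<open>A configuration is encoded by slots \<open>z i\<close>: slot \<open>i\<close> is empty, \<open>z i = (0, 0)\<close>, or holds the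
 point \<open>y\<close>, \<open>z i = (1, y)\<close>, where \<open>y\<close> ranges over the compact set \<open>S i\<close>.\<close>

definition slots :: "(nat => 'a::euclidean_space set) => (nat => real \<times> 'a) set" where
 "slots S = {z. \<forall>i. z i \<in> insert (0, 0) ({1} \<times> S i)}"

definition slot_config :: "(nat => real \<times> 'a) => 'a::euclidean_space config" where
 "slot_config z = cfg {i. fst (z i) = 1} (%i. snd (z i))"

text \<open>The finiteness condition says that only finitely many slots can reach a given ball. It
  makes every assignment of points to slots locally finite.\<close>

definition slot_system :: "(nat => 'a::euclidean_space set) => bool" where
 "slot_system S \<longleftrightarrow> (\<forall>i. compact (S i)) \<and> (\<forall>R. finite {i. S i \<inter> cball 0 R \<noteq> {}})"

lemma slots_fst: "z \<in> slots S ==> fst (z i) = 0 \<or> fst (z i) = 1"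
 by (auto simp: slots_def dest!: spec[of _ i])

lemma slots_snd: "z \<in> slots S ==> fst (z i) = 1 ==> snd (z i) \<in> S i"
 by (auto simp: slots_def dest!: spec[of _ i])

lemma compact_PiE_UNIV:
 fixes T :: "nat => 'b::topological_space set"
 assumes "\<And>i. compact (T i)" shows "compact {z. \<forall>i. z i \<in> T i}"
proof -
 have "compactin (product_topology (%_. euclidean) UNIV) (PiE UNIV T)"
  using assms by (simp add: compactin_PiE)
 moreover have "PiE UNIV T = {z. \<forall>i. z i \<in> T i}" by (auto simp: PiE_def Pi_def)
 ultimately show ?thesis by (simp add: euclidean_product_topology)
qed

lemma compact_slots:
 assumes "slot_system S" shows "compact (slots S)"
 unfolding slots_def using assms
 by (intro compact_PiE_UNIV compact_insert compact_Times) (auto simp: slot_system_def)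

lemma bounded_subset_cball0: "bounded S ==> \<exists>R. S \<subseteq> cball 0 R"
 using bounded_any_center[of S 0] unfolding subset_eq mem_cball by blast

lemma locfin_slots:
 assumes "slot_system S" "z \<in> slots S" shows "locfin {i. fst (z i) = 1} (%i. snd (z i))"
 unfolding locfin_def
proof (intro allI impI)
 fix K :: "'a set" assume "compact K"
 then obtain R where R: "K \<subseteq> cball 0 R"
  using compact_imp_bounded[of K] bounded_subset_cball0[of K] by blast
 have "{i \<in> {i. fst (z i) = 1}. snd (z i) \<in> K} \<subseteq> {i. S i \<inter> cball 0 R \<noteq> {}}"
  using R slots_snd[OF assms(2)] by blast
 then show "finite {i \<in> {i. fst (z i) = 1}. snd (z i) \<in> K}"
  by (rule finite_subset) (use assms(1) in \<open>auto simp: slot_system_def\<close>)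
qed

lemma integral_cfg:
 fixes f :: "'a::euclidean_space => real"
 assumes "locfin I x" "f \<in> borel_measurable borel" "finite {i \<in> I. f (x i) \<noteq> 0}"
 shows "(\<integral>y. f y \<partial>meas_of (cfg I x)) = (\<Sum>i\<in>{i \<in> I. f (x i) \<noteq> 0}. f (x i))"
 using assms by (simp add: meas_of_cfg point_measure_of_def integral_distr
  lebesgue_integral_count_space_finite_support)

text \<open>The finite index set on the right does not depend on \<open>z\<close>, and
  \<open>fst (z i)\<close> acts as a 0-1 factor switching the slot on. Vague continuity of
  \<open>slot_config\<close> is then continuity of a finite sum of coordinate functions.\<close>

lemma integral_slot_config:
 assumes S: "slot_system S" "z \<in> slots S" and f: "test_cc f" and R: "{x. f x \<noteq> 0} \<subseteq> cball 0 R"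
 shows "(\<integral>y. f y \<partial>meas_of (slot_config z)) = (\<Sum>i\<in>{i. S i \<inter> cball 0 R \<noteq> {}}. fst (z i) * f (snd (z i)))"
proof -
 let ?F = "{i. S i \<inter> cball 0 R \<noteq> {}}" and ?A = "{i. fst (z i) = 1 \<and> f (snd (z i)) \<noteq> 0}"
 have fin: "finite ?F" using S(1) by (auto simp: slot_system_def)
 have sub: "?A \<subseteq> ?F" using R slots_snd[OF S(2)] by blast
 have fm: "f \<in> borel_measurable borel"
  using f by (auto simp: test_cc_def intro: borel_measurable_continuous_onI)
 have "(\<integral>y. f y \<partial>meas_of (slot_config z)) = (\<Sum>i\<in>?A. f (snd (z i)))"
  unfolding slot_config_def using finite_subset[OF sub fin]
  by (subst integral_cfg[OF locfin_slots[OF S] fm]) (auto intro!: sum.cong)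
 also have "\<dots> = (\<Sum>i\<in>?A. fst (z i) * f (snd (z i)))" by (intro sum.cong) auto
 also have "\<dots> = (\<Sum>i\<in>?F. fst (z i) * f (snd (z i)))"
 proof (rule sum.mono_neutral_left[OF fin sub], intro ballI)
  fix i assume "i \<in> ?F - ?A"
  then show "fst (z i) * f (snd (z i)) = 0" using slots_fst[OF S(2), of i] by auto
 qed
 finally show ?thesis .
qed

lemma continuous_config_iff:
 fixes p :: "'b::topological_space => 'a::euclidean_space config"
 assumes "\<And>f. test_cc f ==> continuous_on A (%z. \<integral>y. f y \<partial>meas_of (p z))"
 shows "continuous_on A p"
proof (rule continuous_on_generate_topology)
 show "open = generate_topology
   {{g. (\<integral>x. f x \<partial>meas_of g) \<in> U} | (f :: 'a => real) U.
    continuous_on UNIV f \<and> compact (closure {x. f x \<noteq> 0}) \<and> open U}"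
  by (auto simp: fun_eq_iff open_config_def)
next
 fix Q assume "Q \<in> {{g. (\<integral>x. f x \<partial>meas_of g) \<in> U} | (f :: 'a => real) U.
    continuous_on UNIV f \<and> compact (closure {x. f x \<noteq> 0}) \<and> open U}"
 then have "\<exists>(f :: 'a => real) U. Q = {g. (\<integral>x. f x \<partial>meas_of g) \<in> U} \<and>
    continuous_on UNIV f \<and> compact (closure {x. f x \<noteq> 0}) \<and> open U" by (rule CollectD)
 then obtain f :: "'a => real" and U where Q: "Q = {g. (\<integral>x. f x \<partial>meas_of g) \<in> U} \<and>
    continuous_on UNIV f \<and> compact (closure {x. f x \<noteq> 0}) \<and> open U" by (elim exE)
 then have "continuous_on A (%z. \<integral>y. f y \<partial>meas_of (p z))" using assms by (simp add: test_cc_def)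
 then show "\<exists>C. open C \<and> C \<inter> A = p -` Q \<inter> A"
  using Q unfolding continuous_on_open_invariant by (auto simp: vimage_def)
qed

lemma continuous_slot_config:
 assumes "slot_system S" shows "continuous_on (slots S) slot_config"
proof (rule continuous_config_iff)
 fix f :: "'a => real" assume f: "test_cc f"
 then have "bounded (closure {x. f x \<noteq> 0})" by (auto simp: test_cc_def intro: compact_imp_bounded)
 then have "bounded {x. f x \<noteq> 0}" by (rule bounded_subset[OF _ closure_subset])
 then obtain R where R: "{x. f x \<noteq> 0} \<subseteq> cball 0 R" using bounded_subset_cball0[of "{x. f x \<noteq> 0}"] by blast
 have fc: "continuous_on UNIV f" using f by (simp add: test_cc_def)
 have c0: "continuous_on (slots S) (%z. z i)" for i
  by (rule continuous_on_product_then_coordinatewise) (rule continuous_on_id)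
 have c: "continuous_on (slots S) (%z. f (snd (z i)))" for i
  by (rule continuous_on_compose2[OF fc continuous_on_snd[OF c0]]) simp
 have "continuous_on (slots S) (%z. \<Sum>i\<in>{i. S i \<inter> cball 0 R \<noteq> {}}. fst (z i) * f (snd (z i)))"
  by (intro continuous_on_sum continuous_on_mult c continuous_on_fst c0)
 then show "continuous_on (slots S) (%z. \<integral>y. f y \<partial>meas_of (slot_config z))"
  by (subst continuous_on_cong[OF refl integral_slot_config[OF assms _ f R]]) auto
qed

definition ring :: "nat => 'a::euclidean_space set" where
 "ring m = {x. real m \<le> norm x \<and> norm x < real m + 1}"

text \<open>Slot \<open>prod_encode (m, j)\<close> is meant for the \<open>j\<close>-th point in the
  \<open>m\<close>-th ring, \<open>b m\<close> being the number of places there. The rings are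
  closed here for compactness, whereas \<open>ring\<close> is half open so that the rings are
  disjoint. Surplus slots have an empty range and can only stay vacant.\<close>

definition ring_slots :: "(nat => nat) => nat => 'a::euclidean_space set" where
 "ring_slots b i = (case prod_decode i of (m, j) =>
   if j < b m then {x. real m \<le> norm x \<and> norm x \<le> real m + 1} else {})"

lemma ring_borel [measurable, simp]: "ring m \<in> sets borel"
 unfolding ring_def by measurable

lemma ring_bounded: "bounded (ring m)"
 by (rule bounded_subset[OF bounded_cball[of 0 "real m + 1"]]) (auto simp: ring_def)

lemma ring_slot_system: "slot_system (ring_slots b :: nat => 'a::euclidean_space set)"
 unfolding slot_system_def
proof (intro conjI allI)
 fix i :: nat
 obtain m j where ij: "prod_decode i = (m, j)" by fastforce
 have "closed {x :: 'a. real m \<le> norm x \<and> norm x \<le> real m + 1}"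
  by (intro closed_Collect_conj closed_Collect_le continuous_intros)
 moreover have "bounded {x :: 'a. real m \<le> norm x \<and> norm x \<le> real m + 1}"
  by (rule bounded_subset[OF bounded_cball[of 0 "real m + 1"]]) auto
 ultimately show "compact (ring_slots b i :: 'a set)"
  by (auto simp: ring_slots_def ij compact_eq_bounded_closed)
next
 fix R :: real
 obtain n :: nat where n: "R \<le> real n" using real_arch_simple by blast
 have "{i. (ring_slots b i :: 'a set) \<inter> cball 0 R \<noteq> {}} \<subseteq> prod_encode ` (SIGMA m:{..n}. {..<b m})"
 proof
  fix i assume i: "i \<in> {i. (ring_slots b i :: 'a set) \<inter> cball 0 R \<noteq> {}}"
  obtain m j where ij: "prod_decode i = (m, j)" by fastforce
  then have "i = prod_encode (m, j)" by (metis prod_decode_inverse)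
  moreover have "j < b m" "real m \<le> R" using i by (auto simp: ring_slots_def ij split: if_splits)
  ultimately show "i \<in> prod_encode ` (SIGMA m:{..n}. {..<b m})" using n by auto
 qed
 then show "finite {i. (ring_slots b i :: 'a set) \<inter> cball 0 R \<noteq> {}}"
  by (rule finite_subset) auto
qed

text \<open>Enumerate the points ring by ring and put the \<open>j\<close>-th point of ring
  \<open>m\<close> into slot \<open>(m, j)\<close>; the inverse reindexing \<open>g\<close> is a
  bijection because every point lies in exactly one ring.\<close>

lemma slot_config_surj:
 fixes w :: "'a::euclidean_space config"
 assumes "\<And>m. cnt w (ring m) \<le> of_nat (b m)"
 shows "w \<in> slot_config ` slots (ring_slots b)"
proof -
 obtain I x where Ix: "locfin I x" "w = cfg I x" by (rule config_cases)
 define A where "A m = {i \<in> I. x i \<in> ring m}" for m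
 have fin: "finite (A m)" and card: "card (A m) \<le> b m" for m
 proof -
  have c: "cnt w (ring m) = emeasure (count_space UNIV) (A m)"
   using Ix by (simp add: cnt_cfg A_def del: emeasure_count_space)
  then show f: "finite (A m)" using cnt_bounded_finite[OF ring_bounded, of w m]
   by (auto simp: emeasure_count_space split: if_splits)
  show "card (A m) \<le> b m" using assms[of m] c f by simp
 qed
 have "\<exists>h. bij_betw h {..<card (A m)} (A m)" for m
  using fin bij_betw_from_nat_into_finite by blast
 then obtain h where h: "\<And>m. bij_betw (h m) {..<card (A m)} (A m)" by metis
 define z where "z i = (case prod_decode i of (m, j) => if j < card (A m) then (1, x (h m j)) else (0 :: real, 0))" for i
 define J where "J = {i. fst (z i) = 1}"
 define g where "g i = (case prod_decode i of (m, j) => h m j)" for i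
 have zs: "z \<in> slots (ring_slots b)"
  unfolding slots_def
 proof (intro CollectI allI)
  fix i obtain m j where ij: "prod_decode i = (m, j)" by fastforce
  show "z i \<in> insert (0, 0) ({1} \<times> ring_slots b i)"
  proof (cases "j < card (A m)")
   case True
   then have "h m j \<in> A m" using h[of m] by (auto simp: bij_betw_def)
   then show ?thesis using True card[of m] by (auto simp: z_def ring_slots_def ij A_def ring_def)
  qed (simp add: z_def ij)
 qed
 have ring_disj: "m = n" if "x i \<in> ring m" "x i \<in> ring n" for i m n
  using that by (auto simp: ring_def)
 have ring_cov: "\<exists>m. y \<in> ring m" for y :: 'a
  by (rule exI[of _ "nat \<lfloor>norm y\<rfloor>"]) (auto simp: ring_def)
 have Jeq: "J = prod_encode ` (SIGMA m:UNIV. {..<card (A m)})"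
 proof (intro set_eqI iffI)
  fix i assume "i \<in> J"
  moreover obtain m j where ij: "prod_decode i = (m, j)" by fastforce
  ultimately have "j < card (A m)" by (auto simp: J_def z_def split: if_splits)
  then show "i \<in> prod_encode ` (SIGMA m:UNIV. {..<card (A m)})"
   using ij by (intro image_eqI[of _ _ "(m, j)"]) (auto, metis prod_decode_inverse)
 qed (auto simp: J_def z_def)
 have bij: "bij_betw g J I"
  unfolding bij_betw_def
 proof
  show "inj_on g J"
  proof (rule inj_onI)
   fix i i' assume "i \<in> J" "i' \<in> J" and eq: "g i = g i'"
   then obtain m j m' j' where e: "i = prod_encode (m, j)" "i' = prod_encode (m', j')"
    and l: "j < card (A m)" "j' < card (A m')" by (auto simp: Jeq)
   have "h m j = h m' j'" using eq by (simp add: g_def e)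
   moreover have "h m j \<in> A m" "h m' j' \<in> A m'" using h[of m] h[of m'] l by (auto simp: bij_betw_def)
   ultimately have "m = m'" using ring_disj by (auto simp: A_def)
   then show "i = i'" using \<open>h m j = h m' j'\<close> h[of m] l by (auto simp: bij_betw_def inj_on_def e)
  qed
  show "g ` J = I"
  proof (intro set_eqI iffI)
   fix i assume "i \<in> g ` J"
   then obtain m j where "i = h m j" "j < card (A m)" by (auto simp: Jeq g_def)
   then have "i \<in> A m" using h[of m] by (auto simp: bij_betw_def)
   then show "i \<in> I" by (simp add: A_def)
  next
   fix i assume "i \<in> I"
   moreover obtain m where "x i \<in> ring m" using ring_cov by blast
   ultimately have "i \<in> A m" by (simp add: A_def)
   then obtain j where "j < card (A m)" "i = h m j" using h[of m] by (auto simp: bij_betw_def)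
   then show "i \<in> g ` J" by (intro image_eqI[of _ _ "prod_encode (m, j)"]) (auto simp: Jeq g_def)
  qed
 qed
 have "slot_config z = cfg J (%i. snd (z i))" by (simp add: slot_config_def J_def)
 also have "\<dots> = cfg J (x \<circ> g)"
  by (rule cfg_cong) (auto simp: J_def z_def g_def split: prod.splits if_splits)
 also have "\<dots> = w" using cfg_reindex(2)[OF bij Ix(1)] Ix(2) by simp
 finally show ?thesis using zs by auto
qed

text \<open>Closed sets are pulled back from the Polish space of the values of countably many continuous
 functionals, and tightness comes from the number of points in the rings.\<close>

lemma compact_inner:
 fixes \<mu> :: "'a::euclidean_space config measure"
 assumes "finite_measure \<mu>" and sets: "sets \<mu> = sets borel"
  and A: "A \<in> sets borel" "emeasure \<mu> A > 0"
 obtains K b where "compact K" "K \<subseteq> A" "K \<subseteq> slot_config ` slots (ring_slots b)" "emeasure \<mu> K > 0"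
proof -
 interpret finite_measure \<mu> by fact
 have sp: "space \<mu> = UNIV" using sets_eq_imp_space_eq[OF sets] by simp
 define U where "U = from_nat_into (open_base :: 'a set set)"
 define \<Phi> :: "'a config => nat => real" where
  "\<Phi> g i = (case prod_decode i of (u, j) => case prod_decode j of (N, n) =>
    \<integral>x. bump (U u \<inter> ball 0 (real N)) n x \<partial>meas_of g)" for g i
 have cont: "continuous_on UNIV \<Phi>"
 proof (rule continuous_on_coordinatewise_then_product)
  fix i
  obtain u j N n where "prod_decode i = (u, j)" "prod_decode j = (N, n)" by fastforce
  then show "continuous_on UNIV (%g. \<Phi> g i)"
   by (simp add: \<Phi>_def continuous_integral_config bump_cc bounded_open_base_ball)
 qed
 define V where "V = vimage_algebra UNIV \<Phi> borel"
 have \<Phi>V: "\<Phi> \<in> measurable V borel" unfolding V_def by (rule measurable_vimage_algebra1) auto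
 \<comment> \<open>The coordinates of \<open>\<Phi>\<close> include all bump integrals, so the
   algebra pulled back along \<open>\<Phi>\<close> already contains every Borel set. Hence
   \<open>A\<close> is the preimage of a Borel set of sequences, where inner regularity is
   known.\<close>
 have "(%g. g) \<in> measurable V borel"
 proof (rule measurable_config_family)
  fix W :: "'a set" and N n assume W: "W \<in> open_base"
  obtain u where "W = U u"
   using from_nat_into_surj[OF open_base(1) W] unfolding U_def by auto
  then have "(%g. \<integral>x. bump (W \<inter> ball 0 (real N)) n x \<partial>meas_of g) =
    (%g. \<Phi> g (prod_encode (u, prod_encode (N, n))))" by (simp add: \<Phi>_def)
  also have "\<dots> \<in> borel_measurable V"
   by (rule measurable_compose[OF \<Phi>V]) simp
  finally show "(%g. \<integral>x. bump (W \<inter> ball 0 (real N)) n x \<partial>meas_of g) \<in> borel_measurable V" .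
 qed
 from measurable_sets[OF this A(1)] have "A \<in> sets V"
  by (simp add: V_def)
 then obtain A' where A': "A' \<in> sets borel" "A = \<Phi> -` A'"
  by (auto simp: V_def sets_vimage_algebra2)
 define \<nu> where "\<nu> = distr \<mu> borel \<Phi>"
 have \<Phi>m: "\<Phi> \<in> measurable \<mu> borel"
  using borel_measurable_continuous_onI[OF cont] by (simp add: measurable_cong_sets[OF sets refl])
 have \<nu>: "emeasure \<nu> A' = emeasure \<mu> A"
  using A' \<Phi>m by (simp add: \<nu>_def emeasure_distr sp)
 have fin\<nu>: "emeasure \<nu> (space \<nu>) \<noteq> \<infinity>"
  using \<Phi>m by (simp add: \<nu>_def emeasure_distr emeasure_eq_measure)
 have "(SUP K \<in> {K. K \<subseteq> A' \<and> compact K}. emeasure \<nu> K) = emeasure \<nu> A'"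
  by (rule inner_regular[symmetric]) (use A' fin\<nu> in \<open>auto simp: \<nu>_def\<close>)
 then have "\<exists>K \<in> {K. K \<subseteq> A' \<and> compact K}. emeasure \<nu> K > 0"
  using A(2) unfolding \<nu>[symmetric] by (simp only: less_SUP_iff[symmetric])
 then obtain K' where K': "K' \<subseteq> A'" "compact K'" "emeasure \<nu> K' > 0" by blast
 define C where "C = \<Phi> -` K'"
 have Ccl: "closed C"
  unfolding C_def using K'(2) cont by (intro closed_vimage compact_imp_closed)
 have CA: "C \<subseteq> A" using K'(1) A'(2) by (auto simp: C_def)
 have "K' \<in> sets borel" using K'(2) by (simp add: compact_imp_closed borel_closed)
 then have Cpos: "emeasure \<mu> C > 0"
  using K'(3) \<Phi>m by (simp add: \<nu>_def emeasure_distr sp C_def)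
 define e where "e = measure \<mu> C"
 have e: "e > 0" using Cpos by (simp add: e_def emeasure_eq_measure)
 \<comment> \<open>Each ring has finite count, so a large threshold \<open>b m\<close> is exceeded
   with small probability. The geometric shares add up to \<open>e / 2\<close>, half the mass of
   \<open>C\<close>, and \<open>C\<close> keeps positive mass after intersection with the compact
   slot image.\<close>
 have "\<exists>k::nat. measure \<mu> {g. cnt g (ring m) > of_nat k} < e / 2 * (1 / 2) ^ Suc m" for m
 proof -
  define D where "D k = {g :: 'a config. cnt g (ring m) > of_nat k}" for k :: nat
  have D: "D k \<in> sets \<mu>" for k unfolding D_def sets by measurable
  have "(\<Inter>k. D k) = {}"
  proof (intro equalityI subsetI)
   fix g assume "g \<in> (\<Inter>k. D k)"
   moreover obtain k :: nat where "cnt g (ring m) < of_nat k"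
    using cnt_bounded_finite[OF ring_bounded, of g m] ennreal_Ex_less_of_nat by auto
   ultimately show "g \<in> {}" by (auto simp: D_def dest: order.asym)
  qed simp
  moreover have "decseq D"
   by (auto simp: decseq_def D_def) (metis of_nat_mono order_le_less_trans)
  ultimately have "(%k. measure \<mu> (D k)) \<longlonglongrightarrow> 0"
   using finite_Lim_measure_decseq[of D] D by auto
  then have "\<forall>\<^sub>F k in sequentially. measure \<mu> (D k) < e / 2 * (1 / 2) ^ Suc m"
   by (rule order_tendstoD) (use e in simp)
  then show ?thesis unfolding D_def by (auto simp: eventually_sequentially)
 qed
 then obtain b :: "nat => nat" where b: "\<And>m. measure \<mu> {g. cnt g (ring m) > of_nat (b m)} < e / 2 * (1 / 2) ^ Suc m"
  by metis
 define L where "L = slot_config ` slots (ring_slots b :: nat => 'a set)"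
 have cL: "compact L" unfolding L_def
  by (intro compact_continuous_image continuous_slot_config compact_slots ring_slot_system)
 define G where "G m = {g :: 'a config. cnt g (ring m) > of_nat (b m)}" for m
 have Gs: "G m \<in> sets \<mu>" for m unfolding G_def sets by measurable
 have L: "L \<in> sets \<mu>" "C \<in> sets \<mu>" using cL Ccl by (auto simp: sets compact_config_borel)
 have "- L \<subseteq> (\<Union>m. G m)"
 proof (intro subsetI, rule ccontr)
  fix g assume "g \<in> - L" "g \<notin> (\<Union>m. G m)"
  then show False using slot_config_surj[of g b] by (auto simp: L_def G_def not_less)
 qed
 have sumG: "summable (%m. measure \<mu> (G m))"
  by (rule summable_comparison_test'[of "%m. e / 2 * (1 / 2) ^ Suc m" 0])
   (use b in \<open>auto simp: G_def less_imp_le intro!: summable_mult\<close>)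
 have "measure \<mu> (- L) \<le> measure \<mu> (\<Union>m. G m)"
  using \<open>- L \<subseteq> _\<close> Gs by (intro finite_measure_mono) auto
 also have "\<dots> \<le> (\<Sum>m. measure \<mu> (G m))"
  using Gs sumG by (intro finite_measure_subadditive_countably) auto
 also have "\<dots> \<le> (\<Sum>m. e / 2 * (1 / 2) ^ Suc m)"
  using b sumG by (intro suminf_le) (auto simp: G_def less_imp_le intro!: summable_mult)
 also have "\<dots> = e / 2"
  using sums_mult[OF power_half_series, of "e / 2"] by (simp add: sums_iff)
 also have "\<dots> < e" using e by simp
 finally have "measure \<mu> (- L) < e" .
 moreover have "measure \<mu> C \<le> measure \<mu> (C \<inter> L) + measure \<mu> (- L)"
 proof -
  have "measure \<mu> C \<le> measure \<mu> ((C \<inter> L) \<union> - L)"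
   using L sets.compl_sets[OF L(1)] by (intro finite_measure_mono) (auto simp: sp Compl_eq_Diff_UNIV)
  also have "\<dots> \<le> measure \<mu> (C \<inter> L) + measure \<mu> (- L)"
   using L sets.compl_sets[OF L(1)] by (intro measure_Un_le) (auto simp: sp Compl_eq_Diff_UNIV)
  finally show ?thesis .
 qed
 ultimately have "measure \<mu> (C \<inter> L) > 0" by (simp add: e_def)
 then have "emeasure \<mu> (C \<inter> L) > 0" by (simp add: emeasure_eq_measure)
 moreover have "compact (C \<inter> L)" using Ccl cL by (rule closed_Int_compact)
 ultimately show thesis using CA by (intro that[of "C \<inter> L" b]) (auto simp: L_def)
qed

section \<open>Couplings as matrices\<close>

text \<open>A coupling carried by indices instead of points: row \<open>i\<close> distributes the
  unit mass of index \<open>i\<close>, and rows and columns outside \<open>I\<close> and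
  \<open>J\<close> vanish. In this form couplings compose by matrix multiplication and live in a
  compact product space.\<close>

definition matrix_coupling :: "nat set => nat set => (nat => nat => ennreal) => bool" where
 "matrix_coupling I J M \<longleftrightarrow>
   (\<forall>i. (\<Sum>j. M i j) = indicator I i) \<and> (\<forall>j. (\<Sum>i. M i j) = indicator J j)"

definition coupling_cost ::
 "(nat => 'a::euclidean_space) => (nat => 'a) => (nat => nat => ennreal) => ennreal" where
 "coupling_cost x y M = (\<Sum>i. \<Sum>j. M i j * ennreal ((dist (x i) (y j))\<^sup>2))"

lemma countable_borel: "countable X ==> X \<in> sets (borel :: 'a::t1_space measure)"
 by (rule sets.countable) auto

lemma suminf_swap_ennreal:
 fixes f :: "nat => nat => ennreal" shows "(\<Sum>i. \<Sum>j. f i j) = (\<Sum>j. \<Sum>i. f i j)"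
proof -
 have "(\<Sum>i. \<Sum>j. f i j) = (\<integral>\<^sup>+ i. (\<Sum>j. f i j) \<partial>count_space UNIV)"
  by (rule nn_integral_count_space_nat[symmetric])
 also have "\<dots> = (\<Sum>j. \<integral>\<^sup>+ i. f i j \<partial>count_space UNIV)"
  by (rule nn_integral_suminf) simp
 finally show ?thesis by (simp add: nn_integral_count_space_nat)
qed

lemma nn_integral_cfg:
 assumes "locfin I x" "f \<in> borel_measurable borel"
 shows "(\<integral>\<^sup>+ y. f y \<partial>meas_of (cfg I x)) = (\<Sum>i. indicator I i * f (x i))"
proof -
 have "(\<integral>\<^sup>+ y. f y \<partial>meas_of (cfg I x)) = (\<integral>\<^sup>+ i. f (x i) \<partial>count_space I)"
  using assms by (simp add: meas_of_cfg point_measure_of_def nn_integral_distr)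
 also have "\<dots> = (\<integral>\<^sup>+ i. f (x i) * indicator I i \<partial>count_space UNIV)"
  by (auto simp: nn_integral_restrict_space[symmetric] restrict_count_space)
 finally show ?thesis by (simp add: nn_integral_count_space_nat mult.commute)
qed

lemma ennreal_sqrt_finite: "ennreal_sqrt c < \<infinity> \<longleftrightarrow> c < \<infinity>"
 by (auto simp: ennreal_sqrt_def top.not_eq_extremum)

lemma matrix_couplingD:
 assumes "matrix_coupling I J M"
 shows "(\<Sum>j. M i j) = indicator I i" "(\<Sum>i. M i j) = indicator J j"
  "i \<notin> I ==> M i j = 0" "j \<notin> J ==> M i j = 0"
proof -
 show 1: "(\<Sum>j. M i j) = indicator I i" for i using assms by (simp add: matrix_coupling_def)
 show 2: "(\<Sum>i. M i j) = indicator J j" for j using assms by (simp add: matrix_coupling_def)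
 show "i \<notin> I ==> M i j = 0" using 1[of i] by (simp add: suminf_eq_zero_iff)
 show "j \<notin> J ==> M i j = 0" using 2[of j] by (simp add: suminf_eq_zero_iff)
qed

lemma d_config_le_matrix_coupling:
 fixes x y :: "nat => 'a::euclidean_space"
 assumes lf: "locfin I x" "locfin J y" and M: "matrix_coupling I J M"
 shows "d_config (cfg I x) (cfg J y) \<le> ennreal_sqrt (coupling_cost x y M)"
proof -
 define g where "g = (%(i, j). (x i, y j))"
 define q where "q = distr (density (count_space UNIV) (%(i, j). M i j)) borel g"
 have int: "(\<integral>\<^sup>+ z. f z \<partial>q) = (\<Sum>i. \<Sum>j. M i j * f (x i, y j))" if "f \<in> borel_measurable borel" for f
 proof -
  have "(\<integral>\<^sup>+ z. f z \<partial>q) = (\<integral>\<^sup>+ p. (case p of (i, j) => M i j) * f (g p) \<partial>count_space UNIV)"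
   using that by (simp add: q_def nn_integral_distr nn_integral_density)
  also have "\<dots> = (\<integral>\<^sup>+ i. \<integral>\<^sup>+ j. M i j * f (x i, y j) \<partial>count_space UNIV \<partial>count_space UNIV)"
   by (subst nn_integral_fst_count_space[symmetric]) (simp add: g_def)
  finally show ?thesis by (simp add: nn_integral_count_space_nat)
 qed
 have sq [measurable_cong]: "sets q = sets borel" by (simp add: q_def)
 have em: "emeasure q A = (\<Sum>i. \<Sum>j. M i j * indicator A (x i, y j))" if "A \<in> sets borel" for A
  using int[of "indicator A"] that sq by simp
 have m1: "fst \<in> measurable q borel" "snd \<in> measurable q borel"
  unfolding measurable_cong_sets[OF sq refl]
  by (auto intro!: borel_measurable_continuous_onI continuous_intros)
 have spq: "space q = UNIV" using sets_eq_imp_space_eq[OF sq] by simp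
 have f: "distr q borel fst = meas_of (cfg I x)"
 proof (rule measure_eqI)
  fix A :: "'a set" assume "A \<in> sets (distr q borel fst)"
  then have A: "A \<in> sets borel" by simp
  have "emeasure (distr q borel fst) A = emeasure q (fst -` A)"
   using A m1 by (simp add: emeasure_distr spq)
  also have "\<dots> = (\<Sum>i. \<Sum>j. M i j * indicator A (x i))"
   using measurable_sets[OF m1(1) A] by (subst em) (auto simp: spq sq indicator_def)
  also have "\<dots> = (\<Sum>i. indicator I i * indicator A (x i))"
   by (simp add: ennreal_suminf_multc matrix_couplingD[OF M])
  finally show "emeasure (distr q borel fst) A = cnt (cfg I x) A"
   by (simp add: cnt_cfg_suminf lf A)
 qed simp
 have s: "distr q borel snd = meas_of (cfg J y)"
 proof (rule measure_eqI)
  fix A :: "'a set" assume "A \<in> sets (distr q borel snd)"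
  then have A: "A \<in> sets borel" by simp
  have "emeasure (distr q borel snd) A = emeasure q (snd -` A)"
   using A m1 by (simp add: emeasure_distr spq)
  also have "\<dots> = (\<Sum>i. \<Sum>j. M i j * indicator A (y j))"
   using measurable_sets[OF m1(2) A] by (subst em) (auto simp: spq sq indicator_def)
  also have "\<dots> = (\<Sum>j. indicator J j * indicator A (y j))"
   by (subst suminf_swap_ennreal) (simp add: ennreal_suminf_multc matrix_couplingD[OF M])
  finally show "emeasure (distr q borel snd) A = cnt (cfg J y) A"
   by (simp add: cnt_cfg_suminf lf A)
 qed simp
 \<comment> \<open>A compact \<open>K\<close> lies in the preimage of its first projection, so local
   finiteness of \<open>q\<close> is inherited from its first marginal.\<close>
 have "emeasure q K < \<infinity>" if K: "compact K" for K
 proof -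
  have c: "compact (fst ` K)" using K by (intro compact_continuous_image continuous_intros)
  then have b: "fst ` K \<in> sets borel" by (simp add: compact_imp_closed borel_closed)
  have "emeasure q K \<le> emeasure q (fst -` (fst ` K))"
   using measurable_sets[OF m1(1) b] by (intro emeasure_mono) (auto simp: spq)
  also have "\<dots> = cnt (cfg I x) (fst ` K)"
   using b m1 by (simp add: f[symmetric] emeasure_distr spq)
  also have "\<dots> < \<infinity>" using c by (rule meas_of_props(2))
  finally show ?thesis .
 qed
 then have q: "q \<in> couplings (cfg I x) (cfg J y)" using f s sq by (simp add: couplings_def)
 have "(%z. ennreal ((dist (fst z) (snd z))\<^sup>2)) \<in> borel_measurable (borel :: ('a \<times> 'a) measure)"
  by (intro measurable_compose[OF _ measurable_ennreal] borel_measurable_continuous_onI continuous_intros)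
 then have "(\<integral>\<^sup>+ z. ennreal ((dist (fst z) (snd z))\<^sup>2) \<partial>q) = coupling_cost x y M"
  by (subst int) (auto simp: coupling_cost_def)
 then show ?thesis unfolding d_config_def by (intro INF_lower2[OF q]) simp
qed

text \<open>A point of multiplicity \<open>n\<close> occurs under \<open>n\<close> indices and each
  of them contributes one \<open>n\<close>-th of \<open>h\<close>, so the sum over indices becomes
  the sum over distinct points.\<close>

lemma suminf_over_points:
 fixes y :: "nat => 'a::euclidean_space"
 assumes lf: "locfin J y"
 shows "(\<Sum>j. indicator J j * (h (y j) / cnt (cfg J y) {y j})) = (\<integral>\<^sup>+ c. h c \<partial>count_space (y ` J))"
proof -
 define g where "g = cfg J y"
 define f where "f c = h c / cnt g {c} * indicator (y ` J) c" for c
 have fm: "f \<in> borel_measurable borel"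
  by (rule measurable_discrete_difference[of "%_. 0" _ _ "y ` J"]) (auto simp: f_def)
 then have fm' [measurable]: "f \<in> borel_measurable (meas_of g)" by simp
 have Y: "y ` J \<in> sets borel" by (intro countable_borel) simp
 have pos: "cnt g {c} \<noteq> 0" if "c \<in> y ` J" for c
 proof -
  from that obtain j where "j \<in> J" "y j = c" by blast
  then have "{i \<in> J. y i \<in> {c}} \<noteq> {}" by auto
  then show ?thesis by (auto simp: g_def cnt_cfg lf emeasure_count_space)
 qed
 have fin: "cnt g {c} \<noteq> \<infinity>" for c using cnt_bounded_finite[of "{c}" g] by simp
 have "(\<Sum>j. indicator J j * (h (y j) / cnt g {y j})) = (\<Sum>j. indicator J j * f (y j))"
  by (intro arg_cong[of _ _ suminf] ext) (auto simp: f_def indicator_def)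
 also have "\<dots> = (\<integral>\<^sup>+ c. f c \<partial>meas_of g)" unfolding g_def by (rule nn_integral_cfg[symmetric, OF lf fm])
 also have "\<dots> = (\<integral>\<^sup>+ c. f c * indicator (y ` J) c \<partial>meas_of g)"
  by (intro nn_integral_cong) (auto simp: f_def indicator_def)
 also have "\<dots> = emeasure (density (meas_of g) f) (y ` J)"
  using Y by (subst emeasure_density) auto
 also have "\<dots> = (\<integral>\<^sup>+ c. emeasure (density (meas_of g) f) {c} \<partial>count_space (y ` J))"
  by (rule emeasure_countable_singleton) auto
 also have "\<dots> = (\<integral>\<^sup>+ c. h c \<partial>count_space (y ` J))"
 proof (rule nn_integral_cong)
  fix c assume "c \<in> space (count_space (y ` J))"
  then have c: "c \<in> y ` J" by simp
  have "emeasure (density (meas_of g) f) {c} = f c * cnt g {c}"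
   by (subst emeasure_density) (auto simp: nn_integral_indicator_singleton)
  then show "emeasure (density (meas_of g) f) {c} = h c"
   using c pos[OF c] fin[of c] by (simp add: f_def ennreal_divide_times ennreal_times_divide mult_divide_eq_ennreal)
 qed
 finally show ?thesis unfolding g_def .
qed

text \<open>Both marginals live on countable sets, hence so does any coupling \<open>q\<close>, and
  it is determined by its atoms. Finite distance provides a \<open>q\<close> of finite cost, whose
  atoms are then split among the indices.\<close>

lemma matrix_coupling_of_d_config:
 fixes x y :: "nat => 'a::euclidean_space"
 assumes lf: "locfin I x" "locfin J y" and d: "d_config (cfg I x) (cfg J y) < \<infinity>"
 obtains M where "matrix_coupling I J M" "coupling_cost x y M < \<infinity>"
proof -
 define w where "w = cfg I x"
 define v where "v = cfg J y"
 obtain q where q: "q \<in> couplings w v"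
  and "ennreal_sqrt (\<integral>\<^sup>+ z. ennreal ((dist (fst z) (snd z))\<^sup>2) \<partial>q) < \<infinity>"
  using d unfolding d_config_def INF_less_iff w_def v_def by blast
 then have cost: "(\<integral>\<^sup>+ z. ennreal ((dist (fst z) (snd z))\<^sup>2) \<partial>q) < \<infinity>"
  by (simp only: ennreal_sqrt_finite)
 have sq [measurable_cong]: "sets q = sets borel" and f: "distr q borel fst = meas_of w"
  and s: "distr q borel snd = meas_of v" using q by (auto simp: couplings_def)
 have spq: "space q = UNIV" using sets_eq_imp_space_eq[OF sq] by simp
 have m1: "fst \<in> measurable q borel" "snd \<in> measurable q borel"
  unfolding measurable_cong_sets[OF sq refl]
  by (auto intro!: borel_measurable_continuous_onI continuous_intros)
 have e1: "emeasure q (fst -` A) = cnt w A" if "A \<in> sets borel" for A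
  using that m1 by (simp add: f[symmetric] emeasure_distr spq)
 have e2: "emeasure q (snd -` A) = cnt v A" if "A \<in> sets borel" for A
  using that m1 by (simp add: s[symmetric] emeasure_distr spq)
 define X where "X = x ` I"
 define Y where "Y = y ` J"
 have XY: "countable X" "countable Y" "X \<in> sets borel" "Y \<in> sets borel"
  by (simp_all add: X_def Y_def countable_borel)
 have outX: "cnt w (- X) = 0" and outY: "cnt v (- Y) = 0"
 proof -
  have "{i \<in> I. x i \<in> - X} = {}" "{j \<in> J. y j \<in> - Y} = {}" by (auto simp: X_def Y_def)
  then show "cnt w (- X) = 0" "cnt v (- Y) = 0"
   using lf XY by (simp_all only: w_def v_def cnt_cfg borel_comp emeasure_empty)
 qed
 have sing: "{p} \<in> sets q" for p unfolding sq by simp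
 have row: "(\<integral>\<^sup>+ c. emeasure q {(a, c)} \<partial>count_space Y) = cnt w {a}" for a
 proof -
  have "(\<integral>\<^sup>+ c. emeasure q {(a, c)} \<partial>count_space Y) = (\<integral>\<^sup>+ p. emeasure q {p} \<partial>count_space ({a} \<times> Y))"
   by (rule nn_integral_bij_count_space) (auto simp: bij_betw_def inj_on_def)
  also have "\<dots> = emeasure q ({a} \<times> Y)"
   using sing XY by (intro emeasure_countable_singleton[symmetric]) auto
  also have "\<dots> = emeasure q (fst -` {a})"
  proof (rule emeasure_eq_AE)
   have "AE p in q. p \<notin> snd -` (- Y)"
    using e2[of "- Y"] outY XY measurable_sets[OF m1(2), of "- Y"]
    by (intro AE_not_in) (auto simp: null_sets_def spq)
   then show "AE p in q. p \<in> {a} \<times> Y \<longleftrightarrow> p \<in> fst -` {a}" by eventually_elim auto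
   show "{a} \<times> Y \<in> sets q" unfolding sq using XY by (intro countable_borel) auto
   show "fst -` {a} \<in> sets q" using measurable_sets[OF m1(1), of "{a}"] by (simp add: spq)
  qed
  finally show ?thesis by (simp add: e1)
 qed
 have col: "(\<integral>\<^sup>+ a. emeasure q {(a, c)} \<partial>count_space X) = cnt v {c}" for c
 proof -
  have "(\<integral>\<^sup>+ a. emeasure q {(a, c)} \<partial>count_space X) = (\<integral>\<^sup>+ p. emeasure q {p} \<partial>count_space (X \<times> {c}))"
   by (rule nn_integral_bij_count_space) (auto simp: bij_betw_def inj_on_def)
  also have "\<dots> = emeasure q (X \<times> {c})"
   using sing XY by (intro emeasure_countable_singleton[symmetric]) auto
  also have "\<dots> = emeasure q (snd -` {c})"
  proof (rule emeasure_eq_AE)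
   have "AE p in q. p \<notin> fst -` (- X)"
    using e1[of "- X"] outX XY measurable_sets[OF m1(1), of "- X"]
    by (intro AE_not_in) (auto simp: null_sets_def spq)
   then show "AE p in q. p \<in> X \<times> {c} \<longleftrightarrow> p \<in> snd -` {c}" by eventually_elim auto
   show "X \<times> {c} \<in> sets q" unfolding sq using XY by (intro countable_borel) auto
   show "snd -` {c} \<in> sets q" using measurable_sets[OF m1(2), of "{c}"] by (simp add: spq)
  qed
  finally show ?thesis by (simp add: e2)
 qed
 text \<open>The mass of the atom \<open>(a, c)\<close> is spread evenly over the indices of the points \<open>a\<close> and \<open>c\<close>.\<close>
 define M where "M i j = indicator I i * (indicator J j * (emeasure q {(x i, y j)} / cnt v {y j}) / cnt w {x i})" for i j
 have posx: "cnt w {x i} \<noteq> 0" if "i \<in> I" for i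
  using that by (auto simp: w_def cnt_cfg lf emeasure_count_space)
 have posy: "cnt v {y j} \<noteq> 0" if "j \<in> J" for j
  using that by (auto simp: v_def cnt_cfg lf emeasure_count_space)
 have fin: "cnt w {c} \<noteq> \<infinity>" "cnt v {c} \<noteq> \<infinity>" for c
  using cnt_bounded_finite[of "{c}" v] cnt_bounded_finite[of "{c}" w] by simp_all
 have sumrow: "(\<Sum>j. M i j * g (y j)) = indicator I i * ((\<integral>\<^sup>+ c. emeasure q {(x i, c)} * g c \<partial>count_space Y) / cnt w {x i})" for i g
 proof -
  have "(\<Sum>j. M i j * g (y j)) = (\<Sum>j. (indicator J j * (emeasure q {(x i, y j)} * g (y j) / cnt v {y j})) * (indicator I i * inverse (cnt w {x i})))"
   by (intro arg_cong[of _ _ suminf] ext) (simp add: M_def divide_ennreal_def mult_ac)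
  also have "\<dots> = (\<integral>\<^sup>+ c. emeasure q {(x i, c)} * g c \<partial>count_space Y) * (indicator I i * inverse (cnt w {x i}))"
   unfolding ennreal_suminf_multc v_def Y_def
   by (subst suminf_over_points[OF lf(2), of "%c. emeasure q {(x i, c)} * g c"]) simp
  finally show ?thesis by (simp add: divide_ennreal_def mult_ac)
 qed
 have "(\<Sum>j. M i j) = indicator I i" for i
  using sumrow[of i "%_. 1"] posx[of i] fin(1)[of "x i"]
  by (cases "i \<in> I") (auto simp: row ennreal_divide_self less_top)
 moreover have "(\<Sum>i. M i j) = indicator J j" for j
 proof -
  have "(\<Sum>i. M i j) = (\<Sum>i. (indicator I i * (emeasure q {(x i, y j)} / cnt w {x i})) * (indicator J j * inverse (cnt v {y j})))"
   by (intro arg_cong[of _ _ suminf] ext) (simp add: M_def divide_ennreal_def mult_ac)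
  also have "\<dots> = (\<integral>\<^sup>+ a. emeasure q {(a, y j)} \<partial>count_space X) * (indicator J j * inverse (cnt v {y j}))"
   unfolding ennreal_suminf_multc w_def X_def
   by (subst suminf_over_points[OF lf(1), of "%a. emeasure q {(a, y j)}"]) simp
  also have "\<dots> = indicator J j * (cnt v {y j} / cnt v {y j})"
   by (simp add: col divide_ennreal_def mult_ac)
  finally show ?thesis using posy[of j] fin(2)[of "y j"]
   by (cases "j \<in> J") (auto simp: ennreal_divide_self less_top)
 qed
 ultimately have mc: "matrix_coupling I J M" by (simp add: matrix_coupling_def)
 let ?D = "%p. ennreal ((dist (fst p) (snd p))\<^sup>2) :: ennreal"
 have Dm [measurable]: "?D \<in> borel_measurable (borel :: ('a \<times> 'a) measure)"
  by (intro measurable_compose[OF _ measurable_ennreal] borel_measurable_continuous_onI continuous_intros)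
 have Dq: "?D \<in> borel_measurable q" using Dm by (simp cong: measurable_cong_sets add: sq)
 have "coupling_cost x y M = (\<Sum>i. indicator I i * ((\<integral>\<^sup>+ c. emeasure q {(x i, c)} * ?D (x i, c) \<partial>count_space Y) / cnt w {x i}))"
  unfolding coupling_cost_def using sumrow[where g = "%c. ?D (x _, c)"] by simp
 also have "\<dots> = (\<integral>\<^sup>+ a. \<integral>\<^sup>+ c. emeasure q {(a, c)} * ?D (a, c) \<partial>count_space Y \<partial>count_space X)"
  unfolding w_def X_def by (rule suminf_over_points[OF lf(1)])
 also have "\<dots> = (\<integral>\<^sup>+ p. emeasure q {p} * ?D p \<partial>(count_space X \<Otimes>\<^sub>M count_space Y))"
  using XY by (subst sigma_finite_measure.nn_integral_fst[symmetric])
   (auto intro!: sigma_finite_measure_count_space_countable simp: pair_measure_countable)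
 also have "\<dots> = (\<integral>\<^sup>+ p. emeasure q {p} * ?D p \<partial>count_space (X \<times> Y))"
  using XY by (simp add: pair_measure_countable)
 also have "\<dots> = (\<integral>\<^sup>+ p. emeasure (density q ?D) {p} \<partial>count_space (X \<times> Y))"
 proof (rule nn_integral_cong)
  fix p
  have "emeasure (density q ?D) {p} = (\<integral>\<^sup>+ z. ?D z * indicator {p} z \<partial>q)"
   by (rule emeasure_density[OF Dq sing])
  also have "\<dots> = ?D p * emeasure q {p}" by (rule nn_integral_indicator_singleton) (rule sing)
  finally show "emeasure q {p} * ?D p = emeasure (density q ?D) {p}" by (simp add: mult.commute)
 qed
 also have "\<dots> = emeasure (density q ?D) (X \<times> Y)"
  using XY sing by (intro emeasure_countable_singleton[symmetric]) auto
 also have "\<dots> \<le> emeasure (density q ?D) (space (density q ?D))"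
  by (rule emeasure_space)
 also have "\<dots> = (\<integral>\<^sup>+ z. ?D z \<partial>q)"
  by (subst emeasure_density[OF Dq]) (auto intro!: nn_integral_cong)
 finally have "coupling_cost x y M < \<infinity>" using cost by simp
 then show thesis using mc that by blast
qed

lemma d_config_finite_iff:
 "locfin I x ==> locfin J y ==>
   d_config (cfg I x) (cfg J y) < \<infinity> \<longleftrightarrow> (\<exists>M. matrix_coupling I J M \<and> coupling_cost x y M < \<infinity>)"
 by (metis d_config_le_matrix_coupling ennreal_sqrt_finite matrix_coupling_of_d_config order_le_less_trans)

lemma matrix_coupling_sym:
 "matrix_coupling I J M ==> matrix_coupling J I (%i j. M j i)"
 "coupling_cost y x (%i j. M j i) = coupling_cost x y M"
 by (auto simp: matrix_coupling_def coupling_cost_def dist_commute) (rule suminf_swap_ennreal)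

text \<open>Gluing of couplings along the middle configuration is matrix multiplication. The factors
  2 come from \<open>(a + b)^2 <= 2 a^2 + 2 b^2\<close>; they are harmless because the result is
  applied to finiteness of the distance.\<close>

lemma matrix_coupling_trans:
 fixes x y z :: "nat => 'a::euclidean_space"
 assumes M: "matrix_coupling I J M" and N: "matrix_coupling J K N"
 defines "P \<equiv> %i k. \<Sum>j. M i j * N j k"
 shows "matrix_coupling I K P" "coupling_cost x z P \<le> 2 * coupling_cost x y M + 2 * coupling_cost y z N"
proof -
 have MJ: "M i j * indicator J j = M i j" "indicator J j * M i j = M i j" for i j
  using matrix_couplingD(4)[OF M, of j] by (auto simp: indicator_def)
 have NJ: "N j k * indicator J j = N j k" "indicator J j * N j k = N j k" for j k
  using matrix_couplingD(3)[OF N, of j] by (auto simp: indicator_def)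
 have "(\<Sum>k. P i k) = indicator I i" for i
  unfolding P_def by (subst suminf_swap_ennreal)
   (simp add: ennreal_suminf_cmult matrix_couplingD[OF N] MJ matrix_couplingD[OF M])
 moreover have "(\<Sum>i. P i k) = indicator K k" for k
  unfolding P_def by (subst suminf_swap_ennreal)
   (simp add: ennreal_suminf_multc matrix_couplingD[OF M] NJ matrix_couplingD[OF N])
 ultimately show "matrix_coupling I K P" by (simp add: matrix_coupling_def)
 let ?d = "%a b :: 'a. ennreal ((dist a b)\<^sup>2)"
 have tri: "?d a c \<le> 2 * ?d a b + 2 * ?d b c" for a b c :: 'a
 proof -
  have "(dist a c)\<^sup>2 \<le> (dist a b + dist b c)\<^sup>2" by (intro power_mono dist_triangle) simp
  also have "\<dots> \<le> 2 * (dist a b)\<^sup>2 + 2 * (dist b c)\<^sup>2"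
   using sum_squares_bound[of "dist a b" "dist b c"] by (simp add: power2_sum)
  finally have "?d a c \<le> ennreal (2 * (dist a b)\<^sup>2 + 2 * (dist b c)\<^sup>2)" by (rule ennreal_leI)
  then show ?thesis by (simp add: ennreal_plus ennreal_mult)
 qed
 have "coupling_cost x z P = (\<Sum>i. \<Sum>k. \<Sum>j. M i j * N j k * ?d (x i) (z k))"
  by (simp add: coupling_cost_def P_def ennreal_suminf_multc)
 also have "\<dots> \<le> (\<Sum>i. \<Sum>k. \<Sum>j. 2 * (M i j * N j k * ?d (x i) (y j)) + 2 * (M i j * N j k * ?d (y j) (z k)))"
 proof (intro suminf_le summableI)
  fix i k j
  have "M i j * N j k * ?d (x i) (z k) \<le> M i j * N j k * (2 * ?d (x i) (y j) + 2 * ?d (y j) (z k))"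
   by (intro mult_left_mono tri) simp
  then show "M i j * N j k * ?d (x i) (z k) \<le> 2 * (M i j * N j k * ?d (x i) (y j)) + 2 * (M i j * N j k * ?d (y j) (z k))"
   by (simp add: distrib_left mult_ac)
 qed
 also have "\<dots> = 2 * (\<Sum>i. \<Sum>k. \<Sum>j. M i j * N j k * ?d (x i) (y j)) + 2 * (\<Sum>i. \<Sum>k. \<Sum>j. M i j * N j k * ?d (y j) (z k))"
  by (simp add: suminf_add[symmetric] ennreal_suminf_cmult)
 also have "(\<Sum>i. \<Sum>k. \<Sum>j. M i j * N j k * ?d (x i) (y j)) = coupling_cost x y M"
 proof -
  have "(\<Sum>k. \<Sum>j. M i j * N j k * ?d (x i) (y j)) = (\<Sum>j. M i j * ?d (x i) (y j))" for i
  proof -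
   have "(\<Sum>k. \<Sum>j. M i j * N j k * ?d (x i) (y j)) = (\<Sum>j. \<Sum>k. N j k * (M i j * ?d (x i) (y j)))"
    by (subst suminf_swap_ennreal) (simp add: mult_ac)
   also have "\<dots> = (\<Sum>j. indicator J j * (M i j * ?d (x i) (y j)))"
    by (simp add: ennreal_suminf_multc matrix_couplingD[OF N])
   finally show ?thesis by (simp add: mult.assoc[symmetric] MJ)
  qed
  then show ?thesis by (simp add: coupling_cost_def)
 qed
 also have "(\<Sum>i. \<Sum>k. \<Sum>j. M i j * N j k * ?d (y j) (z k)) = coupling_cost y z N"
 proof -
  have "(\<Sum>i. \<Sum>k. \<Sum>j. M i j * N j k * ?d (y j) (z k)) = (\<Sum>k. \<Sum>j. \<Sum>i. M i j * (N j k * ?d (y j) (z k)))"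
   by (subst suminf_swap_ennreal, subst (2) suminf_swap_ennreal) (simp add: mult_ac)
  also have "\<dots> = (\<Sum>k. \<Sum>j. N j k * ?d (y j) (z k))"
   by (simp add: ennreal_suminf_multc matrix_couplingD[OF M] mult.assoc[symmetric] NJ)
  finally show ?thesis unfolding coupling_cost_def by (subst suminf_swap_ennreal) simp
 qed
 finally show "coupling_cost x z P \<le> 2 * coupling_cost x y M + 2 * coupling_cost y z N" .
qed

lemma matrix_coupling_id:
 "matrix_coupling I I (%i j. if i \<in> I \<and> j = i then 1 else 0)"
 "coupling_cost x y (%i j. if i \<in> I \<and> j = i then 1 else 0) = (\<Sum>i. indicator I i * ennreal ((dist (x i) (y i))\<^sup>2))"
proof -
 have s: "(\<Sum>j. if j = i then f j else 0) = f i" for i and f :: "nat => ennreal"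
  using sums_unique[OF sums_single[of i f]] by simp
 have 1: "(\<Sum>j. if i \<in> I \<and> j = i then f j else 0) = indicator I i * f i" for i and f :: "nat => ennreal"
  by (cases "i \<in> I") (auto simp: s)
 have 2: "(\<Sum>i. if i \<in> I \<and> j = i then 1 else 0) = (indicator I j :: ennreal)" for j
 proof -
  have "(%i. if i \<in> I \<and> j = i then 1 else (0 :: ennreal)) = (%i. if i = j then indicator I j else 0)"
   by (auto simp: indicator_def)
  then show ?thesis by (simp add: s)
 qed
 show "matrix_coupling I I (%i j. if i \<in> I \<and> j = i then 1 else 0)"
  using 1[of _ "%_. 1"] 2 by (simp add: matrix_coupling_def)
 have ind: "(if b then 1 else 0) * c = (if b then c else 0)" for b and c :: ennreal
  by simp
 show "coupling_cost x y (%i j. if i \<in> I \<and> j = i then 1 else 0) = (\<Sum>i. indicator I i * ennreal ((dist (x i) (y i))\<^sup>2))"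
  unfolding coupling_cost_def ind 1 ..
qed

lemma d_config_finite_sym: "d_config g c < \<infinity> ==> d_config c g < \<infinity>"
proof -
 assume d: "d_config g c < \<infinity>"
 obtain I x J y where "locfin I x" "g = cfg I x" "locfin J y" "c = cfg J y"
  by (metis config_cases)
 then show ?thesis using d d_config_finite_iff matrix_coupling_sym by metis
qed

lemma d_config_finite_trans:
 "d_config g c < \<infinity> ==> d_config c w < \<infinity> ==> d_config g w < \<infinity>"
proof -
 assume d: "d_config g c < \<infinity>" "d_config c w < \<infinity>"
 obtain I x where 1: "locfin I x" "g = cfg I x" by (rule config_cases)
 obtain J y where 2: "locfin J y" "c = cfg J y" by (rule config_cases)
 obtain K z where 3: "locfin K z" "w = cfg K z" by (rule config_cases)
 obtain M N where M: "matrix_coupling I J M" "coupling_cost x y M < \<infinity>"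
  and N: "matrix_coupling J K N" "coupling_cost y z N < \<infinity>"
  using d d_config_finite_iff 1 2 3 by metis
 have "2 * coupling_cost x y M + 2 * coupling_cost y z N < \<infinity>"
  using M N by (simp add: ennreal_mult_less_top)
 then have "coupling_cost x z (%i k. \<Sum>j. M i j * N j k) < \<infinity>"
  by (rule order_le_less_trans[OF matrix_coupling_trans(2)[OF M(1) N(1)]])
 then show ?thesis
  unfolding 1(2) 3(2) d_config_finite_iff[OF 1(1) 3(1)] using matrix_coupling_trans(1)[OF M(1) N(1)] by blast
qed

text \<open>Both configurations are enumerated with the \<open>k\<close> inner points first and the
  common outer points afterwards at the same indices. The identity matrix then costs only a finite
  sum over the first \<open>k\<close> indices.\<close>

lemma d_config_finite_same_outside:
 fixes c w :: "'a::euclidean_space config"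
 assumes E: "E \<in> sets borel" "bounded E" and out: "restr (- E) c = restr (- E) w"
  and num: "cnt c E = cnt w E"
 shows "d_config c w < \<infinity>"
proof -
 obtain k x where x: "restr E c = pts k x" "cnt c E = of_nat k"
  by (rule restr_finite_pts[OF E(1) cnt_bounded_finite[OF E(2), of c]])
 obtain k' y where y: "restr E w = pts k' y" "cnt w E = of_nat k'"
  by (rule restr_finite_pts[OF E(1) cnt_bounded_finite[OF E(2), of w]])
 have k: "k' = k" using x y num by simp
 obtain I z where Iz: "locfin I z" "restr (- E) c = cfg I z" by (rule config_cases)
 define J where "J = {..<k} \<union> (+) k ` I"
 define x' where "x' i = (if i < k then x i else z (i - k))" for i
 define y' where "y' i = (if i < k then y i else z (i - k))" for i
 have g: "locfin J x'" "c = cfg J x'"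
  using config_add_pts_cfg[OF Iz(1) order_refl, of k x] config_add_restr[OF E(1), of c] x Iz by (simp_all add: J_def x'_def[abs_def])
 have e: "locfin J y'" "w = cfg J y'"
  using config_add_pts_cfg[OF Iz(1) order_refl, of k y] config_add_restr[OF E(1), of w] y k Iz out by (simp_all add: J_def y'_def[abs_def])
 have "(\<Sum>i. indicator J i * ennreal ((dist (x' i) (y' i))\<^sup>2)) = (\<Sum>i<k. indicator J i * ennreal ((dist (x' i) (y' i))\<^sup>2))"
  by (rule suminf_finite) (auto simp: x'_def y'_def)
 also have "\<dots> < \<infinity>" by (simp add: ennreal_mult_less_top indicator_def)
 finally have "coupling_cost x' y' (%i j. if i \<in> J \<and> j = i then 1 else 0) < \<infinity>"
  by (simp only: matrix_coupling_id(2))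
 then show ?thesis
  unfolding g(2) e(2) d_config_finite_iff[OF g(1) e(1)] using matrix_coupling_id(1) by blast
qed

lemma d_config_pts_update_le:
 assumes "i < k" shows "d_config (pts k x) (pts k (x(i := y))) \<le> ennreal (dist (x i) y)"
proof -
 have "(\<Sum>j. indicator {..<k} j * ennreal ((dist (x j) ((x(i := y)) j))\<^sup>2)) =
   (\<Sum>j. if j = i then ennreal ((dist (x i) y)\<^sup>2) else 0)"
  using assms by (intro arg_cong[of _ _ suminf] ext) auto
 also have "\<dots> = ennreal ((dist (x i) y)\<^sup>2)"
  using sums_unique[OF sums_single[of i "%_. ennreal ((dist (x i) y)\<^sup>2)"]] by simp
 finally have "coupling_cost x (x(i := y)) (%i j. if i \<in> {..<k} \<and> j = i then 1 else 0) = ennreal ((dist (x i) y)\<^sup>2)"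
  by (simp only: matrix_coupling_id(2))
 then show ?thesis
  using d_config_le_matrix_coupling[OF locfin_pts locfin_pts matrix_coupling_id(1), of k x "x(i := y)"]
  by (simp add: pts_eq_cfg ennreal_sqrt_def)
qed

section \<open>Saturations of compact sets\<close>

text \<open>Makes room for up to \<open>N\<close> arbitrary points of a ball of radius
  \<open>m\<close> in front of the slots of \<open>S\<close>, to hold the part of a configuration
  that a saturation may change.\<close>

definition front_slots :: "nat => nat => (nat => 'a::euclidean_space set) => nat => 'a set" where
 "front_slots N m S i = (if i < N then cball 0 (real m) else S (i - N))"

lemma front_slot_system:
 assumes "slot_system S" shows "slot_system (front_slots N m S)"
proof -
 have "{i. front_slots N m S i \<inter> cball 0 R \<noteq> {}} \<subseteq> {..<N} \<union> (+) N ` {i. S i \<inter> cball 0 R \<noteq> {}}" for R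
 proof
  fix i assume "i \<in> {i. front_slots N m S i \<inter> cball 0 R \<noteq> {}}"
  then show "i \<in> {..<N} \<union> (+) N ` {i. S i \<inter> cball 0 R \<noteq> {}}"
   by (cases "i < N") (auto simp: front_slots_def intro!: image_eqI[of _ _ "i - N"])
 qed
 moreover have "finite ({..<N} \<union> (+) N ` {i. S i \<inter> cball 0 R \<noteq> {}})" for R
  using assms by (auto simp: slot_system_def)
 ultimately have "finite {i. front_slots N m S i \<inter> cball 0 R \<noteq> {}}" for R
  by (rule finite_subset)
 moreover have "compact (front_slots N m S i)" for i
  using assms by (auto simp: slot_system_def front_slots_def)
 ultimately show ?thesis by (simp add: slot_system_def)
qed

lemma add_pts_slots:
 assumes "k \<le> N" "\<And>i. i < k ==> a i \<in> cball 0 (real m)" and S: "slot_system S" "v \<in> slots S"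
  and I: "I \<subseteq> {i. fst (v i) = 1}"
 defines "z \<equiv> %i. if i < N then if i < k then (1, a i) else (0, 0) else if i - N \<in> I then v (i - N) else (0, 0)"
 shows "z \<in> slots (front_slots N m S)"
  "slot_config z = config_add (pts k a) (cfg I (%i. snd (v i)))"
proof -
 show "z \<in> slots (front_slots N m S)"
  unfolding slots_def
 proof (intro CollectI allI)
  fix i
  have "v (i - N) \<in> insert (0, 0) ({1} \<times> S (i - N))" using S(2) by (auto simp: slots_def)
  then show "z i \<in> insert (0, 0) ({1} \<times> front_slots N m S i)"
   using assms(2)[of i] by (auto simp: z_def front_slots_def)
 qed
 have lf: "locfin I (%i. snd (v i))"
  using locfin_slots[OF S] I unfolding locfin_def by (blast intro: rev_finite_subset)
 have "config_add (pts k a) (cfg I (%i. snd (v i))) =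
   cfg ({..<k} \<union> (+) N ` I) (%i. if i < N then a i else snd (v (i - N)))"
  by (rule config_add_pts_cfg(2)[OF lf assms(1)])
 also have "\<dots> = cfg {i. fst (z i) = 1} (%i. snd (z i))"
 proof -
  have "{i. fst (z i) = 1} = {..<k} \<union> (+) N ` I"
  proof (intro set_eqI iffI)
   fix i assume i: "i \<in> {i. fst (z i) = 1}"
   show "i \<in> {..<k} \<union> (+) N ` I"
   proof (cases "i < N")
    case True then show ?thesis using i by (auto simp: z_def split: if_splits)
   next
    case False
    then have "i - N \<in> I" "i = N + (i - N)" using i by (auto simp: z_def split: if_splits)
    then show ?thesis by blast
   qed
  qed (use assms(1) I in \<open>auto simp: z_def\<close>)
  moreover have "(if i < N then a i else snd (v (i - N))) = snd (z i)" if "i \<in> {..<k} \<union> (+) N ` I" for i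
   using that assms(1) by (auto simp: z_def)
  ultimately show ?thesis by (auto intro: cfg_cong)
 qed
 finally show "slot_config z = config_add (pts k a) (cfg I (%i. snd (v i)))" by (simp add: slot_config_def)
qed

text \<open>The common outer points keep the slots that they have in the code of \<open>h\<close>,
  shifted by \<open>N\<close>. Taking \<open>N\<close> as the larger of the two inner numbers gives
  both configurations the same shift, so that their codes agree from \<open>N\<close> on.\<close>

lemma same_outside_slots:
 fixes g h :: "'a::euclidean_space config"
 assumes E: "E \<in> sets borel" "bounded E" and out: "restr (- E) g = restr (- E) h"
  and S: "slot_system S" "h \<in> slot_config ` slots S"
 obtains N m z w where "z \<in> slots (front_slots N m S)" "w \<in> slots (front_slots N m S)"
  "slot_config z = g" "slot_config w = h" "\<forall>i\<ge>N. z i = w i"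
proof -
 obtain v where v: "v \<in> slots S" "h = slot_config v" using S(2) by blast
 define I where "I = {i \<in> {i. fst (v i) = 1}. snd (v i) \<in> - E}"
 have outI: "restr (- E) h = cfg I (%i. snd (v i))"
  unfolding v(2) slot_config_def I_def by (rule cnt_restr_cfg[OF locfin_slots[OF S(1) v(1)]]) (use E in auto)
 obtain k a where a: "restr E g = pts k a" "\<And>i. i < k ==> a i \<in> E" "cnt g E = of_nat k"
  by (rule restr_finite_pts[OF E(1) cnt_bounded_finite[OF E(2), of g]]) blast
 obtain l c where c: "restr E h = pts l c" "\<And>i. i < l ==> c i \<in> E" "cnt h E = of_nat l"
  by (rule restr_finite_pts[OF E(1) cnt_bounded_finite[OF E(2), of h]]) blast
 obtain R where R: "E \<subseteq> cball 0 R" using bounded_subset_cball0[OF E(2)] by blast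
 obtain m :: nat where "R \<le> real m" using real_arch_simple by blast
 then have m: "E \<subseteq> cball 0 (real m)" using R by auto
 have I: "I \<subseteq> {i. fst (v i) = 1}" by (auto simp: I_def)
 note za = add_pts_slots[OF _ _ S(1) v(1) I, of k "max k l" a m]
 note zc = add_pts_slots[OF _ _ S(1) v(1) I, of l "max k l" c m]
 have am: "a i \<in> cball 0 (real m)" if "i < k" for i using a(2)[OF that] m by blast
 have cm: "c i \<in> cball 0 (real m)" if "i < l" for i using c(2)[OF that] m by blast
 show thesis
 proof (rule that[OF za(1) zc(1)])
  show "slot_config (%i. if i < max k l then if i < k then (1, a i) else (0, 0) else if i - max k l \<in> I then v (i - max k l) else (0, 0)) = g"
   using za(2) am config_add_restr[OF E(1), of g] a(1) out outI by simp
  show "slot_config (%i. if i < max k l then if i < l then (1, c i) else (0, 0) else if i - max k l \<in> I then v (i - max k l) else (0, 0)) = h"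
   using zc(2) cm config_add_restr[OF E(1), of h] c(1) outI by simp
 qed (use am cm in auto)
qed

lemma finite_subset_exhaustion:
 assumes "exhaustion B" "finite P" shows "\<exists>r. P \<subseteq> B r"
 using assms(2)
proof induction
 case (insert x P)
 then obtain r where "P \<subseteq> B r" by blast
 moreover obtain s where "x \<in> B s" using assms(1) by (auto simp: exhaustion_def)
 moreover have "incseq B" using assms(1) by (simp add: exhaustion_def)
 then have "B r \<subseteq> B (max r s)" "B s \<subseteq> B (max r s)" by (simp_all add: incseqD)
 ultimately show ?case by blast
qed simp

lemma exhaustion_sets:
 assumes "exhaustion B"
 shows "B r \<in> sets borel" "bounded (B r)" "compact (B r)" "convex (B r)" "r \<le> s ==> B r \<subseteq> B s"
  "interior (B r) \<noteq> {}"
 using assms by (auto simp: exhaustion_def compact_imp_closed compact_imp_bounded dest: incseqD)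

text \<open>Only the finitely many slots below \<open>N\<close> can differ, and the points stored in
  them all lie in one \<open>B r\<close>.\<close>

lemma slots_same_outside:
 assumes B: "exhaustion B" and S: "slot_system S" and z: "z \<in> slots S" "w \<in> slots S" "\<forall>i\<ge>N. z i = w i"
 shows "\<exists>r. restr (- B r) (slot_config z) = restr (- B r) (slot_config w)"
proof -
 obtain r where r: "(%i. snd (z i)) ` {..<N} \<union> (%i. snd (w i)) ` {..<N} \<subseteq> B r"
  using finite_subset_exhaustion[OF B, of "(%i. snd (z i)) ` {..<N} \<union> (%i. snd (w i)) ` {..<N}"] by auto
 have Br: "- B r \<in> sets borel" using exhaustion_sets[OF B] by auto
 have big: "N \<le> i" if "snd (z i) \<notin> B r \<or> snd (w i) \<notin> B r" for i
  using that r by (meson UnCI image_eqI in_mono lessThan_iff not_le_imp_less)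
 have eq: "{i \<in> {i. fst (z i) = 1}. snd (z i) \<in> - B r} = {i \<in> {i. fst (w i) = 1}. snd (w i) \<in> - B r}"
  using big z(3) by (metis (lifting) ComplD ComplI mem_Collect_eq)
 have "restr (- B r) (slot_config z) = cfg {i \<in> {i. fst (z i) = 1}. snd (z i) \<in> - B r} (%i. snd (z i))"
  unfolding slot_config_def by (rule cnt_restr_cfg[OF locfin_slots[OF S z(1)] Br])
 also have "\<dots> = cfg {i \<in> {i. fst (w i) = 1}. snd (w i) \<in> - B r} (%i. snd (w i))"
  unfolding eq by (rule cfg_cong) (use big z(3) in auto)
 also have "\<dots> = restr (- B r) (slot_config w)"
  unfolding slot_config_def by (rule cnt_restr_cfg[OF locfin_slots[OF S z(2)] Br, symmetric])
 finally show ?thesis by blast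
qed

section \<open>Saturations as projections of compact sets\<close>

definition unit_matrices :: "(nat => nat => real) set" where
 "unit_matrices = {q. \<forall>i. q i \<in> {p. \<forall>j. p j \<in> {0..1}}}"

lemma compact_unit_matrices: "compact unit_matrices"
 unfolding unit_matrices_def by (intro compact_PiE_UNIV compact_Icc)

text \<open>The quantified \<open>w\<close> and \<open>q\<close> range over compact spaces and the
  relation \<open>C\<close> is closed, so the image is the continuous image of a compact set of
  triples.\<close>

lemma compact_saturation:
 fixes K :: "'a::euclidean_space config set"
 assumes S: "slot_system S" and K: "compact K" and C: "closed C"
 shows "compact (slot_config ` {z \<in> slots S. \<exists>w\<in>slots S. \<exists>q\<in>unit_matrices. slot_config w \<in> K \<and> (z, w, q) \<in> C})"
proof -
 define W where "W = slots S \<times> slots S \<times> unit_matrices"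
 have cW: "compact W" unfolding W_def by (intro compact_Times compact_slots S compact_unit_matrices)
 have c1: "continuous_on W (%p. slot_config (fst p))"
  by (rule continuous_on_compose2[OF continuous_slot_config[OF S] continuous_on_fst[OF continuous_on_id]]) (auto simp: W_def)
 have c2: "continuous_on W (%p. slot_config (fst (snd p)))"
  by (rule continuous_on_compose2[OF continuous_slot_config[OF S] continuous_on_fst[OF continuous_on_snd[OF continuous_on_id]]])
   (auto simp: W_def)
 have "closed (W \<inter> (%p. slot_config (fst (snd p))) -` K)"
  by (rule continuous_closed_preimage[OF c2]) (auto intro: compact_imp_closed cW K)
 then have "compact (W \<inter> ((W \<inter> (%p. slot_config (fst (snd p))) -` K) \<inter> C))"
  using C cW compact_Int_closed closed_Int by blast
 then have "compact ((%p. slot_config (fst p)) ` (W \<inter> ((W \<inter> (%p. slot_config (fst (snd p))) -` K) \<inter> C)))"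
  by (intro compact_continuous_image continuous_on_subset[OF c1]) auto
 also have "(%p. slot_config (fst p)) ` (W \<inter> ((W \<inter> (%p. slot_config (fst (snd p))) -` K) \<inter> C)) =
   slot_config ` {z \<in> slots S. \<exists>w\<in>slots S. \<exists>q\<in>unit_matrices. slot_config w \<in> K \<and> (z, w, q) \<in> C}"
  by (force simp: W_def image_iff)
 finally show ?thesis .
qed

text \<open>Expresses by closed conditions that \<open>z\<close> and \<open>w\<close> agree from
  slot \<open>N\<close> on and that \<open>q\<close> is a coupling matrix of cost at most
  \<open>c\<close>. Full row sums are not closed in the product topology. They are replaced by upper
  bounds for partial sums and by Chebyshev lower bounds: if all slots from \<open>n\<close> on have
  distance at least \<open>D\<close> from slot \<open>i\<close>, the row can send at most
  \<open>c / D^2\<close> beyond \<open>n\<close>. The distance is measured between the ranges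
  \<open>S i\<close> and \<open>S j\<close>, so the premise does not involve \<open>z\<close> and
  \<open>w\<close> and the condition stays closed.\<close>

definition slot_cost_set ::
 "(nat => 'a::euclidean_space set) => nat => nat => ((nat => real \<times> 'a) \<times> (nat => real \<times> 'a) \<times> (nat => nat => real)) set" where
 "slot_cost_set S N c = {p. (\<forall>i. N \<le> i --> fst p i = fst (snd p) i) \<and>
   (\<forall>n. (\<Sum>i<n. \<Sum>j<n. snd (snd p) i j * (dist (snd (fst p i)) (snd (fst (snd p) j)))\<^sup>2) \<le> real c) \<and>
   (\<forall>i n. (\<Sum>j<n. snd (snd p) i j) \<le> fst (fst p i)) \<and>
   (\<forall>j n. (\<Sum>i<n. snd (snd p) i j) \<le> fst (fst (snd p) j)) \<and>
   (\<forall>i n D. D > 0 \<and> (\<forall>j\<ge>n. \<forall>x\<in>S i. \<forall>y\<in>S j. D \<le> dist x y) -->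
    fst (fst p i) - real c / D\<^sup>2 \<le> (\<Sum>j<n. snd (snd p) i j)) \<and>
   (\<forall>j n D. D > 0 \<and> (\<forall>i\<ge>n. \<forall>x\<in>S i. \<forall>y\<in>S j. D \<le> dist x y) -->
    fst (fst (snd p) j) - real c / D\<^sup>2 \<le> (\<Sum>i<n. snd (snd p) i j))}"

lemma continuous_slot_coordinates:
 shows "continuous_on A (%p :: (nat => 'b::topological_space) \<times> (nat => 'c::topological_space) \<times> (nat => nat => 'd::topological_space). fst p i)"
  and "continuous_on A (%p :: (nat => 'b) \<times> (nat => 'c) \<times> (nat => nat => 'd). fst (snd p) i)"
  and "continuous_on A (%p :: (nat => 'b) \<times> (nat => 'c) \<times> (nat => nat => 'd). snd (snd p) i j)"
proof -
 show "continuous_on A (%p :: (nat => 'b) \<times> (nat => 'c) \<times> (nat => nat => 'd). fst p i)"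
  by (rule continuous_on_product_then_coordinatewise) (intro continuous_intros)
 show "continuous_on A (%p :: (nat => 'b) \<times> (nat => 'c) \<times> (nat => nat => 'd). fst (snd p) i)"
  by (rule continuous_on_product_then_coordinatewise) (intro continuous_intros)
 have "continuous_on A (%p :: (nat => 'b) \<times> (nat => 'c) \<times> (nat => nat => 'd). snd (snd p) i)"
  by (rule continuous_on_product_then_coordinatewise) (intro continuous_intros)
 then show "continuous_on A (%p :: (nat => 'b) \<times> (nat => 'c) \<times> (nat => nat => 'd). snd (snd p) i j)"
  by (rule continuous_on_product_then_coordinatewise)
qed

lemma closed_same_slots:
 "closed {p :: (nat => real \<times> 'a::euclidean_space) \<times> (nat => real \<times> 'a) \<times> (nat => nat => real).
   \<forall>i. N \<le> i --> fst p i = fst (snd p) i}"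
 by (intro closed_Collect_all closed_Collect_imp open_Collect_const closed_Collect_eq continuous_slot_coordinates)

lemma closed_slot_cost_set: "closed (slot_cost_set S N c)"
 unfolding slot_cost_set_def
 by (intro closed_Collect_conj closed_same_slots closed_Collect_all closed_Collect_imp open_Collect_const
  closed_Collect_le continuous_intros continuous_slot_coordinates continuous_on_sum)

text \<open>Since only finitely many slots reach a given ball, every \<open>D\<close> admits a
  suitable \<open>n\<close> (\<open>far\<close>). Letting \<open>D\<close> grow removes the defect
  \<open>c / D^2\<close>, and the inequalities become the exact row and column sums of a coupling of
  finite cost.\<close>

lemma slot_cost_set_d_config:
 fixes S :: "nat => 'a::euclidean_space set"
 assumes S: "slot_system S" and z: "z \<in> slots S" "w \<in> slots S" and q: "q \<in> unit_matrices"
  and p: "(z, w, q) \<in> slot_cost_set S N c"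
 shows "d_config (slot_config z) (slot_config w) < \<infinity>"
proof -
 have q0: "0 \<le> q i j" for i j using q by (auto simp: unit_matrices_def)
 have cost: "(\<Sum>i<n. \<Sum>j<n. q i j * (dist (snd (z i)) (snd (w j)))\<^sup>2) \<le> real c"
  and up: "(\<Sum>j<n. q i j) \<le> fst (z i)" "(\<Sum>i<n. q i j) \<le> fst (w j)" for i j n
  using p by (simp_all add: slot_cost_set_def)
 have lo: "fst (z i) - real c / D\<^sup>2 \<le> (\<Sum>j<n. q i j)" if "D > 0" "\<forall>j\<ge>n. \<forall>x\<in>S i. \<forall>y\<in>S j. D \<le> dist x y" for i n D
  using p that by (simp add: slot_cost_set_def)
 have lo': "fst (w j) - real c / D\<^sup>2 \<le> (\<Sum>i<n. q i j)" if "D > 0" "\<forall>i\<ge>n. \<forall>x\<in>S i. \<forall>y\<in>S j. D \<le> dist x y" for j n D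
  using p that by (simp add: slot_cost_set_def)
 have far: "\<exists>n. \<forall>j\<ge>n. \<forall>x\<in>S i. \<forall>y\<in>S j. D \<le> dist x y" for i D
 proof -
  have "bounded (S i)" using S by (auto simp: slot_system_def intro: compact_imp_bounded)
  then obtain R where R: "S i \<subseteq> cball 0 R" using bounded_subset_cball0 by blast
  have "finite {j. S j \<inter> cball 0 (R + D) \<noteq> {}}" using S by (simp add: slot_system_def)
  then obtain n where n: "\<And>j. S j \<inter> cball 0 (R + D) \<noteq> {} ==> j < n"
   by (metis (mono_tags) finite_nat_set_iff_bounded mem_Collect_eq)
  have "D \<le> dist x y" if "n \<le> j" "x \<in> S i" "y \<in> S j" for j x y
  proof -
   have "norm y > R + D" using n[of j] that by (force simp: not_less[symmetric])
   moreover have "norm x \<le> R" using R that by auto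
   moreover have "norm y \<le> norm x + dist x y" by (subst dist_commute) (simp add: dist_norm norm_triangle_sub)
   ultimately show ?thesis by linarith
  qed
  then show ?thesis by blast
 qed
 have eps: "\<exists>D>0. real c / D\<^sup>2 \<le> e" if "e > 0" for e
 proof (intro exI conjI)
  show "0 < max 1 (real c / e)" by simp
  have "real c \<le> e * max 1 (real c / e)" using that by (simp add: field_simps max_def)
  also have "\<dots> \<le> e * (max 1 (real c / e))\<^sup>2"
   using that by (intro mult_left_mono self_le_power) auto
  finally show "real c / (max 1 (real c / e))\<^sup>2 \<le> e" by (simp add: divide_le_eq)
 qed
 \<comment> \<open>Abstracted from rows and columns alike: partial sums at most \<open>s\<close> and
   missing at most \<open>c / D^2\<close> for every \<open>D\<close> must add up to
   \<open>s\<close>.\<close>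
 have full: "(\<Sum>n. ennreal (a n)) = ennreal s"
  if a0: "\<And>n. 0 \<le> a n" and a1: "\<And>n. (\<Sum>j<n. a j) \<le> s"
   and a2: "\<And>D. D > 0 ==> \<exists>n. s - real c / D\<^sup>2 \<le> (\<Sum>j<n. a j)" for a s
 proof -
  have sm: "summable a" using a0 a1 by (rule summableI_nonneg_bounded)
  have "suminf a \<le> s" using sm a1 by (rule suminf_le_const)
  moreover have "s \<le> suminf a"
  proof (rule field_le_epsilon)
   fix e :: real assume "e > 0"
   then obtain D where D: "D > 0" "real c / D\<^sup>2 \<le> e" using eps by blast
   obtain n where "s - real c / D\<^sup>2 \<le> (\<Sum>j<n. a j)" using a2[OF D(1)] by blast
   moreover have "(\<Sum>j<n. a j) \<le> suminf a" using sm a0 by (intro sum_le_suminf) auto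
   ultimately show "s \<le> suminf a + e" using D(2) by linarith
  qed
  ultimately have "suminf a = s" by simp
  then show ?thesis using suminf_ennreal2[OF a0 sm] by simp
 qed
 let ?I = "{i. fst (z i) = 1}" and ?J = "{i. fst (w i) = 1}"
 have fz: "ennreal (fst (z i)) = indicator ?I i" and fw: "ennreal (fst (w i)) = indicator ?J i" for i
  using slots_fst[OF z(1), of i] slots_fst[OF z(2), of i] by (auto simp: indicator_def)
 have "(\<Sum>j. ennreal (q i j)) = indicator ?I i" for i
  unfolding fz[symmetric]
 proof (rule full)
  fix D :: real assume D: "D > 0"
  obtain n where "\<forall>j\<ge>n. \<forall>x\<in>S i. \<forall>y\<in>S j. D \<le> dist x y" using far by blast
  then have "fst (z i) - real c / D\<^sup>2 \<le> (\<Sum>j<n. q i j)" using D by (intro lo)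
  then show "\<exists>n. fst (z i) - real c / D\<^sup>2 \<le> (\<Sum>j<n. q i j)" by blast
 qed (use q0 up in blast)+
 moreover have "(\<Sum>i. ennreal (q i j)) = indicator ?J j" for j
  unfolding fw[symmetric]
 proof (rule full)
  fix D :: real assume "D > 0"
  moreover obtain n where n: "\<forall>i\<ge>n. \<forall>x\<in>S j. \<forall>y\<in>S i. D \<le> dist x y" using far by blast
  ultimately have "fst (w j) - real c / D\<^sup>2 \<le> (\<Sum>i<n. q i j)"
   by (intro lo') (metis dist_commute)+
  then show "\<exists>n. fst (w j) - real c / D\<^sup>2 \<le> (\<Sum>i<n. q i j)" by blast
 qed (use q0 up in blast)+
 ultimately have mc: "matrix_coupling ?I ?J (%i j. ennreal (q i j))" by (simp add: matrix_coupling_def)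
 let ?f = "%i j. q i j * (dist (snd (z i)) (snd (w j)))\<^sup>2"
 have f0: "0 \<le> ?f i j" for i j using q0 by simp
 have "coupling_cost (%i. snd (z i)) (%i. snd (w i)) (%i j. ennreal (q i j)) = (\<Sum>i. \<Sum>j. ennreal (?f i j))"
  using q0 by (simp add: coupling_cost_def ennreal_mult)
 also have "\<dots> \<le> ennreal (real c)"
 proof (rule suminf_le_const)
  fix n
  have "(\<Sum>i<n. \<Sum>j. ennreal (?f i j)) = (\<Sum>j. \<Sum>i<n. ennreal (?f i j))"
   by (rule suminf_sum[symmetric]) simp
  also have "\<dots> \<le> ennreal (real c)"
  proof (rule suminf_le_const)
   fix m
   have "(\<Sum>j<m. \<Sum>i<n. ennreal (?f i j)) = ennreal (\<Sum>j<m. \<Sum>i<n. ?f i j)"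
    using f0 by (simp add: sum_nonneg)
   also have "(\<Sum>j<m. \<Sum>i<n. ?f i j) \<le> (\<Sum>j<max n m. \<Sum>i<n. ?f i j)"
    using f0 by (intro sum_mono2) (auto intro!: sum_nonneg)
   also have "\<dots> \<le> (\<Sum>j<max n m. \<Sum>i<max n m. ?f i j)"
    using f0 by (intro sum_mono sum_mono2) auto
   also have "\<dots> \<le> real c" using cost[of "max n m"] by (subst sum.swap)
   finally show "(\<Sum>j<m. \<Sum>i<n. ennreal (?f i j)) \<le> ennreal (real c)"
    by (simp add: ennreal_leI)
  qed simp
  finally show "(\<Sum>i<n. \<Sum>j. ennreal (?f i j)) \<le> ennreal (real c)" .
 qed simp
 finally have "coupling_cost (%i. snd (z i)) (%i. snd (w i)) (%i j. ennreal (q i j)) < \<infinity>"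
  by (rule order_le_less_trans) simp
 then show ?thesis
  unfolding slot_config_def d_config_finite_iff[OF locfin_slots[OF S z(1)] locfin_slots[OF S z(2)]]
  using mc by blast
qed

text \<open>The converse direction. A matrix of finite cost has entries at most 1, being bounded by
  a row sum, so it lies in \<open>unit_matrices\<close>; any integer above its cost serves as
  \<open>c\<close>, and the lower bounds are Chebyshev's inequality.\<close>

lemma d_config_slot_cost_set:
 fixes S :: "nat => 'a::euclidean_space set"
 assumes S: "slot_system S" and z: "z \<in> slots S" "w \<in> slots S" "\<forall>i\<ge>N. z i = w i"
  and d: "d_config (slot_config z) (slot_config w) < \<infinity>"
 obtains c q where "q \<in> unit_matrices" "(z, w, q) \<in> slot_cost_set S N c"
proof -
 let ?I = "{i. fst (z i) = 1}" and ?J = "{i. fst (w i) = 1}"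
 let ?x = "%i. snd (z i)" and ?y = "%i. snd (w i)"
 obtain M where M: "matrix_coupling ?I ?J M" "coupling_cost ?x ?y M < \<infinity>"
  using d unfolding slot_config_def by (rule matrix_coupling_of_d_config[OF locfin_slots[OF S z(1)] locfin_slots[OF S z(2)]])
 obtain c :: nat where c: "coupling_cost ?x ?y M \<le> of_nat c"
  using M(2) ennreal_Ex_less_of_nat by (metis infinity_ennreal_def less_imp_le)
 define q where "q i j = enn2real (M i j)" for i j
 have M1: "M i j \<le> 1" for i j
 proof -
  have "M i j = (\<Sum>j\<in>{j}. M i j)" by simp
  also have "\<dots> \<le> (\<Sum>j. M i j)" by (rule sum_le_suminf) auto
  also have "\<dots> \<le> 1" by (simp add: matrix_couplingD[OF M(1)] indicator_def)
  finally show ?thesis .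
 qed
 have Mq: "M i j = ennreal (q i j)" for i j
  using M1[of i j] by (simp add: q_def) (metis ennreal_enn2real ennreal_one_less_top order_le_less_trans)
 have q0: "0 \<le> q i j" for i j by (simp add: q_def)
 have q1: "q i j \<le> 1" for i j using M1[of i j] by (simp add: Mq)
 have qu: "q \<in> unit_matrices" using q0 q1 by (auto simp: unit_matrices_def)
 have fz: "ennreal (fst (z i)) = indicator ?I i" "0 \<le> fst (z i)" and fw: "ennreal (fst (w i)) = indicator ?J i" "0 \<le> fst (w i)" for i
  using slots_fst[OF z(1), of i] slots_fst[OF z(2), of i] by (auto simp: indicator_def)
 have sums_of: "a sums s" if "\<And>n. 0 \<le> a n" "(\<Sum>n. ennreal (a n)) = ennreal s" "0 \<le> s" for a s
 proof -
  have "summable a" using that by (intro summable_suminf_not_top) auto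
  moreover from this have "ennreal (suminf a) = ennreal s" using suminf_ennreal2[of a] that by simp
  moreover have "suminf a \<ge> 0" using \<open>summable a\<close> that(1) by (rule suminf_nonneg)
  ultimately show ?thesis using that(3) by (simp add: sums_iff)
 qed
 have row: "q i sums fst (z i)" for i
  by (rule sums_of) (use q0 fz matrix_couplingD(1)[OF M(1), of i] in \<open>auto simp: Mq\<close>)
 have col: "(%i. q i j) sums fst (w j)" for j
  by (rule sums_of) (use q0 fw matrix_couplingD(2)[OF M(1), of j] in \<open>auto simp: Mq\<close>)
 let ?f = "%i j. q i j * (dist (?x i) (?y j))\<^sup>2"
 have f0: "0 \<le> ?f i j" for i j using q0 by simp
 have cost: "(\<Sum>i<n. \<Sum>j<m. ?f i j) \<le> real c" for n m
 proof -
  have "ennreal (\<Sum>i<n. \<Sum>j<m. ?f i j) = (\<Sum>i<n. \<Sum>j<m. ennreal (?f i j))"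
   using f0 by (simp add: sum_nonneg)
  also have "\<dots> \<le> (\<Sum>i<n. \<Sum>j. ennreal (?f i j))" by (intro sum_mono sum_le_suminf) auto
  also have "\<dots> \<le> (\<Sum>i. \<Sum>j. ennreal (?f i j))" by (intro sum_le_suminf) auto
  also have "\<dots> = coupling_cost ?x ?y M" using q0 by (simp add: coupling_cost_def Mq ennreal_mult)
  also have "\<dots> \<le> ennreal (real c)" using c by (simp add: ennreal_of_nat_eq_real_of_nat)
  finally show ?thesis by simp
 qed
 have Mpos: "fst (z i) = 1" "fst (w j) = 1" if "q i j \<noteq> 0" for i j
  using matrix_couplingD(3)[OF M(1), of i j] matrix_couplingD(4)[OF M(1), of j i] q0[of i j] that
  by (auto simp: Mq ennreal_eq_0_iff)
 \<comment> \<open>Chebyshev: each unit of mass \<open>a j\<close> beyond \<open>n\<close> costs at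
   least \<open>D^2\<close>, and the total cost is at most \<open>c\<close>. Indices with
   \<open>a j = 0\<close> are exempt because an empty slot stores no actual point of its
   range.\<close>
 have tail: "s - real c / D\<^sup>2 \<le> (\<Sum>j<n. a j)"
  if a: "a sums s" "\<And>j. 0 \<le> a j" and b: "\<And>m. (\<Sum>j<m. a j * b j) \<le> real c" "\<And>j. 0 \<le> b j"
   and D: "D > 0" "\<And>j. n \<le> j ==> a j \<noteq> 0 ==> D\<^sup>2 \<le> b j" for a b :: "nat => real" and s D n
 proof -
  have sm: "summable a" "suminf a = s" using a(1) by (auto simp: sums_iff)
  have smb: "summable (%j. a j * b j)" using a b by (intro summableI_nonneg_bounded) auto
  have "D\<^sup>2 * (s - (\<Sum>j<n. a j)) = D\<^sup>2 * (\<Sum>j. a (j + n))"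
   using suminf_split_initial_segment[OF sm(1), of n] sm(2) by simp
  also have "\<dots> = (\<Sum>j. D\<^sup>2 * a (j + n))"
   using sm(1) by (intro suminf_mult[symmetric] summable_ignore_initial_segment)
  also have "\<dots> \<le> (\<Sum>j. a (j + n) * b (j + n))"
  proof (rule suminf_le)
   show "D\<^sup>2 * a (j + n) \<le> a (j + n) * b (j + n)" for j
    using D(2)[of "j + n"] a(2)[of "j + n"] by (cases "a (j + n) = 0") (auto simp: mult.commute intro!: mult_right_mono)
   show "summable (%j. D\<^sup>2 * a (j + n))" using sm(1) by (intro summable_mult summable_ignore_initial_segment)
   show "summable (%j. a (j + n) * b (j + n))" using smb by (rule summable_ignore_initial_segment)
  qed
  also have "\<dots> \<le> (\<Sum>j. a j * b j)"
   using suminf_split_initial_segment[OF smb, of n] a b by (simp add: sum_nonneg)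
  also have "\<dots> \<le> real c" using smb b(1) by (rule suminf_le_const)
  finally show ?thesis using D(1) by (simp add: field_simps)
 qed
 have rowc: "(\<Sum>j<m. ?f i j) \<le> real c" for i m
 proof -
  have "(\<Sum>j<m. ?f i j) = (\<Sum>i\<in>{i}. \<Sum>j<m. ?f i j)" by simp
  also have "\<dots> \<le> (\<Sum>i<Suc i. \<Sum>j<m. ?f i j)" using f0 by (intro sum_mono2) (auto intro!: sum_nonneg)
  finally show ?thesis using cost[where n = "Suc i" and m = m] by linarith
 qed
 have colc: "(\<Sum>i<m. ?f i j) \<le> real c" for j m
 proof -
  have "(\<Sum>i<m. ?f i j) = (\<Sum>i<m. \<Sum>j\<in>{j}. ?f i j)" by simp
  also have "\<dots> \<le> (\<Sum>i<m. \<Sum>j<Suc j. ?f i j)" using f0 by (intro sum_mono sum_mono2) auto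
  finally show ?thesis using cost[where n = m and m = "Suc j"] by linarith
 qed
 have lo: "fst (z i) - real c / D\<^sup>2 \<le> (\<Sum>j<n. q i j)" if D: "D > 0" "\<forall>j\<ge>n. \<forall>x\<in>S i. \<forall>y\<in>S j. D \<le> dist x y" for i n D
 proof (rule tail[where b = "%j. (dist (?x i) (?y j))\<^sup>2", OF row q0 rowc _ D(1)])
  fix j assume "n \<le> j" "q i j \<noteq> 0"
  then have "D \<le> dist (?x i) (?y j)"
   using D(2) slots_snd[OF z(1) Mpos(1)] slots_snd[OF z(2) Mpos(2)] by blast
  then show "D\<^sup>2 \<le> (dist (?x i) (?y j))\<^sup>2" using D(1) by (intro power_mono) auto
 qed simp
 have lo': "fst (w j) - real c / D\<^sup>2 \<le> (\<Sum>i<n. q i j)" if D: "D > 0" "\<forall>i\<ge>n. \<forall>x\<in>S i. \<forall>y\<in>S j. D \<le> dist x y" for j n D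
 proof (rule tail[where b = "%i. (dist (?x i) (?y j))\<^sup>2", OF col q0 colc _ D(1)])
  fix i assume "n \<le> i" "q i j \<noteq> 0"
  then have "D \<le> dist (?x i) (?y j)"
   using D(2) slots_snd[OF z(1) Mpos(1)] slots_snd[OF z(2) Mpos(2)] by blast
  then show "D\<^sup>2 \<le> (dist (?x i) (?y j))\<^sup>2" using D(1) by (intro power_mono) auto
 qed simp
 have up: "(\<Sum>j<n. q i j) \<le> fst (z i)" "(\<Sum>i<n. q i j) \<le> fst (w j)" for i j n
 proof -
  have "(\<Sum>j<n. q i j) \<le> suminf (q i)" "(\<Sum>i<n. q i j) \<le> (\<Sum>i. q i j)"
   using row[of i] col[of j] q0 by (intro sum_le_suminf; auto simp: sums_iff)+
  then show "(\<Sum>j<n. q i j) \<le> fst (z i)" "(\<Sum>i<n. q i j) \<le> fst (w j)"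
   using row[of i] col[of j] by (auto simp: sums_iff)
 qed
 have "(z, w, q) \<in> slot_cost_set S N c"
  using z(3) cost up lo lo' by (simp add: slot_cost_set_def)
 then show thesis using qu that by blast
qed

definition tail_saturation :: "(nat => 'a set) => 'a config set => 'a::euclidean_space config set" where
 "tail_saturation B K = {g. \<exists>c\<in>K. \<exists>r. restr (- B r) g = restr (- B r) c}"

definition dist_saturation :: "(nat => 'a set) => 'a config set => 'a::euclidean_space config set" where
 "dist_saturation B K = {g. \<exists>c\<in>K. dbar_config B g c < \<infinity>}"

lemma dbar_config_finite_iff:
 "dbar_config B g c < \<infinity> \<longleftrightarrow> (\<exists>r. restr (- B r) g = restr (- B r) c) \<and> d_config g c < \<infinity>"
 by (auto simp: dbar_config_def)

lemma saturation_borel: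
 assumes B: "exhaustion B" and K: "compact K" "K \<subseteq> slot_config ` slots S" and S: "slot_system S"
 shows "tail_saturation B K \<in> sets borel" "dist_saturation B K \<in> sets borel"
proof -
 define T where "T N m C = slot_config ` {z \<in> slots (front_slots N m S). \<exists>w\<in>slots (front_slots N m S).
   \<exists>q\<in>unit_matrices. slot_config w \<in> K \<and> (z, w, q) \<in> C}" for N m C
 have T: "T N m C \<in> sets borel" if "closed C" for N m C
  unfolding T_def by (intro compact_config_borel compact_saturation front_slot_system S K that)
 define C where "C N = {p :: (nat => real \<times> 'a) \<times> (nat => real \<times> 'a) \<times> (nat => nat => real).
   \<forall>i. N \<le> i --> fst p i = fst (snd p) i}" for N :: nat
 \<comment> \<open>The tail relation involves no matrix; the zero matrix is a dummy witness that
   lets it share the set \<open>T\<close> with the distance relation.\<close>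
 have 0: "(%_ _. 0) \<in> unit_matrices" by (simp add: unit_matrices_def)
 have "tail_saturation B K = (\<Union>N m. T N m (C N))"
 proof (intro set_eqI iffI)
  fix g assume "g \<in> tail_saturation B K"
  then obtain v r where v: "v \<in> K" "restr (- B r) g = restr (- B r) v" by (auto simp: tail_saturation_def)
  then have "v \<in> slot_config ` slots S" using K by blast
  from same_outside_slots[OF exhaustion_sets(1,2)[OF B] v(2) S this]
  obtain N m z w where "z \<in> slots (front_slots N m S)" "w \<in> slots (front_slots N m S)"
   "slot_config z = g" "slot_config w = v" "\<forall>i\<ge>N. z i = w i" .
  then have "g \<in> T N m (C N)" using v(1) 0 by (force simp: T_def C_def)
  then show "g \<in> (\<Union>N m. T N m (C N))" by blast
 next
  fix g assume "g \<in> (\<Union>N m. T N m (C N))"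
  then obtain N m z w where *: "z \<in> slots (front_slots N m S)" "w \<in> slots (front_slots N m S)"
   "slot_config z = g" "slot_config w \<in> K" "\<forall>i\<ge>N. z i = w i" by (auto simp: T_def C_def)
  then show "g \<in> tail_saturation B K"
   using slots_same_outside[OF B front_slot_system[OF S] *(1,2,5)] by (auto simp: tail_saturation_def)
 qed
 also have "\<dots> \<in> sets borel"
  by (auto intro!: sets.countable_UN'' T simp: C_def closed_same_slots)
 finally show "tail_saturation B K \<in> sets borel" .
 have "dist_saturation B K = (\<Union>N m c. T N m (slot_cost_set (front_slots N m S) N c))"
 proof (intro set_eqI iffI)
  fix g assume "g \<in> dist_saturation B K"
  then obtain v r where v: "v \<in> K" "restr (- B r) g = restr (- B r) v" "d_config g v < \<infinity>"
   unfolding dist_saturation_def dbar_config_finite_iff by blast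
  then have "v \<in> slot_config ` slots S" using K by blast
  from same_outside_slots[OF exhaustion_sets(1,2)[OF B] v(2) S this]
  obtain N m z w where *: "z \<in> slots (front_slots N m S)" "w \<in> slots (front_slots N m S)"
   "slot_config z = g" "slot_config w = v" "\<forall>i\<ge>N. z i = w i" .
  have "d_config (slot_config z) (slot_config w) < \<infinity>" using * v(3) by simp
  from d_config_slot_cost_set[OF front_slot_system[OF S] *(1,2,5) this]
  obtain c q where "q \<in> unit_matrices" "(z, w, q) \<in> slot_cost_set (front_slots N m S) N c" .
  then have "g \<in> T N m (slot_cost_set (front_slots N m S) N c)" using * v(1) unfolding T_def by blast
  then show "g \<in> (\<Union>N m c. T N m (slot_cost_set (front_slots N m S) N c))" by blast
 next
  fix g assume "g \<in> (\<Union>N m c. T N m (slot_cost_set (front_slots N m S) N c))"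
  then obtain N m c z w q where *: "z \<in> slots (front_slots N m S)" "w \<in> slots (front_slots N m S)"
   "slot_config z = g" "slot_config w \<in> K" "q \<in> unit_matrices" "(z, w, q) \<in> slot_cost_set (front_slots N m S) N c"
   unfolding T_def by blast
  have same: "\<forall>i\<ge>N. z i = w i" using *(6) by (simp add: slot_cost_set_def)
  have "dbar_config B g (slot_config w) < \<infinity>"
   unfolding dbar_config_finite_iff *(3)[symmetric]
   using slots_same_outside[OF B front_slot_system[OF S] *(1,2) same]
    slot_cost_set_d_config[OF front_slot_system[OF S] *(1,2,5,6)] by blast
  then show "g \<in> dist_saturation B K" using *(4) by (auto simp: dist_saturation_def)
 qed
 also have "\<dots> \<in> sets borel"
  by (auto intro!: sets.countable_UN'' T closed_slot_cost_set)
 finally show "dist_saturation B K \<in> sets borel" .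
qed

section \<open>Tail triviality and finite distance\<close>

lemma restr_outside_mono:
 assumes B: "exhaustion B" and "restr (- B r) g = restr (- B r) c" "r \<le> s"
 shows "restr (- B s) g = restr (- B s) c"
proof -
 have "- B s \<inter> - B r = - B s" using exhaustion_sets(5)[OF B assms(3)] by auto
 then have "restr (- B s) w = restr (- B s) (restr (- B r) w)" for w
  using exhaustion_sets(1)[OF B] by (subst restr_restr) auto
 then show ?thesis using assms(2) by metis
qed

lemma dbar_config_finite_sym:
 "dbar_config B g c < \<infinity> ==> dbar_config B c g < \<infinity>"
 unfolding dbar_config_finite_iff using d_config_finite_sym by metis

lemma dbar_config_finite_trans:
 assumes B: "exhaustion B" and "dbar_config B g c < \<infinity>" "dbar_config B c w < \<infinity>"
 shows "dbar_config B g w < \<infinity>"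
proof -
 obtain r s where r: "restr (- B r) g = restr (- B r) c" and s: "restr (- B s) c = restr (- B s) w"
  and d: "d_config g c < \<infinity>" "d_config c w < \<infinity>"
  using assms(2,3) unfolding dbar_config_finite_iff by blast
 have "restr (- B (max r s)) g = restr (- B (max r s)) w"
  using restr_outside_mono[OF B r, of "max r s"] restr_outside_mono[OF B s, of "max r s"] by simp
 then show ?thesis unfolding dbar_config_finite_iff using d_config_finite_trans[OF d] by blast
qed

lemma dbar_config_finite_same_outside:
 assumes B: "exhaustion B" and "restr (- B r) g = restr (- B r) c" "cnt g (B r) = cnt c (B r)"
 shows "dbar_config B g c < \<infinity>"
 unfolding dbar_config_finite_iff
 using assms d_config_finite_same_outside[OF exhaustion_sets(1,2)[OF B]] by blast

lemma dbar_config_finite_refl: "exhaustion B ==> dbar_config B g g < \<infinity>"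
 by (rule dbar_config_finite_same_outside[where r = 0]) auto

text \<open>If the supremum of the almost sure lower bounds is infinite, every natural number is
  such a bound. Countably many null sets combine, and the distance to \<open>h\<close> is infinite
  almost everywhere on \<open>v\<close>.\<close>

lemma dbar_sets_finiteI:
 assumes "\<not> (AE g in \<mu>. g \<in> v --> (INF w \<in> h. dbar_config B g w) = \<infinity>)"
 shows "dbar_sets B \<mu> v h < \<infinity>"
proof (rule ccontr)
 let ?d = "%g. INF w \<in> h. dbar_config B g w"
 assume "\<not> dbar_sets B \<mu> v h < \<infinity>"
 then have sup: "Sup {c. AE g in \<mu>. g \<in> v --> c \<le> ?d g} = \<infinity>"
  by (simp only: dbar_sets_def infinity_ennreal_def not_less top_unique)
 have "AE g in \<mu>. g \<in> v --> of_nat n \<le> ?d g" for n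
 proof -
  have "of_nat n < Sup {c. AE g in \<mu>. g \<in> v --> c \<le> ?d g}"
   unfolding sup by (simp add: of_nat_less_top)
  then obtain c where "of_nat n < c" "AE g in \<mu>. g \<in> v --> c \<le> ?d g"
   unfolding less_Sup_iff by blast
  then show ?thesis by (auto elim!: eventually_mono)
 qed
 then have "AE g in \<mu>. \<forall>n::nat. g \<in> v --> of_nat n \<le> ?d g"
  unfolding AE_all_countable by blast
 then have "AE g in \<mu>. g \<in> v --> ?d g = \<infinity>"
 proof eventually_elim
  case (elim g)
  show ?case
  proof (rule impI, rule ccontr)
   assume "g \<in> v" "?d g \<noteq> \<infinity>"
   then have "?d g < top" by (simp only: less_top infinity_ennreal_def)
   then obtain n :: nat where "?d g < of_nat n" using ennreal_Ex_less_of_nat by blast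
   then show False using elim \<open>g \<in> v\<close> by (meson leD)
  qed
 qed
 then show False using assms by simp
qed

text \<open>Both routes to (b) prove the stronger fact that almost every configuration, not just a
  set of positive measure, is at finite distance from a given Borel set of positive measure.\<close>

lemma positive_sets_finite_distanceI:
 fixes \<mu> :: "'a::euclidean_space config measure"
 assumes "\<And>v. v \<in> sets borel ==> emeasure \<mu> v > 0 ==> AE g in \<mu>. \<exists>c\<in>v. dbar_config B g c < \<infinity>"
 shows "positive_sets_finite_distance B \<mu>"
 unfolding positive_sets_finite_distance_def
proof (intro ballI impI dbar_sets_finiteI notI)
 fix w v assume w: "w \<in> sets (completion \<mu>)" and v: "v \<in> sets borel"
  and pos: "0 < emeasure (completion \<mu>) w * emeasure \<mu> v"
  and inf: "AE g in \<mu>. g \<in> w --> (INF c \<in> v. dbar_config B g c) = \<infinity>"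
 have "emeasure \<mu> v > 0" using pos by (auto simp: zero_less_iff_neq_zero)
 from assms[OF v this] inf have "AE g in \<mu>. g \<notin> w"
 proof eventually_elim
  case (elim g)
  then obtain c where "c \<in> v" "dbar_config B g c < \<infinity>" by blast
  then have "(INF c \<in> v. dbar_config B g c) < \<infinity>" by (meson INF_lower order_le_less_trans)
  then show ?case using elim by auto
 qed
 then have "AE g in completion \<mu>. g \<notin> w" by (rule AE_completion)
 then have "emeasure (completion \<mu>) w = 0" 
  using AE_iff_measurable[OF w, of "%g. g \<notin> w"] sets.sets_into_space[OF w] by auto
 then show False using pos by simp
qed

lemma tail_trivial_of_finite_distance:
 fixes \<mu> :: "'a::euclidean_space config measure"
 assumes p: "prob_space \<mu>" and sets: "sets \<mu> = sets borel" and fd: "positive_sets_finite_distance B \<mu>"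
 shows "tail_trivial B \<mu>"
 unfolding tail_trivial_def
proof (intro ballI, rule ccontr)
 interpret prob_space \<mu> by fact
 have sp: "space \<mu> = UNIV" using sets_eq_imp_space_eq[OF sets] by simp
 fix w assume w: "w \<in> (\<Inter>r. sets (outside_algebra B r))" and n: "\<not> (emeasure \<mu> w = 0 \<or> emeasure \<mu> w = 1)"
 \<comment> \<open>A set outside \<open>sets \<mu>\<close> would have measure 0 by convention, which
   is excluded here.\<close>
 then have \<Xi>s: "w \<in> sets \<mu>" using emeasure_notin_sets by blast
 have cs: "- w \<in> sets \<mu>" using sets.compl_sets[OF \<Xi>s] by (simp add: sp Compl_eq_Diff_UNIV)
 have pc: "emeasure \<mu> (- w) > 0"
 proof (rule ccontr)
  assume "\<not> emeasure \<mu> (- w) > 0"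
  then have "\<not> 0 < prob (- w)" by (simp add: emeasure_eq_measure)
  then have "prob (- w) = 0" using measure_nonneg[of \<mu> "- w"] by linarith
  then have "prob w = 1" using prob_compl[OF \<Xi>s] by (simp add: sp Compl_eq_Diff_UNIV)
  then show False using n by (simp add: emeasure_eq_measure)
 qed
 have inf: "dbar_config B g c = \<infinity>" if "g \<in> w" "c \<in> - w" for g c
 proof (rule ccontr)
  assume "dbar_config B g c \<noteq> \<infinity>"
  then obtain r where r: "restr (- B r) g = restr (- B r) c" by (auto simp: dbar_config_def split: if_splits)
  have "w \<in> sets (vimage_algebra UNIV (restr (- B r)) borel)" using w by (auto simp: outside_algebra_def)
  then obtain X where "w = restr (- B r) -` X" by (auto simp: sets_vimage_algebra2)
  then show False using that r by auto
 qed
 have "emeasure (completion \<mu>) w * emeasure \<mu> (- w) > 0"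
  using n pc \<Xi>s by (auto simp: zero_less_iff_neq_zero ennreal_zero_less_mult_iff)
 then have "dbar_sets B \<mu> w (- w) < \<infinity>"
  using fd \<Xi>s cs unfolding positive_sets_finite_distance_def by (auto simp: sets)
 moreover have "(INF c \<in> - w. dbar_config B g c) = \<infinity>" if "g \<in> w" for g
  using inf[OF that] by (auto simp: top_unique[symmetric] intro!: INF_greatest)
 then have "AE g in \<mu>. g \<in> w --> \<infinity> \<le> (INF c \<in> - w. dbar_config B g c)" by simp
 then have "\<infinity> \<le> dbar_sets B \<mu> w (- w)" unfolding dbar_sets_def by (intro Sup_upper) simp
 ultimately show False by simp
qed

text \<open>Membership depends only on the configuration far out, hence does not change under
  \<open>restr (- B r)\<close>; the set is its own preimage under this map.\<close>

lemma tail_saturation_outside: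
 assumes B: "exhaustion B" and T: "tail_saturation B K \<in> sets borel"
 shows "tail_saturation B K \<in> sets (outside_algebra B r)"
proof -
 have idem: "restr (- B r) (restr (- B r) g) = restr (- B r) g" for g :: "'a config"
  using exhaustion_sets(1)[OF B] by (subst restr_restr) auto
 have "g \<in> tail_saturation B K \<longleftrightarrow> restr (- B r) g \<in> tail_saturation B K" for g
 proof -
  have "(\<exists>s. restr (- B s) g = restr (- B s) c) \<longleftrightarrow> (\<exists>s. restr (- B s) (restr (- B r) g) = restr (- B s) c)" for c
  proof
   assume "\<exists>s. restr (- B s) g = restr (- B s) c"
   then obtain s where "restr (- B s) g = restr (- B s) c" ..
   then show "\<exists>s. restr (- B s) (restr (- B r) g) = restr (- B s) c"
    using restr_outside_mono[OF B idem, of "max r s" g] restr_outside_mono[OF B, of s g c "max r s"]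
    by (intro exI[of _ "max r s"]) simp
  next
   assume "\<exists>s. restr (- B s) (restr (- B r) g) = restr (- B s) c"
   then obtain s where "restr (- B s) (restr (- B r) g) = restr (- B s) c" ..
   then show "\<exists>s. restr (- B s) g = restr (- B s) c"
    using restr_outside_mono[OF B idem, of "max r s" g] restr_outside_mono[OF B, of s "restr (- B r) g" c "max r s"]
    by (intro exI[of _ "max r s"]) simp
  qed
  then show ?thesis unfolding tail_saturation_def by simp
 qed
 then have "tail_saturation B K = restr (- B r) -` tail_saturation B K \<inter> UNIV" by auto
 then show ?thesis unfolding outside_algebra_def using in_vimage_algebra[OF T, of "restr (- B r)" UNIV] by simp
qed

lemma finite_distance_of_tail_trivial:
 fixes \<mu> :: "'a::euclidean_space config measure"
 assumes B: "exhaustion B" and p: "prob_space \<mu>" and sets: "sets \<mu> = sets borel"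
  and R: "number_rigid \<mu>" and T: "tail_trivial B \<mu>"
 shows "positive_sets_finite_distance B \<mu>"
proof (rule positive_sets_finite_distanceI)
 interpret prob_space \<mu> by fact
 fix w assume w: "w \<in> sets borel" "emeasure \<mu> w > 0"
 have "\<exists>v \<in> sets \<mu>. emeasure \<mu> v = 1 \<and> (\<forall>g\<in>v. \<forall>c\<in>v. restr (- B r) g = restr (- B r) c -->
    cnt g (B r) = cnt c (B r))" for r
  using R exhaustion_sets(1,2)[OF B] unfolding number_rigid_def by blast
 then obtain v where v: "\<And>r. v r \<in> sets \<mu>" "\<And>r. emeasure \<mu> (v r) = 1"
  "\<And>r g c. g \<in> v r ==> c \<in> v r ==> restr (- B r) g = restr (- B r) c ==> cnt g (B r) = cnt c (B r)"
  by metis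
 have AE\<Omega>: "AE g in \<mu>. \<forall>r. g \<in> v r"
  unfolding AE_all_countable using v by (auto intro!: AE_prob_1 simp: emeasure_eq_measure)
 \<comment> \<open>Rigidity compares two configurations only if both lie in the full-measure set
   \<open>v r\<close>. Cutting \<open>w\<close> down to all these sets before choosing the compact
   \<open>K\<close> guarantees this for the representative in \<open>K\<close>, whatever
   \<open>r\<close> turns up.\<close>
 define \<Lambda>' where "\<Lambda>' = w \<inter> (\<Inter>r. v r)"
 have \<Lambda>'s: "\<Lambda>' \<in> sets \<mu>" using v w by (auto simp: \<Lambda>'_def sets)
 have "emeasure \<mu> \<Lambda>' = emeasure \<mu> w"
  using AE\<Omega> by (intro emeasure_eq_AE) (use \<Lambda>'s w in \<open>auto simp: \<Lambda>'_def sets elim!: eventually_mono\<close>)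
 then obtain K b where K: "compact K" "K \<subseteq> \<Lambda>'" "K \<subseteq> slot_config ` slots (ring_slots b)" "emeasure \<mu> K > 0"
  using compact_inner[OF finite_measure_axioms sets, of \<Lambda>'] w \<Lambda>'s by (auto simp: sets)
 have Ts: "tail_saturation B K \<in> sets borel"
  by (rule saturation_borel(1)[OF B K(1,3) ring_slot_system])
 have "K \<subseteq> tail_saturation B K" by (auto simp: tail_saturation_def)
 then have "emeasure \<mu> (tail_saturation B K) \<noteq> 0"
  using K(4) emeasure_mono[of K "tail_saturation B K" \<mu>] Ts by (auto simp: sets)
 then have "emeasure \<mu> (tail_saturation B K) = 1"
  using T tail_saturation_outside[OF B Ts] unfolding tail_trivial_def by blast
 then have "AE g in \<mu>. g \<in> tail_saturation B K"
  by (intro AE_prob_1) (simp add: emeasure_eq_measure)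
 with AE\<Omega> show "AE g in \<mu>. \<exists>c\<in>w. dbar_config B g c < \<infinity>"
 proof eventually_elim
  case (elim g)
  then obtain c r where c: "c \<in> K" "restr (- B r) g = restr (- B r) c" by (auto simp: tail_saturation_def)
  then have "c \<in> w" "c \<in> v r" using K(2) by (auto simp: \<Lambda>'_def)
  moreover have "dbar_config B g c < \<infinity>"
   using dbar_config_finite_same_outside[OF B c(2)] v(3)[OF _ \<open>c \<in> v r\<close> c(2)] elim(1) by blast
  ultimately show ?case by blast
 qed
qed

text \<open>Finite distance is an equivalence relation, so \<open>V\<close> is a union of classes
  and its indicator does not distinguish configurations at finite distance. Passing to a compact
  subset of \<open>w\<close> first makes \<open>V\<close> Borel.\<close>

lemma exists_dist_saturation:
 fixes \<mu> :: "'a::euclidean_space config measure"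
 assumes B: "exhaustion B" and p: "finite_measure \<mu>" and sets: "sets \<mu> = sets borel"
  and w: "w \<in> sets borel" "emeasure \<mu> w > 0"
 obtains V where "V \<in> sets borel" "emeasure \<mu> V > 0" "\<And>g. g \<in> V ==> \<exists>c\<in>w. dbar_config B g c < \<infinity>"
  "\<And>g \<gamma>'. dbar_config B g \<gamma>' < \<infinity> ==> g \<in> V \<longleftrightarrow> \<gamma>' \<in> V"
proof -
 obtain K b where K: "compact K" "K \<subseteq> w" "K \<subseteq> slot_config ` slots (ring_slots b)" "emeasure \<mu> K > 0"
  using compact_inner[OF p sets w] by blast
 have Vs: "dist_saturation B K \<in> sets borel"
  by (rule saturation_borel(2)[OF B K(1,3) ring_slot_system])
 have sub: "K \<subseteq> dist_saturation B K" using dbar_config_finite_refl[OF B] by (auto simp: dist_saturation_def)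
 show thesis
 proof (rule that[OF Vs])
  show "emeasure \<mu> (dist_saturation B K) > 0"
   using K(4) emeasure_mono[OF sub, of \<mu>] Vs by (auto simp: sets intro: order.strict_trans2)
  show "\<exists>c\<in>w. dbar_config B g c < \<infinity>" if "g \<in> dist_saturation B K" for g
   using that K(2) unfolding dist_saturation_def by blast
  show "g \<in> dist_saturation B K \<longleftrightarrow> \<gamma>' \<in> dist_saturation B K" if "dbar_config B g \<gamma>' < \<infinity>" for g \<gamma>'
   unfolding dist_saturation_def
   using dbar_config_finite_trans[OF B that] dbar_config_finite_trans[OF B dbar_config_finite_sym[OF that]] by blast
 qed
qed

section \<open>Smooth bump functions\<close>

text \<open>Smoothness as membership in a family closed under differentiation, the one-dimensional
  counterpart of \<open>smooth_power\<close>, so that products of such functions fit that definition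
  directly.\<close>

definition smooth_fun :: "(real => real) => bool" where
 "smooth_fun f \<longleftrightarrow> (\<exists>S. f \<in> S \<and> (\<forall>g\<in>S. \<exists>h\<in>S. \<forall>t. (g has_real_derivative h t) (at t)))"

text \<open>By the Leibniz rule the finite sums of products of a member of \<open>S\<close> and a
  member of \<open>T\<close> are closed under differentiation; the lists of pairs name such
  sums.\<close>

lemma smooth_fun_mult:
 assumes "smooth_fun f" "smooth_fun g" shows "smooth_fun (%t. f t * g t)"
proof -
 obtain S where S: "f \<in> S" "\<And>u. u \<in> S ==> \<exists>h\<in>S. \<forall>t. (u has_real_derivative h t) (at t)"
  using assms(1) by (auto simp: smooth_fun_def)
 obtain T where T: "g \<in> T" "\<And>u. u \<in> T ==> \<exists>h\<in>T. \<forall>t. (u has_real_derivative h t) (at t)"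
  using assms(2) by (auto simp: smooth_fun_def)
 define Q where "Q = (%xs t. \<Sum>(a, b)\<leftarrow>xs. a t * b t :: real) ` {xs. set xs \<subseteq> S \<times> T}"
 have "\<exists>ys. set ys \<subseteq> S \<times> T \<and> (\<forall>t. ((%t. \<Sum>(a, b)\<leftarrow>xs. a t * b t) has_real_derivative (\<Sum>(a, b)\<leftarrow>ys. a t * b t)) (at t))"
  if "set xs \<subseteq> S \<times> T" for xs
  using that
 proof (induction xs)
  case Nil
  then show ?case by (intro exI[of _ "[]"]) auto
 next
  case (Cons p xs)
  obtain a b where p: "p = (a, b)" by fastforce
  from Cons obtain ys where ys: "set ys \<subseteq> S \<times> T"
   "\<And>t. ((%t. \<Sum>(a, b)\<leftarrow>xs. a t * b t) has_real_derivative (\<Sum>(a, b)\<leftarrow>ys. a t * b t)) (at t)" by auto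
  have ab: "a \<in> S" "b \<in> T" using Cons.prems p by auto
  obtain a' where a': "a' \<in> S" "\<And>t. (a has_real_derivative a' t) (at t)" using S(2)[OF ab(1)] by blast
  obtain b' where b': "b' \<in> T" "\<And>t. (b has_real_derivative b' t) (at t)" using T(2)[OF ab(2)] by blast
  show ?case
  proof (intro exI[of _ "(a', b) # (a, b') # ys"] conjI allI)
   show "set ((a', b) # (a, b') # ys) \<subseteq> S \<times> T" using ys ab a' b' by auto
   fix t
   show "((%t. \<Sum>(a, b)\<leftarrow>p # xs. a t * b t) has_real_derivative (\<Sum>(a, b)\<leftarrow>(a', b) # (a, b') # ys. a t * b t)) (at t)"
    unfolding p by (auto intro!: derivative_eq_intros a' b' ys simp: algebra_simps)
  qed
 qed
 then have "\<forall>g\<in>Q. \<exists>h\<in>Q. \<forall>t. (g has_real_derivative h t) (at t)"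
  unfolding Q_def by (simp add: image_iff)
 moreover have "(%t. f t * g t) \<in> Q"
  unfolding Q_def using S(1) T(1) by (intro image_eqI[of _ _ "[(f, g)]"]) auto
 ultimately show ?thesis unfolding smooth_fun_def by blast
qed

lemma smooth_fun_affine:
 assumes "smooth_fun f" shows "smooth_fun (%t. f (a * t + b))"
proof -
 obtain S where S: "f \<in> S" "\<And>u. u \<in> S ==> \<exists>h\<in>S. \<forall>t. (u has_real_derivative h t) (at t)"
  using assms(1) by (auto simp: smooth_fun_def)
 define Q where "Q = {%t. k * g (a * t + b) | k g. g \<in> S}"
 have "\<exists>h\<in>Q. \<forall>t. (u has_real_derivative h t) (at t)" if u: "u \<in> Q" for u
 proof -
  obtain k g where kg: "u = (%t. k * g (a * t + b))" "g \<in> S" using u by (auto simp: Q_def)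
  obtain h where h: "h \<in> S" "\<And>t. (g has_real_derivative h t) (at t)" using S(2)[OF kg(2)] by blast
  have "(u has_real_derivative k * a * h (a * t + b)) (at t)" for t
  proof -
   have "((%t. g (a * t + b)) has_real_derivative h (a * t + b) * a) (at t)"
    by (rule DERIV_chain2[OF h(2)]) (auto intro!: derivative_eq_intros)
   from DERIV_cmult[OF this, of k] show ?thesis unfolding kg(1) by (simp add: mult_ac)
  qed
  then show ?thesis using h(1) unfolding Q_def by (intro bexI[of _ "%t. (k * a) * h (a * t + b)"]) auto
 qed
 moreover have "(%t. f (a * t + b)) \<in> Q"
  unfolding Q_def using S(1) by (auto intro!: exI[of _ "1::real"] exI[of _ f])
 ultimately show ?thesis unfolding smooth_fun_def by blast
qed

text \<open>The classical flat functions \<open>p(1/t) exp(-c/t)\<close>, extended by 0 to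
  \<open>t <= 0\<close>. The polynomial factor closes the family under differentiation.\<close>

definition exp_poly :: "real => real poly => real => real" where
 "exp_poly c p t = (if t > 0 then poly p (1 / t) * exp (- c / t) else 0)"

lemma poly_exp_tendsto_0:
 assumes "c > 0" shows "((%s :: real. poly p s * exp (- c * s)) \<longlongrightarrow> 0) at_top"
proof -
 have "((%s. s ^ i * exp (- c * s)) \<longlongrightarrow> 0) at_top" for i
 proof -
  have "filterlim (%s. c * s) at_top at_top"
   using assms by (intro filterlim_tendsto_pos_mult_at_top[OF tendsto_const] filterlim_ident)
  then have "((%s. (c * s) ^ i / exp (c * s)) \<longlongrightarrow> 0) at_top"
   by (rule filterlim_compose[OF tendsto_power_div_exp_0])
  then have "((%s. (1 / c ^ i) * ((c * s) ^ i / exp (c * s))) \<longlongrightarrow> (1 / c ^ i) * 0) at_top"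
   by (intro tendsto_mult tendsto_const)
  then show ?thesis using assms by (simp add: power_mult_distrib exp_minus field_simps)
 qed
 then have "((%s. \<Sum>i\<le>degree p. coeff p i * (s ^ i * exp (- c * s))) \<longlongrightarrow> (\<Sum>i\<le>degree p. coeff p i * 0)) at_top"
  by (intro tendsto_sum tendsto_mult tendsto_const)
 then show ?thesis by (simp add: poly_altdef sum_distrib_right mult.assoc)
qed

text \<open>With \<open>s = 1/t\<close> the derivative has the polynomial
  \<open>s^2 (c p - p')\<close>. At 0 the same substitution turns the right difference quotient into
  a polynomial times \<open>exp (- c s)\<close> for \<open>s\<close> tending to infinity.\<close>

lemma exp_poly_deriv:
 assumes c: "c > 0"
 shows "(exp_poly c p has_real_derivative exp_poly c ([:0, 0, 1:] * (smult c p - pderiv p)) t) (at t)"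
proof (rule linorder_cases[of t 0])
 assume t: "t < 0"
 have "((%_. 0) has_real_derivative 0) (at t)" by simp
 then have "(exp_poly c p has_real_derivative 0) (at t)"
  by (rule has_field_derivative_transform_within_open[of _ _ _ "{..<0}"]) (use t in \<open>auto simp: exp_poly_def\<close>)
 then show ?thesis using t by (simp add: exp_poly_def)
next
 assume t: "t > 0"
 have "((%t. poly p (1 / t) * exp (- c / t)) has_real_derivative
   (poly (pderiv p) (1 / t) * (- 1 / t\<^sup>2)) * exp (- c / t) + exp (- c / t) * (c / t\<^sup>2) * poly p (1 / t)) (at t)"
 proof (rule DERIV_mult)
  have "((%t. 1 / t) has_real_derivative (- 1 / t\<^sup>2)) (at t)"
   using t by (auto intro!: derivative_eq_intros simp: power2_eq_square)
  from DERIV_chain2[OF poly_DERIV this, of p]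
  show "((%t. poly p (1 / t)) has_real_derivative poly (pderiv p) (1 / t) * (- 1 / t\<^sup>2)) (at t)" .
  show "((%t. exp (- c / t)) has_real_derivative exp (- c / t) * (c / t\<^sup>2)) (at t)"
   using t by (auto intro!: derivative_eq_intros simp: power2_eq_square)
 qed
 then have "((%t. poly p (1 / t) * exp (- c / t)) has_real_derivative
   exp_poly c ([:0, 0, 1:] * (smult c p - pderiv p)) t) (at t)"
  using t by (simp add: exp_poly_def power2_eq_square algebra_simps)
 then show ?thesis
  by (rule has_field_derivative_transform_within_open[of _ _ _ "{0<..}"]) (use t in \<open>auto simp: exp_poly_def\<close>)
next
 assume t: "t = 0"
 have "((%h. exp_poly c p h / h) \<longlongrightarrow> 0) (at_right 0)"
  unfolding filterlim_at_right_to_top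
 proof (rule Lim_transform_eventually[OF poly_exp_tendsto_0[OF c, of "pCons 0 p"]])
  show "\<forall>\<^sub>F s in at_top. poly (pCons 0 p) s * exp (- c * s) = exp_poly c p (inverse s) / inverse s"
   using eventually_gt_at_top[of 0] by eventually_elim (simp add: exp_poly_def field_simps)
 qed
 moreover have "((%h. exp_poly c p h / h) \<longlongrightarrow> 0) (at_left 0)"
  by (rule Lim_transform_eventually[OF tendsto_const[of 0]])
   (auto simp: exp_poly_def eventually_at_filter)
 ultimately have "((%h. exp_poly c p h / h) \<longlongrightarrow> 0) (at 0)" by (simp add: filterlim_at_split)
 then show ?thesis unfolding t DERIV_def by (simp add: exp_poly_def)
qed

lemma smooth_exp_poly: assumes "c > 0" shows "smooth_fun (exp_poly c p)"
 unfolding smooth_fun_def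
 by (rule exI[of _ "range (exp_poly c)"]) (use exp_poly_deriv[OF assms] in blast)

text \<open>Smooth, positive exactly on the open interval, and convergent to its indicator because
  the constant \<open>1 / Suc n\<close> in the exponent tends to 0.\<close>

definition window :: "nat => real => real => real => real" where
 "window n l u t = exp_poly (1 / real (Suc n)) 1 (t - l) * exp_poly (1 / real (Suc n)) 1 (u - t)"

lemma window_smooth: "smooth_fun (window n l u)"
proof -
 have "smooth_fun (%t. exp_poly (1 / real (Suc n)) 1 (1 * t + (- l)) * exp_poly (1 / real (Suc n)) 1 ((- 1) * t + u))"
  by (intro smooth_fun_mult smooth_fun_affine smooth_exp_poly) auto
 then show ?thesis by (simp add: window_def[abs_def])
qed

lemma window_bounds: "0 \<le> window n l u t" "window n l u t \<le> 1"
proof -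
 have 1: "0 \<le> exp_poly (1 / real (Suc n)) 1 s" "exp_poly (1 / real (Suc n)) 1 s \<le> 1" for s
  by (auto simp: exp_poly_def)
 show "0 \<le> window n l u t" "window n l u t \<le> 1"
  unfolding window_def using 1 by (auto intro!: mult_nonneg_nonneg mult_le_one)
qed

lemma window_nonzero: "window n l u t \<noteq> 0 \<longleftrightarrow> l < t \<and> t < u"
 by (auto simp: window_def exp_poly_def)

lemma window_tendsto: "(%n. window n l u t) \<longlonglongrightarrow> indicator {l<..<u} t"
proof (cases "l < t \<and> t < u")
 case True
 have "(%n. exp (- (1 / real (Suc n)) / s)) \<longlonglongrightarrow> exp (- 0 / s)" if "s > 0" for s :: real
  by (intro tendsto_intros LIMSEQ_inverse_real_of_nat[unfolded inverse_eq_divide]) (use that in auto)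
 from tendsto_mult[OF this[of "t - l"] this[of "u - t"]] True
 have "(%n. window n l u t) \<longlonglongrightarrow> 1" by (simp add: window_def exp_poly_def)
 then show ?thesis using True by simp
next
 case False
 then have "window n l u t = 0" for n using window_nonzero by blast
 then show ?thesis using False by auto
qed

definition bump_power :: "nat => nat => (nat => 'a) => (nat => 'a) => (nat => 'a::euclidean_space) => real" where
 "bump_power n k l u x = (\<Prod>(i, b)\<in>{..<k} \<times> Basis. window n (l i \<bullet> b) (u i \<bullet> b) (x i \<bullet> b))"

lemma smooth_fun_continuous: "smooth_fun f ==> continuous_on A f"
 unfolding smooth_fun_def by (meson DERIV_continuous_on has_field_derivative_at_within)

text \<open>Each coordinate \<open>(i, b)\<close> occurs in one factor only, so a partial derivative
  replaces that factor by its derivative. The products of smooth one-dimensional functions therefore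
  form a family as \<open>smooth_power\<close> requires.\<close>

lemma smooth_power_prod:
 fixes w :: "nat \<times> 'a::euclidean_space => real => real"
 assumes "\<And>p. smooth_fun (w p)"
 shows "smooth_power k (%x. \<Prod>p\<in>{..<k} \<times> Basis. w p (x (fst p) \<bullet> snd p))"
proof -
 let ?P = "{..<k} \<times> (Basis :: 'a set)"
 define F where "F v x = (\<Prod>p\<in>?P. v p (x (fst p) \<bullet> snd p))" for v :: "nat \<times> 'a => real => real" and x
 have fin: "finite ?P" by simp
 define SS where "SS = {v :: nat \<times> 'a => real => real. \<forall>p. smooth_fun (v p)}"
 have c: "continuous_on A (%x :: nat => 'a. v p (x i \<bullet> b))" if "v \<in> SS" for v p i b A
 proof -
  have "smooth_fun (v p)" using that unfolding SS_def by blast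
  then have "continuous_on UNIV (v p)" by (rule smooth_fun_continuous)
  moreover have "continuous_on A (%x :: nat => 'a. x i \<bullet> b)"
   by (intro continuous_on_inner continuous_on_const continuous_on_product_then_coordinatewise[OF continuous_on_id])
  ultimately show ?thesis by (rule continuous_on_compose2) simp
 qed
 have d: "\<exists>h. smooth_fun h \<and> (\<forall>t. (f has_real_derivative h t) (at t))" if "smooth_fun f" for f
  using that unfolding smooth_fun_def by blast
 have "\<exists>g\<in>F ` SS. \<forall>x \<in> cube k UNIV. ((%t. F v (x(i := x i + t *\<^sub>R b))) has_real_derivative g x) (at 0)"
  if v: "v \<in> SS" and i: "i < k" and b: "b \<in> Basis" for v i and b :: 'a
 proof -
  obtain h where h: "smooth_fun h" "\<And>t. (v (i, b) has_real_derivative h t) (at t)"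
   using d[of "v (i, b)"] v by (auto simp: SS_def)
  have ib: "(i, b) \<in> ?P" using i b by simp
  have "((%t. F v (x(i := x i + t *\<^sub>R b))) has_real_derivative F (v((i, b) := h)) x) (at 0)" for x
  proof -
   let ?R = "\<Prod>p\<in>?P - {(i, b)}. v p (x (fst p) \<bullet> snd p)"
   have "v p ((x(i := x i + t *\<^sub>R b)) (fst p) \<bullet> snd p) = v p (x (fst p) \<bullet> snd p)" if "p \<in> ?P - {(i, b)}" for p t
    using that b by (cases p) (auto simp: inner_add_left inner_Basis)
   then have "F v (x(i := x i + t *\<^sub>R b)) = v (i, b) (x i \<bullet> b + t) * ?R" for t
    unfolding F_def prod.remove[OF fin ib] using b by (simp add: inner_add_left inner_Basis)
   moreover have "F (v((i, b) := h)) x = h (x i \<bullet> b) * ?R"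
    unfolding F_def prod.remove[OF fin ib] by (auto intro!: prod.cong)
   moreover have "((%t. v (i, b) (x i \<bullet> b + t) * ?R) has_real_derivative h (x i \<bullet> b + 0) * ?R) (at 0)"
   proof (rule DERIV_cmult_right)
    have "((%t. v (i, b) (x i \<bullet> b + t)) has_real_derivative h (x i \<bullet> b + 0) * 1) (at 0)"
     by (rule DERIV_chain2[OF h(2)]) (auto intro!: derivative_eq_intros)
    then show "((%t. v (i, b) (x i \<bullet> b + t)) has_real_derivative h (x i \<bullet> b + 0)) (at 0)" by simp
   qed
   ultimately show ?thesis by simp
  qed
  moreover have "v((i, b) := h) \<in> SS" using v h(1) by (auto simp: SS_def)
  ultimately show ?thesis by blast
 qed
 moreover have "continuous_on (cube k UNIV) (F v)" if "v \<in> SS" for v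
  unfolding F_def by (intro continuous_on_prod c that)
 moreover have "F w \<in> F ` SS" using assms by (auto simp: SS_def)
 ultimately have "smooth_power k (F w)" unfolding smooth_power_def by (intro exI[of _ "F ` SS"]) blast
 then show ?thesis by (simp add: F_def[abs_def])
qed

lemma compact_PiE_lessThan:
 fixes T :: "nat => 'a::topological_space set"
 assumes "\<And>i. i < k ==> compact (T i)" shows "compact (PiE {..<k} T)"
proof -
 have "compactin (product_topology (%_. euclidean) UNIV) (PiE UNIV (%i. if i < k then T i else {undefined}))"
  using assms by (auto simp: compactin_PiE)
 moreover have "PiE UNIV (%i. if i < k then T i else {undefined}) = PiE {..<k} T"
  by (auto simp: PiE_def Pi_def extensional_def split: if_splits)
 ultimately show ?thesis by (simp add: euclidean_product_topology)
qed

lemma bump_power_nonzero: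
 "bump_power n k l u x \<noteq> 0 \<longleftrightarrow> (\<forall>i<k. x i \<in> box (l i) (u i))"
 by (auto simp: bump_power_def window_nonzero mem_box)

lemma bump_power_test:
 assumes "\<And>i. i < k ==> cbox (l i) (u i) \<subseteq> U" shows "bump_power n k l u \<in> test_funs k U"
proof -
 have "bump_power n k l u = (%x. \<Prod>p\<in>{..<k} \<times> Basis. window n (l (fst p) \<bullet> snd p) (u (fst p) \<bullet> snd p) (x (fst p) \<bullet> snd p))"
  by (simp add: bump_power_def fun_eq_iff split_def)
 then have "smooth_power k (bump_power n k l u)"
  using smooth_power_prod[of "%p. window n (l (fst p) \<bullet> snd p) (u (fst p) \<bullet> snd p)" k] window_smooth by simp
 moreover have "compact (PiE {..<k} (%i. cbox (l i) (u i)))" by (rule compact_PiE_lessThan) simp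
 moreover have "PiE {..<k} (%i. cbox (l i) (u i)) \<subseteq> cube k U" using assms by (intro PiE_mono) auto
 moreover have "x \<in> PiE {..<k} (%i. cbox (l i) (u i))" if "x \<in> cube k UNIV" "bump_power n k l u x \<noteq> 0" for x
  using that box_subset_cbox unfolding bump_power_nonzero by (auto simp: PiE_iff)
 ultimately show ?thesis unfolding test_funs_def
  by (intro CollectI conjI exI[of _ "PiE {..<k} (%i. cbox (l i) (u i))"] ballI impI)
qed

lemma bump_power_tendsto:
 "(%n. bump_power n k l u x) \<longlonglongrightarrow> (if \<forall>i<k. x i \<in> box (l i) (u i) then 1 else 0)"
proof -
 have "(%n. bump_power n k l u x) \<longlonglongrightarrow> (\<Prod>(i, b)\<in>{..<k} \<times> Basis. indicator {l i \<bullet> b<..<u i \<bullet> b} (x i \<bullet> b))"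
  unfolding bump_power_def split_def by (intro tendsto_prod window_tendsto)
 also have "(\<Prod>(i, b)\<in>{..<k} \<times> Basis. indicator {l i \<bullet> b<..<u i \<bullet> b} (x i \<bullet> b)) = (if \<forall>i<k. x i \<in> box (l i) (u i) then 1 else 0 :: real)"
 proof (cases "\<forall>i<k. x i \<in> box (l i) (u i)")
  case True
  then show ?thesis by (auto simp: mem_box split_def intro!: prod.neutral)
 next
  case False
  then obtain i b where "i < k" "b \<in> Basis" "\<not> (l i \<bullet> b < x i \<bullet> b \<and> x i \<bullet> b < u i \<bullet> b)"
   by (auto simp: mem_box)
  then have "(\<Prod>(i, b)\<in>{..<k} \<times> Basis. indicator {l i \<bullet> b<..<u i \<bullet> b} (x i \<bullet> b)) = (0 :: real)"
   by (intro prod_zero bexI[of _ "(i, b)"]) auto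
  then show ?thesis unfolding if_not_P[OF False] .
 qed
 finally show ?thesis .
qed

lemma bump_power_bounds: "0 \<le> bump_power n k l u x" "bump_power n k l u x \<le> 1"
 unfolding bump_power_def by (auto intro!: prod_nonneg prod_le_1 simp: window_bounds)

lemma bump_power_measurable:
 "bump_power n k l u \<in> borel_measurable (PiM {..<k} (%_. lborel :: 'a::euclidean_space measure))"
proof -
 have w: "window n a b \<in> borel_measurable borel" for a b
  using smooth_fun_continuous[OF window_smooth] by (rule borel_measurable_continuous_onI)
 have "(%x. window n (l i \<bullet> b) (u i \<bullet> b) (x i \<bullet> b)) \<in> borel_measurable (PiM {..<k} (%_. lborel :: 'a measure))" if "i < k" for i b
 proof (rule measurable_compose[OF _ w])
  have "(%x. x i) \<in> borel_measurable (PiM {..<k} (%_. lborel :: 'a measure))"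
   using measurable_component_singleton[of i "{..<k}" "%_. lborel :: 'a measure"] that by simp
  then show "(%x. x i \<bullet> b) \<in> borel_measurable (PiM {..<k} (%_. lborel :: 'a measure))" by measurable
 qed
 then show ?thesis unfolding bump_power_def split_def by (intro borel_measurable_prod) auto
qed

section \<open>The fundamental lemma of the calculus of variations on powers\<close>

lemma product_lborel: "product_sigma_finite (%_ :: nat. lborel :: 'a::euclidean_space measure)"
 by unfold_locales

lemma sets_PiM_boxes:
 fixes k :: nat
 shows "sets (PiM {..<k} (%_. lborel :: 'a::euclidean_space measure)) =
   sigma_sets (cube k UNIV) {PiE {..<k} (%i. box (l i) (u i)) | l u. True}"
proof -
 let ?E = "range (%(a, b). box a b :: 'a set)"
 let ?P = "{{f \<in> cube k UNIV. \<forall>i\<in>j. f i \<in> A i} | A j. j \<in> {{..<k}} \<and> A \<in> Pi j (%_. ?E)}"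
 have "sets (PiM {..<k} (%_. lborel :: 'a measure)) = sets (PiM {..<k} (%_. sigma UNIV ?E))"
  by (rule sets_PiM_cong) (simp_all add: borel_eq_box[symmetric])
 also have "\<dots> = sets (sigma (cube k UNIV) ?P)"
 proof (rule sets_PiM_sigma)
  fix i
  show "\<exists>S\<subseteq>?E. countable S \<and> UNIV = \<Union>S"
  proof (intro exI[of _ "range (%n::nat. box (- real n *\<^sub>R One) (real n *\<^sub>R One))"] conjI)
   show "UNIV = \<Union> (range (%n::nat. box (- real n *\<^sub>R One) (real n *\<^sub>R One :: 'a)))"
    using UN_box_eq_UNIV[where ?'a = 'a] by simp
  qed auto
 qed auto
 also have "\<dots> = sigma_sets (cube k UNIV) ?P" by (rule sets_measure_of) auto
 also have "?P = {PiE {..<k} (%i. box (l i) (u i)) | l u. True}"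
 proof (intro set_eqI iffI)
  fix X assume "X \<in> ?P"
  then obtain A where A: "X = {f \<in> cube k UNIV. \<forall>i\<in>{..<k}. f i \<in> A i}" "A \<in> Pi {..<k} (%_. ?E)" by auto
  have "\<forall>i\<in>{..<k}. \<exists>l u. A i = box l u" using A(2) by (auto simp: Pi_def image_iff)
  then obtain l u where "\<And>i. i < k ==> A i = box (l i) (u i)" by (metis lessThan_iff)
  then have "X = PiE {..<k} (%i. box (l i) (u i))" unfolding A(1)
   by (intro set_eqI iffI) (simp_all add: PiE_iff Ball_def)
  then show "X \<in> {PiE {..<k} (%i. box (l i) (u i)) | l u. True}" by blast
 next
  fix X assume "X \<in> {PiE {..<k} (%i. box (l i) (u i) :: 'a set) | l u. True}"
  then obtain l u where X: "X = PiE {..<k} (%i. box (l i) (u i) :: 'a set)" by blast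
  have "X = {f \<in> cube k UNIV. \<forall>i\<in>{..<k}. f i \<in> box (l i) (u i)}" unfolding X
   by (intro set_eqI iffI) (simp_all add: PiE_iff Ball_def)
  then show "X \<in> ?P" by (intro CollectI exI[of _ "%i. box (l i) (u i)"] exI[of _ "{..<k}"]) auto
 qed
 finally show ?thesis .
qed

text \<open>Products of windows converge boundedly to indicators of sub-boxes, whose integrals
  against \<open>h\<close> therefore vanish. These boxes are intersection stable and generate the
  product algebra, so the integral of \<open>h\<close> over every measurable part of the open box
  vanishes.\<close>

lemma zero_of_test_integrals_box:
 fixes h :: "(nat => 'a::euclidean_space) => real"
 assumes int: "set_integrable (leb_k k) (PiE {..<k} (%i. cbox (l i) (u i))) h"
  and box: "\<And>i. i < k ==> cbox (l i) (u i) \<subseteq> U"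
  and test: "\<And>c. c \<in> test_funs k U ==> (\<integral>x. h x * c x \<partial>leb_k k) = 0"
 shows "AE x in leb_k k. (\<forall>i<k. x i \<in> box (l i) (u i)) --> h x = 0"
proof -
 define P where "P = PiM {..<k} (%_. lborel :: 'a measure)"
 have leb: "leb_k k = completion P" by (simp add: leb_k_def P_def)
 interpret product_sigma_finite "%_ :: nat. lborel :: 'a measure" by (rule product_lborel)
 interpret P: sigma_finite_measure P unfolding P_def by (rule sigma_finite) simp
 have spP: "space P = cube k UNIV" by (simp add: P_def space_PiM)
 define Q where "Q = PiE {..<k} (%i. cbox (l i) (u i))"
 define O' where "O' = PiE {..<k} (%i. box (l i) (u i))"
 have bmP [measurable]: "bump_power n k l u \<in> borel_measurable P" for n and l u :: "nat => 'a"
  unfolding P_def by (rule bump_power_measurable)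
 have O's: "O' \<in> sets P" unfolding O'_def P_def by (intro sets_PiM_I_finite) auto
 have OQ: "O' \<subseteq> Q" unfolding O'_def Q_def by (intro PiE_mono) (auto simp: box_subset_cbox)
 have i1: "integrable (completion P) (%x. indicator Q x * h x)"
  using int unfolding set_integrable_def leb Q_def by simp
 \<comment> \<open>\<open>h\<close> is measurable only for the completion; a version on the
   uncompleted product is required for the Dynkin argument over generated sets.\<close>
 then obtain g where g: "g \<in> borel_measurable P" "AE x in P. indicator Q x * h x = g x"
  using completion_ex_borel_measurable_real[OF borel_measurable_integrable[OF i1]] by blast
 note g(1)[measurable]
 have gc: "AE x in completion P. indicator Q x * h x = g x" using g(2) by (rule AE_completion)
 have ig: "integrable P g"
  using i1 Bochner_Integration.integrable_cong_AE[OF _ _ gc] g(1) integrable_completion[of g P] measurable_completion by blast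
 have zero: "(\<integral>x. g x * indicator (PiE {..<k} (%i. box (l' i) (u' i))) x \<partial>P) = 0"
  if sub: "PiE {..<k} (%i. box (l' i) (u' i)) \<subseteq> O'" for l' u'
 proof (cases "PiE {..<k} (%i. box (l' i) (u' i)) = {}")
  case True then show ?thesis by simp
 next
  case False
  let ?R = "PiE {..<k} (%i. box (l' i) (u' i))"
  have "box (l' i) (u' i) \<noteq> {} \<and> box (l' i) (u' i) \<subseteq> box (l i) (u i)" if "i < k" for i
   using False sub that subset_PiE[of "{..<k}" "%i. box (l' i) (u' i)" "%i. box (l i) (u i)"] PiE_eq_empty_iff[of "{..<k}" "%i. box (l' i) (u' i)"]
   by (auto simp: O'_def)
  then have ne: "box (l' i) (u' i) \<noteq> {}" and bb: "box (l' i) (u' i) \<subseteq> box (l i) (u i)" if "i < k" for i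
   using that by blast+
  have "cbox (l' i) (u' i) \<subseteq> cbox (l i) (u i)" if "i < k" for i
   unfolding closure_box[OF ne[OF that], symmetric]
   by (rule closure_minimal[OF order_trans[OF bb[OF that] box_subset_cbox] closed_cbox])
  then have cb: "cbox (l' i) (u' i) \<subseteq> U" if "i < k" for i using that box by blast
  have mem: "x \<in> ?R \<longleftrightarrow> (\<forall>i<k. x i \<in> box (l' i) (u' i))" if "x \<in> space P" for x
   using that by (auto simp: spP PiE_iff)
  have RQ: "?R \<subseteq> Q" using sub OQ by blast
  have "(\<integral>x. g x * bump_power n k l' u' x \<partial>P) = 0" for n
  proof -
   have "(\<integral>x. g x * bump_power n k l' u' x \<partial>P) = (\<integral>x. g x * bump_power n k l' u' x \<partial>completion P)"
    by (intro integral_completion[symmetric]) measurable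
   also have "\<dots> = (\<integral>x. h x * bump_power n k l' u' x \<partial>completion P)"
   proof (rule integral_cong_AE)
    have bm: "bump_power n k l' u' \<in> borel_measurable (completion P)"
     by (rule measurable_completion[OF bmP])
    then show "(%x. g x * bump_power n k l' u' x) \<in> borel_measurable (completion P)"
     using measurable_completion[OF g(1)] by measurable
    have eq: "h x * bump_power n k l' u' x = (indicator Q x * h x) * bump_power n k l' u' x" if "x \<in> space (completion P)" for x
     using that RQ mem[of x] bump_power_nonzero[of n k l' u' x] by (auto simp: indicator_def)
    show "(%x. h x * bump_power n k l' u' x) \<in> borel_measurable (completion P)"
     by (subst measurable_cong[OF eq], assumption)
      (rule borel_measurable_times[OF borel_measurable_integrable[OF i1] bm])
    show "AE x in completion P. g x * bump_power n k l' u' x = h x * bump_power n k l' u' x"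
     using gc AE_space by eventually_elim (simp add: eq)
   qed
   also have "\<dots> = 0" using test[OF bump_power_test[OF cb, where n = n]] by (simp add: leb)
   finally show ?thesis .
  qed
  moreover have "(%n. \<integral>x. g x * bump_power n k l' u' x \<partial>P) \<longlonglongrightarrow> (\<integral>x. g x * indicator ?R x \<partial>P)"
  proof (rule integral_dominated_convergence[where w = "%x. \<bar>g x\<bar>"])
   show "integrable P (%x. \<bar>g x\<bar>)" using ig by simp
   have "?R \<in> sets P" unfolding P_def by (intro sets_PiM_I_finite) auto
   then show "(%x. g x * indicator ?R x) \<in> borel_measurable P" by measurable
   show "(%x. g x * bump_power n k l' u' x) \<in> borel_measurable P" for n
    by measurable
   show "AE x in P. (%n. g x * bump_power n k l' u' x) \<longlonglongrightarrow> g x * indicator ?R x"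
   proof (rule AE_I2)
    fix x assume "x \<in> space P"
    then have "(if \<forall>i<k. x i \<in> box (l' i) (u' i) then 1 else 0) = (indicator ?R x :: real)"
     using mem by auto
    then show "(%n. g x * bump_power n k l' u' x) \<longlonglongrightarrow> g x * indicator ?R x"
     using tendsto_mult_left[OF bump_power_tendsto[of k l' u' x], of "g x"] by simp
   qed
   show "AE x in P. norm (g x * bump_power n k l' u' x) \<le> \<bar>g x\<bar>" for n
    using bump_power_bounds[of n k l' u'] by (intro AE_I2) (auto simp: abs_mult intro!: mult_left_le)
  qed
  ultimately show ?thesis by (simp add: LIMSEQ_const_iff)
 qed
 define f where "f x = g x * indicator O' x" for x
 have fi: "integrable P f"
  unfolding f_def using integrable_real_mult_indicator[OF O's ig] by (simp add: mult.commute)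
 let ?G = "{PiE {..<k} (%i. box (l i) (u i) :: 'a set) | l u. True}"
 have boxint: "PiE {..<k} (%i. box (l1 i) (u1 i) :: 'a set) \<inter> PiE {..<k} (%i. box (l2 i) (u2 i)) \<in> ?G" for l1 u1 l2 u2
  unfolding PiE_Int box_Int_box by (intro CollectI exI conjI TrueI) (rule refl)
 have setsP: "sets P = sigma_sets (space P) ?G" unfolding spP unfolding P_def by (rule sets_PiM_boxes)
 have si: "set_integrable P A f" if "A \<in> sets P" for A
  unfolding set_integrable_def by (rule integrable_mult_indicator[OF that fi])
 have tot: "(\<integral>x. f x \<partial>P) = 0" unfolding f_def O'_def by (rule zero) (simp add: O'_def)
 have IS: "Int_stable ?G" unfolding Int_stable_def using boxint by blast
 have cl: "?G \<subseteq> Pow (space P)" by (auto simp: spP PiE_iff)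
 have "(LINT x:A|P. f x) = 0" if A: "A \<in> sets P" for A
  using IS cl A[unfolded setsP]
 proof (induction rule: sigma_sets_induct_disjoint)
  case (basic A)
  then obtain l' u' where A: "A = PiE {..<k} (%i. box (l' i) (u' i))" by blast
  obtain l2 u2 where A2: "A \<inter> O' = PiE {..<k} (%i. box (l2 i) (u2 i))"
   using boxint[of l' u' l u] unfolding A[symmetric] O'_def[symmetric] by (elim CollectE exE conjE) (rule that)
  have "(LINT x:A|P. f x) = (\<integral>x. g x * indicator (A \<inter> O') x \<partial>P)"
   unfolding set_lebesgue_integral_def f_def by (intro Bochner_Integration.integral_cong) (auto simp: indicator_def)
  also have "\<dots> = 0" unfolding A2 by (rule zero) (use A2 in blast)
  finally show ?case .
 next
  case (compl A)
  then have A: "A \<in> sets P" by (simp add: setsP)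
  have "(LINT x:space P - A|P. f x) = (\<integral>x. f x - indicator A x *\<^sub>R f x \<partial>P)"
   unfolding set_lebesgue_integral_def by (intro Bochner_Integration.integral_cong) (auto simp: indicator_def)
  also have "\<dots> = 0"
   using compl.IH tot fi si[OF A] unfolding set_integrable_def set_lebesgue_integral_def by (subst Bochner_Integration.integral_diff) simp_all
  finally show ?case .
 next
  case (union A)
  then have A: "A i \<in> sets P" for i by (auto simp: setsP)
  show ?case
   using union by (subst lebesgue_integral_countable_add[OF A _ si]) (auto simp: disjoint_family_on_def A)
 qed (simp add: set_lebesgue_integral_def)
 then have "AE x in P. f x = 0"
  by (intro density_unique_real[OF fi, of "%_. 0"]) (simp_all add: set_lebesgue_integral_def)
 with g(2) have "AE x in P. (\<forall>i<k. x i \<in> box (l i) (u i)) --> h x = 0"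
  using AE_space
 proof eventually_elim
  case (elim x)
  show ?case
  proof
   assume "\<forall>i<k. x i \<in> box (l i) (u i)"
   then have "x \<in> O'" using elim(3) by (auto simp: O'_def spP PiE_iff)
   then show "h x = 0" using elim(1,2) OQ by (auto simp: indicator_def f_def)
  qed
 qed
 then show ?thesis unfolding leb by (rule AE_completion)
qed

text \<open>By Lindelof, \<open>U\<close> is a countable union of boxes with closure in
  \<open>U\<close>. The power of \<open>U\<close> is then covered by countably many products of
  boxes, on each of which local integrability and the box version apply.\<close>

lemma zero_of_test_integrals:
 fixes h :: "(nat => 'a::euclidean_space) => real"
 assumes U: "open U" and int: "locally_integrable k U h"
  and test: "\<And>g. g \<in> test_funs k U ==> (\<integral>x. h x * g x \<partial>leb_k k) = 0"
 shows "AE x in leb_k k. (\<forall>i<k. x i \<in> U) --> h x = 0"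
proof -
 let ?F = "{box a b | a b. cbox a b \<subseteq> U}"
 obtain F' where F': "F' \<subseteq> ?F" "countable F'" "\<Union>F' = \<Union>?F"
  by (rule Lindelof[of ?F]) auto
 have cov: "\<Union>?F = U"
 proof (intro equalityI subsetI)
  fix x assume "x \<in> U"
  then obtain e where e: "e > 0" "cball x e \<subseteq> U" using U open_contains_cball by blast
  obtain a b where "x \<in> box a b" "box a b \<subseteq> ball x e" using rational_boxes[OF e(1)] by metis
  moreover from this have "cbox a b \<subseteq> cball x e"
   by (metis closure_box closure_mono closure_ball e(1) empty_iff)
  ultimately show "x \<in> \<Union>?F" using e(2) by blast
 next
  fix x assume "x \<in> \<Union>?F" then show "x \<in> U" using box_subset_cbox by blast
 qed
 have "AE x in leb_k k. (\<forall>i<k. x i \<in> f i) --> h x = 0" if f: "f \<in> cube k F'" for f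
 proof -
  have "\<forall>i\<in>{..<k}. \<exists>a b. f i = box a b \<and> cbox a b \<subseteq> U"
  proof
   fix i assume "i \<in> {..<k}"
   from subsetD[OF F'(1) PiE_mem[OF f this]] show "\<exists>a b. f i = box a b \<and> cbox a b \<subseteq> U" by simp
  qed
  then obtain l u where lu: "\<And>i. i < k ==> f i = box (l i) (u i)" "\<And>i. i < k ==> cbox (l i) (u i) \<subseteq> U"
   by (metis lessThan_iff)
  define K where "K = (\<Union>i<k. cbox (l i) (u i))"
  have "compact K" "K \<subseteq> U" unfolding K_def using lu(2) by (auto intro!: compact_UN)
  then have "set_integrable (leb_k k) (cube k K) h" using int by (simp add: locally_integrable_def)
  moreover have "PiE {..<k} (%i. cbox (l i) (u i)) \<in> sets (leb_k k)"
   unfolding leb_k_def by (intro sets_completionI_sets sets_PiM_I_finite) auto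
  moreover have "PiE {..<k} (%i. cbox (l i) (u i)) \<subseteq> cube k K"
   unfolding K_def by (intro PiE_mono) auto
  ultimately have "set_integrable (leb_k k) (PiE {..<k} (%i. cbox (l i) (u i))) h"
   by (rule set_integrable_subset)
  from zero_of_test_integrals_box[OF this lu(2) test]
  show ?thesis using lu(1) by simp
 qed
 moreover have "countable (cube k F')" using F'(2) by (intro countable_PiE) auto
 ultimately have "AE x in leb_k k. \<forall>f\<in>cube k F'. (\<forall>i<k. x i \<in> f i) --> h x = 0"
  by (intro AE_ball_countable')
 then show ?thesis
 proof eventually_elim
  case (elim x)
  show ?case
  proof
   assume "\<forall>i<k. x i \<in> U"
   then have "\<forall>i\<in>{..<k}. \<exists>A\<in>F'. x i \<in> A" unfolding F'(3)[unfolded cov, symmetric] by blast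
   then obtain f where "\<And>i. i < k ==> f i \<in> F' \<and> x i \<in> f i" by (metis lessThan_iff)
   then have "restrict f {..<k} \<in> cube k F'" "\<forall>i<k. x i \<in> restrict f {..<k} i" by auto
   then show "h x = 0" using elim by blast
  qed
 qed
qed

section \<open>Closures of forms\<close>

text \<open>Optimising over \<open>d\<close>, the inequality says that the square root of \<open>E\<close> is subadditive; in this shape
 it passes to integrals of forms.\<close>

definition quadratic_like :: "'b measure => (('b => real) => ennreal) => ('b => real) set => bool" where
 "quadratic_like \<nu> E D \<longleftrightarrow> D \<subseteq> l2_space \<nu> \<and> (%_. 0) \<in> D \<and> E (%_. 0) = 0 \<and> (\<forall>u\<in>D. E u < \<infinity>) \<and>
   (\<forall>u\<in>D. \<forall>v\<in>D. (%x. u x - v x) \<in> D \<and>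
    (\<forall>d>0. E (%x. u x - v x) \<le> ennreal (1 + d) * E u + ennreal (1 + 1 / d) * E v))"

text \<open>The right side is minimal at \<open>d = q / p\<close>, with value
  \<open>(p + q)^2\<close>. If \<open>p\<close> or \<open>q\<close> vanishes, the infimum is only
  approached, by large or by small \<open>d\<close>, which accounts for the explicit choices with an
  error.\<close>

lemma sqrt_le_of_interpolation:
 fixes p q e :: real
 assumes p: "0 \<le> p" and q: "0 \<le> q" and e: "\<And>d. d > 0 ==> e \<le> (1 + d) * p\<^sup>2 + (1 + 1 / d) * q\<^sup>2"
 shows "sqrt e \<le> p + q"
proof -
 have "e \<le> (p + q)\<^sup>2"
 proof (cases "p = 0 \<or> q = 0")
  case False
  then have "p > 0" "q > 0" using p q by auto
  then have "e \<le> (1 + q / p) * p\<^sup>2 + (1 + 1 / (q / p)) * q\<^sup>2" by (intro e) simp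
  also have "\<dots> = (p + q)\<^sup>2" using \<open>p > 0\<close> \<open>q > 0\<close> by (simp add: field_simps power2_eq_square)
  finally show ?thesis .
 next
  case True
  show ?thesis
  proof (rule field_le_epsilon)
   fix g :: real assume g: "g > 0"
   show "e \<le> (p + q)\<^sup>2 + g"
   proof (cases "p = 0")
    case True
    define d where "d = q\<^sup>2 / g + 1"
    have d: "d > 0" unfolding d_def using g by (intro add_nonneg_pos) auto
    have "q\<^sup>2 \<le> g * d" using g by (simp add: d_def field_simps)
    then have "q\<^sup>2 / d \<le> g" using d by (simp add: pos_divide_le_eq)
    moreover have "e \<le> (1 + 1 / d) * q\<^sup>2" using e[OF d] True by simp
    moreover have "(1 + 1 / d) * q\<^sup>2 = q\<^sup>2 + q\<^sup>2 / d" by (simp add: algebra_simps)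
    ultimately show ?thesis using True by simp
   next
    case False
    then have q0: "q = 0" using True by simp
    have "p\<^sup>2 / (p\<^sup>2 + 1) \<le> 1" by (simp add: divide_le_eq_1 add_nonneg_pos)
    then have "p\<^sup>2 * (g / (p\<^sup>2 + 1)) \<le> g"
     using mult_left_mono[of "p\<^sup>2 / (p\<^sup>2 + 1)" 1 g] g by (simp add: mult.commute)
    moreover have "e \<le> (1 + g / (p\<^sup>2 + 1)) * p\<^sup>2"
     using e[of "g / (p\<^sup>2 + 1)"] g q0 by (simp add: add_nonneg_pos)
    ultimately show ?thesis by (simp add: q0 algebra_simps)
   qed
  qed
 qed
 then show ?thesis using p q by (intro real_le_lsqrt) auto
qed

lemma tendsto_0_ennrealI:
 fixes f :: "nat => ennreal"
 assumes "\<And>e. e > 0 ==> \<exists>N. \<forall>n\<ge>N. f n \<le> ennreal e" shows "f \<longlonglongrightarrow> 0"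
proof (rule order_tendstoI)
 fix a :: ennreal assume "0 < a"
 then obtain b where b: "0 < b" "b < a" using dense by blast
 then have "b < top" by (metis order.strict_trans2 top_greatest)
 define e where "e = enn2real b"
 have e: "0 < e" "ennreal e < a" using b \<open>b < top\<close> by (auto simp: e_def enn2real_positive_iff)
 then show "\<forall>\<^sub>F n in sequentially. f n < a"
  using assms[OF e(1)] by (auto simp: eventually_sequentially intro: order_le_less_trans)
qed simp

lemma tendsto_0_squeeze:
 fixes f g :: "nat => real"
 assumes "\<And>n. 0 \<le> f n" "\<And>n. f n \<le> g n" "g \<longlonglongrightarrow> 0" shows "f \<longlonglongrightarrow> 0"
 by (rule tendsto_sandwich[OF _ _ tendsto_const assms(3)]) (use assms in auto)

locale quadratic_form =
 fixes \<nu> :: "'b measure" and E :: "('b => real) => ennreal" and D :: "('b => real) set"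
 assumes ql: "quadratic_like \<nu> E D"
begin

definition s :: "('b => real) => real" where "s u = sqrt (enn2real (E u))"

lemma D_l2: "u \<in> D ==> u \<in> l2_space \<nu>" and D_0: "(%_. 0) \<in> D" and E_0: "E (%_. 0) = 0"
 and E_fin: "u \<in> D ==> E u < \<infinity>" and D_diff: "u \<in> D ==> v \<in> D ==> (%x. u x - v x) \<in> D"
 and E_diff: "u \<in> D ==> v \<in> D ==> d > 0 ==>
  E (%x. u x - v x) \<le> ennreal (1 + d) * E u + ennreal (1 + 1 / d) * E v"
 using ql unfolding quadratic_like_def by auto

lemma s_nonneg [simp]: "0 \<le> s u" by (simp add: s_def)

lemma E_eq: "u \<in> D ==> E u = ennreal ((s u)\<^sup>2)"
 using E_fin[of u] by (simp add: s_def)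

lemma s_0: "s (%_. 0) = 0" by (simp add: s_def E_0)

lemma s_diff: assumes u: "u \<in> D" and v: "v \<in> D" shows "s (%x. u x - v x) \<le> s u + s v"
proof -
 have "enn2real (E (%x. u x - v x)) \<le> (1 + d) * (s u)\<^sup>2 + (1 + 1 / d) * (s v)\<^sup>2" if "d > 0" for d
 proof -
  have "E (%x. u x - v x) \<le> ennreal ((1 + d) * (s u)\<^sup>2 + (1 + 1 / d) * (s v)\<^sup>2)"
   using E_diff[OF u v that] that by (simp add: E_eq[OF u] E_eq[OF v] ennreal_plus ennreal_mult)
  then have "enn2real (E (%x. u x - v x)) \<le> enn2real (ennreal ((1 + d) * (s u)\<^sup>2 + (1 + 1 / d) * (s v)\<^sup>2))"
   by (rule enn2real_mono) simp
  then show ?thesis using that by (subst (asm) enn2real_ennreal) auto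
 qed
 then show ?thesis unfolding s_def[of "%x. u x - v x"] by (intro sqrt_le_of_interpolation) auto
qed

lemma s_minus_commute: "u \<in> D ==> v \<in> D ==> s (%x. u x - v x) = s (%x. v x - u x)"
 using s_diff[OF D_0 D_diff, of u v] s_diff[OF D_0 D_diff, of v u] by (simp add: s_0)

lemma s_tri: "u \<in> D ==> v \<in> D ==> w \<in> D ==> s (%x. u x - w x) \<le> s (%x. u x - v x) + s (%x. v x - w x)"
 using s_diff[OF D_diff D_diff, of u v w v] by (simp add: s_minus_commute[of w v])

lemma s_rev: assumes "u \<in> D" "v \<in> D" shows "\<bar>s u - s v\<bar> \<le> s (%x. u x - v x)"
proof -
 have neg: "s (%x. 0 - v x) \<le> s v" if "v \<in> D" for v using s_diff[OF D_0 that] by (simp add: s_0)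
 have "s u \<le> s (%x. u x - v x) + s v" if "u \<in> D" "v \<in> D" for u v
  using s_diff[OF D_diff[OF that] D_diff[OF D_0 that(2)]] neg[OF that(2)] by simp
 from this[OF assms] this[OF assms(2,1)] show ?thesis using s_minus_commute[OF assms] by linarith
qed

lemma E_less_iff: "u \<in> D ==> e > 0 ==> E u < ennreal e \<longleftrightarrow> s u < sqrt e"
 using real_sqrt_less_iff[of "(s u)\<^sup>2" e] by (simp add: E_eq ennreal_less_iff)

lemma Cauchy_iff:
 assumes "\<And>n. un n \<in> D"
 shows "form_Cauchy E un \<longleftrightarrow> (\<forall>e>0. \<exists>N. \<forall>m\<ge>N. \<forall>n\<ge>N. s (%x. un m x - un n x) < e)"
proof
 assume c: "form_Cauchy E un"
 show "\<forall>e>0. \<exists>N. \<forall>m\<ge>N. \<forall>n\<ge>N. s (%x. un m x - un n x) < e"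
 proof (intro allI impI)
  fix e :: real assume e: "e > 0"
  then obtain N where "\<forall>m\<ge>N. \<forall>n\<ge>N. E (%x. un m x - un n x) < ennreal (e\<^sup>2)"
   using c[unfolded form_Cauchy_def, rule_format, of "e\<^sup>2"] by auto
  then show "\<exists>N. \<forall>m\<ge>N. \<forall>n\<ge>N. s (%x. un m x - un n x) < e"
   using E_less_iff[OF D_diff[OF assms assms], of "e\<^sup>2"] e by (intro exI[of _ N]) simp
 qed
next
 assume c: "\<forall>e>0. \<exists>N. \<forall>m\<ge>N. \<forall>n\<ge>N. s (%x. un m x - un n x) < e"
 show "form_Cauchy E un" unfolding form_Cauchy_def
 proof (intro allI impI)
  fix e :: real assume e: "e > 0"
  then obtain N where "\<forall>m\<ge>N. \<forall>n\<ge>N. s (%x. un m x - un n x) < sqrt e"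
   using c[rule_format, of "sqrt e"] by auto
  then show "\<exists>N. \<forall>m\<ge>N. \<forall>n\<ge>N. E (%x. un m x - un n x) < ennreal e"
   using E_less_iff[OF D_diff[OF assms assms] e] by (intro exI[of _ N]) simp
 qed
qed

lemma tendsto_0_iff: assumes "\<And>n. un n \<in> D" shows "(%n. E (un n)) \<longlonglongrightarrow> 0 \<longleftrightarrow> (%n. s (un n)) \<longlonglongrightarrow> 0"
proof -
 have "(%n. E (un n)) \<longlonglongrightarrow> 0 \<longleftrightarrow> (%n. ennreal ((s (un n))\<^sup>2)) \<longlonglongrightarrow> ennreal 0" by (simp add: E_eq assms)
 also have "\<dots> \<longleftrightarrow> (%n. (s (un n))\<^sup>2) \<longlonglongrightarrow> 0" by (rule tendsto_ennreal_iff) auto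
 also have "\<dots> \<longleftrightarrow> (%n. s (un n)) \<longlonglongrightarrow> 0"
  using tendsto_real_sqrt[of "%n. (s (un n))\<^sup>2" 0 sequentially] tendsto_power[of "%n. s (un n)" 0 sequentially 2]
  by auto
 finally show ?thesis .
qed

lemma Cauchy_convergent:
 assumes un: "\<And>n. un n \<in> D" and c: "form_Cauchy E un"
 obtains l where "(%n. s (un n)) \<longlonglongrightarrow> l" "(%n. E (un n)) \<longlonglongrightarrow> ennreal (l\<^sup>2)"
proof -
 have "Cauchy (%n. s (un n))"
  unfolding Cauchy_def dist_real_def
  using c[unfolded Cauchy_iff[OF un]] s_rev[OF un un] by (meson order_le_less_trans)
 then obtain l where l: "(%n. s (un n)) \<longlonglongrightarrow> l" using Cauchy_convergent_iff convergent_def by blast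
 moreover have "(%n. ennreal ((s (un n))\<^sup>2)) \<longlonglongrightarrow> ennreal (l\<^sup>2)"
  by (intro tendsto_ennrealI tendsto_power l)
 ultimately show thesis using that by (simp add: E_eq un)
qed

end

lemma l2_quadratic: "quadratic_like \<nu> (l2_sq \<nu>) (l2_space \<nu>)"
proof -
 have interp: "(a - b)\<^sup>2 \<le> (1 + d) * a\<^sup>2 + (1 + 1 / d) * b\<^sup>2" if "d > 0" for a b d :: real
 proof -
  have "0 \<le> (d * a + b)\<^sup>2 / d" using that by simp
  also have "(d * a + b)\<^sup>2 / d = d * a\<^sup>2 + 2 * a * b + b\<^sup>2 / d"
   using that by (simp add: power2_eq_square field_simps)
  finally show ?thesis by (simp add: power2_eq_square algebra_simps)
 qed
 have E: "l2_sq \<nu> (%x. u x - v x) \<le> ennreal (1 + d) * l2_sq \<nu> u + ennreal (1 + 1 / d) * l2_sq \<nu> v"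
  if [measurable]: "u \<in> borel_measurable (completion \<nu>)" "v \<in> borel_measurable (completion \<nu>)" and d: "d > 0" for u v d
 proof -
  have "l2_sq \<nu> (%x. u x - v x) \<le> (\<integral>\<^sup>+ x. ennreal (1 + d) * ennreal ((u x)\<^sup>2) + ennreal (1 + 1 / d) * ennreal ((v x)\<^sup>2) \<partial>completion \<nu>)"
   unfolding l2_sq_def using interp[OF d] d
   by (intro nn_integral_mono) (simp add: ennreal_mult[symmetric] ennreal_plus[symmetric] del: ennreal_plus)
  also have "\<dots> = ennreal (1 + d) * l2_sq \<nu> u + ennreal (1 + 1 / d) * l2_sq \<nu> v"
   by (simp add: nn_integral_add nn_integral_cmult l2_sq_def)
  finally show ?thesis .
 qed
 have "l2_sq \<nu> (%x. u x - v x) < \<infinity>" if "u \<in> l2_space \<nu>" "v \<in> l2_space \<nu>" for u v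
  using that E[of u v 1] by (auto simp: l2_space_def ennreal_mult_less_top intro!: order_le_less_trans[OF E[of u v 1]])
 then show ?thesis unfolding quadratic_like_def using E by (auto simp: l2_space_def) (auto simp: l2_sq_def)
qed

interpretation l2: quadratic_form \<nu> "l2_sq \<nu>" "l2_space \<nu>" for \<nu>
 by (rule quadratic_form.intro) (rule l2_quadratic)

locale closable_quadratic_form = quadratic_form +
 assumes closable: "closable_form \<nu> E D"
begin

abbreviation "C \<equiv> closure_dom \<nu> E D"
abbreviation "EC \<equiv> closure_form \<nu> E D"

lemma approx_diff:
 assumes u: "u \<in> l2_space \<nu>" "form_approx \<nu> E D un u" and v: "v \<in> l2_space \<nu>" "form_approx \<nu> E D vn v"
 shows "form_approx \<nu> E D (%n x. un n x - vn n x) (%x. u x - v x)"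
proof -
 have unD: "un n \<in> D" and vnD: "vn n \<in> D" for n using u v by (auto simp: form_approx_def)
 have "form_Cauchy E (%n x. un n x - vn n x)"
  unfolding Cauchy_iff[OF D_diff[OF unD vnD]]
 proof (intro allI impI)
  fix e :: real assume e: "e > 0"
  obtain N where N: "\<And>m n. m \<ge> N ==> n \<ge> N ==> s (%x. un m x - un n x) < e / 2"
   using u(2) e Cauchy_iff[OF unD] unfolding form_approx_def by (meson half_gt_zero)
  obtain M where M: "\<And>m n. m \<ge> M ==> n \<ge> M ==> s (%x. vn m x - vn n x) < e / 2"
   using v(2) e Cauchy_iff[OF vnD] unfolding form_approx_def by (meson half_gt_zero)
  have "s (%x. (un m x - vn m x) - (un n x - vn n x)) < e" if "m \<ge> max M N" "n \<ge> max M N" for m n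
  proof -
   have "s (%x. (un m x - un n x) - (vn m x - vn n x)) \<le> s (%x. un m x - un n x) + s (%x. vn m x - vn n x)"
    by (intro s_diff D_diff unD vnD)
   also have "\<dots> < e" using N[of m n] M[of m n] that by simp
   finally show ?thesis by (simp add: algebra_simps)
  qed
  then show "\<exists>N. \<forall>m\<ge>N. \<forall>n\<ge>N. s (%x. (un m x - vn m x) - (un n x - vn n x)) < e" by blast
 qed
 moreover have "(%n. l2_sq \<nu> (%x. (un n x - vn n x) - (u x - v x))) \<longlonglongrightarrow> 0"
 proof -
  have d: "(%x. un n x - u x) \<in> l2_space \<nu>" "(%x. vn n x - v x) \<in> l2_space \<nu>" for n
   using u(1) v(1) D_l2[OF unD] D_l2[OF vnD] by (auto intro: l2.D_diff)
  have dd: "(%x. (un n x - vn n x) - (u x - v x)) = (%x. (un n x - u x) - (vn n x - v x))" for n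
   by (auto simp: algebra_simps)
  have "(%n. l2.s \<nu> (%x. un n x - u x) + l2.s \<nu> (%x. vn n x - v x)) \<longlonglongrightarrow> 0 + 0"
   using u(2) v(2) by (intro tendsto_add) (auto simp: form_approx_def l2.tendsto_0_iff[OF d(1)] l2.tendsto_0_iff[OF d(2)])
  then have "(%n. l2.s \<nu> (%x. (un n x - u x) - (vn n x - v x))) \<longlonglongrightarrow> 0"
   by (intro tendsto_0_squeeze[OF _ l2.s_diff[OF d]]) auto
  then show ?thesis unfolding dd by (subst l2.tendsto_0_iff) (auto intro: l2.D_diff d)
 qed
 ultimately show ?thesis using D_diff[OF unD vnD] by (simp add: form_approx_def)
qed

text \<open>Two approximating sequences of \<open>u\<close> differ by a sequence approximating 0,
  along which closability makes the form vanish. Their forms have the same limit, and the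
  description by \<open>THE\<close> is determined.\<close>

lemma closure_form_eqI:
 assumes u: "u \<in> l2_space \<nu>" "form_approx \<nu> E D un u" and l: "(%n. E (un n)) \<longlonglongrightarrow> l"
 shows "EC u = l"
 unfolding closure_form_def
proof (rule the_equality)
 show "\<exists>un. form_approx \<nu> E D un u \<and> (%n. E (un n)) \<longlonglongrightarrow> l" using u l by blast
 fix l' assume "\<exists>vn. form_approx \<nu> E D vn u \<and> (%n. E (vn n)) \<longlonglongrightarrow> l'"
 then obtain vn where v: "form_approx \<nu> E D vn u" "(%n. E (vn n)) \<longlonglongrightarrow> l'" by blast
 have unD: "un n \<in> D" and vnD: "vn n \<in> D" for n using u v by (auto simp: form_approx_def)
 have "form_approx \<nu> E D (%n x. un n x - vn n x) (%x. u x - u x)"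
  by (rule approx_diff[OF u u(1) v(1)])
 then have "(%n. E (%x. un n x - vn n x)) \<longlonglongrightarrow> 0"
  using closable unfolding closable_form_def by simp
 then have s0: "(%n. s (%x. un n x - vn n x)) \<longlonglongrightarrow> 0" by (subst (asm) tendsto_0_iff) (auto intro: D_diff unD vnD)
 obtain a where a: "(%n. s (un n)) \<longlonglongrightarrow> a" "(%n. E (un n)) \<longlonglongrightarrow> ennreal (a\<^sup>2)"
  using Cauchy_convergent[where un = un, OF unD] u(2) by (auto simp: form_approx_def)
 obtain b where b: "(%n. s (vn n)) \<longlonglongrightarrow> b" "(%n. E (vn n)) \<longlonglongrightarrow> ennreal (b\<^sup>2)"
  using Cauchy_convergent[where un = vn, OF vnD] v(1) by (auto simp: form_approx_def)
 have "(%n. \<bar>s (un n) - s (vn n)\<bar>) \<longlonglongrightarrow> 0"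
  by (rule tendsto_0_squeeze[OF _ s_rev[OF unD vnD] s0]) simp
 moreover have "(%n. \<bar>s (un n) - s (vn n)\<bar>) \<longlonglongrightarrow> \<bar>a - b\<bar>" by (intro tendsto_intros a b)
 ultimately have "\<bar>a - b\<bar> = 0" by (rule LIMSEQ_unique[rotated])
 then have "ennreal (a\<^sup>2) = ennreal (b\<^sup>2)" by simp
 then show "l' = l" using LIMSEQ_unique[OF l a(2)] LIMSEQ_unique[OF v(2) b(2)] by simp
qed

lemma closure_approx:
 assumes "u \<in> C" "form_approx \<nu> E D un u"
 shows "(%n. E (un n)) \<longlonglongrightarrow> EC u" "EC u < \<infinity>"
proof -
 have u: "u \<in> l2_space \<nu>" using assms by (simp add: closure_dom_def)
 have unD: "un n \<in> D" for n using assms by (auto simp: form_approx_def)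
 obtain a where a: "(%n. E (un n)) \<longlonglongrightarrow> ennreal (a\<^sup>2)"
  using Cauchy_convergent[where un = un, OF unD] assms(2) by (auto simp: form_approx_def)
 have "EC u = ennreal (a\<^sup>2)" by (rule closure_form_eqI[OF u assms(2) a])
 then show "(%n. E (un n)) \<longlonglongrightarrow> EC u" "EC u < \<infinity>" using a by auto
qed

lemma C_l2: "u \<in> C ==> u \<in> l2_space \<nu>" by (simp add: closure_dom_def)

lemma D_closure: assumes "u \<in> D" shows "u \<in> C" "EC u = E u"
proof -
 have a: "form_approx \<nu> E D (%_. u) u"
  using assms by (auto simp: form_approx_def form_Cauchy_def E_0 l2_sq_def)
 then show "u \<in> C" using D_l2[OF assms] by (auto simp: closure_dom_def)
 show "EC u = E u" by (rule closure_form_eqI[OF D_l2[OF assms] a]) simp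
qed

lemma closure_quadratic: "quadratic_like \<nu> EC C"
 unfolding quadratic_like_def
proof (intro conjI ballI allI impI subsetI)
 show "(%_. 0) \<in> C" "EC (%_. 0) = 0" using D_closure[OF D_0] by (auto simp: E_0)
 fix u assume u: "u \<in> C"
 then show "u \<in> l2_space \<nu>" by (rule C_l2)
 obtain un where un: "form_approx \<nu> E D un u" using u by (auto simp: closure_dom_def)
 show "EC u < \<infinity>" by (rule closure_approx(2)[OF u un])
 fix v assume v: "v \<in> C"
 obtain vn where vn: "form_approx \<nu> E D vn v" using v by (auto simp: closure_dom_def)
 have uv: "form_approx \<nu> E D (%n x. un n x - vn n x) (%x. u x - v x)"
  by (rule approx_diff[OF C_l2[OF u] un C_l2[OF v] vn])
 show uvC: "(%x. u x - v x) \<in> C"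
  using uv l2.D_diff[OF C_l2[OF u] C_l2[OF v]] by (auto simp: closure_dom_def)
 fix d :: real assume d: "d > 0"
 show "EC (%x. u x - v x) \<le> ennreal (1 + d) * EC u + ennreal (1 + 1 / d) * EC v"
 proof (rule tendsto_le[OF trivial_limit_sequentially _ closure_approx(1)[OF uvC uv]])
  show "(%n. ennreal (1 + d) * E (un n) + ennreal (1 + 1 / d) * E (vn n)) \<longlonglongrightarrow> ennreal (1 + d) * EC u + ennreal (1 + 1 / d) * EC v"
   by (intro tendsto_add ennreal_tendsto_cmult closure_approx(1)[OF u un] closure_approx(1)[OF v vn]) auto
  show "\<forall>\<^sub>F n in sequentially. E (%x. un n x - vn n x) \<le> ennreal (1 + d) * E (un n) + ennreal (1 + 1 / d) * E (vn n)"
   using un vn d by (intro always_eventually allI E_diff) (auto simp: form_approx_def)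
 qed
qed

text \<open>For fixed \<open>n\<close> the differences \<open>un n - un m\<close> approximate
  \<open>un n - u\<close> as \<open>m\<close> grows, so the closed form inherits the Cauchy
  bound.\<close>

lemma closure_approx_tendsto:
 assumes u: "u \<in> C" and un: "form_approx \<nu> E D un u"
 shows "(%n. EC (%x. un n x - u x)) \<longlonglongrightarrow> 0"
proof (rule tendsto_0_ennrealI)
 fix e :: real assume e: "e > 0"
 have unD: "un n \<in> D" for n using un by (auto simp: form_approx_def)
 obtain N where N: "\<And>m n. m \<ge> N ==> n \<ge> N ==> E (%x. un m x - un n x) < ennreal e"
  using un e unfolding form_approx_def form_Cauchy_def by meson
 have "EC (%x. un n x - u x) \<le> ennreal e" if n: "n \<ge> N" for n
 proof -
  have c: "form_approx \<nu> E D (%_. un n) (un n)"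
   using unD by (auto simp: form_approx_def form_Cauchy_def E_0 l2_sq_def)
  have ap: "form_approx \<nu> E D (%m x. un n x - un m x) (%x. un n x - u x)"
   by (rule approx_diff[OF D_l2[OF unD] c C_l2[OF u] un])
  have "(%x. un n x - u x) \<in> C" using ap l2.D_diff[OF D_l2[OF unD] C_l2[OF u]] by (auto simp: closure_dom_def)
  then have "(%m. E (%x. un n x - un m x)) \<longlonglongrightarrow> EC (%x. un n x - u x)" by (rule closure_approx(1)[OF _ ap])
  then show ?thesis
   by (rule LIMSEQ_le_const2) (use N[OF n] in \<open>auto intro: less_imp_le\<close>)
 qed
 then show "\<exists>N. \<forall>n\<ge>N. EC (%x. un n x - u x) \<le> ennreal e" by blast
qed

sublocale cl: quadratic_form \<nu> EC C
 by (rule quadratic_form.intro) (rule closure_quadratic)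

text \<open>A diagonal choice: \<open>v n\<close> in \<open>D\<close> is within
  \<open>1 / Suc n\<close> of \<open>wn n\<close> for the form and in L2. The sequence
  \<open>v\<close> is then Cauchy for the original form and approximates \<open>w\<close>
  directly.\<close>

lemma closure_complete:
 assumes wn: "\<And>n. wn n \<in> C" "form_Cauchy EC wn" and w: "w \<in> l2_space \<nu>" "(%n. l2_sq \<nu> (%x. wn n x - w x)) \<longlonglongrightarrow> 0"
 shows "w \<in> C" "(%n. EC (%x. wn n x - w x)) \<longlonglongrightarrow> 0"
proof -
 have "\<exists>v\<in>D. cl.s (%x. v x - wn n x) < 1 / real (Suc n) \<and> l2.s \<nu> (%x. v x - wn n x) < 1 / real (Suc n)" for n
 proof -
  obtain un where un: "form_approx \<nu> E D un (wn n)" using wn(1)[of n] by (auto simp: closure_dom_def)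
  have unD: "un m \<in> D" for m using un by (auto simp: form_approx_def)
  have "(%m. cl.s (%x. un m x - wn n x)) \<longlonglongrightarrow> 0"
   using closure_approx_tendsto[OF wn(1) un] by (subst (asm) cl.tendsto_0_iff) (auto intro: cl.D_diff D_closure unD wn)
  then have 1: "\<forall>\<^sub>F m in sequentially. cl.s (%x. un m x - wn n x) < 1 / real (Suc n)"
   by (rule order_tendstoD) simp
  have "(%m. l2.s \<nu> (%x. un m x - wn n x)) \<longlonglongrightarrow> 0"
   using un by (subst l2.tendsto_0_iff[symmetric]) (auto simp: form_approx_def intro: l2.D_diff D_l2 unD C_l2 wn)
  then have "\<forall>\<^sub>F m in sequentially. l2.s \<nu> (%x. un m x - wn n x) < 1 / real (Suc n)"
   by (rule order_tendstoD) simp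
  from eventually_happens[OF eventually_conj[OF 1 this]] show ?thesis using unD by auto
 qed
 then obtain v where v: "\<And>n. v n \<in> D" "\<And>n. cl.s (%x. v n x - wn n x) < 1 / real (Suc n)"
  "\<And>n. l2.s \<nu> (%x. v n x - wn n x) < 1 / real (Suc n)" by metis
 have vC: "v n \<in> C" for n by (rule D_closure(1)[OF v(1)])
 have inv: "(%n. 1 / real (Suc n)) \<longlonglongrightarrow> 0"
  using LIMSEQ_inverse_real_of_nat by (simp add: inverse_eq_divide)
 have s1: "(%n. cl.s (%x. v n x - wn n x)) \<longlonglongrightarrow> 0"
  by (rule tendsto_0_squeeze[OF _ less_imp_le[OF v(2)] inv]) simp
 have s2: "(%n. l2.s \<nu> (%x. v n x - wn n x)) \<longlonglongrightarrow> 0"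
  by (rule tendsto_0_squeeze[OF _ less_imp_le[OF v(3)] inv]) simp
 have "form_Cauchy E v"
  unfolding Cauchy_iff[OF v(1)]
 proof (intro allI impI)
  fix e :: real assume e: "e > 0"
  obtain N where N: "\<And>m n. m \<ge> N ==> n \<ge> N ==> cl.s (%x. wn m x - wn n x) < e / 3"
   using wn(2)[unfolded cl.Cauchy_iff[where un = wn, OF wn(1)], rule_format, of "e / 3"] e by auto
  have "\<forall>\<^sub>F n in sequentially. cl.s (%x. v n x - wn n x) < e / 3" by (rule order_tendstoD[OF s1]) (use e in simp)
  then obtain M where M: "\<And>n. n \<ge> M ==> cl.s (%x. v n x - wn n x) < e / 3" by (auto simp: eventually_sequentially)
  have "s (%x. v m x - v n x) < e" if "m \<ge> max M N" "n \<ge> max M N" for m n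
  proof -
   have "s (%x. v m x - v n x) = cl.s (%x. v m x - v n x)"
    using D_closure(2)[OF D_diff[OF v(1) v(1)]] by (simp add: s_def cl.s_def)
   also have "\<dots> \<le> cl.s (%x. v m x - wn m x) + cl.s (%x. wn m x - v n x)" by (intro cl.s_tri vC wn)
   also have "cl.s (%x. wn m x - v n x) \<le> cl.s (%x. wn m x - wn n x) + cl.s (%x. wn n x - v n x)" by (intro cl.s_tri vC wn)
   also have "cl.s (%x. wn n x - v n x) = cl.s (%x. v n x - wn n x)" by (intro cl.s_minus_commute vC wn)
   finally show ?thesis using N[of m n] M[of m] M[of n] that by simp
  qed
  then show "\<exists>N. \<forall>m\<ge>N. \<forall>n\<ge>N. s (%x. v m x - v n x) < e" by blast
 qed
 moreover have "(%n. l2_sq \<nu> (%x. v n x - w x)) \<longlonglongrightarrow> 0"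
 proof -
  have s3: "(%n. l2.s \<nu> (%x. wn n x - w x)) \<longlonglongrightarrow> 0"
   using w by (subst l2.tendsto_0_iff[symmetric]) (auto intro: l2.D_diff C_l2 wn)
  have "(%n. l2.s \<nu> (%x. v n x - w x)) \<longlonglongrightarrow> 0"
   by (rule tendsto_0_squeeze[OF _ l2.s_tri[OF C_l2[OF vC] C_l2[OF wn(1)] w(1)] tendsto_add_zero[OF s2 s3]]) simp
  then show ?thesis by (subst l2.tendsto_0_iff) (auto intro: l2.D_diff C_l2 vC w)
 qed
 ultimately have ap: "form_approx \<nu> E D v w" using v(1) by (simp add: form_approx_def)
 then show wC: "w \<in> C" using w by (auto simp: closure_dom_def)
 have "(%n. cl.s (%x. v n x - w x)) \<longlonglongrightarrow> 0"
  using closure_approx_tendsto[OF wC ap] by (subst (asm) cl.tendsto_0_iff) (auto intro: cl.D_diff vC wC)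
 from tendsto_add_zero[OF s1 this]
 have "(%n. cl.s (%x. wn n x - w x)) \<longlonglongrightarrow> 0"
 proof (rule tendsto_0_squeeze[rotated 2])
  show "cl.s (%x. wn n x - w x) \<le> cl.s (%x. v n x - wn n x) + cl.s (%x. v n x - w x)" for n
   using cl.s_tri[OF wn(1)[of n] vC[of n] wC] cl.s_minus_commute[OF wn(1)[of n] vC[of n]] by simp
 qed simp
 then show "(%n. EC (%x. wn n x - w x)) \<longlonglongrightarrow> 0" by (subst cl.tendsto_0_iff) (auto intro: cl.D_diff wn wC)
qed

end

section \<open>Sums over the points of a configuration\<close>

lemma points_in_cfg:
 assumes "locfin I x" shows "points_in E (cfg I x) = x ` {i \<in> I. x i \<in> E}"
proof -
 have "cnt (cfg I x) {y} > 0 \<longleftrightarrow> (\<exists>i\<in>I. x i = y)" for y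
  using assms by (simp add: cnt_cfg emeasure_count_space_eq_0 zero_less_iff_neq_zero del: emeasure_count_space) blast
 then show ?thesis by (auto simp: points_in_def)
qed

lemma finite_points_in: assumes "bounded E" shows "finite (points_in E g)"
proof -
 obtain I x where Ix: "locfin I x" "g = cfg I x" by (rule config_cases)
 have "finite {i \<in> I. x i \<in> closure E}" using Ix(1) assms by (simp add: locfin_def)
 then have "finite {i \<in> I. x i \<in> E}" by (rule rev_finite_subset) (use closure_subset in auto)
 then show ?thesis by (simp add: Ix(2) points_in_cfg[OF Ix(1)])
qed

lemma cnt_zero_iff:
 assumes "S \<in> sets borel" shows "cnt g S = 0 \<longleftrightarrow> points_in S g = {}"
proof -
 obtain I x where Ix: "locfin I x" "g = cfg I x" by (rule config_cases)
 show ?thesis unfolding Ix(2) points_in_cfg[OF Ix(1)] using assms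
  by (simp add: cnt_cfg[OF Ix(1)] emeasure_count_space_eq_0 del: emeasure_count_space)
qed

lemma restr_cong_points:
 assumes "E \<in> sets borel" "F \<in> sets borel" "points_in (E - F) g = {}" "points_in (F - E) g = {}"
 shows "restr E g = restr F g"
proof (rule config_eqI)
 fix A :: "'a set" assume A: "A \<in> sets borel"
 have z: "cnt g ((E - F) \<inter> A) = 0" "cnt g ((F - E) \<inter> A) = 0"
  using assms A by (subst cnt_zero_iff; auto simp: points_in_def)+
 have "cnt g (E \<inter> A) = cnt g (E \<inter> F \<inter> A)"
 proof -
  have "cnt g (E \<inter> A) = cnt g ((E \<inter> F \<inter> A) \<union> ((E - F) \<inter> A))" by (rule arg_cong[of _ _ "cnt g"]) auto
  also have "\<dots> = cnt g (E \<inter> F \<inter> A) + cnt g ((E - F) \<inter> A)" using assms A by (intro plus_emeasure[symmetric]) auto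
  finally show ?thesis using z by simp
 qed
 moreover have "cnt g (F \<inter> A) = cnt g (E \<inter> F \<inter> A)"
 proof -
  have "cnt g (F \<inter> A) = cnt g ((E \<inter> F \<inter> A) \<union> ((F - E) \<inter> A))" by (rule arg_cong[of _ _ "cnt g"]) auto
  also have "\<dots> = cnt g (E \<inter> F \<inter> A) + cnt g ((F - E) \<inter> A)" using assms A by (intro plus_emeasure[symmetric]) auto
  finally show ?thesis using z by simp
 qed
 ultimately show "cnt (restr E g) A = cnt (restr F g) A" using assms A by (simp add: cnt_restr)
qed

text \<open>Near the bounded \<open>E\<close> there are finitely many points, so their distances
  have a positive minimum, and finer cells hold at most one of them. The margin 2 around
  \<open>E\<close> accommodates cells that reach out of \<open>E\<close>.\<close>

lemma cells_separate_points:
 fixes g :: "'a::euclidean_space config"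
 assumes "bounded E"
 obtains m0 where "\<And>m j x y. m0 \<le> m ==> x \<in> points_in E g ==> x \<in> cell m j ==> y \<in> points_in (cell m j) g ==> y = x"
proof -
 obtain R where R: "E \<subseteq> ball 0 R" using bounded_subset_ballD[OF assms, of 0] by blast
 define P where "P = points_in (ball 0 (R + 2)) g"
 have fin: "finite P" unfolding P_def by (rule finite_points_in) simp
 have "\<forall>a\<in>P. \<exists>d>0. \<forall>x\<in>P. x \<noteq> a --> d \<le> dist a x" using finite_set_avoid[OF fin] by blast
 then obtain d where d: "\<And>a. a \<in> P ==> d a > 0" "\<And>a x. a \<in> P ==> x \<in> P ==> x \<noteq> a ==> d a \<le> dist a x" by metis
 define c where "c = Min (insert 1 (d ` P))"
 have c: "c > 0" "\<And>a. a \<in> P ==> c \<le> d a" using fin d by (auto simp: c_def)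
 obtain m0 :: nat where m0: "2 / (real m0 + 1) < c"
  using reals_Archimedean[of "c / 2"] c(1) by (auto simp: inverse_eq_divide field_simps)
 show thesis
 proof (rule that[of m0])
  fix m j and x y :: 'a
  assume m: "m0 \<le> m" and x: "x \<in> points_in E g" "x \<in> cell m j" and y: "y \<in> points_in (cell m j) g"
  have "dist x y \<le> dist (dense_seq j) x + dist (dense_seq j) y" by (rule dist_triangle3)
  also have "\<dots> < 2 / (real m + 1)" using cell_dist[OF x(2)] cell_dist[of y m j] y by (auto simp: points_in_def)
  finally have xy: "dist x y < 2 / (real m + 1)" .
  also have "\<dots> \<le> 2 / (real m0 + 1)" using m by (simp add: field_simps)
  finally have xy1: "dist x y < c" using m0 by linarith
  have "dist x y < 2" using xy by (rule order.strict_trans2) (simp add: field_simps)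
  moreover have xE: "norm x < R" using x(1) R by (auto simp: points_in_def)
  moreover have "norm y \<le> norm x + dist x y" by (subst dist_commute) (simp add: dist_norm norm_triangle_sub)
  ultimately have "y \<in> P" "x \<in> P" using x(1) y by (auto simp: P_def points_in_def)
  then show "y = x" using d(2)[of x y] c(2)[of x] xy1 by force
 qed
qed

text \<open>Once the cells separate the points, deleting a point is the same as deleting its cell,
  and the latter is a measurable operation for each fixed cell. The sums \<open>S m\<close> over
  cells are eventually constant in \<open>m\<close>, so their \<open>liminf\<close> is the point
  sum. Multiple points count once, which is the reason for testing a count against 0.\<close>

lemma measurable_point_sum_rectangle:
 fixes A :: "'a::euclidean_space config set"
 assumes E: "E \<in> sets borel" "bounded E" and A [measurable]: "A \<in> sets borel" and C [measurable]: "C \<in> sets borel"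
 shows "(%g. \<Sum>x\<in>points_in E g. indicator (A \<times> C) (restr (- {x}) g, x) :: ennreal) \<in> borel_measurable borel"
proof -
 note E(1) [measurable]
 define S where "S m g = (\<Sum>j. indicator A (restr (- cell m j) g) * (if cnt g (cell m j \<inter> C \<inter> E) = 0 then 0 else 1) :: ennreal)" for m g
 have [measurable]: "restr (- cell m j) \<in> borel_measurable (borel :: 'a config measure)" for m j
  by (rule measurable_restr) auto
 have Sm [measurable]: "S m \<in> borel_measurable borel" for m unfolding S_def by measurable
 have "(\<Sum>x\<in>points_in E g. indicator (A \<times> C) (restr (- {x}) g, x)) = liminf (%m. S m g)" for g
 proof -
  obtain m0 where m0: "\<And>m j x y. m0 \<le> m ==> x \<in> points_in E g ==> x \<in> cell m j ==> y \<in> points_in (cell m j) g ==> y = x"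
   by (rule cells_separate_points[OF E(2), of g]) blast
  have "S m g = (\<Sum>x\<in>points_in E g. indicator (A \<times> C) (restr (- {x}) g, x))" if m: "m0 \<le> m" for m
  proof -
   have "\<forall>x::'a. \<exists>j. x \<in> cell m j" using cell_cover by blast
   then obtain J where J: "\<And>x::'a. x \<in> cell m (J x)" by metis
   have fin: "finite (points_in E g)" by (rule finite_points_in[OF E(2)])
   have inj: "inj_on J (points_in E g)"
   proof (rule inj_onI)
    fix x y assume xy: "x \<in> points_in E g" "y \<in> points_in E g" "J x = J y"
    have "y \<in> points_in (cell m (J x)) g" using xy(2) J[of y] unfolding points_in_def xy(3) by simp
    from m0[OF m xy(1) J this] show "x = y" by simp
   qed
   have "S m g = (\<Sum>j\<in>J ` points_in E g. indicator A (restr (- cell m j) g) * (if cnt g (cell m j \<inter> C \<inter> E) = 0 then 0 else 1))"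
    unfolding S_def
   proof (rule suminf_finite)
    fix j assume j: "j \<notin> J ` points_in E g"
    have "points_in (cell m j \<inter> C \<inter> E) g = {}"
     using j cell_disjoint[OF J] by (auto simp: points_in_def image_iff)
    then have "cnt g (cell m j \<inter> C \<inter> E) = 0" by (subst cnt_zero_iff) auto
    then show "indicator A (restr (- cell m j) g) * (if cnt g (cell m j \<inter> C \<inter> E) = 0 then 0 else 1) = (0 :: ennreal)" by simp
   qed (use fin in simp)
   also have "\<dots> = (\<Sum>x\<in>points_in E g. indicator A (restr (- cell m (J x)) g) * (if cnt g (cell m (J x) \<inter> C \<inter> E) = 0 then 0 else 1))"
    by (rule sum.reindex_cong[OF inj refl refl])
   also have "\<dots> = (\<Sum>x\<in>points_in E g. indicator (A \<times> C) (restr (- {x}) g, x))"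
   proof (rule sum.cong[OF refl])
    fix x assume x: "x \<in> points_in E g"
    have "restr (- cell m (J x)) g = restr (- {x}) g"
    proof (rule restr_cong_points)
     show "points_in (- cell m (J x) - - {x}) g = {}" using J[of x] by (auto simp: points_in_def)
     show "points_in (- {x} - - cell m (J x)) g = {}" using m0[OF m x J]
      by (auto simp: points_in_def zero_less_iff_neq_zero)
    qed auto
    moreover have "cnt g (cell m (J x) \<inter> C \<inter> E) = 0 \<longleftrightarrow> x \<notin> C"
    proof -
     have "cnt g (cell m (J x) \<inter> C \<inter> E) = 0 \<longleftrightarrow> points_in (cell m (J x) \<inter> C \<inter> E) g = {}"
      by (rule cnt_zero_iff) simp
     also have "\<dots> \<longleftrightarrow> x \<notin> C" using x J[of x] m0[OF m x J]
      by (auto simp: points_in_def zero_less_iff_neq_zero)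
     finally show ?thesis .
    qed
    ultimately show "indicator A (restr (- cell m (J x)) g) * (if cnt g (cell m (J x) \<inter> C \<inter> E) = 0 then 0 else 1) =
      (indicator (A \<times> C) (restr (- {x}) g, x) :: ennreal)" by (auto simp: indicator_def)
   qed
   finally show ?thesis .
  qed
  then have "(%m. S m g) \<longlonglongrightarrow> (\<Sum>x\<in>points_in E g. indicator (A \<times> C) (restr (- {x}) g, x))"
   by (intro tendsto_eventually) (auto simp: eventually_sequentially)
  then show ?thesis by (rule lim_imp_Liminf[OF trivial_limit_sequentially, symmetric])
 qed
 moreover have "(%g. liminf (%m. S m g)) \<in> borel_measurable borel" by measurable
 ultimately show ?thesis by simp
qed

text \<open>Dynkin's argument from rectangles to measurable sets, where finiteness of the point sums
  allows subtraction for complements, followed by monotone approximation.\<close>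

lemma measurable_point_sum:
 fixes F :: "'a::euclidean_space config \<times> 'a => ennreal"
 assumes E: "E \<in> sets borel" "bounded E" and F: "F \<in> borel_measurable (borel \<Otimes>\<^sub>M borel)"
 shows "(%w. \<Sum>x\<in>points_in E w. F (restr (- {x}) w, x)) \<in> borel_measurable borel"
 using F
proof (induction rule: borel_measurable_induct)
 case (cong f g)
 have "f = g" using cong(3) by (auto simp: space_pair_measure)
 then show ?case using cong by simp
next
 case (set A)
 let ?T = "%A w. (\<Sum>x\<in>points_in E w. indicator A (restr (- {x}) w, x) :: ennreal)"
 have A: "A \<in> sigma_sets (UNIV \<times> UNIV) {a \<times> b | a b. a \<in> sets (borel :: 'a config measure) \<and> b \<in> sets (borel :: 'a measure)}"
  using set by (simp add: sets_pair_measure)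
 have tot: "?T (UNIV \<times> UNIV) \<in> borel_measurable borel"
  by (rule measurable_point_sum_rectangle[OF E]) auto
 show ?case
 proof (rule sigma_sets_induct_disjoint[OF Int_stable_pair_measure_generator _ A, where P = "%A. ?T A \<in> borel_measurable borel"])
  fix X assume "X \<in> {a \<times> b | a b. a \<in> sets (borel :: 'a config measure) \<and> b \<in> sets (borel :: 'a measure)}"
  then show "?T X \<in> borel_measurable borel" using measurable_point_sum_rectangle[OF E] by auto
 next
  fix X assume X: "?T X \<in> borel_measurable borel"
  have "?T (UNIV \<times> UNIV - X) w = ?T (UNIV \<times> UNIV) w - ?T X w" for w
  proof -
   have "?T (UNIV \<times> UNIV - X) w + ?T X w = ?T (UNIV \<times> UNIV) w"
    unfolding sum.distrib[symmetric] by (intro sum.cong refl) (auto simp: indicator_def)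
   moreover have "?T X w \<noteq> top"
    using finite_points_in[OF E(2)] by (auto simp: indicator_def)
   ultimately show ?thesis
    using ennreal_add_diff_cancel_right[of "?T X w" "?T (UNIV \<times> UNIV - X) w"] by simp
  qed
  then show "?T (UNIV \<times> UNIV - X) \<in> borel_measurable borel" using X tot by simp
 next
  fix X :: "nat => _" assume dis: "disjoint_family X" and X: "\<And>i. ?T (X i) \<in> borel_measurable borel"
  have "?T (\<Union>i. X i) w = (\<Sum>i. ?T (X i) w)" for w
  proof -
   have "?T (\<Union>i. X i) w = (\<Sum>x\<in>points_in E w. \<Sum>i. indicator (X i) (restr (- {x}) w, x))"
    by (intro sum.cong refl suminf_indicator[OF dis, symmetric])
   also have "\<dots> = (\<Sum>i. ?T (X i) w)" by (rule suminf_sum[symmetric]) simp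
   finally show ?thesis .
  qed
  then show "?T (\<Union>i. X i) \<in> borel_measurable borel" using X by simp
 qed auto
next
 case (mult u c)
 then show ?case by (simp add: sum_distrib_left[symmetric])
next
 case (add u v)
 then show ?case by (simp add: sum.distrib)
next
 case (seq U)
 have "(\<Sum>x\<in>points_in E w. (SUP i. U i) (restr (- {x}) w, x)) = (SUP i. \<Sum>x\<in>points_in E w. U i (restr (- {x}) w, x))" for w
 proof -
  have inc: "incseq (%i. U i p)" for p using seq(3) unfolding incseq_def le_fun_def by blast
  show ?thesis unfolding SUP_apply by (rule ennreal_SUP_sum[OF inc, symmetric])
 qed
 then show ?case using seq(5) by simp
qed

section \<open>Disintegration\<close>

lemma config_eqI_cells:
 assumes "\<And>m j. cnt g (cell m j) = cnt c (cell m j)" shows "g = c"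
proof (rule ccontr)
 assume "g \<noteq> c"
 then obtain S T where "open S" "g \<in> S" "c \<in> T" "S \<inter> T = {}" using hausdorff by blast
 moreover from this obtain M where "\<forall>c. same_cells M g c --> c \<in> S" using open_contains_same_cells by blast
 ultimately show False using assms by (auto simp: same_cells_def)
qed

lemma measurable_completion_AE:
 assumes "g \<in> borel_measurable (completion M)" "AE x in M. f x = g x" shows "f \<in> borel_measurable (completion M)"
proof (rule measurableI)
 fix A :: "'b set" assume A: "A \<in> sets borel"
 show "f -` A \<inter> space (completion M) \<in> sets (completion M)"
 proof (rule completion.in_sets_AE)
  show "AE x in completion M. x \<in> g -` A \<inter> space (completion M) \<longleftrightarrow> x \<in> f -` A \<inter> space (completion M)"
   using AE_completion[OF assms(2)] by eventually_elim auto
  show "g -` A \<inter> space (completion M) \<in> sets (completion M)" by (rule measurable_sets[OF assms(1) A])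
 qed simp
qed simp

lemma borel_measurable_completionI:
 "g \<in> borel_measurable M ==> AE x in M. f x = g x ==> f \<in> borel_measurable (completion M)"
 by (rule measurable_completion_AE[OF measurable_completion])

locale conditioned =
 fixes B :: "nat => 'a::euclidean_space set" and \<mu> :: "'a config measure" and \<kappa> :: "nat => 'a config => 'a config measure"
 assumes exh: "exhaustion B" and prob: "prob_space \<mu>" and sets_\<mu> [measurable_cong, simp]: "sets \<mu> = sets borel"
  and kernels: "cond_prob_kernels B \<mu> \<kappa>"
begin

sublocale prob_space \<mu> by (rule prob)

lemma space_\<mu> [simp]: "space \<mu> = UNIV" using sets_eq_imp_space_eq[OF sets_\<mu>] by simp

lemma Br [simp]: "B r \<in> sets borel" "- B r \<in> sets borel"
 using exhaustion_sets(1)[OF exh] by auto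

lemma outside_sub: "sets (outside_algebra B r) \<subseteq> sets borel"
proof
 fix X assume "X \<in> sets (outside_algebra B r)"
 then obtain Y where "Y \<in> sets borel" "X = restr (- B r) -` Y"
  by (auto simp: outside_algebra_def sets_vimage_algebra2)
 then show "X \<in> sets borel" using measurable_sets[OF measurable_restr[OF Br(2)], of Y r] by simp
qed

lemma outside_mono: "s \<le> r ==> sets (outside_algebra B r) \<subseteq> sets (outside_algebra B s)"
proof
 fix X assume sr: "s \<le> r" and "X \<in> sets (outside_algebra B r)"
 then obtain Y where Y: "Y \<in> sets borel" "X = restr (- B r) -` Y"
  by (auto simp: outside_algebra_def sets_vimage_algebra2)
 have "- B r \<inter> - B s = - B r" using exhaustion_sets(5)[OF exh sr] by auto
 then have "restr (- B r) g = restr (- B r) (restr (- B s) g)" for g by (subst restr_restr) auto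
 then have "X = restr (- B s) -` (restr (- B r) -` Y) \<inter> UNIV" using Y(2) by auto
 moreover have "restr (- B r) -` Y \<in> sets borel" using measurable_sets[OF measurable_restr[OF Br(2)] Y(1), of r] by simp
 ultimately show "X \<in> sets (outside_algebra B s)" unfolding outside_algebra_def by (metis in_vimage_algebra)
qed

lemma space_outside [simp]: "space (outside_algebra B r) = UNIV"
 by (simp add: outside_algebra_def)

lemma kernel_outside: "\<kappa> r \<in> outside_algebra B r \<rightarrow>\<^sub>M prob_algebra borel"
 using kernels by (simp add: cond_prob_kernels_def)

lemma kernel_measurable: "\<kappa> r \<in> borel \<rightarrow>\<^sub>M prob_algebra borel"
proof (rule measurableI)
 fix X assume "X \<in> sets (prob_algebra (borel :: 'a config measure))"
 from measurable_sets[OF kernel_outside this, of r] show "\<kappa> r -` X \<inter> space borel \<in> sets borel"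
  using outside_sub by auto
qed (use measurable_space[OF kernel_outside] in auto)

lemma kernel_subprob: "\<kappa> r \<in> \<mu> \<rightarrow>\<^sub>M subprob_algebra borel"
 using measurable_prob_algebraD[OF kernel_measurable] by (simp cong: measurable_cong_sets)

lemma sets_kernel [simp, measurable_cong]: "sets (\<kappa> r g) = sets borel" and prob_kernel: "prob_space (\<kappa> r g)"
 using measurable_space[OF kernel_measurable, of g r] by (auto simp: space_prob_algebra)

lemma space_kernel [simp]: "space (\<kappa> r g) = UNIV" using sets_eq_imp_space_eq[OF sets_kernel] by simp

lemma kernel_emeasure_measurable: "A \<in> sets borel ==> (%g. emeasure (\<kappa> r g) A) \<in> borel_measurable (outside_algebra B r)"
 using measurable_emeasure_kernel[OF measurable_prob_algebraD[OF kernel_outside]] by simp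

lemma kernel_emeasure_measurable' [measurable (raw)]: "A \<in> sets borel ==> (%g. emeasure (\<kappa> r g) A) \<in> borel_measurable borel"
 using measurable_emeasure_kernel[OF measurable_prob_algebraD[OF kernel_measurable]] by simp

lemma kernel_emeasure_measurable_\<mu>: "A \<in> sets borel ==> (%g. emeasure (\<kappa> r g) A) \<in> borel_measurable \<mu>"
 using kernel_emeasure_measurable' by (simp cong: measurable_cong_sets)

lemma kernel_outside_int:
 "A \<in> sets borel ==> S \<in> sets (outside_algebra B r) ==>
   emeasure \<mu> (A \<inter> S) = (\<integral>\<^sup>+ g. emeasure (\<kappa> r g) A * indicator S g \<partial>\<mu>)"
 using kernels by (simp add: cond_prob_kernels_def)

lemma emeasure_disint: "A \<in> sets borel ==> emeasure \<mu> A = (\<integral>\<^sup>+ g. emeasure (\<kappa> r g) A \<partial>\<mu>)"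
 using kernel_outside_int[of A UNIV r] sets.top[of "outside_algebra B r"] by simp

lemma bind_kernel: "\<mu> \<bind> \<kappa> r = \<mu>"
proof (rule measure_eqI)
 show s: "sets (\<mu> \<bind> \<kappa> r) = sets \<mu>" using sets_bind[of \<mu> "\<kappa> r" borel] by simp
 fix A assume "A \<in> sets (\<mu> \<bind> \<kappa> r)"
 then have A: "A \<in> sets borel" using s by simp
 show "emeasure (\<mu> \<bind> \<kappa> r) A = emeasure \<mu> A"
  using emeasure_bind[OF _ kernel_subprob A] emeasure_disint[OF A, of r] by simp
qed

lemma nn_integral_disint: "f \<in> borel_measurable borel ==> (\<integral>\<^sup>+ g. f g \<partial>\<mu>) = (\<integral>\<^sup>+ c. \<integral>\<^sup>+ g. f g \<partial>\<kappa> r c \<partial>\<mu>)"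
 using nn_integral_bind[OF _ kernel_subprob, of f r] by (simp add: bind_kernel)

lemma nn_integral_kernel_measurable [measurable]:
 "f \<in> borel_measurable borel ==> (%c. \<integral>\<^sup>+ g. f g \<partial>\<kappa> r c) \<in> borel_measurable borel"
 using measurable_compose[OF measurable_prob_algebraD[OF kernel_measurable] nn_integral_measurable_subprob_algebra] .

lemma AE_kernel: assumes "AE g in \<mu>. P g" shows "AE c in \<mu>. AE g in \<kappa> r c. P g"
proof -
 obtain N where N: "{g. \<not> P g} \<subseteq> N" "N \<in> null_sets \<mu>" using assms unfolding eventually_ae_filter by auto
 have Nb: "N \<in> sets borel" and "emeasure \<mu> N = 0" using N(2) by auto
 then have "(\<integral>\<^sup>+ c. emeasure (\<kappa> r c) N \<partial>\<mu>) = 0" using emeasure_disint[OF Nb, of r] by simp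
 then have "AE c in \<mu>. emeasure (\<kappa> r c) N = 0"
  by (subst (asm) nn_integral_0_iff_AE[OF kernel_emeasure_measurable_\<mu>[OF Nb]])
 then show ?thesis
 proof eventually_elim
  case (elim c)
  then have "N \<in> null_sets (\<kappa> r c)" using Nb by (simp add: null_sets_def)
  then show ?case using N(1) by (intro AE_I') auto
 qed
qed

lemma AE_kernelD:
 assumes "{g. P g} \<in> sets borel" "AE c in \<mu>. AE g in \<kappa> r c. P g" shows "AE g in \<mu>. P g"
proof -
 have N: "{g. \<not> P g} \<in> sets borel" using sets.compl_sets[OF assms(1)] by (simp add: Collect_neg_eq Compl_eq_Diff_UNIV)
 have "AE c in \<mu>. emeasure (\<kappa> r c) {g. \<not> P g} = 0"
  using assms(2)
 proof eventually_elim
  case (elim c)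
  then show ?case using AE_iff_measurable[of "{g. \<not> P g}" "\<kappa> r c" P] N by simp
 qed
 then have "emeasure \<mu> {g. \<not> P g} = 0"
  unfolding emeasure_disint[OF N, of r] nn_integral_0_iff_AE[OF kernel_emeasure_measurable_\<mu>[OF N]] .
 then show ?thesis using AE_iff_measurable[of "{g. \<not> P g}" \<mu> P] N by simp
qed

text \<open>The defining identity of the kernel for the pair \<open>- S\<close>, \<open>S\<close>
  has the measure of the empty set on its left side.\<close>

lemma AE_kernel_outside:
 assumes S: "S \<in> sets (outside_algebra B r)" shows "AE c in \<mu>. c \<in> S --> (AE g in \<kappa> r c. g \<in> S)"
proof -
 have Sb': "S \<in> sets borel" using S outside_sub by blast
 then have Sb: "- S \<in> sets borel" by (rule borel_comp)
 have "(\<integral>\<^sup>+ c. emeasure (\<kappa> r c) (- S) * indicator S c \<partial>\<mu>) = 0"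
  using kernel_outside_int[OF Sb S] by simp
 moreover have "(%c. emeasure (\<kappa> r c) (- S) * indicator S c) \<in> borel_measurable \<mu>"
  by (intro borel_measurable_times_ennreal kernel_emeasure_measurable_\<mu> Sb borel_measurable_indicator) (simp add: Sb')
 ultimately have "AE c in \<mu>. emeasure (\<kappa> r c) (- S) * indicator S c = 0"
  using nn_integral_0_iff_AE by blast
 then show ?thesis
 proof eventually_elim
  case (elim c)
  show ?case
  proof
   assume "c \<in> S"
   then have "- S \<in> null_sets (\<kappa> r c)" using elim Sb by auto
   then show "AE g in \<kappa> r c. g \<in> S" by (intro AE_I') auto
  qed
 qed
qed

text \<open>The outer configuration is determined by its counts in countably many cells. Each event
  fixing one such count belongs to the outer algebra and is almost surely reproduced by the
  kernel.\<close>

lemma AE_same_outside: "AE c in \<mu>. AE g in \<kappa> r c. restr (- B r) g = restr (- B r) c"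
proof -
 define S where "S m j n = {g :: 'a config. cnt (restr (- B r) g) (cell m j) = of_nat n}" for m j n :: nat
 have S: "S m j n \<in> sets (outside_algebra B r)" for m j n
 proof -
  have "{g :: 'a config. cnt g (cell m j) = of_nat n} \<in> sets borel" by measurable
  from in_vimage_algebra[OF this, of "restr (- B r)" UNIV]
  have "restr (- B r) -` {g :: 'a config. cnt g (cell m j) = of_nat n} \<inter> UNIV \<in> sets (outside_algebra B r)"
   by (simp only: outside_algebra_def)
  moreover have "S m j n = restr (- B r) -` {g :: 'a config. cnt g (cell m j) = of_nat n} \<inter> UNIV" by (auto simp: S_def)
  ultimately show ?thesis by simp
 qed
 have "AE c in \<mu>. \<forall>m j n. c \<in> S m j n --> (AE g in \<kappa> r c. g \<in> S m j n)"
  unfolding AE_all_countable using AE_kernel_outside[OF S] by blast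
 then show ?thesis
 proof eventually_elim
  case (elim c)
  have "AE g in \<kappa> r c. cnt (restr (- B r) g) (cell m j) = cnt (restr (- B r) c) (cell m j)" for m j
  proof -
   obtain n where n: "cnt (restr (- B r) c) (cell m j) = of_nat n"
    by (rule restr_finite_pts[OF cell_borel cnt_cell_finite]) auto
   then have "c \<in> S m j n" by (simp add: S_def)
   then have "AE g in \<kappa> r c. g \<in> S m j n" using elim by blast
   then show ?thesis by eventually_elim (simp add: S_def n)
  qed
  then have "AE g in \<kappa> r c. \<forall>m j. cnt (restr (- B r) g) (cell m j) = cnt (restr (- B r) c) (cell m j)"
   unfolding AE_all_countable by blast
  then show ?case by eventually_elim (auto intro: config_eqI_cells)
 qed
qed

section \<open>Conditional measures inside the ball and their gluing with the outer
  configuration\<close>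

abbreviation "\<nu> \<equiv> cond_meas B \<kappa>"

lemma sets_cond [simp, measurable_cong]: "sets (\<nu> r g) = sets borel" by (simp add: cond_meas_def)

lemma space_cond [simp]: "space (\<nu> r g) = UNIV" by (simp add: cond_meas_def)

lemma prob_cond: "prob_space (\<nu> r g)"
 unfolding cond_meas_def by (rule prob_space.prob_space_distr[OF prob_kernel]) (simp add: measurable_restr cong: measurable_cong_sets)

lemma measurable_glue [measurable]: "(%g. config_add g c) \<in> borel_measurable borel"
 by measurable

lemma measurable_glue' [measurable]: "(%c. config_add c w) \<in> borel_measurable (\<nu> r g)"
 by (simp cong: measurable_cong_sets add: measurable_glue)

text \<open>\<open>cond_meas\<close> forgets what lies outside \<open>B r\<close>. Adding the outer
  part of \<open>c\<close> restores it, because the kernel is concentrated on configurations with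
  that outer part.\<close>

lemma nn_integral_cond:
 assumes "AE g in \<kappa> r c. restr (- B r) g = restr (- B r) c" and f [measurable]: "f \<in> borel_measurable borel"
 shows "(\<integral>\<^sup>+ w. f (config_add w (restr (- B r) c)) \<partial>\<nu> r c) = (\<integral>\<^sup>+ g. f g \<partial>\<kappa> r c)"
proof -
 have m: "restr (B r) \<in> measurable (\<kappa> r c) borel" by (simp add: measurable_restr cong: measurable_cong_sets)
 have "(\<integral>\<^sup>+ w. f (config_add w (restr (- B r) c)) \<partial>\<nu> r c) =
   (\<integral>\<^sup>+ g. f (config_add (restr (B r) g) (restr (- B r) c)) \<partial>\<kappa> r c)"
  unfolding cond_meas_def by (subst nn_integral_distr[OF m]) (auto intro!: measurable_compose[OF measurable_glue f])
 also have "\<dots> = (\<integral>\<^sup>+ g. f g \<partial>\<kappa> r c)"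
  using assms(1) by (intro nn_integral_cong_AE, eventually_elim) (metis Br(1) config_add_restr)
 finally show ?thesis .
qed

lemma emeasure_cond:
 assumes "AE g in \<kappa> r c. restr (- B r) g = restr (- B r) c" "A \<in> sets borel"
 shows "emeasure (\<nu> r c) {w. config_add w (restr (- B r) c) \<in> A} = emeasure (\<kappa> r c) A"
proof -
 have "{w. config_add w (restr (- B r) c) \<in> A} \<in> sets borel"
  using measurable_sets[OF measurable_glue assms(2)] by (simp add: vimage_def)
 moreover have "(%w. indicator A (config_add w (restr (- B r) c)) :: ennreal) = indicator {w. config_add w (restr (- B r) c) \<in> A}"
  by (auto simp: indicator_def fun_eq_iff)
 ultimately have "emeasure (\<nu> r c) {w. config_add w (restr (- B r) c) \<in> A} = (\<integral>\<^sup>+ w. indicator A (config_add w (restr (- B r) c)) \<partial>\<nu> r c)"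
  by (simp only: nn_integral_indicator sets_cond)
 also have "\<dots> = emeasure (\<kappa> r c) A" using assms by (subst nn_integral_cond) auto
 finally show ?thesis .
qed

lemma AE_cond:
 assumes "AE g in \<mu>. P g" shows "AE c in \<mu>. AE w in \<nu> r c. P (config_add w (restr (- B r) c))"
proof -
 obtain N where N: "{g. \<not> P g} \<subseteq> N" "N \<in> null_sets \<mu>" using assms unfolding eventually_ae_filter by auto
 have "AE g in \<mu>. g \<notin> N" using N(2) by (rule AE_not_in)
 from AE_kernel[OF this, of r] AE_same_outside[of r] show ?thesis
 proof eventually_elim
  case (elim c)
  have Nb: "N \<in> sets borel" using N(2) by auto
  have "emeasure (\<kappa> r c) N = 0" using elim(1) AE_iff_measurable[of N "\<kappa> r c" "%g. g \<notin> N"] Nb by auto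
  then have "{w. config_add w (restr (- B r) c) \<in> N} \<in> null_sets (\<nu> r c)"
   using emeasure_cond[OF elim(2) Nb] measurable_sets[OF measurable_glue Nb] by (auto simp: vimage_def)
  then show ?case using N(1) by (intro AE_I') auto
 qed
qed

lemma AE_condD:
 assumes P: "{g. P g} \<in> sets borel" and ae: "AE c in \<mu>. AE w in \<nu> r c. P (config_add w (restr (- B r) c))"
 shows "AE g in \<mu>. P g"
proof (rule AE_kernelD[OF P, of r])
 have N: "{g. \<not> P g} \<in> sets borel" using sets.compl_sets[OF P] by (simp add: Collect_neg_eq Compl_eq_Diff_UNIV)
 from ae AE_same_outside[of r] show "AE c in \<mu>. AE g in \<kappa> r c. P g"
 proof eventually_elim
  case (elim c)
  have "{w. \<not> P (config_add w (restr (- B r) c))} \<in> sets borel"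
   using measurable_sets[OF measurable_glue N] by (simp add: vimage_def)
  then have "emeasure (\<nu> r c) {w. \<not> P (config_add w (restr (- B r) c))} = 0"
   using elim(1) AE_iff_measurable[of "{w. \<not> P (config_add w (restr (- B r) c))}" "\<nu> r c" "%w. P (config_add w (restr (- B r) c))"] by simp
  then have "emeasure (\<kappa> r c) {g. \<not> P g} = 0" using emeasure_cond[OF elim(2) N] by simp
  then show ?case using AE_iff_measurable[of "{g. \<not> P g}" "\<kappa> r c" P] N by simp
 qed
qed

lemma cond_configs: "AE c in \<nu> r g. c \<in> configs (B r)"
proof -
 have m: "restr (B r) \<in> measurable (\<kappa> r g) borel" by (simp add: measurable_restr cong: measurable_cong_sets)
 have "{c :: 'a config. c \<in> configs (B r)} \<in> sets borel"
  using measurable_sets[OF measurable_cnt[OF Br(2)], of "{0}" r] by (simp add: configs_def vimage_def)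
 then show ?thesis unfolding cond_meas_def
  by (subst AE_distr_iff[OF m]) (auto simp: configs_def cnt_restr)
qed

lemma cond_fun_borel: "u \<in> borel_measurable borel ==> cond_fun B r g u \<in> borel_measurable borel"
 unfolding cond_fun_def by (rule measurable_compose[OF measurable_glue])

lemma cond_fun_measurable:
 assumes "u \<in> borel_measurable (completion \<mu>)"
 shows "AE c in \<mu>. cond_fun B r c u \<in> borel_measurable (completion (\<nu> r c))"
proof -
 obtain u' where u': "u' \<in> borel_measurable \<mu>" "AE g in \<mu>. u g = u' g"
  using completion_ex_borel_measurable_real[OF assms] by blast
 have u'b: "u' \<in> borel_measurable borel" using u'(1) by (simp cong: measurable_cong_sets)
 from AE_cond[OF u'(2), of r] show ?thesis
 proof eventually_elim
  case (elim c)
  have "cond_fun B r c u' \<in> borel_measurable (\<nu> r c)" using cond_fun_borel[OF u'b] by (simp cong: measurable_cong_sets)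
  then show ?case by (rule borel_measurable_completionI) (use elim in \<open>simp add: cond_fun_def\<close>)
 qed
qed

text \<open>The function \<open>g\<close> is a Borel version of the conditional second moment.
  \<open>u\<close> itself is measurable only for the completion, so its conditioned norm is
  controlled through a Borel modification.\<close>

lemma l2_disint:
 assumes "u \<in> borel_measurable (completion \<mu>)"
 obtains g where "g \<in> borel_measurable borel" "AE w in \<mu>. l2_sq (\<nu> r w) (cond_fun B r w u) = g w" "(\<integral>\<^sup>+ w. g w \<partial>\<mu>) = l2_sq \<mu> u"
proof -
 obtain u' where u': "u' \<in> borel_measurable \<mu>" "AE c in \<mu>. u c = u' c"
  using completion_ex_borel_measurable_real[OF assms] by blast
 have u'b [measurable]: "u' \<in> borel_measurable borel" using u'(1) by (simp cong: measurable_cong_sets)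
 define g where "g w = (\<integral>\<^sup>+ c. ennreal ((u' c)\<^sup>2) \<partial>\<kappa> r w)" for w
 have gm: "g \<in> borel_measurable borel" unfolding g_def by measurable
 have ae: "AE w in \<mu>. l2_sq (\<nu> r w) (cond_fun B r w u) = g w"
  using AE_cond[OF u'(2), of r] AE_same_outside[of r]
 proof eventually_elim
  case (elim w)
  have "l2_sq (\<nu> r w) (cond_fun B r w u) = (\<integral>\<^sup>+ v. ennreal ((u' (config_add v (restr (- B r) w)))\<^sup>2) \<partial>\<nu> r w)"
   unfolding l2_sq_def nn_integral_completion cond_fun_def
   by (intro nn_integral_cong_AE) (use elim(1) in eventually_elim, simp)
  also have "\<dots> = g w" unfolding g_def
   by (rule nn_integral_cond[OF elim(2), of "%c. ennreal ((u' c)\<^sup>2)"]) measurable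
  finally show ?case .
 qed
 have "(\<integral>\<^sup>+ w. g w \<partial>\<mu>) = (\<integral>\<^sup>+ c. ennreal ((u' c)\<^sup>2) \<partial>\<mu>)"
  unfolding g_def by (rule nn_integral_disint[symmetric]) measurable
 also have "\<dots> = l2_sq \<mu> u"
  unfolding l2_sq_def nn_integral_completion by (intro nn_integral_cong_AE) (use u'(2) in eventually_elim, simp)
 finally show thesis using that gm ae by blast
qed

end

section \<open>Convex combinations of bounded sequences\<close>

text \<open>Elements of the convex hull of the tail \<open>n, n + 1, ...\<close>, recorded by
  coefficients so that one choice of weights can be applied to several functions at once.\<close>

definition convex_weights :: "nat => ((nat => real) \<times> nat) set" where
 "convex_weights n = {(c, K). (\<forall>m. 0 \<le> c m) \<and> (\<forall>m<n. c m = 0) \<and> (\<forall>m\<ge>K. c m = 0) \<and> (\<Sum>m<K. c m) = 1}"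

definition weighted :: "(nat => real) \<times> nat => (nat => real) => real" where
 "weighted p a = (\<Sum>m<snd p. fst p m * a m)"

lemma convex_weights_mono: "n \<le> m ==> convex_weights m \<subseteq> convex_weights n"
 by (auto simp: convex_weights_def)

lemma weighted_extend: "p \<in> convex_weights n ==> snd p \<le> K ==> weighted p a = (\<Sum>m<K. fst p m * a m)"
 unfolding weighted_def by (rule sum.mono_neutral_left) (auto simp: convex_weights_def)

lemma weighted_const: "p \<in> convex_weights n ==> weighted p (%_. c) = c"
 by (auto simp: weighted_def convex_weights_def sum_distrib_right[symmetric])

lemma weighted_bound:
 assumes p: "p \<in> convex_weights n" and b: "\<And>m. n \<le> m ==> \<bar>a m - c\<bar> \<le> e"
 shows "\<bar>weighted p a - c\<bar> \<le> e"
proof -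
 have "weighted p a - c = weighted p a - weighted p (%_. c)" by (simp add: weighted_const[OF p])
 also have "\<dots> = (\<Sum>m<snd p. fst p m * (a m - c))" by (simp add: weighted_def sum_subtractf algebra_simps)
 also have "\<bar>\<dots>\<bar> \<le> (\<Sum>m<snd p. \<bar>fst p m * (a m - c)\<bar>)" by (rule sum_abs)
 also have "\<dots> \<le> (\<Sum>m<snd p. fst p m * e)"
 proof (rule sum_mono)
  fix m
  have c0: "0 \<le> fst p m" and z: "m < n ==> fst p m = 0" using p by (auto simp: convex_weights_def)
  show "\<bar>fst p m * (a m - c)\<bar> \<le> fst p m * e"
   using b[of m] c0 z by (cases "m < n") (auto simp: abs_mult intro!: mult_left_mono)
 qed
 also have "\<dots> = e" using weighted_const[OF p, of e] by (simp add: weighted_def)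
 finally show ?thesis .
qed

lemma weighted_midpoint:
 assumes "p \<in> convex_weights n" "p' \<in> convex_weights n"
 obtains r where "r \<in> convex_weights n" "\<And>a. weighted r a = (weighted p a + weighted p' a) / 2"
proof -
 let ?K = "max (snd p) (snd p')"
 let ?r = "(%m. (fst p m + fst p' m) / 2, ?K)"
 have eq: "weighted ?r a = (weighted p a + weighted p' a) / 2" for a
  using weighted_extend[OF assms(1), of ?K a] weighted_extend[OF assms(2), of ?K a]
  by (simp add: weighted_def sum.distrib[symmetric] sum_divide_distrib algebra_simps)
 have "weighted ?r (%_. 1) = 1" unfolding eq by (simp add: weighted_const[OF assms(1)] weighted_const[OF assms(2)])
 then have "?r \<in> convex_weights n" using assms by (auto simp: convex_weights_def weighted_def)
 then show thesis using that eq by blast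
qed

text \<open>Near-minimisers of the norm over the convex hulls of the tails form a Cauchy sequence by the
 parallelogram identity.\<close>

lemma convex_combinations_converge:
 fixes q :: "nat => 'i => 'x => real"
 assumes M: "finite_measure M" and A: "finite A" and q [measurable]: "\<And>m a. a \<in> A ==> q m a \<in> borel_measurable M"
  and bd: "\<And>m a x. \<bar>q m a x\<bar> \<le> L"
 obtains p where "\<And>j. p j \<in> convex_weights j"
  "AE x in M. \<forall>a\<in>A. convergent (%j. weighted (p j) (%m. q m a x))"
proof -
 interpret finite_measure M by fact
 define T where "T w a x = weighted w (%m. q m a x)" for w a x
 have Tm [measurable]: "T w a \<in> borel_measurable M" if "a \<in> A" for w a
  unfolding T_def weighted_def using that by measurable
 have Tb: "\<bar>T w a x\<bar> \<le> L" if "w \<in> convex_weights n" for w n a x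
  using weighted_bound[OF that, of "%m. q m a x" 0 L] bd by (simp add: T_def)
 have int: "integrable M (%x. (T w a x)\<^sup>2)" "integrable M (%x. T w a x * T w' a x)"
  if "a \<in> A" "w \<in> convex_weights n" "w' \<in> convex_weights n'" for w w' a n n'
 proof -
  have b: "\<bar>T w a x * T w' a x\<bar> \<le> L * L" for x
   unfolding abs_mult using Tb[OF that(2)] Tb[OF that(3)] by (intro mult_mono) (auto intro: order_trans[OF abs_ge_zero])
  have b2: "\<bar>T w a x * T w a x\<bar> \<le> L * L" for x
   unfolding abs_mult using Tb[OF that(2)] by (intro mult_mono) (auto intro: order_trans[OF abs_ge_zero])
  show "integrable M (%x. T w a x * T w' a x)"
   using that(1) b by (intro integrable_const_bound[where B = "L * L"]) auto
  show "integrable M (%x. (T w a x)\<^sup>2)" unfolding power2_eq_square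
   using that(1) b2 by (intro integrable_const_bound[where B = "L * L"]) auto
 qed
 \<comment> \<open>The norm is summed over all \<open>a\<close> in \<open>A\<close>; minimising the
   sum yields common weights for all partial derivatives.\<close>
 define N where "N w = (\<Sum>a\<in>A. \<integral>x. (T w a x)\<^sup>2 \<partial>M)" for w
 have N0: "0 \<le> N w" for w unfolding N_def by (intro sum_nonneg integral_nonneg_AE) auto
 define d where "d n = Inf (N ` convex_weights n)" for n
 have ne: "convex_weights n \<noteq> {}" for n
 proof -
  have "((%m. if m = n then 1 else 0), Suc n) \<in> convex_weights n" by (auto simp: convex_weights_def)
  then show ?thesis by blast
 qed
 have bdd: "bdd_below (N ` convex_weights n)" for n by (rule bdd_belowI2[where m = 0]) (rule N0)
 have dle: "d n \<le> N w" if "w \<in> convex_weights n" for n w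
  unfolding d_def using bdd that by (intro cInf_lower) auto
 have dmono: "incseq d"
  
 proof (intro incseq_SucI)
  fix n
  have "N ` convex_weights (Suc n) \<subseteq> N ` convex_weights n" by (intro image_mono convex_weights_mono) simp
  then show "d n \<le> d (Suc n)" unfolding d_def using ne[of "Suc n"] bdd[of n] by (intro cInf_superset_mono) simp_all
 qed
 have Nup: "N w \<le> (\<Sum>a\<in>A. L * L * measure M (space M))" if "w \<in> convex_weights n" for w n
  unfolding N_def
 proof (rule sum_mono)
  fix a assume a: "a \<in> A"
  have "(\<integral>x. (T w a x)\<^sup>2 \<partial>M) \<le> (\<integral>x. L * L \<partial>M)"
  proof (rule integral_mono[OF int(1)[OF a that that]])
   fix x show "(T w a x)\<^sup>2 \<le> L * L"
    using Tb[OF that, of a x] abs_le_square_iff[of "T w a x" L] by (simp add: power2_eq_square)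
  qed simp
  then show "(\<integral>x. (T w a x)\<^sup>2 \<partial>M) \<le> L * L * measure M (space M)" by (simp add: mult.commute)
 qed
 have "d n \<le> (\<Sum>a\<in>A. L * L * measure M (space M))" for n
  using ne[of n] dle[of _ n] Nup[of _ n] by (meson ex_in_conv order_trans)
 then obtain D where D: "d \<longlonglongrightarrow> D" using incseq_convergent[OF dmono] by blast
 have "\<exists>w\<in>convex_weights n. N w \<le> d n + 1 / real (Suc n)" for n
 proof -
  have "Inf (N ` convex_weights n) < d n + 1 / real (Suc n)" by (simp add: d_def)
  then show ?thesis using cInf_lessD[of "N ` convex_weights n"] ne by (force intro: less_imp_le)
 qed
 then obtain p where p: "\<And>n. p n \<in> convex_weights n" "\<And>n. N (p n) \<le> d n + 1 / real (Suc n)" by metis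
 define X where "X n m = (\<Sum>a\<in>A. \<integral>x. (T (p n) a x - T (p m) a x)\<^sup>2 \<partial>M)" for n m
 have X: "X n m \<le> 2 * (d m - d n) + 4 / real (Suc n)" if nm: "n \<le> m" for n m
 proof -
  have pm: "p m \<in> convex_weights n" using p(1) convex_weights_mono[OF nm] by blast
  obtain r where r: "r \<in> convex_weights n" "\<And>a. weighted r a = (weighted (p n) a + weighted (p m) a) / 2"
   using weighted_midpoint[OF p(1) pm] by metis
  have "(T (p n) a x - T (p m) a x)\<^sup>2 = 2 * (T (p n) a x)\<^sup>2 + 2 * (T (p m) a x)\<^sup>2 - 4 * (T r a x)\<^sup>2" for a x
   unfolding T_def r(2) by (simp add: power2_eq_square field_simps)
  then have "(\<integral>x. (T (p n) a x - T (p m) a x)\<^sup>2 \<partial>M) =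
    2 * (\<integral>x. (T (p n) a x)\<^sup>2 \<partial>M) + 2 * (\<integral>x. (T (p m) a x)\<^sup>2 \<partial>M) - 4 * (\<integral>x. (T r a x)\<^sup>2 \<partial>M)" if "a \<in> A" for a
   using int(1)[OF that p(1) p(1), of n] int(1)[OF that p(1) p(1), of m] int(1)[OF that r(1) r(1)] by simp
  then have "X n m = 2 * N (p n) + 2 * N (p m) - 4 * N r"
   unfolding X_def N_def by (simp add: sum.distrib sum_subtractf sum_distrib_left)
  also have "\<dots> \<le> 2 * (d n + 1 / real (Suc n)) + 2 * (d m + 1 / real (Suc m)) - 4 * d n"
   using p(2)[of n] p(2)[of m] dle[OF r(1)] by argo
  also have "\<dots> \<le> 2 * (d m - d n) + 4 / real (Suc n)"
  proof -
   have "1 / real (Suc m) \<le> 1 / real (Suc n)" using nm by (simp add: field_simps)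
   then show ?thesis by simp
  qed
  finally show ?thesis .
 qed
 have "\<exists>n0. \<forall>n\<ge>n0. \<forall>m\<ge>n. X n m \<le> (1 / 4) ^ j" for j
 proof -
  have e: "(1 / 4 :: real) ^ j / 8 > 0" by simp
  obtain n1 where n1: "\<And>n. n \<ge> n1 ==> \<bar>d n - D\<bar> < (1 / 4) ^ j / 8"
   using D[unfolded LIMSEQ_def dist_real_def] e by blast
  obtain n2 :: nat where n2: "1 / real (Suc n2) < (1 / 4) ^ j / 8"
   using reals_Archimedean[OF e] by (auto simp: inverse_eq_divide)
  have "X n m \<le> (1 / 4) ^ j" if "n \<ge> max n1 n2" "m \<ge> n" for n m
  proof -
   have "1 / real (Suc n) \<le> 1 / real (Suc n2)" using that by (simp add: field_simps)
   moreover have "d m - d n < 2 * ((1 / 4) ^ j / 8)" using n1[of n] n1[of m] that by linarith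
   ultimately show ?thesis using X[OF that(2)] n2 by simp
  qed
  then show ?thesis by blast
 qed
 then obtain n0 where n0: "\<And>j n m. n \<ge> n0 j ==> m \<ge> n ==> X n m \<le> (1 / 4) ^ j" by metis
 \<comment> \<open>Along \<open>g\<close> consecutive squared distances are at most
   \<open>4^-j\<close>. Since \<open>j <= g j\<close>, the selected weights still lie in the hull of
   the \<open>j\<close>-th tail.\<close>
 define g where "g j = j + (\<Sum>i\<le>j. n0 i)" for j
 have g: "j \<le> g j" "n0 j \<le> g j" "g j \<le> g (Suc j)" for j
  by (auto simp: g_def intro!: trans_le_add2 member_le_sum)
 define P where "P j = p (g j)" for j
 have Pw: "P j \<in> convex_weights j" for j unfolding P_def using p(1) convex_weights_mono[OF g(1)] by blast
 have "AE x in M. convergent (%j. T (P j) a x)" if a: "a \<in> A" for a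
 proof -
  define c where "c j x = T (P (Suc j)) a x - T (P j) a x" for j x
  have \<Delta>m [measurable]: "c j \<in> borel_measurable M" for j unfolding c_def using a by measurable
  have i\<Delta>: "integrable M (%x. (c j x)\<^sup>2)" for j
  proof (rule integrable_const_bound[where B = "(2 * L)\<^sup>2"])
   show "AE x in M. norm ((c j x)\<^sup>2) \<le> (2 * L)\<^sup>2"
   proof (rule AE_I2)
    fix x
    have "\<bar>c j x\<bar> \<le> 2 * L" using Tb[OF Pw, of "Suc j" a x] Tb[OF Pw, of j a x] by (simp add: c_def)
    then show "norm ((c j x)\<^sup>2) \<le> (2 * L)\<^sup>2" using power_mono[of "\<bar>c j x\<bar>" "2 * L" 2] by simp
   qed
  qed simp
  have \<Delta>4: "(\<integral>x. (c j x)\<^sup>2 \<partial>M) \<le> (1 / 4) ^ j" for j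
  proof -
   have "(\<integral>x. (c j x)\<^sup>2 \<partial>M) = (\<integral>x. (T (p (g j)) a x - T (p (g (Suc j))) a x)\<^sup>2 \<partial>M)"
    by (simp add: c_def P_def power2_commute)
   also have "\<dots> \<le> X (g j) (g (Suc j))"
    unfolding X_def by (rule member_le_sum[OF a _ A, of "%a. \<integral>x. (T (p (g j)) a x - T (p (g (Suc j))) a x)\<^sup>2 \<partial>M"]) (auto intro!: integral_nonneg_AE)
   also have "\<dots> \<le> (1 / 4) ^ j" by (rule n0[OF g(2,3)])
   finally show ?thesis .
  qed
  have "(\<integral>\<^sup>+ x. (\<Sum>j. ennreal (2 ^ j * (c j x)\<^sup>2)) \<partial>M) = (\<Sum>j. \<integral>\<^sup>+ x. ennreal (2 ^ j * (c j x)\<^sup>2) \<partial>M)"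
   by (rule nn_integral_suminf) measurable
  also have "\<dots> \<le> (\<Sum>j. ennreal ((1 / 2) ^ j))"
  proof (intro suminf_le summableI)
   fix j
   have "(\<integral>\<^sup>+ x. ennreal (2 ^ j * (c j x)\<^sup>2) \<partial>M) = ennreal (\<integral>x. 2 ^ j * (c j x)\<^sup>2 \<partial>M)"
    using i\<Delta> by (intro nn_integral_eq_integral) auto
   also have "(\<integral>x. 2 ^ j * (c j x)\<^sup>2 \<partial>M) = 2 ^ j * (\<integral>x. (c j x)\<^sup>2 \<partial>M)" by simp
   also have "\<dots> \<le> 2 ^ j * (1 / 4) ^ j" using \<Delta>4 by (intro mult_left_mono) auto
   also have "\<dots> = (1 / 2) ^ j" by (simp add: power_mult_distrib[symmetric])
   finally show "(\<integral>\<^sup>+ x. ennreal (2 ^ j * (c j x)\<^sup>2) \<partial>M) \<le> ennreal ((1 / 2) ^ j)" by (simp add: ennreal_leI)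
  qed
  also have "\<dots> < \<infinity>" by (subst suminf_ennreal2) (auto intro: summable_geometric)
  finally have fin: "(\<integral>\<^sup>+ x. (\<Sum>j. ennreal (2 ^ j * (c j x)\<^sup>2)) \<partial>M) \<noteq> \<infinity>" by simp
  have "AE x in M. (\<Sum>j. ennreal (2 ^ j * (c j x)\<^sup>2)) \<noteq> \<infinity>" by (rule nn_integral_PInf_AE[OF _ fin]) measurable
  then show ?thesis
  proof eventually_elim
   case (elim x)
   have sm: "summable (%j. 2 ^ j * (c j x)\<^sup>2)" using elim by (intro summable_suminf_not_top) auto
   \<comment> \<open>An increment is either at most \<open>2^-j\<close> or at most
     \<open>2^j\<close> times its square. The weight \<open>2^j\<close> leaves the integrals of the
     squares summable, so the limit exists almost everywhere.\<close>
   have "summable (%j. c j x)"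
   proof (rule summable_comparison_test'[where N = 0])
    show "summable (%j. (1 / 2) ^ j + 2 ^ j * (c j x)\<^sup>2)" by (intro summable_add sm summable_geometric) simp
    fix j :: nat
    show "norm (c j x) \<le> (1 / 2) ^ j + 2 ^ j * (c j x)\<^sup>2"
    proof (cases "\<bar>c j x\<bar> \<le> (1 / 2) ^ j")
     case False
     have "\<bar>c j x\<bar> = 2 ^ j * ((1 / 2) ^ j * \<bar>c j x\<bar>)" by (simp add: power_one_over)
     also have "\<dots> \<le> 2 ^ j * (\<bar>c j x\<bar> * \<bar>c j x\<bar>)" using False by (intro mult_left_mono mult_right_mono) auto
     also have "\<dots> = 2 ^ j * (c j x)\<^sup>2" by (simp add: power2_eq_square)
     finally show ?thesis by (simp add: add_increasing)
    qed (simp add: add_increasing2)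
   qed
   then have "convergent (%n. \<Sum>j<n. c j x)" by (simp add: summable_iff_convergent)
   moreover have "(\<Sum>j<n. c j x) = T (P n) a x - T (P 0) a x" for n
    unfolding c_def by (rule sum_lessThan_telescope)
   ultimately have "convergent (%n. T (P n) a x - T (P 0) a x)" by simp
   then show ?case using convergent_diff_const_right_iff by blast
  qed
 qed
 then have "AE x in M. \<forall>a\<in>A. convergent (%j. T (P j) a x)"
  using A by (intro AE_finite_allI)
 then show thesis using that[OF Pw] by (simp add: T_def)
qed

section \<open>Lebesgue measure on powers\<close>

abbreviation Leb :: "nat => (nat => 'a::euclidean_space) measure" where
 "Leb k \<equiv> PiM {..<k} (%_. lborel)"

lemma space_Leb: "space (Leb k :: (nat => 'a::euclidean_space) measure) = cube k UNIV"
 by (simp add: space_PiM)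

lemma PiE_in_Leb [measurable]: "(\<And>i. i < k ==> A i \<in> sets borel) ==> PiE {..<k} A \<in> sets (Leb k)"
 by (intro sets_PiM_I_finite) auto

lemma emeasure_Leb: "(\<And>i. i < k ==> A i \<in> sets borel) ==> emeasure (Leb k) (PiE {..<k} A) = (\<Prod>i<k. emeasure lborel (A i))"
 using product_sigma_finite.emeasure_PiM[OF product_lborel, of "{..<k}" A] by simp

lemma leb_power_eq:
 fixes E :: "'a::euclidean_space set"
 assumes E: "E \<in> sets borel" "bounded E"
 shows "leb_power E k = density (Leb k) (indicator (cube k E))"
proof -
 have fin: "finite_measure (density lborel (indicator E :: 'a => ennreal))"
  by (rule finite_measureI) (use E emeasure_bounded_finite[OF E(2)] in \<open>simp add: emeasure_density less_top\<close>)
 have psf: "product_sigma_finite (%_ :: nat. density lborel (indicator E :: 'a => ennreal))"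
  unfolding product_sigma_finite_def using finite_measure.sigma_finite_measure[OF fin] by blast
 have "density (Leb k) (indicator (cube k E)) = PiM {..<k} (%_. density lborel (indicator E :: 'a => ennreal))"
 proof (rule product_sigma_finite.PiM_eqI[OF psf])
  show "sets (density (Leb k) (indicator (cube k E))) = sets (PiM {..<k} (%_. density lborel (indicator E :: 'a => ennreal)))"
   by (simp, rule sets_PiM_cong) auto
  fix A :: "nat => 'a set" assume "\<And>i. i \<in> {..<k} ==> A i \<in> sets (density lborel (indicator E))"
  then have A: "\<And>i. i < k ==> A i \<in> sets borel" by simp
  have "emeasure (density (Leb k) (indicator (cube k E))) (PiE {..<k} A) = emeasure (Leb k) (cube k E \<inter> PiE {..<k} A)"
   using A E by (subst emeasure_density) (auto simp: indicator_inter_arith[symmetric] intro!: PiE_in_Leb)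
  also have "\<dots> = (\<Prod>i<k. emeasure lborel (E \<inter> A i))" unfolding PiE_Int using A E by (intro emeasure_Leb) auto
  also have "\<dots> = (\<Prod>i\<in>{..<k}. emeasure (density lborel (indicator E)) (A i))"
   using A E by (intro prod.cong refl) (auto simp: emeasure_density indicator_inter_arith[symmetric])
  finally show "emeasure (density (Leb k) (indicator (cube k E))) (PiE {..<k} A) =
    (\<Prod>i\<in>{..<k}. emeasure (density lborel (indicator E)) (A i))" .
 qed simp
 then show ?thesis by (simp add: leb_power_def)
qed

lemma AE_leb_power:
 fixes E :: "'a::euclidean_space set"
 assumes E: "E \<in> sets borel" "bounded E"
 shows "(AE x in leb_power E k. P x) \<longleftrightarrow> (AE x in Leb k. (\<forall>i<k. x i \<in> E) --> P x)"
proof -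
 have m: "indicator (cube k E) \<in> borel_measurable (Leb k)" using E by (intro borel_measurable_indicator PiE_in_Leb)
 have "(AE x in leb_power E k. P x) \<longleftrightarrow> (AE x in Leb k. 0 < (indicator (cube k E) x :: ennreal) --> P x)"
  unfolding leb_power_eq[OF E] by (rule AE_density[OF m])
 also have "\<dots> \<longleftrightarrow> (AE x in Leb k. (\<forall>i<k. x i \<in> E) --> P x)"
  by (rule AE_cong) (auto simp: indicator_def PiE_iff space_Leb)
 finally show ?thesis .
qed

lemma AE_Leb_not_in_null:
 fixes N :: "'a::euclidean_space set"
 assumes N: "N \<in> sets borel" "emeasure lborel N = 0"
 shows "AE x in Leb k. \<forall>i<k. x i \<notin> N"
proof -
 have "AE x in Leb k. x i \<notin> N" if i: "i < k" for i
 proof -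
  let ?A = "%j. if j = i then N else UNIV"
  have "emeasure (Leb k) (PiE {..<k} ?A) = (\<Prod>j<k. emeasure lborel (?A j))" using N by (intro emeasure_Leb) auto
  also have "\<dots> = 0" using i N by (intro prod_zero bexI[of _ i]) auto
  finally have "PiE {..<k} ?A \<in> null_sets (Leb k)" using N by (auto simp: null_sets_def intro!: PiE_in_Leb)
  then show ?thesis 
  proof (rule AE_I', intro subsetI)
   fix x assume "x \<in> {x \<in> space (Leb k). \<not> x i \<notin> N}"
   then show "x \<in> PiE {..<k} ?A" by (simp add: space_Leb PiE_iff)
  qed
 qed
 then have "AE x in Leb k. \<forall>i\<in>{..<k}. x i \<notin> N" by (intro AE_finite_allI) simp_all
 then show ?thesis by (simp add: Ball_def)
qed

text \<open>The frontier of a convex set is negligible. A weak gradient, which is tested on the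
  interior only, thus determines values almost everywhere on the compact domain.\<close>

lemma null_convex_boundary:
 fixes E :: "'a::euclidean_space set"
 assumes "compact E" "convex E" shows "E - interior E \<in> sets borel" "emeasure lborel (E - interior E) = 0"
proof -
 have cl: "closure E = E" using assms(1) by (simp add: compact_imp_closed closure_closed)
 have "negligible (frontier E)" by (rule negligible_convex_frontier[OF assms(2)])
 then have "emeasure lebesgue (E - interior E) = 0" by (auto simp: frontier_def cl negligible_iff_null_sets)
 moreover show s: "E - interior E \<in> sets borel" using assms(1) by (auto simp: compact_imp_closed)
 ultimately show "emeasure lborel (E - interior E) = 0" by simp
qed

lemma AE_Leb_interior:
 fixes E :: "'a::euclidean_space set"
 assumes "compact E" "convex E"
 shows "AE x in Leb k. (\<forall>i<k. x i \<in> E) --> (\<forall>i<k. x i \<in> interior E)"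
 using AE_Leb_not_in_null[OF null_convex_boundary[OF assms], of k] by eventually_elim auto

lemma Leb_split:
 fixes f :: "(nat => 'a::euclidean_space) => ennreal"
 assumes i: "i < k" and f: "f \<in> borel_measurable (Leb k)"
 shows "(\<integral>\<^sup>+ x. f x \<partial>Leb k) = (\<integral>\<^sup>+ x. \<integral>\<^sup>+ y. f (x(i := y)) \<partial>lborel \<partial>PiM ({..<k} - {i}) (%_. lborel))"
proof -
 have I: "insert i ({..<k} - {i}) = {..<k}" using i by auto
 show ?thesis
  by (rule product_sigma_finite.product_nn_integral_insert[OF product_lborel, of "{..<k} - {i}" i f, unfolded I]) (simp_all add: f)
qed

text \<open>Integrating first over coordinate \<open>i\<close> leaves the Lebesgue measure of a
  single point. Consequently almost every \<open>pts k x\<close> is simple, and sums over its points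
  agree with sums over the labels.\<close>

lemma AE_Leb_distinct:
 "AE x in (Leb k :: (nat => 'a::euclidean_space) measure). \<forall>i<k. \<forall>j<k. i \<noteq> j --> x i \<noteq> x j"
proof -
 have "AE x in (Leb k :: (nat => 'a) measure). x i \<noteq> x j" if ij: "i < k" "j < k" "i \<noteq> j" for i j
 proof -
  have ms: "(%x. x i) \<in> borel_measurable (Leb k :: (nat => 'a) measure)" "(%x. x j) \<in> borel_measurable (Leb k :: (nat => 'a) measure)"
   using measurable_component_singleton[of i "{..<k}" "%_. lborel :: 'a measure"]
    measurable_component_singleton[of j "{..<k}" "%_. lborel :: 'a measure"] ij by simp_all
  have s: "{x \<in> space (Leb k :: (nat => 'a) measure). x i = x j} \<in> sets (Leb k)" using ms by measurable
  have "emeasure (Leb k) {x \<in> space (Leb k :: (nat => 'a) measure). x i = x j} =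
    (\<integral>\<^sup>+ x. indicator {x \<in> space (Leb k). x i = x j} x \<partial>(Leb k :: (nat => 'a) measure))" using s by simp
  also have "\<dots> = (\<integral>\<^sup>+ x. \<integral>\<^sup>+ y. indicator {x \<in> space (Leb k). x i = x j} (x(i := y)) \<partial>lborel \<partial>PiM ({..<k} - {i}) (%_. lborel :: 'a measure))"
   using s by (intro Leb_split ij) auto
  also have "\<dots> \<le> (\<integral>\<^sup>+ x. \<integral>\<^sup>+ y. indicator {x j} y \<partial>lborel \<partial>PiM ({..<k} - {i}) (%_. lborel :: 'a measure))"
   using ij by (intro nn_integral_mono) (auto simp: indicator_def)
  also have "\<dots> = 0" by simp
  finally have "emeasure (Leb k) {x \<in> space (Leb k :: (nat => 'a) measure). x i = x j} = 0" by simp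
  then show ?thesis using s by (subst AE_iff_measurable[OF s]) auto
 qed
 then have "AE x in (Leb k :: (nat => 'a) measure). \<forall>i\<in>{..<k}. \<forall>j\<in>{..<k}. i \<noteq> j --> x i \<noteq> x j"
  by (intro AE_finite_allI) (simp_all add: AE_impI)
 then show ?thesis by (simp add: Ball_def)
qed

lemma measurable_shift:
 assumes "i < k"
 shows "(%x. x(i := x i + h)) \<in> measurable (Leb k) (Leb k :: (nat => 'a::euclidean_space) measure)"
proof -
 have c: "(%x. x i) \<in> borel_measurable (Leb k :: (nat => 'a) measure)"
  using measurable_component_singleton[of i "{..<k}" "%_. lborel :: 'a measure"] assms by simp
 have "(%x. x(i := x i + h)) \<in> measurable (Leb k) (PiM {..<k} (%_. lborel :: 'a measure))"
  by (rule measurable_fun_upd[of "{..<k}" "{..<k}" i]) (use assms c in auto)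
 then show ?thesis .
qed

lemma shift_Leb:
 assumes i: "i < k"
 shows "distr (Leb k) (Leb k) (%x. x(i := x i + h)) = (Leb k :: (nat => 'a::euclidean_space) measure)"
proof -
 interpret product_sigma_finite "%_ :: nat. lborel :: 'a measure" by (rule product_lborel)
 show ?thesis
 proof (rule PiM_eqI)
  fix A :: "nat => 'a set" assume "\<And>j. j \<in> {..<k} ==> A j \<in> sets lborel"
  then have A: "\<And>j. j < k ==> A j \<in> sets borel" by simp
  let ?A = "%j. if j = i then (%y. y + h) -` A i else A j"
  have Ai: "(%y. y + h) -` A i \<in> sets borel"
   using measurable_sets[of "%y. y + h" borel borel "A i"] A[OF i] by simp
  have "emeasure (distr (Leb k) (Leb k) (%x. x(i := x i + h))) (PiE {..<k} A) =
    emeasure (Leb k) ((%x. x(i := x i + h)) -` PiE {..<k} A \<inter> space (Leb k))"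
   using A by (intro emeasure_distr measurable_shift i PiE_in_Leb)
  also have "(%x. x(i := x i + h)) -` PiE {..<k} A \<inter> space (Leb k) = PiE {..<k} ?A"
  proof (intro set_eqI iffI)
   fix x assume "x \<in> (%x. x(i := x i + h)) -` PiE {..<k} A \<inter> space (Leb k)"
   then have x: "x(i := x i + h) \<in> PiE {..<k} A" "x \<in> extensional {..<k}" by (simp_all add: space_Leb PiE_iff)
   have "x j \<in> ?A j" if j: "j \<in> {..<k}" for j using PiE_mem[OF x(1) j] by (cases "j = i") simp_all
   then show "x \<in> PiE {..<k} ?A" using x(2) by (simp add: PiE_iff)
  next
   fix x assume x: "x \<in> PiE {..<k} ?A"
   have "(x(i := x i + h)) j \<in> A j" if j: "j \<in> {..<k}" for j using PiE_mem[OF x j] by (cases "j = i") simp_all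
   moreover have "x(i := x i + h) \<in> extensional {..<k}" using x i by (simp add: PiE_iff extensional_def)
   ultimately show "x \<in> (%x. x(i := x i + h)) -` PiE {..<k} A \<inter> space (Leb k)" using x by (simp add: space_Leb PiE_iff)
  qed
  also have "emeasure (Leb k) (PiE {..<k} ?A) = (\<Prod>j<k. emeasure lborel (?A j))" using A Ai by (intro emeasure_Leb) auto
  also have "\<dots> = (\<Prod>j\<in>{..<k}. emeasure lborel (A j))"
  proof (rule prod.cong[OF refl])
   fix j assume "j \<in> {..<k}"
   have "emeasure lborel ((%y. y + h) -` A i) = emeasure lborel (A i)"
    using lborel_distr_plus[of h] A[OF i] Ai emeasure_distr[of "(+) h" lborel borel "A i"]
    by (simp add: add.commute[of h] vimage_def)
   then show "emeasure lborel (?A j) = emeasure lborel (A j)" by simp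
  qed
  finally show "emeasure (distr (Leb k) (Leb k) (%x. x(i := x i + h))) (PiE {..<k} A) = (\<Prod>j\<in>{..<k}. emeasure lborel (A j))" .
 qed auto
qed

lemma measurable_id_Leb: "(%x. x) \<in> measurable (Leb k) (borel :: (nat => 'a::euclidean_space) measure)"
proof (rule measurable_coordinatewise_then_product)
 fix i
 show "(%x. x i) \<in> borel_measurable (Leb k :: (nat => 'a) measure)"
 proof (cases "i < k")
  case True
  then show ?thesis using measurable_component_singleton[of i "{..<k}" "%_. lborel :: 'a measure"] by simp
 next
  case False
  then have "x i = undefined" if "x \<in> space (Leb k :: (nat => 'a) measure)" for x
   using that by (auto simp: space_Leb PiE_iff extensional_def)
  then show ?thesis by (subst measurable_cong[of _ _ "%_. undefined"]) auto
 qed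
qed

lemma continuous_measurable_Leb:
 fixes f :: "(nat => 'a::euclidean_space) => real"
 assumes "continuous_on X f" "closed X"
 shows "(%x. indicator X x * f x) \<in> borel_measurable (Leb k)"
proof -
 have "(%x. indicator X x *\<^sub>R f x) \<in> borel_measurable borel"
  using assms by (intro borel_measurable_continuous_on_indicator) auto
 from measurable_compose[OF measurable_id_Leb this] show ?thesis by simp
qed

lemma closed_PiE_UNIV: "closed (cube k UNIV :: (nat => 'a::euclidean_space) set)"
proof -
 have "cube k UNIV = {x :: nat => 'a. \<forall>i. \<not> i < k --> x i = undefined}"
  by (auto simp: PiE_iff extensional_def)
 also have "closed \<dots>"
  by (intro closed_Collect_all closed_Collect_imp open_Collect_const closed_Collect_eq continuous_intros continuous_on_product_coordinates)
 finally show ?thesis .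
qed

section \<open>Weak gradients of Lipschitz functions\<close>

lemma continuous_Leb_measurable:
 fixes h :: "(nat => 'a::euclidean_space) => real"
 assumes "continuous_on (cube k UNIV) h" shows "h \<in> borel_measurable (Leb k)"
proof -
 have "(%x. indicator (cube k UNIV) x * h x) \<in> borel_measurable (Leb k)"
  by (rule continuous_measurable_Leb[OF assms closed_PiE_UNIV])
 then show ?thesis by (subst measurable_cong[of _ _ "%x. indicator (cube k UNIV) x * h x"]) (auto simp: space_Leb)
qed

text \<open>\<open>smooth_power\<close> supplies derivatives at parameter 0; moving the base point
  gives them along the whole line. The derivative \<open>w\<close> vanishes off \<open>K\<close>
  because the complement of \<open>K\<close> is open, and continuity on \<open>K\<close> bounds both
  functions.\<close>

lemma test_fun_deriv:
 fixes g :: "(nat => 'a::euclidean_space) => real"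
 assumes g: "g \<in> test_funs k U" and i: "i < k" and b: "b \<in> Basis"
 obtains K w C where "compact K" "K \<subseteq> cube k U"
  "continuous_on (cube k UNIV) g" "continuous_on (cube k UNIV) w"
  "\<And>x. x \<in> cube k UNIV ==> x \<notin> K ==> g x = 0"
  "\<And>x. x \<in> cube k UNIV ==> x \<notin> K ==> w x = 0"
  "\<And>x t. x \<in> cube k UNIV ==>
    ((%t. g (x(i := x i + t *\<^sub>R b))) has_real_derivative w (x(i := x i + t *\<^sub>R b))) (at t)"
  "\<And>x. x \<in> cube k UNIV ==> partial_deriv g i b x = w x"
  "0 \<le> C" "\<And>x. x \<in> cube k UNIV ==> \<bar>g x\<bar> \<le> C"
  "\<And>x. x \<in> cube k UNIV ==> \<bar>w x\<bar> \<le> C"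
proof -
 let ?W = "cube k UNIV :: (nat => 'a) set"
 have sp: "smooth_power k g" using g by (simp add: test_funs_def)
 obtain K where K: "compact K" "K \<subseteq> cube k U" "\<And>x. x \<in> ?W ==> g x \<noteq> 0 ==> x \<in> K"
  using g unfolding test_funs_def mem_Collect_eq by metis
 obtain S where S: "g \<in> S" and S2: "\<forall>v\<in>S. continuous_on ?W v \<and>
    (\<forall>i<k. \<forall>b\<in>Basis. \<exists>w\<in>S. \<forall>x \<in> ?W.
      ((%t. v (x(i := x i + t *\<^sub>R b))) has_real_derivative w x) (at 0))"
  using sp unfolding smooth_power_def by blast
 have c\<phi>: "continuous_on ?W g" using S S2 by blast
 obtain w where w: "w \<in> S" and d0: "\<And>x. x \<in> ?W ==> ((%t. g (x(i := x i + t *\<^sub>R b))) has_real_derivative w x) (at 0)"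
  using S S2 i b by meson
 have c\<zeta>: "continuous_on ?W w" using w S2 by blast
 have upd: "x(i := y) \<in> ?W" if "x \<in> ?W" for x :: "nat => 'a" and y using that i by (simp add: PiE_iff extensional_def)
 have d: "((%t. g (x(i := x i + t *\<^sub>R b))) has_real_derivative w (x(i := x i + t *\<^sub>R b))) (at t)" if x: "x \<in> ?W" for x t
 proof -
  have "((%s. g (x(i := x i + (s + t) *\<^sub>R b))) has_real_derivative w (x(i := x i + t *\<^sub>R b))) (at 0)"
   using d0[OF upd[OF x], of "x i + t *\<^sub>R b"] by (simp add: algebra_simps scaleR_left_distrib)
  then show ?thesis using DERIV_shift[of "%t. g (x(i := x i + t *\<^sub>R b))" "w (x(i := x i + t *\<^sub>R b))" 0 t] by simp
 qed
 have p: "partial_deriv g i b x = w x" if "x \<in> ?W" for x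
  unfolding partial_deriv_def by (rule DERIV_imp_deriv) (rule d0[OF that])
 have \<phi>0: "g x = 0" if "x \<in> ?W" "x \<notin> K" for x using K(3) that by blast
 have \<zeta>0: "w x = 0" if x: "x \<in> ?W" "x \<notin> K" for x
 proof -
  let ?c = "%t. x(i := x i + t *\<^sub>R b)"
  have "continuous_on UNIV ?c"
  proof (rule continuous_on_coordinatewise_then_product)
   fix j show "continuous_on UNIV (%t. (x(i := x i + t *\<^sub>R b)) j)"
    by (cases "j = i") (auto intro!: continuous_intros)
  qed
  then have "open (?c -` (- K))" using K(1) by (intro open_vimage) (auto simp: compact_imp_closed)
  moreover have "0 \<in> ?c -` (- K)" using x(2) by simp
  ultimately have ev: "eventually (%t. t \<in> ?c -` (- K)) (nhds 0)" by (rule eventually_nhds_in_open)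
  have "((%t. 0) has_real_derivative w x) (at 0)"
  proof (rule DERIV_cong_ev[THEN iffD1, OF refl _ refl d0[OF x(1)]])
   show "\<forall>\<^sub>F t in nhds 0. g (?c t) = 0" using ev by eventually_elim (auto intro!: \<phi>0 upd x(1))
  qed
  then show ?thesis using DERIV_unique[OF _ DERIV_const] by blast
 qed
 have KW: "K \<subseteq> ?W" using K(2) by (auto simp: PiE_iff)
 have bd: "\<exists>C. \<forall>x\<in>K. \<bar>h x\<bar> \<le> C" if "continuous_on ?W h" for h :: "(nat => 'a) => real"
 proof -
  have "bounded (h ` K)" using compact_continuous_image[OF continuous_on_subset[OF that KW] K(1)] by (rule compact_imp_bounded)
  then show ?thesis unfolding bounded_iff by auto
 qed
 obtain C1 where C1: "\<forall>x\<in>K. \<bar>g x\<bar> \<le> C1" using bd[OF c\<phi>] by blast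
 obtain C2 where C2: "\<forall>x\<in>K. \<bar>w x\<bar> \<le> C2" using bd[OF c\<zeta>] by blast
 let ?C = "\<bar>C1\<bar> + \<bar>C2\<bar>"
 have b1: "\<bar>g x\<bar> \<le> ?C" if "x \<in> ?W" for x using C1 \<phi>0[OF that] by (cases "x \<in> K") force+
 have b2: "\<bar>w x\<bar> \<le> ?C" if "x \<in> ?W" for x using C2 \<zeta>0[OF that] by (cases "x \<in> K") force+
 show thesis by (rule that[OF K(1,2) c\<phi> c\<zeta> \<phi>0 \<zeta>0 d p _ b1 b2]) simp_all
qed

lemma emeasure_Leb_bounded:
 assumes "E \<in> sets borel" "bounded (E :: 'a::euclidean_space set)" shows "emeasure (Leb k) (cube k E) < \<infinity>"
proof -
 have "emeasure (Leb k) (cube k E) = (\<Prod>i<k. emeasure lborel E)" by (rule emeasure_Leb) (use assms in simp)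
 also have "\<dots> < \<infinity>" using emeasure_bounded_finite[OF assms(2)] by (simp add: power_less_top_ennreal less_top)
 finally show ?thesis .
qed

lemma integrable_Leb_bounded:
 fixes h :: "(nat => 'a::euclidean_space) => 'b::{banach, second_countable_topology}"
 assumes E: "E \<in> sets borel" "bounded E" and h: "h \<in> borel_measurable (Leb k)"
  and bd: "AE x in Leb k. norm (h x) \<le> indicator (cube k E) x * C"
 shows "integrable (Leb k) h"
proof (rule Bochner_Integration.integrable_bound[OF _ h])
 show "integrable (Leb k) (%x. indicator (cube k E) x * C)"
  using emeasure_Leb_bounded[OF E, of k] E by (intro integrable_mult_left integrable_real_indicator PiE_in_Leb) auto
 show "AE x in Leb k. norm (h x) \<le> norm (indicator (cube k E) x * C)"
  using bd by eventually_elim auto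
qed

text \<open>The Lipschitz bound is stated for moving one coordinate, which corresponds to moving a
  single particle; this is what distances of labelled configurations provide.\<close>

locale lipschitz_power =
 fixes E :: "'a::euclidean_space set" and k :: nat and f :: "(nat => 'a) => real" and L :: real
 assumes E: "compact E" and L0: "0 \<le> L"
  and lip: "\<And>x i y. x \<in> cube k E ==> i < k ==> y \<in> E ==> \<bar>f (x(i := y)) - f x\<bar> \<le> L * dist (x i) y"
begin

abbreviation "X \<equiv> cube k E"

lemma E_props: "E \<in> sets borel" "bounded E" "closed E"
 using E by (auto simp: compact_imp_closed compact_imp_bounded)

lemma lip_sum: assumes x: "x \<in> X" and y: "y \<in> X" shows "\<bar>f y - f x\<bar> \<le> (\<Sum>i<k. L * dist (x i) (y i))"
proof -
 define h where "h j i = (if i < j then y i else x i)" for j i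
 have hX: "h j \<in> X" for j using x y by (simp add: h_def PiE_iff extensional_def)
 have "j \<le> k ==> \<bar>f (h j) - f x\<bar> \<le> (\<Sum>i<j. L * dist (x i) (y i))" for j
 proof (induction j)
  case 0
  have "h 0 = x" by (simp add: h_def fun_eq_iff)
  then show ?case by simp
 next
  case (Suc j)
  have "h (Suc j) = (h j)(j := y j)" by (auto simp: h_def less_Suc_eq fun_eq_iff)
  moreover have "\<bar>f ((h j)(j := y j)) - f (h j)\<bar> \<le> L * dist (h j j) (y j)"
   using Suc.prems y by (intro lip hX) (auto simp: PiE_iff)
  moreover have "h j j = x j" by (simp add: h_def)
  moreover have "\<bar>f (h j) - f x\<bar> \<le> (\<Sum>i<j. L * dist (x i) (y i))" using Suc by simp
  ultimately have "\<bar>f (h (Suc j)) - f x\<bar> \<le> (\<Sum>i<j. L * dist (x i) (y i)) + L * dist (x j) (y j)" by (simp only:)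
  then show ?case by (simp only: sum.lessThan_Suc)
 qed
 from this[of k] have "\<bar>f (h k) - f x\<bar> \<le> (\<Sum>i<k. L * dist (x i) (y i))" by simp
 moreover have "h k = y" using x y by (auto simp: h_def PiE_iff extensional_def fun_eq_iff)
 ultimately show ?thesis by simp
qed

lemma continuous: "continuous_on X f"
proof (unfold continuous_on_def, intro ballI)
 fix x assume x: "x \<in> X"
 have "((%y. \<Sum>i<k. L * dist (x i) (y i)) \<longlongrightarrow> (\<Sum>i<k. L * dist (x i) (x i))) (at x within X)"
 proof (intro tendsto_intros)
  fix i
  have "continuous_on X (%y :: nat => 'a. y i)" by (rule continuous_on_product_coordinates[THEN continuous_on_subset]) simp
  then show "((%y. y i) \<longlongrightarrow> x i) (at x within X)" using x by (simp add: continuous_on_def)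
 qed
 then have lim: "((%y. \<Sum>i<k. L * dist (x i) (y i)) \<longlongrightarrow> 0) (at x within X)" by simp
 show "(f \<longlongrightarrow> f x) (at x within X)"
 proof (rule LIM_zero_cancel, rule Lim_null_comparison[OF _ lim])
  show "\<forall>\<^sub>F y in at x within X. norm (f y - f x) \<le> (\<Sum>i<k. L * dist (x i) (y i))"
   unfolding eventually_at_filter using lip_sum[OF x] by (intro always_eventually) simp
 qed
qed

lemma closed_X: "closed X" using compact_PiE_lessThan[of k "%_. E"] E by (simp add: compact_imp_closed)

definition fE :: "(nat => 'a) => real" where "fE x = indicator X x * f x"

lemma fE_measurable [measurable]: "fE \<in> borel_measurable (Leb k)"
 unfolding fE_def[abs_def] by (rule continuous_measurable_Leb[OF continuous closed_X])

lemma fE_bounded: obtains F where "0 \<le> F" "\<And>x. \<bar>fE x\<bar> \<le> indicator X x * F"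
proof -
 have "bounded (f ` X)" using compact_continuous_image[OF continuous] compact_PiE_lessThan[of k "%_. E"] E by (simp add: compact_imp_bounded)
 then obtain F where F: "\<And>x. x \<in> X ==> \<bar>f x\<bar> \<le> F" unfolding bounded_iff by auto
 have "\<bar>fE x\<bar> \<le> indicator X x * \<bar>F\<bar>" for x using F[of x] by (cases "x \<in> X") (auto simp: fE_def)
 then show thesis using that[of "\<bar>F\<bar>"] by simp
qed

text \<open>Difference quotients with dyadic steps. The value 0 when the shifted point leaves
  \<open>E\<close> keeps them bounded by \<open>L\<close> everywhere; test functions do not notice
  it, since their support has a positive margin inside \<open>E\<close>.\<close>

definition quot :: "nat => nat => 'a => (nat => 'a) => real" where
 "quot m i b x = (if x \<in> X \<and> x i + (1/2)^m *\<^sub>R b \<in> E then 2^m * (f (x(i := x i + (1/2)^m *\<^sub>R b)) - f x) else 0)"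

lemma quot_bound: assumes "i < k" "b \<in> Basis" shows "\<bar>quot m i b x\<bar> \<le> indicator X x * L"
proof (cases "x \<in> X \<and> x i + (1/2)^m *\<^sub>R b \<in> E")
 case True
 have "\<bar>f (x(i := x i + (1/2)^m *\<^sub>R b)) - f x\<bar> \<le> L * dist (x i) (x i + (1/2)^m *\<^sub>R b)"
  using True assms by (intro lip) auto
 also have "dist (x i) (x i + (1/2)^m *\<^sub>R b) = (1/2)^m" using assms by (simp add: dist_norm)
 finally have "2^m * \<bar>f (x(i := x i + (1/2)^m *\<^sub>R b)) - f x\<bar> \<le> 2^m * (L * (1/2)^m)" by (rule mult_left_mono) simp
 also have "\<dots> = L" by (simp add: power_one_over)
 finally show ?thesis using True by (simp add: quot_def abs_mult)
next
 case False then show ?thesis using L0 by (auto simp: quot_def)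
qed

lemma quot_bound': assumes "i < k" "b \<in> Basis" shows "\<bar>quot m i b x\<bar> \<le> L"
 using quot_bound[OF assms, of m x] L0 by (cases "x \<in> X") auto

lemma upd_X: "x \<in> X ==> i < k ==> y \<in> E ==> x(i := y) \<in> X" by (simp add: PiE_iff extensional_def)

lemma coord_measurable: "i < k ==> (%x. x i) \<in> borel_measurable (Leb k :: (nat => 'a) measure)"
 using measurable_component_singleton[of i "{..<k}" "%_. lborel :: 'a measure"] by simp

lemma quot_measurable: assumes i: "i < k" shows "quot m i b \<in> borel_measurable (Leb k)"
proof -
 let ?h = "(1/2)^m *\<^sub>R b"
 note [measurable] = E_props(1) coord_measurable[OF i] measurable_compose[OF measurable_shift[OF i] fE_measurable]
 have [measurable]: "X \<in> sets (Leb k)" by (rule PiE_in_Leb) (rule E_props(1))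
 have "quot m i b = (%x. indicator X x * indicator E (x i + ?h) * (2^m * (fE (x(i := x i + ?h)) - fE x)))"
 proof
  fix x show "quot m i b x = indicator X x * indicator E (x i + ?h) * (2^m * (fE (x(i := x i + ?h)) - fE x))"
  proof (cases "x \<in> X \<and> x i + ?h \<in> E")
   case True
   then show ?thesis using upd_X[OF _ i, of x "x i + ?h"] unfolding quot_def fE_def by (simp only: indicator_def if_True) simp
  next
   case False then show ?thesis unfolding quot_def by (simp only: if_False) (simp add: indicator_def)
  qed
 qed
 also have "\<dots> \<in> borel_measurable (Leb k)" by measurable
 finally show ?thesis .
qed

lemma test_margin:
 assumes "compact K" "K \<subseteq> cube k (interior E)" and i: "i < k"
 obtains d where "0 < d" "\<And>x y. x \<in> K ==> dist (x i) y < d ==> y \<in> E"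
proof -
 have "continuous_on K (%x :: nat => 'a. x i)" by (rule continuous_on_product_coordinates[THEN continuous_on_subset]) simp
 then have c: "compact ((%x. x i) ` K)" using assms(1) by (rule compact_continuous_image)
 have "(%x. x i) ` K \<subseteq> interior E" using assms(2) i by (auto simp: PiE_iff)
 then obtain d where d: "d > 0" "(\<Union>y\<in>(%x. x i) ` K. ball y d) \<subseteq> interior E"
  using compact_subset_open_imp_ball_epsilon_subset[OF c open_interior] by metis
 show thesis
 proof (rule that[OF d(1)])
  fix x y assume xy: "x \<in> K" "dist (x i) y < d"
  then have "y \<in> (\<Union>y\<in>(%x. x i) ` K. ball y d)" by auto
  then show "y \<in> E" using d(2) interior_subset by blast
 qed
qed

text \<open>Discrete integration by parts: translation invariance moves the shift from
  \<open>f\<close> to the test function. Its difference quotients are bounded by \<open>C\<close> by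
  the mean value theorem, so dominated convergence applies. The identity holds for steps below the
  margin \<open>q\<close> of the support.\<close>

lemma quot_integral:
 assumes g: "g \<in> test_funs k (interior E)" and i: "i < k" and b: "b \<in> Basis"
 shows "(%m. \<integral>x. quot m i b x * g x \<partial>Leb k) \<longlonglongrightarrow> - (\<integral>x. fE x * partial_deriv g i b x \<partial>Leb k)"
proof -
 obtain K v C where K: "compact K" "K \<subseteq> cube k (interior E)"
  and c\<phi>: "continuous_on (cube k UNIV) g" and c\<zeta>: "continuous_on (cube k UNIV) v"
  and \<phi>0: "\<And>x. x \<in> cube k UNIV ==> x \<notin> K ==> g x = 0"
  and \<zeta>0: "\<And>x. x \<in> cube k UNIV ==> x \<notin> K ==> v x = 0"
  and d: "\<And>x t. x \<in> cube k UNIV ==>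
    ((%t. g (x(i := x i + t *\<^sub>R b))) has_real_derivative v (x(i := x i + t *\<^sub>R b))) (at t)"
  and p: "\<And>x. x \<in> cube k UNIV ==> partial_deriv g i b x = v x"
  and C: "0 \<le> C" "\<And>x. x \<in> cube k UNIV ==> \<bar>g x\<bar> \<le> C"
  "\<And>x. x \<in> cube k UNIV ==> \<bar>v x\<bar> \<le> C"
  using test_fun_deriv[OF g i b] by blast
 obtain F where F: "0 \<le> F" "\<And>x. \<bar>fE x\<bar> \<le> indicator X x * F" using fE_bounded by metis
 obtain q where q: "0 < q" "\<And>x y. x \<in> K ==> dist (x i) y < q ==> y \<in> E" using test_margin[OF K i] by blast
 have KX: "K \<subseteq> X" using K(2) interior_subset[of E] by (auto simp: PiE_iff)
 define h :: "nat => real" where "h m = (1/2)^m" for m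
 have h0: "h m > 0" "2^m = 1 / h m" for m by (simp_all add: h_def power_one_over)
 have hlim: "h \<longlonglongrightarrow> 0" unfolding h_def[abs_def] by (intro LIMSEQ_power_zero) simp
 define n where "n s x = x(i := x i + s *\<^sub>R b)" for s :: real and x :: "nat => 'a"
 have \<tau>W: "n s x \<in> cube k UNIV" if "x \<in> cube k UNIV" for s x
  using that i by (simp add: n_def PiE_iff extensional_def)
 have \<tau>m [measurable]: "n s \<in> measurable (Leb k) (Leb k)" for s unfolding n_def by (rule measurable_shift[OF i])
 have \<phi>m [measurable]: "g \<in> borel_measurable (Leb k)" by (rule continuous_Leb_measurable[OF c\<phi>])
 have \<zeta>m [measurable]: "v \<in> borel_measurable (Leb k)" by (rule continuous_Leb_measurable[OF c\<zeta>])
 have \<tau>\<tau>: "n (- s) (n s x) = x" for s x by (simp add: n_def)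
 have i1: "integrable (Leb k) (%x. fE x * g (n s x))" for s
 proof (rule integrable_Leb_bounded[OF E_props(1,2)])
  show "AE x in Leb k. norm (fE x * g (n s x)) \<le> indicator X x * (F * C)"
  proof (rule AE_I2)
   fix x :: "nat => 'a" assume x: "x \<in> space (Leb k)"
   have "\<bar>fE x * g (n s x)\<bar> \<le> (indicator X x * F) * C" unfolding abs_mult
    using F(2)[of x] F(1) C(2)[of "n s x"] \<tau>W x by (intro mult_mono) (auto simp: space_Leb)
   then show "norm (fE x * g (n s x)) \<le> indicator X x * (F * C)" by (simp add: mult.assoc)
  qed
 qed measurable
 have i1': "integrable (Leb k) (%x. fE (n s x) * g x)" "(\<integral>x. fE (n s x) * g x \<partial>Leb k) = (\<integral>x. fE x * g (n (- s) x) \<partial>Leb k)" for s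
 proof -
  have D: "distr (Leb k) (Leb k) (n s) = Leb k" unfolding n_def by (rule shift_Leb[OF i])
  have m: "(%x. fE x * g (n (- s) x)) \<in> borel_measurable (Leb k)" by measurable
  show "integrable (Leb k) (%x. fE (n s x) * g x)"
   using integrable_distr_eq[OF \<tau>m m, of s] i1[of "- s"] unfolding D \<tau>\<tau> by simp
  show "(\<integral>x. fE (n s x) * g x \<partial>Leb k) = (\<integral>x. fE x * g (n (- s) x) \<partial>Leb k)"
   using integral_distr[OF \<tau>m m, of s] unfolding D \<tau>\<tau> by simp
 qed
 have eq: "(\<integral>x. quot m i b x * g x \<partial>Leb k) = - (\<integral>x. fE x * ((g x - g (n (- h m) x)) / h m) \<partial>Leb k)" if m: "h m < q" for m
 proof -
  have "(\<integral>x. quot m i b x * g x \<partial>Leb k) = (\<integral>x. (fE (n (h m) x) * g x - fE x * g (n 0 x)) * (1 / h m) \<partial>Leb k)"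
  proof (rule Bochner_Integration.integral_cong[OF refl])
   fix x :: "nat => 'a" assume x: "x \<in> space (Leb k)"
   show "quot m i b x * g x = (fE (n (h m) x) * g x - fE x * g (n 0 x)) * (1 / h m)"
   proof (cases "x \<in> K")
    case True
    have "x i + h m *\<^sub>R b \<in> E" using h0[of m] m b by (intro q(2)[OF True]) (simp add: dist_norm)
    then have "quot m i b x = (fE (n (h m) x) - fE x) / h m"
     using True KX upd_X[of x i "x i + h m *\<^sub>R b"] i by (auto simp: quot_def fE_def n_def h0(2) h_def[symmetric])
    then show ?thesis by (simp add: n_def field_simps)
   next
    case False
    then show ?thesis using \<phi>0 x by (simp add: space_Leb n_def)
   qed
  qed
  also have "\<dots> = ((\<integral>x. fE x * g (n (- h m) x) \<partial>Leb k) - (\<integral>x. fE x * g (n 0 x) \<partial>Leb k)) * (1 / h m)"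
   using i1'[of "h m"] i1[of 0] by simp
  also have "\<dots> = - (\<integral>x. fE x * ((g x - g (n (- h m) x)) / h m) \<partial>Leb k)"
  proof -
   have "(\<integral>x. fE x * ((g x - g (n (- h m) x)) / h m) \<partial>Leb k) = (\<integral>x. (fE x * g (n 0 x) - fE x * g (n (- h m) x)) * (1 / h m) \<partial>Leb k)"
    by (rule Bochner_Integration.integral_cong[OF refl]) (simp add: n_def field_simps)
   also have "\<dots> = ((\<integral>x. fE x * g (n 0 x) \<partial>Leb k) - (\<integral>x. fE x * g (n (- h m) x) \<partial>Leb k)) * (1 / h m)"
    using i1[of 0] i1[of "- h m"] by simp
   finally have e: "(\<integral>x. fE x * ((g x - g (n (- h m) x)) / h m) \<partial>Leb k) =
     ((\<integral>x. fE x * g (n 0 x) \<partial>Leb k) - (\<integral>x. fE x * g (n (- h m) x) \<partial>Leb k)) * (1 / h m)" .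
   show ?thesis by (subst e) (simp add: left_diff_distrib minus_divide_left)
  qed
  finally show ?thesis .
 qed
 have mv: "\<bar>g x - g (n (- h m) x)\<bar> \<le> C * h m" if x: "x \<in> cube k UNIV" for x m
 proof -
  have "\<bar>(%t. g (n t x)) 0 - (%t. g (n t x)) (- h m)\<bar> \<le> C * norm (0 - (- h m))"
   using field_differentiable_bound[of UNIV "%t. g (n t x)" "%t. v (n t x)" C 0 "- h m"] d[OF x] C(3) \<tau>W[OF x]
   by (simp add: n_def)
  then show ?thesis using h0[of m] by (simp add: n_def)
 qed
 have "(%m. \<integral>x. fE x * ((g x - g (n (- h m) x)) / h m) \<partial>Leb k) \<longlonglongrightarrow> (\<integral>x. fE x * partial_deriv g i b x \<partial>Leb k)"
 proof (rule integral_dominated_convergence[where w = "%x. indicator X x * (F * C)"])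
  have "(%x. fE x * v x) \<in> borel_measurable (Leb k)" by measurable
  then show "(%x. fE x * partial_deriv g i b x) \<in> borel_measurable (Leb k)"
   by (subst measurable_cong[of _ _ "%x. fE x * v x"]) (simp_all add: p space_Leb)
  show "integrable (Leb k) (%x. indicator X x * (F * C))"
   using emeasure_Leb_bounded[OF E_props(1,2), of k] E_props by (intro integrable_mult_left integrable_real_indicator PiE_in_Leb) auto
  show "AE x in Leb k. (%m. fE x * ((g x - g (n (- h m) x)) / h m)) \<longlonglongrightarrow> fE x * partial_deriv g i b x"
  proof (rule AE_I2)
   fix x :: "nat => 'a" assume "x \<in> space (Leb k)"
   then have x: "x \<in> cube k UNIV" by (simp add: space_Leb)
   have "((%t. (g (n t x) - g (n 0 x)) / t) \<longlongrightarrow> v x) (at 0)"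
    using d[OF x, of 0] unfolding n_def has_field_derivative_iff by simp
   moreover have "filterlim (%m. - h m) (at 0) sequentially"
    using tendsto_minus[OF hlim] less_imp_neq[OF h0(1)] by (simp add: filterlim_at eq_commute[of 0])
   ultimately have "(%m. (g (n (- h m) x) - g (n 0 x)) / - h m) \<longlonglongrightarrow> v x" by (rule filterlim_compose)
   moreover have "(g (n (- h m) x) - g (n 0 x)) / - h m = (g x - g (n (- h m) x)) / h m" for m
    by (simp add: n_def minus_divide_left)
   ultimately show "(%m. fE x * ((g x - g (n (- h m) x)) / h m)) \<longlonglongrightarrow> fE x * partial_deriv g i b x"
    unfolding p[OF x] by (intro tendsto_mult_left) simp
  qed
  fix m
  show "AE x in Leb k. norm (fE x * ((g x - g (n (- h m) x)) / h m)) \<le> indicator X x * (F * C)"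
  proof (rule AE_I2)
   fix x :: "nat => 'a" assume x: "x \<in> space (Leb k)"
   have "\<bar>(g x - g (n (- h m) x)) / h m\<bar> \<le> C" using mv[of x m] x h0(1)[of m] by (simp add: space_Leb field_simps)
   then have "\<bar>fE x * ((g x - g (n (- h m) x)) / h m)\<bar> \<le> (indicator X x * F) * C" unfolding abs_mult
    using F(2)[of x] F(1) by (intro mult_mono) auto
   then show "norm (fE x * ((g x - g (n (- h m) x)) / h m)) \<le> indicator X x * (F * C)" by (simp add: mult.assoc)
  qed
 qed measurable
 then have lim: "(%m. - (\<integral>x. fE x * ((g x - g (n (- h m) x)) / h m) \<partial>Leb k)) \<longlonglongrightarrow> - (\<integral>x. fE x * partial_deriv g i b x \<partial>Leb k)"
  by (rule tendsto_minus)
 have "\<forall>\<^sub>F m in sequentially. h m < q" using order_tendstoD(2)[OF hlim q(1)] .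
 then have "\<forall>\<^sub>F m in sequentially. - (\<integral>x. fE x * ((g x - g (n (- h m) x)) / h m) \<partial>Leb k) = (\<integral>x. quot m i b x * g x \<partial>Leb k)"
  by eventually_elim (simp add: eq)
 from Lim_transform_eventually[OF lim this] show ?thesis .
qed

text \<open>Where the convex combinations do not converge, \<open>lim\<close> has an unspecified
  value; with weights from \<open>convergent_weights\<close> this concerns a null set only, and the
  limit is measurable in any case.\<close>

definition grad :: "(nat => (nat => real) \<times> nat) => (nat => 'a) => nat => 'a" where
 "grad p x i = (\<Sum>b\<in>Basis. lim (%j. weighted (p j) (%m. quot m i b x)) *\<^sub>R b)"

lemma weighted_quot_measurable: "i < k ==> (%x. weighted w (%m. quot m i b x)) \<in> borel_measurable (Leb k)"
 using quot_measurable[of i _ b] unfolding weighted_def by measurable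

lemma grad_measurable: "i < k ==> (%x. grad p x i) \<in> borel_measurable (Leb k)"
 unfolding grad_def[abs_def]
 by (intro borel_measurable_sum borel_measurable_scaleR borel_measurable_const borel_measurable_lim_metric weighted_quot_measurable)

lemma grad_inner: "b \<in> Basis ==> grad p x i \<bullet> b = lim (%j. weighted (p j) (%m. quot m i b x))"
 unfolding grad_def by (simp add: inner_sum_left_Basis)

lemma weighted_quot_bound:
 assumes "i < k" "b \<in> Basis" "w \<in> convex_weights n"
 shows "\<bar>weighted w (%m. quot m i b x)\<bar> \<le> indicator X x * L"
 using weighted_bound[OF assms(3), of "%m. quot m i b x" 0 "indicator X x * L"] quot_bound[OF assms(1,2)] by simp

text \<open>The weights \<open>p j\<close> live on indices from \<open>j\<close> on, so the weighted
  integrals against a test function have the same limit as those of \<open>quot\<close>. Dominated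
  convergence computes this limit in terms of \<open>grad\<close>, and the two values give the
  integration by parts formula.\<close>

lemma weak_gradient_grad:
 assumes p: "\<And>j. p j \<in> convex_weights j"
  and conv: "AE x in Leb k. x \<in> X --> (\<forall>i<k. \<forall>b\<in>Basis. convergent (%j. weighted (p j) (%m. quot m i b x)))"
 shows "weak_gradient k (interior E) f (grad p)"
proof -
 have conv': "AE x in Leb k. \<forall>i<k. \<forall>b\<in>Basis. (%j. weighted (p j) (%m. quot m i b x)) \<longlonglongrightarrow> grad p x i \<bullet> b"
  using conv
 proof eventually_elim
  case (elim x)
  have z: "weighted w (%m. quot m i b x) = 0" if "x \<notin> X" for w i b using that by (simp add: weighted_def quot_def)
  have "convergent (%j. weighted (p j) (%m. quot m i b x))" if "i < k" "b \<in> Basis" for i b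
   using elim z[of _ i b] that convergent_const[of 0] by (cases "x \<in> X") simp_all
  then show ?case by (simp add: grad_inner convergent_LIMSEQ_iff)
 qed
 have bd: "AE x in Leb k. \<forall>i<k. \<forall>b\<in>Basis. \<bar>grad p x i \<bullet> b\<bar> \<le> indicator X x * L"
  using conv'
 proof eventually_elim
  case (elim x)
  show ?case
  proof (intro allI impI ballI)
   fix i and b :: 'a assume ib: "i < k" "b \<in> Basis"
   have "(%j. \<bar>weighted (p j) (%m. quot m i b x)\<bar>) \<longlonglongrightarrow> \<bar>grad p x i \<bullet> b\<bar>" using elim ib by (intro tendsto_rabs) blast
   then show "\<bar>grad p x i \<bullet> b\<bar> \<le> indicator X x * L"
    by (rule LIMSEQ_le_const2) (use weighted_quot_bound[OF ib p] in blast)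
  qed
 qed
 have int_sub: "set_integrable (leb_k k) (cube k K) h"
  if K: "compact K" "K \<subseteq> interior E" and h: "h' \<in> borel_measurable (Leb k)" and e: "\<And>x. x \<in> cube k K ==> h x = h' x"
   and b: "AE x in Leb k. norm (h' x) \<le> indicator X x * M" for K M and h h' :: "(nat => 'a) => 'b::{banach, second_countable_topology}"
 proof -
  have Kb: "K \<in> sets borel" using K(1) by (simp add: compact_imp_closed)
  have [measurable]: "cube k K \<in> sets (Leb k)" by (rule PiE_in_Leb) (rule Kb)
  have m: "(%x. indicator (cube k K) x *\<^sub>R h' x) \<in> borel_measurable (Leb k)" using h by measurable
  have "integrable (Leb k) (%x. indicator (cube k K) x *\<^sub>R h' x)"
  proof (rule integrable_Leb_bounded[OF E_props(1,2) m])
   show "AE x in Leb k. norm (indicator (cube k K) x *\<^sub>R h' x) \<le> indicator X x * M"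
    using b
   proof eventually_elim
    case (elim x)
    have "norm (indicator (cube k K) x *\<^sub>R h' x) \<le> norm (h' x)" by (simp add: indicator_def)
    then show ?case using elim by linarith
   qed
  qed
  then have "integrable (leb_k k) (%x. indicator (cube k K) x *\<^sub>R h' x)"
   unfolding leb_k_def using integrable_completion[OF m] by simp
  moreover have "(%x. indicator (cube k K) x *\<^sub>R h' x) = (%x. indicator (cube k K) x *\<^sub>R h x)"
  proof
   fix x show "indicator (cube k K) x *\<^sub>R h' x = indicator (cube k K) x *\<^sub>R h x"
   proof (cases "x \<in> cube k K")
    case False
    then have "indicator (cube k K) x = (0 :: real)" by (rule indicator_simps(2))
    then show ?thesis by (simp only: scaleR_zero_left)
   qed (simp only: e)
  qed
  ultimately show ?thesis unfolding set_integrable_def by simp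
 qed
 obtain F where F: "0 \<le> F" "\<And>x. \<bar>fE x\<bar> \<le> indicator X x * F" using fE_bounded by metis
 show ?thesis unfolding weak_gradient_def
 proof (intro conjI allI impI ballI)
  show "locally_integrable k (interior E) f" unfolding locally_integrable_def
  proof (intro allI impI, elim conjE)
   fix K assume K: "compact K" "K \<subseteq> interior E"
   have "x \<in> X" if "x \<in> cube k K" for x using that K(2) interior_subset[of E] unfolding PiE_iff by blast
   then show "set_integrable (leb_k k) (cube k K) f"
    using F(2) by (intro int_sub[OF K fE_measurable, of _ F]) (simp_all add: fE_def)
  qed
  fix i assume i: "i < k"
  show "locally_integrable k (interior E) (%x. grad p x i)" unfolding locally_integrable_def
  proof (intro allI impI, elim conjE)
   fix K assume K: "compact K" "K \<subseteq> interior E"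
   show "set_integrable (leb_k k) (cube k K) (%x. grad p x i)"
   proof (rule int_sub[OF K grad_measurable[OF i]])
    show "AE x in Leb k. norm (grad p x i) \<le> indicator X x * (L * DIM('a))"
     using bd
    proof eventually_elim
     case (elim x)
     have "norm (grad p x i) \<le> (\<Sum>b\<in>Basis. \<bar>grad p x i \<bullet> b\<bar>)" by (rule norm_le_l1)
     also have "\<dots> \<le> (\<Sum>b\<in>(Basis :: 'a set). indicator X x * L)" using elim i by (intro sum_mono) blast
     also have "\<dots> = indicator X x * (L * DIM('a))" by simp
     finally show ?case .
    qed
   qed simp
  qed
  fix v b assume v: "v \<in> test_funs k (interior E)" and b: "b \<in> (Basis :: 'a set)"
  obtain K n C where K: "compact K" "K \<subseteq> cube k (interior E)"
   and c\<phi>: "continuous_on (cube k UNIV) v" and c\<zeta>: "continuous_on (cube k UNIV) n"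
   and "\<And>x. x \<in> cube k UNIV ==> x \<notin> K ==> v x = 0"
   and \<zeta>0: "\<And>x. x \<in> cube k UNIV ==> x \<notin> K ==> n x = 0"
   and "\<And>x t. x \<in> cube k UNIV ==>
    ((%t. v (x(i := x i + t *\<^sub>R b))) has_real_derivative n (x(i := x i + t *\<^sub>R b))) (at t)"
   and pd: "\<And>x. x \<in> cube k UNIV ==> partial_deriv v i b x = n x"
   and C: "0 \<le> C" "\<And>x. x \<in> cube k UNIV ==> \<bar>v x\<bar> \<le> C"
   "\<And>x. x \<in> cube k UNIV ==> \<bar>n x\<bar> \<le> C"
   using test_fun_deriv[OF v i b] by blast
  have KX: "K \<subseteq> X" using K(2) interior_subset[of E] by (auto simp: PiE_iff)
  have \<phi>m [measurable]: "v \<in> borel_measurable (Leb k)" by (rule continuous_Leb_measurable[OF c\<phi>])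
  have \<zeta>m [measurable]: "n \<in> borel_measurable (Leb k)" by (rule continuous_Leb_measurable[OF c\<zeta>])
  note [measurable] = quot_measurable[OF i] weighted_quot_measurable[OF i] grad_measurable[OF i]
  have qi: "integrable (Leb k) (%x. quot m i b x * v x)" for m
  proof (rule integrable_Leb_bounded[OF E_props(1,2)])
   show "AE x in Leb k. norm (quot m i b x * v x) \<le> indicator X x * (L * C)"
   proof (rule AE_I2)
    fix x :: "nat => 'a" assume "x \<in> space (Leb k)"
    then have "\<bar>quot m i b x * v x\<bar> \<le> (indicator X x * L) * C" unfolding abs_mult
     using quot_bound[OF i b, of m x] L0 C(2)[of x] by (intro mult_mono) (auto simp: space_Leb)
    then show "norm (quot m i b x * v x) \<le> indicator X x * (L * C)" by (simp add: mult.assoc)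
   qed
  qed measurable
  define I where "I = (\<integral>x. fE x * partial_deriv v i b x \<partial>Leb k)"
  have wI: "(\<integral>x. weighted (p j) (%m. quot m i b x) * v x \<partial>Leb k) = weighted (p j) (%m. \<integral>x. quot m i b x * v x \<partial>Leb k)" for j
  proof -
   have "(\<integral>x. weighted (p j) (%m. quot m i b x) * v x \<partial>Leb k) = (\<integral>x. (\<Sum>m<snd (p j). fst (p j) m * (quot m i b x * v x)) \<partial>Leb k)"
    by (simp add: weighted_def sum_distrib_right mult.assoc)
   also have "\<dots> = (\<Sum>m<snd (p j). fst (p j) m * (\<integral>x. quot m i b x * v x \<partial>Leb k))"
    using qi by (subst Bochner_Integration.integral_sum) simp_all
   finally show ?thesis by (simp add: weighted_def)
  qed
  have l1: "(%j. \<integral>x. weighted (p j) (%m. quot m i b x) * v x \<partial>Leb k) \<longlonglongrightarrow> - I"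
   unfolding wI
  proof (rule LIMSEQ_I)
   fix e :: real assume e: "0 < e"
   obtain N where N: "\<And>m. N \<le> m ==> norm ((\<integral>x. quot m i b x * v x \<partial>Leb k) - - I) < e / 2"
    using LIMSEQ_D[OF quot_integral[OF v i b, folded I_def], of "e / 2"] e by auto
   have "norm (weighted (p j) (%m. \<integral>x. quot m i b x * v x \<partial>Leb k) - - I) < e" if "N \<le> j" for j
   proof -
    have "\<bar>weighted (p j) (%m. \<integral>x. quot m i b x * v x \<partial>Leb k) - - I\<bar> \<le> e / 2"
    proof (rule weighted_bound[OF p])
     fix m assume "j \<le> m"
     with that have "N \<le> m" by simp
     from N[OF this] show "\<bar>(\<integral>x. quot m i b x * v x \<partial>Leb k) - - I\<bar> \<le> e / 2" by simp
    qed
    then show ?thesis using e by simp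
   qed
   then show "\<exists>N. \<forall>j\<ge>N. norm (weighted (p j) (%m. \<integral>x. quot m i b x * v x \<partial>Leb k) - - I) < e" by blast
  qed
  have l2: "(%j. \<integral>x. weighted (p j) (%m. quot m i b x) * v x \<partial>Leb k) \<longlonglongrightarrow> (\<integral>x. (grad p x i \<bullet> b) * v x \<partial>Leb k)"
  proof (rule integral_dominated_convergence[where w = "%x. indicator X x * (L * C)"])
   show "integrable (Leb k) (%x. indicator X x * (L * C))"
    using emeasure_Leb_bounded[OF E_props(1,2), of k] E_props by (intro integrable_mult_left integrable_real_indicator PiE_in_Leb) auto
   show "AE x in Leb k. (%j. weighted (p j) (%m. quot m i b x) * v x) \<longlonglongrightarrow> (grad p x i \<bullet> b) * v x"
    using conv' by eventually_elim (intro tendsto_mult_right, use i b in blast)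
   fix j
   show "AE x in Leb k. norm (weighted (p j) (%m. quot m i b x) * v x) \<le> indicator X x * (L * C)"
   proof (rule AE_I2)
    fix x :: "nat => 'a" assume "x \<in> space (Leb k)"
    then have "\<bar>weighted (p j) (%m. quot m i b x) * v x\<bar> \<le> (indicator X x * L) * C" unfolding abs_mult
     using weighted_quot_bound[OF i b p[of j], of x] L0 C(2)[of x] by (intro mult_mono) (auto simp: space_Leb)
    then show "norm (weighted (p j) (%m. quot m i b x) * v x) \<le> indicator X x * (L * C)" by (simp add: mult.assoc)
   qed
  qed measurable
  have g: "(\<integral>x. (grad p x i \<bullet> b) * v x \<partial>leb_k k) = - I"
  proof -
   have m: "(%x. (grad p x i \<bullet> b) * v x) \<in> borel_measurable (Leb k)" by measurable
   show ?thesis unfolding leb_k_def integral_completion[OF m] using LIMSEQ_unique[OF l1 l2] by simp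
  qed
  have "(\<integral>x. f x * partial_deriv v i b x \<partial>leb_k k) = (\<integral>x. fE x * n x \<partial>leb_k k)"
  proof (rule Bochner_Integration.integral_cong[OF refl])
   fix x assume "x \<in> space (leb_k k :: (nat => 'a) measure)"
   then have x: "x \<in> cube k UNIV" by (simp add: leb_k_def space_Leb)
   show "f x * partial_deriv v i b x = fE x * n x"
    unfolding pd[OF x] using KX \<zeta>0[OF x] by (cases "x \<in> K") (auto simp: fE_def)
  qed
  also have "\<dots> = (\<integral>x. fE x * n x \<partial>Leb k)" unfolding leb_k_def by (rule integral_completion) measurable
  also have "\<dots> = I" unfolding I_def by (rule Bochner_Integration.integral_cong[OF refl]) (simp add: pd space_Leb)
  finally show "(\<integral>x. f x * partial_deriv v i b x \<partial>leb_k k) = - (\<integral>x. (grad p x i \<bullet> b) * v x \<partial>leb_k k)"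
   using g by simp
 qed
qed

lemma convergent_weights:
 obtains p where "\<And>j. p j \<in> convex_weights j"
  "AE x in Leb k. x \<in> X --> (\<forall>i<k. \<forall>b\<in>Basis. convergent (%j. weighted (p j) (%m. quot m i b x)))"
proof -
 let ?M = "density (Leb k) (indicator X)"
 have Xs: "X \<in> sets (Leb k)" by (rule PiE_in_Leb) (rule E_props(1))
 have fm: "finite_measure ?M"
  by (rule finite_measureI) (use emeasure_Leb_bounded[OF E_props(1,2), of k] Xs in \<open>simp add: emeasure_density less_top\<close>)
 obtain p where p: "\<And>j. p j \<in> convex_weights j"
  and ae: "AE x in ?M. \<forall>a\<in>{..<k} \<times> Basis. convergent (%j. weighted (p j) (%m. indicator X x * quot m (fst a) (snd a) x))"
 proof (rule convex_combinations_converge[OF fm, of "{..<k} \<times> (Basis :: 'a set)" "%m a x. if fst a < k \<and> snd a \<in> Basis then indicator X x * quot m (fst a) (snd a) x else 0" L])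
  fix m :: nat and a :: "nat \<times> 'a" assume "a \<in> {..<k} \<times> Basis"
  then have "(%x. indicator X x * quot m (fst a) (snd a) x) \<in> borel_measurable (Leb k)"
   using quot_measurable[of "fst a" m "snd a"] Xs by (intro borel_measurable_times borel_measurable_indicator) auto
  then show "(%x. if fst a < k \<and> snd a \<in> Basis then indicator X x * quot m (fst a) (snd a) x else 0) \<in> borel_measurable ?M"
   by (cases "fst a < k \<and> snd a \<in> Basis") simp_all
 next
  fix m :: nat and a :: "nat \<times> 'a" and x
  show "\<bar>if fst a < k \<and> snd a \<in> Basis then indicator X x * quot m (fst a) (snd a) x else 0\<bar> \<le> L"
   using quot_bound'[of "fst a" "snd a" m x] L0 by (auto simp: indicator_def)
 next
  fix p assume "\<And>j. p j \<in> convex_weights j" and ae: "AE x in ?M. \<forall>a\<in>{..<k} \<times> Basis. convergent (%j. weighted (p j)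
   (%m. if fst a < k \<and> snd a \<in> Basis then indicator X x * quot m (fst a) (snd a) x else 0))"
  moreover from ae have "AE x in ?M. \<forall>a\<in>{..<k} \<times> Basis. convergent (%j. weighted (p j) (%m. indicator X x * quot m (fst a) (snd a) x))"
   by eventually_elim simp
  ultimately show ?thesis using that by blast
 qed simp
 have "AE x in Leb k. x \<in> X --> (\<forall>a\<in>{..<k} \<times> Basis. convergent (%j. weighted (p j) (%m. indicator X x * quot m (fst a) (snd a) x)))"
  using ae AE_density[of "indicator X :: _ => ennreal" "Leb k"] Xs by (auto elim!: eventually_mono)
 then have "AE x in Leb k. x \<in> X --> (\<forall>i<k. \<forall>b\<in>Basis. convergent (%j. weighted (p j) (%m. quot m i b x)))"
  by eventually_elim force
 then show thesis using p that by blast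
qed

text \<open>With \<open>L = 0\<close> all quotients vanish, so any convergent weights produce the
  zero gradient.\<close>

lemma weak_gradient_constant:
 assumes "L = 0" shows "weak_gradient k (interior E) f (%_ _. 0)"
proof -
 have q: "quot m i b x = 0" if "i < k" "b \<in> Basis" for m i b x using quot_bound[OF that, of m x] assms by simp
 show ?thesis
 proof (rule convergent_weights)
 fix p :: "nat => (nat => real) \<times> nat"
 assume p: "\<And>j. p j \<in> convex_weights j"
  "AE x in Leb k. x \<in> X --> (\<forall>i<k. \<forall>b\<in>Basis. convergent (%j. weighted (p j) (%m. quot m i b x)))"
 have w: "weak_gradient k (interior E) f (grad p)" by (rule weak_gradient_grad[OF p])
 have g: "grad p x i = 0" if "i < k" for x i
  unfolding grad_def weighted_def using that by (intro sum.neutral) (simp add: q)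
 have li: "locally_integrable k (interior E) (%_. 0 :: 'a)" unfolding locally_integrable_def set_integrable_def by simp
 show ?thesis unfolding weak_gradient_def
 proof (intro conjI allI impI ballI)
  show "locally_integrable k (interior E) f" using w unfolding weak_gradient_def by (rule conjunct1)
  show "locally_integrable k (interior E) (%_. 0 :: 'a)" by (rule li)
  fix c i and b :: 'a assume a: "c \<in> test_funs k (interior E)" "i < k" "b \<in> Basis"
  have "(\<integral>x. f x * partial_deriv c i b x \<partial>leb_k k) = - (\<integral>x. (grad p x i \<bullet> b) * c x \<partial>leb_k k)"
   using w a unfolding weak_gradient_def by blast
  also have "\<dots> = - (\<integral>x. (0 \<bullet> b) * c x \<partial>leb_k k)" unfolding g[OF a(2)] by (rule refl)
  finally show "(\<integral>x. f x * partial_deriv c i b x \<partial>leb_k k) = - (\<integral>x. (0 \<bullet> b) * c x \<partial>leb_k k)" .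
 qed
 qed
qed

end

section \<open>Calculus of weak gradients: differences, uniqueness, restriction to smaller
  sets\<close>

lemma AE_leb_k: "(AE x in leb_k k. P x) \<longleftrightarrow> (AE x in Leb k. P x)"
 unfolding leb_k_def by (rule AE_completion_iff)

lemma space_leb_k: "space (leb_k k :: (nat => 'a::euclidean_space) measure) = cube k UNIV"
 by (simp add: leb_k_def space_Leb)

lemma locally_integrable_times:
 fixes f :: "(nat => 'a::euclidean_space) => real"
 assumes f: "locally_integrable k U f" and K: "compact K" "K \<subseteq> cube k U"
  and g: "g \<in> borel_measurable (Leb k)" and \<psi>0: "\<And>x. x \<in> cube k UNIV ==> x \<notin> K ==> g x = 0"
  and C: "0 \<le> C" "\<And>x. x \<in> cube k UNIV ==> \<bar>g x\<bar> \<le> C"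
 shows "integrable (leb_k k) (%x. f x * g x)"
proof -
 \<comment> \<open>Local integrability speaks only of powers of a compact set. The union of the
   coordinate projections of \<open>K\<close> is compact in \<open>U\<close>, and its power contains
   \<open>K\<close>.\<close>
 define K' where "K' = (\<Union>i<k. (%x. x i) ` K)"
 have "compact K'" unfolding K'_def
 proof (intro compact_UN finite_lessThan)
  fix i show "compact ((%x. x i) ` K)"
   by (rule compact_continuous_image[OF continuous_on_subset[OF continuous_on_product_coordinates] K(1)]) simp
 qed
 moreover have "K' \<subseteq> U" using K(2) by (auto simp: K'_def PiE_iff)
 ultimately have fi: "integrable (leb_k k) (%x. indicator (cube k K') x *\<^sub>R f x)"
  using f unfolding locally_integrable_def set_integrable_def by blast
 have KK': "x \<in> cube k K'" if x: "x \<in> K" for x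
 proof -
  have "x \<in> extensional {..<k}" using K(2) x by (auto simp: PiE_iff)
  moreover have "\<forall>i<k. x i \<in> K'" using x by (auto simp: K'_def)
  ultimately show ?thesis by (simp add: PiE_iff)
 qed
 have \<psi>m: "g \<in> borel_measurable (leb_k k)" unfolding leb_k_def by (rule measurable_completion[OF g])
 have e: "f x * g x = (indicator (cube k K') x *\<^sub>R f x) * g x" if "x \<in> space (leb_k k)" for x
 proof (cases "x \<in> K")
  case True
  have "indicator (cube k K') x = (1 :: real)" by (rule indicator_simps(1)[OF KK'[OF True]])
  then show ?thesis by (simp only: scaleR_one)
 next
  case False
  have "g x = 0" using \<psi>0[OF _ False] that by (simp add: space_leb_k)
  then show ?thesis by simp
 qed
 have "integrable (leb_k k) (%x. (indicator (cube k K') x *\<^sub>R f x) * g x)"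
 proof (rule Bochner_Integration.integrable_bound[OF integrable_mult_left[OF integrable_abs[OF fi], of C]])
  show "(%x. (indicator (cube k K') x *\<^sub>R f x) * g x) \<in> borel_measurable (leb_k k)"
   by (intro borel_measurable_times borel_measurable_integrable[OF fi] \<psi>m)
  show "AE x in leb_k k. norm ((indicator (cube k K') x *\<^sub>R f x) * g x) \<le>
    norm (\<bar>indicator (cube k K') x *\<^sub>R f x\<bar> * C)"
  proof (rule AE_I2)
   fix x :: "nat => 'a" assume "x \<in> space (leb_k k)"
   then have "\<bar>g x\<bar> \<le> C" by (intro C(2)) (simp only: space_leb_k)
   then show "norm ((indicator (cube k K') x *\<^sub>R f x) * g x) \<le>
     norm (\<bar>indicator (cube k K') x *\<^sub>R f x\<bar> * C)"
    unfolding real_norm_def abs_mult abs_abs using C(1) by (intro mult_left_mono) simp_all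
  qed
 qed
 then show ?thesis by (subst Bochner_Integration.integrable_cong[OF refl e])
qed

lemma test_fun_integrable:
 fixes f :: "(nat => 'a::euclidean_space) => real"
 assumes f: "locally_integrable k U f" and g: "g \<in> test_funs k U" and i: "i < k" and b: "b \<in> Basis"
 shows "integrable (leb_k k) (%x. f x * g x)" "integrable (leb_k k) (%x. f x * partial_deriv g i b x)"
proof -
 obtain K w C where K: "compact K" "K \<subseteq> cube k U"
  and c\<phi>: "continuous_on (cube k UNIV) g" and c\<zeta>: "continuous_on (cube k UNIV) w"
  and \<phi>0: "\<And>x. x \<in> cube k UNIV ==> x \<notin> K ==> g x = 0"
  and \<zeta>0: "\<And>x. x \<in> cube k UNIV ==> x \<notin> K ==> w x = 0"
  and "\<And>x t. x \<in> cube k UNIV ==>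
    ((%t. g (x(i := x i + t *\<^sub>R b))) has_real_derivative w (x(i := x i + t *\<^sub>R b))) (at t)"
  and pd: "\<And>x. x \<in> cube k UNIV ==> partial_deriv g i b x = w x"
  and C: "0 \<le> C" "\<And>x. x \<in> cube k UNIV ==> \<bar>g x\<bar> \<le> C"
  "\<And>x. x \<in> cube k UNIV ==> \<bar>w x\<bar> \<le> C"
  using test_fun_deriv[OF g i b] by blast
 show "integrable (leb_k k) (%x. f x * g x)"
  by (rule locally_integrable_times[OF f K continuous_Leb_measurable[OF c\<phi>] \<phi>0 C(1,2)])
 have e: "f x * partial_deriv g i b x = f x * w x" if "x \<in> space (leb_k k)" for x
  using pd that by (simp add: space_leb_k)
 have "integrable (leb_k k) (%x. f x * w x)"
  by (rule locally_integrable_times[OF f K continuous_Leb_measurable[OF c\<zeta>] \<zeta>0 C(1,3)])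
 then show "integrable (leb_k k) (%x. f x * partial_deriv g i b x)"
  by (subst Bochner_Integration.integrable_cong[OF refl e])
qed

lemma locally_integrable_diff:
 "locally_integrable k U f ==> locally_integrable k U g ==> locally_integrable k U (%x. f x - g x)"
 unfolding locally_integrable_def set_integrable_def by (simp add: scaleR_diff_right)

lemma locally_integrable_inner:
 assumes "locally_integrable k U f" shows "locally_integrable k U (%x. f x \<bullet> b)"
 unfolding locally_integrable_def set_integrable_def
proof (intro allI impI)
 fix K assume "compact K \<and> K \<subseteq> U"
 then have "integrable (leb_k k) (%x. (indicator (cube k K) x *\<^sub>R f x) \<bullet> b)"
  using assms unfolding locally_integrable_def set_integrable_def by (intro integrable_inner_left) blast
 then show "integrable (leb_k k) (%x. indicator (cube k K) x *\<^sub>R (f x \<bullet> b))" by simp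
qed

lemma weak_gradient_diff:
 assumes f: "weak_gradient k U f g" and f': "weak_gradient k U f' g'"
 shows "weak_gradient k U (%x. f x - f' x) (%x i. g x i - g' x i)"
 unfolding weak_gradient_def
proof (intro conjI allI impI ballI)
 have l: "locally_integrable k U f" "locally_integrable k U f'" and lg: "\<And>i. i < k ==> locally_integrable k U (%x. g x i)"
  "\<And>i. i < k ==> locally_integrable k U (%x. g' x i)" using f f' by (auto simp: weak_gradient_def)
 show "locally_integrable k U (%x. f x - f' x)" by (rule locally_integrable_diff[OF l])
 fix i assume i: "i < k"
 show "locally_integrable k U (%x. g x i - g' x i)" by (rule locally_integrable_diff[OF lg[OF i]])
 fix c and b :: 'a assume c: "c \<in> test_funs k U" and b: "b \<in> Basis"
 note I = test_fun_integrable[OF _ c i b]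
 have "(\<integral>x. (f x - f' x) * partial_deriv c i b x \<partial>leb_k k) =
   (\<integral>x. f x * partial_deriv c i b x \<partial>leb_k k) - (\<integral>x. f' x * partial_deriv c i b x \<partial>leb_k k)"
  using I(2)[OF l(1)] I(2)[OF l(2)] by (simp add: left_diff_distrib)
 also have "\<dots> = - (\<integral>x. (g x i \<bullet> b) * c x \<partial>leb_k k) + (\<integral>x. (g' x i \<bullet> b) * c x \<partial>leb_k k)"
  using f f' c i b by (simp add: weak_gradient_def)
 also have "\<dots> = - (\<integral>x. ((g x i - g' x i) \<bullet> b) * c x \<partial>leb_k k)"
  using I(1)[OF locally_integrable_inner[OF lg(1)[OF i]], of b] I(1)[OF locally_integrable_inner[OF lg(2)[OF i]], of b]
  by (simp add: left_diff_distrib inner_diff_left)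
 finally show "(\<integral>x. (f x - f' x) * partial_deriv c i b x \<partial>leb_k k) = - (\<integral>x. ((g x i - g' x i) \<bullet> b) * c x \<partial>leb_k k)" .
qed

lemma test_fun_partial_outside:
 fixes U :: "'a::euclidean_space set"
 assumes "g \<in> test_funs k U" "i < k" "b \<in> Basis" "x \<in> cube k UNIV" "x \<notin> cube k U"
 shows "partial_deriv g i b x = 0"
proof -
 obtain K c where K: "K \<subseteq> cube k U" and z: "\<And>x. x \<in> cube k UNIV ==> x \<notin> K ==> c x = 0"
  and pd: "\<And>x. x \<in> cube k UNIV ==> partial_deriv g i b x = c x"
  by (rule test_fun_deriv[OF assms(1,2,3)]) (rule that)
 show ?thesis using pd[OF assms(4)] z[OF assms(4) contra_subsetD[OF K assms(5)]] by simp
qed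

text \<open>Agreement of \<open>f\<close> and \<open>f'\<close> inside the power of \<open>U\<close>
  suffices because derivatives of test functions vanish outside it. The difference of the gradients
  then integrates to 0 against all test functions, coordinate by coordinate.\<close>

lemma weak_gradient_unique:
 fixes U :: "'a::euclidean_space set"
 assumes U: "open U" and f: "weak_gradient k U f g" and f': "weak_gradient k U f' g'"
  and eq: "\<And>x. x \<in> cube k U ==> f x = f' x"
 shows "AE x in Leb k. (\<forall>i<k. x i \<in> U) --> (\<forall>i<k. g x i = g' x i)"
proof -
 have d: "weak_gradient k U (%x. f x - f' x) (%x i. g x i - g' x i)" by (rule weak_gradient_diff[OF f f'])
 have "AE x in Leb k. (\<forall>i<k. x i \<in> U) --> (g x i - g' x i) \<bullet> b = 0" if i: "i < k" and b: "b \<in> Basis" for i b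
  unfolding AE_leb_k[symmetric]
 proof (rule zero_of_test_integrals[OF U])
  show "locally_integrable k U (%x. (g x i - g' x i) \<bullet> b)"
   using d i by (intro locally_integrable_inner) (simp add: weak_gradient_def)
  fix c assume c: "c \<in> test_funs k U"
  have "(\<integral>x. (f x - f' x) * partial_deriv c i b x \<partial>leb_k k) = (\<integral>x. 0 \<partial>(leb_k k :: (nat => 'a) measure))"
  proof (rule Bochner_Integration.integral_cong[OF refl])
   fix x :: "nat => 'a" assume "x \<in> space (leb_k k)"
   then show "(f x - f' x) * partial_deriv c i b x = 0"
    using eq[of x] test_fun_partial_outside[OF c i b, of x] unfolding space_leb_k by (cases "x \<in> cube k U") simp_all
  qed
  then show "(\<integral>x. ((g x i - g' x i) \<bullet> b) * c x \<partial>leb_k k) = 0" using d c i b by (simp add: weak_gradient_def)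
 qed
 then have "AE x in Leb k. \<forall>a\<in>{..<k} \<times> Basis. (\<forall>i<k. x i \<in> U) --> (g x (fst a) - g' x (fst a)) \<bullet> snd a = 0"
  by (intro AE_finite_allI) auto
 then show ?thesis
 proof eventually_elim
  case (elim x)
  show ?case
  proof (intro impI allI)
   fix i assume a: "\<forall>i<k. x i \<in> U" "i < k"
   have "(g x i - g' x i) \<bullet> b = 0" if "b \<in> Basis" for b using elim[rule_format, of "(i, b)"] a that by simp
   then show "g x i = g' x i" by (simp add: euclidean_eq_iff[of "g x i"] inner_diff_left)
  qed
 qed
qed

lemma weak_gradient_mono:
 assumes "weak_gradient k V f g" "U \<subseteq> V" shows "weak_gradient k U f g"
proof -
 have t: "w \<in> test_funs k V" if "w \<in> test_funs k U" for w :: "(nat => 'a) => real"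
 proof -
  have "cube k U \<subseteq> cube k V" using assms(2) by (intro PiE_mono) auto
  then show ?thesis using that unfolding test_funs_def mem_Collect_eq by (meson order_trans)
 qed
 have "locally_integrable k U h" if "locally_integrable k V h" for h :: "(nat => 'a) => 'c::{banach, second_countable_topology}"
  using that assms(2) unfolding locally_integrable_def by (meson order_trans)
 note l = this
 show ?thesis unfolding weak_gradient_def
 proof (intro conjI allI impI ballI)
  show "locally_integrable k U f" using assms(1) unfolding weak_gradient_def by (intro l) (elim conjE)
  fix i assume i: "i < k"
  show "locally_integrable k U (%x. g x i)" using assms(1) i unfolding weak_gradient_def by (intro l) (elim conjE allE, blast)
  fix w and b :: 'a assume "w \<in> test_funs k U" "b \<in> Basis"
  then show "(\<integral>x. f x * partial_deriv w i b x \<partial>leb_k k) = - (\<integral>x. (g x i \<bullet> b) * w x \<partial>leb_k k)"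
   using assms(1) t[of w] i unfolding weak_gradient_def by (elim conjE) simp
 qed
qed

section \<open>Functions on finite configurations\<close>

lemma cnt_cfg_finite:
 assumes "finite I" "A \<in> sets borel" shows "cnt (cfg I x) A = (\<Sum>j\<in>I. indicator A (x j))"
proof -
 have l: "locfin I x" using assms(1) by (simp add: locfin_def)
 have "cnt (cfg I x) A = (\<Sum>j. indicator I j * indicator A (x j))" by (rule cnt_cfg_suminf[OF l assms(2)])
 also have "\<dots> = (\<Sum>j\<in>I. indicator I j * indicator A (x j))" by (rule suminf_finite[OF assms(1)]) simp
 also have "\<dots> = (\<Sum>j\<in>I. indicator A (x j))" by (rule sum.cong) simp_all
 finally show ?thesis .
qed

lemma cnt_pts: "A \<in> sets borel ==> cnt (pts k x) A = (\<Sum>j<k. indicator A (x j))"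
 unfolding pts_eq_cfg by (rule cnt_cfg_finite) simp

lemma cnt_dirac: "A \<in> sets borel ==> cnt (dirac y) A = indicator A y"
 unfolding dirac_def by (simp add: cnt_pts)

lemma measurable_dirac [measurable]: "dirac \<in> borel_measurable borel"
 by (rule measurable_configI) (simp add: cnt_dirac)

lemma cfg_add_dirac:
 assumes "i < k" shows "config_add (cfg ({..<k} - {i}) x) (dirac z) = pts k (x(i := z))"
proof (rule config_eqI)
 fix A :: "'a set" assume A: "A \<in> sets borel"
 have "cnt (pts k (x(i := z))) A = indicator A z + (\<Sum>j\<in>{..<k} - {i}. indicator A ((x(i := z)) j))"
  unfolding cnt_pts[OF A] using assms by (subst sum.remove[of _ i]) auto
 also have "(\<Sum>j\<in>{..<k} - {i}. indicator A ((x(i := z)) j)) = (\<Sum>j\<in>{..<k} - {i}. (indicator A (x j) :: ennreal))"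
  by (rule sum.cong) auto
 finally have r: "cnt (pts k (x(i := z))) A = indicator A z + (\<Sum>j\<in>{..<k} - {i}. indicator A (x j))" .
 have "cnt (config_add (cfg ({..<k} - {i}) x) (dirac z)) A = (\<Sum>j\<in>{..<k} - {i}. indicator A (x j)) + indicator A z"
  using A by (simp add: emeasure_config_add cnt_cfg_finite cnt_dirac)
 then show "cnt (config_add (cfg ({..<k} - {i}) x) (dirac z)) A = cnt (pts k (x(i := z))) A" unfolding r by (simp only: add.commute)
qed

lemma remove_point_pts:
 assumes i: "i < k" and d: "\<And>j. j < k ==> j \<noteq> i ==> x j \<noteq> x i"
 shows "restr (- {x i}) (pts k x) = cfg ({..<k} - {i}) x"
proof -
 have "{j \<in> {..<k}. x j \<in> - {x i}} = {..<k} - {i}" using d by auto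
 then show ?thesis unfolding pts_eq_cfg by (subst cnt_restr_cfg[OF locfin_pts]) auto
qed

lemma points_in_pts: assumes "\<And>i. i < k ==> x i \<in> E" shows "points_in E (pts k x) = x ` {..<k}"
 unfolding pts_eq_cfg points_in_cfg[OF locfin_pts] using assms by auto

lemma pts_kconfigs:
 assumes "E \<in> sets borel" "\<And>i. i < k ==> x i \<in> E" shows "pts k x \<in> kconfigs E k"
 using assms by (auto simp: kconfigs_def configs_def cnt_pts)

lemma kconfigs_borel [measurable]: "E \<in> sets borel ==> kconfigs E k \<in> sets borel"
 and configs_borel [measurable]: "E \<in> sets borel ==> configs E \<in> sets borel"
proof -
 assume E [measurable]: "E \<in> sets borel"
 have "- E \<in> sets borel" by measurable
 note [measurable] = measurable_cnt[OF this] measurable_cnt[OF E]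
 have "{g \<in> space borel. cnt g (- E) = 0} \<in> sets borel" "{g \<in> space borel. cnt g (- E) = 0 \<and> cnt g E = of_nat k} \<in> sets borel"
  by measurable
 then show "kconfigs E k \<in> sets borel" "configs E \<in> sets borel" by (simp_all add: kconfigs_def configs_def)
qed

lemma kconfigs_eq_pts:
 assumes E: "E \<in> sets borel" and g: "w \<in> kconfigs E k"
 obtains x where "x \<in> cube k E" "w = pts k x"
proof -
 have c: "cnt w (- E) = 0" "cnt w E = of_nat k" using g by (auto simp: kconfigs_def configs_def)
 then have "cnt w E < \<infinity>" by (simp add: of_nat_less_top)
 then obtain k' x where x: "restr E w = pts k' x" "\<And>i. i < k' ==> x i \<in> E" "cnt w E = of_nat k'"
  using restr_finite_pts[OF E] by metis
 have kk: "k' = k" using x(3) c(2) by simp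
 have "w = restr E w"
 proof (rule config_eqI)
  fix A :: "'a set" assume A: "A \<in> sets borel"
  have "cnt w A = cnt w (E \<inter> A) + cnt w (- E \<inter> A)" using A E by (subst plus_emeasure) (auto intro!: arg_cong[of _ _ "cnt w"])
  moreover have "cnt w (- E \<inter> A) = 0" using emeasure_mono[of "- E \<inter> A" "- E" "meas_of w"] c(1) E by auto
  ultimately show "cnt w A = cnt (restr E w) A" by (simp add: cnt_restr E A)
 qed
 also have "\<dots> = pts k (restrict x {..<k})" unfolding x(1) kk pts_eq_cfg by (rule cfg_cong) simp
 finally have "w = pts k (restrict x {..<k})" .
 moreover have "restrict x {..<k} \<in> cube k E" using x(2) kk by auto
 ultimately show thesis using that by blast
qed

lemma configs_eq_UN: assumes "E \<in> sets borel" "bounded E" shows "configs E = (\<Union>k. kconfigs E k)"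
proof -
 have "\<exists>k. cnt g E = of_nat k" for g
  using restr_finite_pts[OF assms(1) cnt_bounded_finite[OF assms(2), of g]] by metis
 then show ?thesis by (auto simp: kconfigs_def)
qed

lemma kconfigs_disjoint: "g \<in> kconfigs E j ==> g \<in> kconfigs E k ==> j = k"
 by (simp add: kconfigs_def)

lemma kconfigs_configs: "g \<in> kconfigs E k ==> g \<in> configs E" by (simp add: kconfigs_def)

lemma continuous_pts: "continuous_on S (pts k :: (nat => 'a::euclidean_space) => _)"
proof (rule continuous_config_iff)
 fix f :: "'a => real" assume f: "test_cc f"
 have cf: "continuous_on UNIV f" using f by (simp add: test_cc_def)
 have "(\<integral>y. f y \<partial>meas_of (pts k z)) = (\<Sum>i<k. f (z i))" for z
  unfolding pts_eq_cfg using cf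
  by (subst integral_cfg[OF locfin_pts]) (auto intro!: borel_measurable_continuous_onI sum.mono_neutral_left)
 moreover have "continuous_on S (%z :: nat => 'a. f (z i))" for i
  by (rule continuous_on_compose2[OF cf continuous_on_subset[OF continuous_on_product_coordinates]]) auto
 ultimately show "continuous_on S (%z. \<integral>y. f y \<partial>meas_of (pts k z))" by (simp add: continuous_on_sum)
qed

definition lipschitz_components :: "'a::euclidean_space set => ('a config => real) => bool" where
 "lipschitz_components E w \<longleftrightarrow> (\<forall>k. \<exists>L. lipschitz_wrt d_config (kconfigs E k) L w)"

lemma lipschitz_power_pts:
 assumes E: "compact E" and w: "lipschitz_wrt d_config (kconfigs E k) L w"
 shows "lipschitz_power E k (w \<circ> pts k) L"
proof
 have Eb: "E \<in> sets borel" using E by (simp add: compact_imp_closed)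
 show "compact E" by fact
 show L: "0 \<le> L" using w by (simp add: lipschitz_wrt_def)
 fix x i y assume x: "x \<in> cube k E" and i: "i < k" and y: "y \<in> E"
 have k: "pts k x \<in> kconfigs E k" "pts k (x(i := y)) \<in> kconfigs E k"
  using x y by (auto intro!: pts_kconfigs[OF Eb] simp: PiE_iff)
 have d: "d_config (pts k x) (pts k (x(i := y))) \<le> ennreal (dist (x i) y)" by (rule d_config_pts_update_le[OF i])
 then have fin: "d_config (pts k x) (pts k (x(i := y))) \<noteq> \<infinity>" using ennreal_less_top[of "dist (x i) y"] by (simp add: top_unique less_top[symmetric] order_le_less_trans) (metis ennreal_neq_top top_unique)
 have "\<bar>w (pts k x) - w (pts k (x(i := y)))\<bar> \<le> L * enn2real (d_config (pts k x) (pts k (x(i := y))))"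
  using w k fin by (simp add: lipschitz_wrt_def)
 also have "\<dots> \<le> L * dist (x i) y" using enn2real_mono[OF d] L by (intro mult_left_mono) simp_all
 finally show "\<bar>(w \<circ> pts k) (x(i := y)) - (w \<circ> pts k) x\<bar> \<le> L * dist (x i) y" by (simp add: abs_minus_commute)
qed

lemma lipschitz_components_diff:
 assumes "lipschitz_components E u" "lipschitz_components E v" shows "lipschitz_components E (%x. u x - v x)"
 unfolding lipschitz_components_def
proof
 fix k
 obtain L1 L2 where L: "lipschitz_wrt d_config (kconfigs E k) L1 u" "lipschitz_wrt d_config (kconfigs E k) L2 v"
  using assms unfolding lipschitz_components_def by meson
 have "lipschitz_wrt d_config (kconfigs E k) (L1 + L2) (%x. u x - v x)"
  unfolding lipschitz_wrt_def
 proof (intro conjI ballI impI)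
  show "0 \<le> L1 + L2" using L by (simp add: lipschitz_wrt_def)
  fix x y assume a: "x \<in> kconfigs E k" "y \<in> kconfigs E k" "d_config x y \<noteq> \<infinity>"
  have "\<bar>u x - u y\<bar> \<le> L1 * enn2real (d_config x y)" "\<bar>v x - v y\<bar> \<le> L2 * enn2real (d_config x y)"
   using L a unfolding lipschitz_wrt_def by blast+
  then show "\<bar>u x - v x - (u y - v y)\<bar> \<le> (L1 + L2) * enn2real (d_config x y)" by (simp add: distrib_right)
 qed
 then show "\<exists>L. lipschitz_wrt d_config (kconfigs E k) L (%x. u x - v x)" ..
qed

text \<open>Functions on the space over \<open>E\<close> have unspecified values off
  \<open>configs E\<close>; setting these to 0 turns a component-wise Lipschitz function into a
  Borel function of all configurations.\<close>

definition cutoff :: "'a::euclidean_space set => ('a config => real) => 'a config => real" where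
 "cutoff E w g = (if g \<in> configs E then w g else 0)"

text \<open>On the \<open>k\<close>-particle component a sublevel set is the image under the
  continuous map \<open>pts k\<close> of a compact set of labelled points, hence compact.\<close>

lemma cutoff_borel:
 assumes E: "compact E" and w: "lipschitz_components E w" shows "cutoff E w \<in> borel_measurable borel"
proof (rule borel_measurableI_le)
 fix c :: real
 have Eb: "E \<in> sets borel" "bounded E" using E by (simp_all add: compact_imp_closed compact_imp_bounded)
 have k: "{v \<in> kconfigs E k. w v \<le> c} \<in> sets borel" for k
 proof -
  let ?X = "cube k E"
  obtain L where L: "lipschitz_wrt d_config (kconfigs E k) L w" using w unfolding lipschitz_components_def by blast
  interpret lipschitz_power E k "w \<circ> pts k" L by (rule lipschitz_power_pts[OF E L])
  have "closed (?X \<inter> (w \<circ> pts k) -` {..c})" by (rule continuous_closed_preimage[OF continuous closed_X]) simp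
  then have "compact (?X \<inter> (?X \<inter> (w \<circ> pts k) -` {..c}))"
   using E by (intro compact_Int_closed compact_PiE_lessThan) auto
  then have "compact (pts k ` (?X \<inter> (?X \<inter> (w \<circ> pts k) -` {..c})))" by (rule compact_continuous_image[OF continuous_pts])
  moreover have "pts k ` (?X \<inter> (?X \<inter> (w \<circ> pts k) -` {..c})) = {v \<in> kconfigs E k. w v \<le> c}"
  proof (intro set_eqI iffI)
   fix v assume "v \<in> pts k ` (?X \<inter> (?X \<inter> (w \<circ> pts k) -` {..c}))"
   then obtain x where x: "x \<in> ?X" "w (pts k x) \<le> c" "v = pts k x" by auto
   then show "v \<in> {v \<in> kconfigs E k. w v \<le> c}" using pts_kconfigs[OF Eb(1), of k x] by (simp add: PiE_iff)
  next
   fix v assume g: "v \<in> {v \<in> kconfigs E k. w v \<le> c}"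
   then have "v \<in> kconfigs E k" by simp
   then obtain x where x: "x \<in> ?X" "v = pts k x" using kconfigs_eq_pts[OF Eb(1)] by metis
   then have "x \<in> ?X \<inter> (?X \<inter> (w \<circ> pts k) -` {..c})" using g by simp
   then show "v \<in> pts k ` (?X \<inter> (?X \<inter> (w \<circ> pts k) -` {..c}))" unfolding x(2) by (rule imageI)
  qed
  ultimately show ?thesis by (simp add: compact_config_borel)
 qed
 have "{v \<in> space borel. cutoff E w v \<le> c} = (\<Union>k. {v \<in> kconfigs E k. w v \<le> c}) \<union> (if 0 \<le> c then - configs E else {})"
  using configs_eq_UN[OF Eb] by (auto simp: cutoff_def)
 also have "\<dots> \<in> sets borel" using k configs_borel[OF Eb(1)] by (intro sets.Un sets.countable_UN) auto
 finally show "{v \<in> space borel. cutoff E w v \<le> c} \<in> sets borel" .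
qed

section \<open>Square fields of Lipschitz functions\<close>

text \<open>The quotient of \<open>lipschitz_power.quot\<close> rewritten as a function of the
  configuration without the moved point and of that point. It no longer refers to labels and is
  jointly Borel.\<close>

definition shift_quot :: "'a::euclidean_space set => ('a config => real) => nat => 'a => 'a config \<times> 'a => real" where
 "shift_quot E w m b p = (if snd p \<in> E \<and> snd p + (1/2)^m *\<^sub>R b \<in> E then
   2^m * (cutoff E w (config_add (fst p) (dirac (snd p + (1/2)^m *\<^sub>R b))) - cutoff E w (config_add (fst p) (dirac (snd p)))) else 0)"

lemma shift_quot_borel:
 assumes E: "compact E" and w: "lipschitz_components E w"
 shows "shift_quot E w m b \<in> borel_measurable (borel \<Otimes>\<^sub>M borel)"
proof -
 note [measurable] = cutoff_borel[OF E w]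
 have [measurable]: "E \<in> sets borel" using E by (simp add: compact_imp_closed)
 have [measurable]: "(%p :: 'a config \<times> 'a. dirac (snd p + c)) \<in> borel_measurable (borel \<Otimes>\<^sub>M borel)" for c
  by (rule measurable_compose[OF _ measurable_dirac]) measurable
 have [measurable]: "(%p :: 'a config \<times> 'a. dirac (snd p)) \<in> borel_measurable (borel \<Otimes>\<^sub>M borel)"
  by (rule measurable_compose[OF _ measurable_dirac]) measurable
 have [measurable]: "(%p :: 'a config \<times> 'a. cutoff E w (config_add (fst p) (dirac (snd p + c)))) \<in> borel_measurable (borel \<Otimes>\<^sub>M borel)" for c
  by (rule measurable_compose[OF _ cutoff_borel[OF E w]]) measurable
 have [measurable]: "(%p :: 'a config \<times> 'a. cutoff E w (config_add (fst p) (dirac (snd p)))) \<in> borel_measurable (borel \<Otimes>\<^sub>M borel)"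
  by (rule measurable_compose[OF _ cutoff_borel[OF E w]]) measurable
 show ?thesis unfolding shift_quot_def[abs_def] by measurable
qed

lemma shift_quot_pts:
 assumes E: "compact E" and lp: "lipschitz_power E k (w \<circ> pts k) L" and x: "x \<in> cube k E"
  and d: "\<And>i j. i < k ==> j < k ==> i \<noteq> j ==> x i \<noteq> x j" and i: "i < k"
 shows "shift_quot E w m b (restr (- {x i}) (pts k x), x i) = lipschitz_power.quot E k (w \<circ> pts k) m i b x"
proof -
 interpret lipschitz_power E k "w \<circ> pts k" L by (rule lp)
 have r: "restr (- {x i}) (pts k x) = cfg ({..<k} - {i}) x" by (rule remove_point_pts[OF i]) (use d i in blast)
 have c: "cutoff E w (config_add (restr (- {x i}) (pts k x)) (dirac z)) = w (pts k (x(i := z)))" if z: "z \<in> E" for z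
 proof -
  have "pts k (x(i := z)) \<in> kconfigs E k" using x z by (intro pts_kconfigs[OF E_props(1)]) (auto simp: PiE_iff)
  then show ?thesis unfolding r cfg_add_dirac[OF i] cutoff_def by (simp only: kconfigs_configs if_True)
 qed
 have xi: "x i \<in> E" using x i by (auto simp: PiE_iff)
 have u: "x(i := x i) = x" by (rule fun_upd_triv)
 show ?thesis
 proof (cases "x i + (1/2)^m *\<^sub>R b \<in> E")
  case True
  show ?thesis unfolding shift_quot_def quot_def fst_conv snd_conv comp_apply c[OF xi] c[OF True] u using x xi True by (simp only: simp_thms if_True)
 next
  case False
  then show ?thesis unfolding shift_quot_def quot_def fst_conv snd_conv by (simp only: simp_thms if_False)
 qed
qed

lemma square_field_exists:
 assumes E: "compact E" "convex E" and w: "lipschitz_components E w"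
 shows "\<exists>G. is_square_field E w w G"
proof -
 have Eb: "E \<in> sets borel" "bounded E" using E by (simp_all add: compact_imp_closed compact_imp_bounded)
 have "\<exists>L. lipschitz_power E k (w \<circ> pts k) L" for k
  using w lipschitz_power_pts[OF E(1)] unfolding lipschitz_components_def by meson
 then obtain L where lp: "\<And>k. lipschitz_power E k (w \<circ> pts k) (L k)" by metis
 define Q where "Q k p \<longleftrightarrow> (\<forall>j. p j \<in> convex_weights j) \<and> (AE x in Leb k. x \<in> cube k E -->
   (\<forall>i<k. \<forall>b\<in>Basis. convergent (%j. weighted (p j) (%m. lipschitz_power.quot E k (w \<circ> pts k) m i b x))))"
  for k and p :: "nat => (nat => real) \<times> nat"
 have "\<exists>p. Q k p" for k
  unfolding Q_def by (rule lipschitz_power.convergent_weights[OF lp[of k]]) blast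
 then have "\<forall>k. \<exists>p. Q k p" by blast
 then obtain P where "\<forall>k. Q k (P k)" by (rule choice[THEN exE])
 then have P: "\<And>k j. P k j \<in> convex_weights j"
  and conv: "\<And>k. AE x in Leb k. x \<in> cube k E -->
   (\<forall>i<k. \<forall>b\<in>Basis. convergent (%j. weighted (P k j) (%m. lipschitz_power.quot E k (w \<circ> pts k) m i b x)))"
  unfolding Q_def by (elim allE conjE; blast)+
 define F where "F k p = ennreal (\<Sum>b\<in>Basis. (lim (%j. weighted (P k j) (%m. shift_quot E w m b p)))\<^sup>2)" for k p
 have F: "F k \<in> borel_measurable (borel \<Otimes>\<^sub>M borel)" for k
 proof -
  have "(%p. weighted (P k j) (%m. shift_quot E w m b p)) \<in> borel_measurable (borel \<Otimes>\<^sub>M borel)" for j b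
   unfolding weighted_def using shift_quot_borel[OF E(1) w] by measurable
  then have "(%p. lim (%j. weighted (P k j) (%m. shift_quot E w m b p))) \<in> borel_measurable (borel \<Otimes>\<^sub>M borel)" for b
   by (rule borel_measurable_lim_metric)
  then show ?thesis unfolding F_def[abs_def] by measurable
 qed
 \<comment> \<open>Summing over points instead of labels makes \<open>S k\<close> a Borel function
   of the configuration; \<open>G\<close> then selects the term of the component that contains
   \<open>c\<close>.\<close>
 define S where "S k c = (\<Sum>y\<in>points_in E c. F k (restr (- {y}) c, y))" for k c
 have S: "S k \<in> borel_measurable borel" for k unfolding S_def[abs_def] by (rule measurable_point_sum[OF Eb F])
 define G where "G c = enn2real (\<Sum>k. indicator (kconfigs E k) c * S k c)" for c
 have G_k: "G c = enn2real (S k c)" if g: "c \<in> kconfigs E k" for c k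
 proof -
  have "(\<Sum>k. indicator (kconfigs E k) c * S k c) = (\<Sum>j\<in>{k}. indicator (kconfigs E j) c * S j c)"
  proof (rule suminf_finite)
   fix j assume "j \<notin> {k}"
   then have "c \<notin> kconfigs E j" using kconfigs_disjoint[OF g, of j] by auto
   then show "indicator (kconfigs E j) c * S j c = 0" by simp
  qed simp
  then show ?thesis using g by (simp add: G_def)
 qed
 have "is_square_field E w w G" unfolding is_square_field_def
 proof (intro conjI allI)
  show "G \<in> borel_measurable borel" unfolding G_def[abs_def] using S kconfigs_borel[OF Eb(1)] by measurable
  fix k
  interpret lipschitz_power E k "w \<circ> pts k" "L k" by (rule lp)
  have wg: "weak_gradient k (interior E) (w \<circ> pts k) (grad (P k))" by (rule weak_gradient_grad[OF P conv])
  \<comment> \<open>At almost every \<open>x\<close> the coordinates are distinct, so the sum over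
    the set of points is the sum over labels, and the label-free quotients coincide with the
    quotients in coordinates.\<close>
  have "AE x in leb_power E k. G (pts k x) = (\<Sum>i<k. grad (P k) x i \<bullet> grad (P k) x i)"
   unfolding AE_leb_power[OF Eb] using AE_Leb_distinct[of k] AE_space
  proof eventually_elim
   case (elim x)
   show ?case
   proof
    assume xE: "\<forall>i<k. x i \<in> E"
    have x: "x \<in> X" using elim(2) xE by (simp add: space_Leb PiE_iff)
    have d: "x i \<noteq> x j" if "i < k" "j < k" "i \<noteq> j" for i j using elim(1) that by blast
    have inj: "inj_on x {..<k}" using d by (auto simp: inj_on_def)
    have pe: "points_in E (pts k x) = x ` {..<k}" by (rule points_in_pts) (use xE in blast)
    have "S k (pts k x) = (\<Sum>i<k. F k (restr (- {x i}) (pts k x), x i))"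
     unfolding S_def pe sum.reindex[OF inj] by (rule sum.cong) simp_all
    also have "\<dots> = (\<Sum>i<k. ennreal (grad (P k) x i \<bullet> grad (P k) x i))"
    proof (rule sum.cong[OF refl])
     fix i assume i: "i \<in> {..<k}"
     have q: "shift_quot E w m b (restr (- {x i}) (pts k x), x i) = quot m i b x" for m b
      using i by (intro shift_quot_pts[OF E(1) lp x d]) auto
     show "F k (restr (- {x i}) (pts k x), x i) = ennreal (grad (P k) x i \<bullet> grad (P k) x i)"
      unfolding F_def q by (subst euclidean_inner) (simp add: grad_inner power2_eq_square)
    qed
    also have "\<dots> = ennreal (\<Sum>i<k. grad (P k) x i \<bullet> grad (P k) x i)" by (rule sum_ennreal) simp
    finally have "enn2real (S k (pts k x)) = (\<Sum>i<k. grad (P k) x i \<bullet> grad (P k) x i)" by (simp add: sum_nonneg)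
    moreover have "pts k x \<in> kconfigs E k" using xE by (intro pts_kconfigs[OF Eb(1)]) blast
    ultimately show "G (pts k x) = (\<Sum>i<k. grad (P k) x i \<bullet> grad (P k) x i)" using G_k by simp
   qed
  qed
  then show "\<exists>g h. weak_gradient k (interior E) (w \<circ> pts k) g \<and> weak_gradient k (interior E) (w \<circ> pts k) h \<and>
    (AE x in leb_power E k. G (pts k x) = (\<Sum>i<k. g x i \<bullet> h x i))" using wg by blast
 qed
 then show ?thesis by (rule exI[where x = G])
qed

text \<open>\<open>square_field\<close> is some version chosen by \<open>SOME\<close>, possibly
  built from two different gradients. Uniqueness of weak gradients allows it to be computed with any
  gradient at hand.\<close>

lemma square_field_props:
 assumes E: "compact E" "convex E" and w: "lipschitz_components E w"
 shows "square_field E w w \<in> borel_measurable borel"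
  and "weak_gradient k (interior E) (w \<circ> pts k) g ==>
   AE x in Leb k. (\<forall>i<k. x i \<in> E) --> square_field E w w (pts k x) = (\<Sum>i<k. (norm (g x i))\<^sup>2)"
  and "\<exists>g. weak_gradient k (interior E) (w \<circ> pts k) g"
proof -
 have Eb: "E \<in> sets borel" "bounded E" using E by (simp_all add: compact_imp_closed compact_imp_bounded)
 have sf: "is_square_field E w w (square_field E w w)"
  unfolding square_field_def by (rule someI_ex[OF square_field_exists[OF E w]])
 then show "square_field E w w \<in> borel_measurable borel" by (simp add: is_square_field_def)
 obtain g1 g2 where g: "weak_gradient k (interior E) (w \<circ> pts k) g1" "weak_gradient k (interior E) (w \<circ> pts k) g2"
  and ae: "AE x in leb_power E k. square_field E w w (pts k x) = (\<Sum>i<k. g1 x i \<bullet> g2 x i)"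
  using sf unfolding is_square_field_def by meson
 show "\<exists>g. weak_gradient k (interior E) (w \<circ> pts k) g" using g by blast
 assume w: "weak_gradient k (interior E) (w \<circ> pts k) g"
 show "AE x in Leb k. (\<forall>i<k. x i \<in> E) --> square_field E w w (pts k x) = (\<Sum>i<k. (norm (g x i))\<^sup>2)"
  using ae[unfolded AE_leb_power[OF Eb]] weak_gradient_unique[OF open_interior g(1) w refl]
   weak_gradient_unique[OF open_interior g(2) w refl] AE_Leb_interior[OF E, of k]
  by eventually_elim (simp add: power2_norm_eq_inner)
qed

lemma emeasure_poisson:
 fixes E :: "'a::euclidean_space set"
 shows "sets (poisson_config E) = sets borel"
  and "A \<in> sets borel ==> emeasure (poisson_config E) A =
   (\<Sum>k. ennreal (exp (- measure lborel E) / fact k) * emeasure (distr (leb_power E k) borel (pts k)) A)"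
proof -
 let ?m = "%A. (\<Sum>k. ennreal (exp (- measure lborel E) / fact k) * emeasure (distr (leb_power E k) borel (pts k :: (nat => 'a) => _)) A)"
 show s: "sets (poisson_config E) = sets borel"
  unfolding poisson_config_def using sets.sets_measure_of_eq[of "borel :: 'a config measure"] by simp
 show "emeasure (poisson_config E) A = ?m A" if A: "A \<in> sets borel" for A
 proof (rule emeasure_measure_of[of _ UNIV "sets borel"])
  show "poisson_config E = measure_of UNIV (sets borel) ?m" by (rule poisson_config_def)
  show "countably_additive (sets (poisson_config E)) ?m"
   unfolding s
  proof (rule countably_additiveI)
   fix F :: "nat => 'a config set" assume F: "range F \<subseteq> sets borel" "disjoint_family F" "(\<Union>i. F i) \<in> sets borel"
   have "(\<Sum>i. ?m (F i)) = (\<Sum>k. \<Sum>i. ennreal (exp (- measure lborel E) / fact k) * emeasure (distr (leb_power E k) borel (pts k)) (F i))"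
    by (rule suminf_swap_ennreal)
   also have "\<dots> = ?m (\<Union>i. F i)"
   proof (rule suminf_cong)
    fix k
    show "(\<Sum>i. ennreal (exp (- measure lborel E) / fact k) * emeasure (distr (leb_power E k) borel (pts k)) (F i)) =
      ennreal (exp (- measure lborel E) / fact k) * emeasure (distr (leb_power E k) borel (pts k)) (\<Union>i. F i)"
     using suminf_emeasure[of F "distr (leb_power E k) borel (pts k)"] F by simp
   qed
   finally show "(\<Sum>i. ?m (F i)) = ?m (\<Union>i. F i)" .
  qed
 qed (use A s in \<open>auto simp: positive_def\<close>)
qed

lemma measurable_pts_leb_power: "pts k \<in> measurable (leb_power E k) (borel :: 'a::euclidean_space config measure)"
proof -
 have "sets (leb_power E k) = sets (PiM {..<k} (%_. borel :: 'a measure))" unfolding leb_power_def by (rule sets_PiM_cong) simp_all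
 then show ?thesis using measurable_pts[of k] by (simp cong: measurable_cong_sets)
qed

lemma emeasure_restr_k:
 assumes "sets \<nu> = sets borel" "E \<in> sets borel" "A \<in> sets borel"
 shows "emeasure (restr_k \<nu> E k) A = emeasure \<nu> (kconfigs E k \<inter> A)"
proof -
 have "kconfigs E k \<in> sets \<nu>" using assms by (simp add: kconfigs_borel)
 then show ?thesis unfolding restr_k_def using assms
  by (subst emeasure_density) (auto simp: indicator_inter_arith[symmetric])
qed

text \<open>Only the \<open>k\<close>-th term of the Poisson series charges
  \<open>kconfigs E k\<close>, and its coefficient is positive; null sets are thus those of Lebesgue
  measure on the labelled power.\<close>

lemma poisson_null_iff:
 fixes E :: "'a::euclidean_space set"
 assumes E: "E \<in> sets borel" "bounded E" and A: "A \<in> sets borel"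
 shows "emeasure (restr_k (poisson_config E) E k) A = 0 \<longleftrightarrow> (AE x in Leb k. (\<forall>i<k. x i \<in> E) --> pts k x \<notin> A)"
proof -
 let ?S = "kconfigs E k \<inter> A"
 have S: "?S \<in> sets borel" using E A by (simp add: kconfigs_borel)
 have d: "emeasure (distr (leb_power E j) borel (pts j)) ?S = 0 \<longleftrightarrow> (AE x in Leb j. (\<forall>i<j. x i \<in> E) --> pts j x \<notin> ?S)" for j
 proof -
  let ?D = "distr (leb_power E j) borel (pts j)"
  have "emeasure ?D ?S = 0 \<longleftrightarrow> (AE y in ?D. y \<notin> ?S)"
   using AE_iff_null_sets[of ?S ?D] S by (simp add: null_sets_def)
  also have "\<dots> \<longleftrightarrow> (AE x in leb_power E j. pts j x \<notin> ?S)"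
  proof (rule AE_distr_iff[OF measurable_pts_leb_power])
   have "{y \<in> space borel. y \<notin> ?S} = space borel - ?S" by blast
   then show "{y \<in> space borel. y \<notin> ?S} \<in> sets borel" using sets.compl_sets[OF S] by (simp only:)
  qed
  also have "\<dots> \<longleftrightarrow> (AE x in Leb j. (\<forall>i<j. x i \<in> E) --> pts j x \<notin> ?S)" by (rule AE_leb_power[OF E])
  finally show ?thesis .
 qed
 have o: "AE x in Leb j. (\<forall>i<j. x i \<in> E) --> pts j x \<notin> ?S" if "j \<noteq> k" for j
  using that kconfigs_disjoint pts_kconfigs[OF E(1)] by (intro always_eventually) blast
 have "emeasure (restr_k (poisson_config E) E k) A =
   (\<Sum>j. ennreal (exp (- measure lborel E) / fact j) * emeasure (distr (leb_power E j) borel (pts j)) ?S)"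
  using emeasure_restr_k[OF emeasure_poisson(1) E(1) A] emeasure_poisson(2)[OF S] by simp
 also have "\<dots> = 0 \<longleftrightarrow> (\<forall>j. emeasure (distr (leb_power E j) borel (pts j)) ?S = 0)"
  by (subst suminf_eq_zero_iff) (auto intro: summableI)
 also have "\<dots> \<longleftrightarrow> (AE x in Leb k. (\<forall>i<k. x i \<in> E) --> pts k x \<notin> ?S)"
  unfolding d
 proof (intro iffI allI)
  fix j assume ae: "AE x in Leb k. (\<forall>i<k. x i \<in> E) --> pts k x \<notin> ?S"
  show "AE x in Leb j. (\<forall>i<j. x i \<in> E) --> pts j x \<notin> ?S"
  proof (cases "j = k")
   case True
   show ?thesis unfolding True by (rule ae)
  qed (rule o)
 qed (elim allE)
 also have "\<dots> \<longleftrightarrow> (AE x in Leb k. (\<forall>i<k. x i \<in> E) --> pts k x \<notin> A)"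
  by (intro AE_cong) (use pts_kconfigs[OF E(1)] in blast)
 finally show ?thesis .
qed

section \<open>Pre-forms for measures equivalent to Lebesgue measure on components\<close>

lemma (in prob_space) bounded_l2:
 assumes u: "u \<in> borel_measurable (completion M)" and c: "AE x in M. \<bar>u x\<bar> \<le> c"
 shows "u \<in> l2_space M"
proof -
 have "AE x in completion M. ennreal ((u x)\<^sup>2) \<le> ennreal (c\<^sup>2)"
  unfolding AE_completion_iff using c
 proof eventually_elim
  case (elim x)
  show ?case using power_mono[OF elim, of 2] by (intro ennreal_leI) simp
 qed
 then have "l2_sq M u \<le> (\<integral>\<^sup>+ x. ennreal (c\<^sup>2) \<partial>completion M)" unfolding l2_sq_def by (rule nn_integral_mono_AE)
 also have "\<dots> < \<infinity>" unfolding nn_integral_completion by (simp add: emeasure_space_1 ennreal_mult_less_top)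
 finally show ?thesis using u by (simp add: l2_space_def)
qed

text \<open>What (CAC') says about one conditional measure: Lebesgue null sets of labelled
  configurations are null on every component, and conversely on every component that is
  charged.\<close>

locale comparable =
 fixes E :: "'a::euclidean_space set" and \<nu> :: "'a config measure"
 assumes E: "compact E" "convex E" and sets_\<nu> [measurable_cong, simp]: "sets \<nu> = sets borel" and prob: "prob_space \<nu>"
  and configs: "AE \<alpha> in \<nu>. \<alpha> \<in> configs E"
  and null: "\<And>k A. A \<in> sets borel ==> (AE x in Leb k. (\<forall>i<k. x i \<in> E) --> pts k x \<notin> A) ==> emeasure \<nu> (kconfigs E k \<inter> A) = 0"
  and null': "\<And>k A. A \<in> sets borel ==> emeasure \<nu> (kconfigs E k) > 0 ==> emeasure \<nu> (kconfigs E k \<inter> A) = 0 ==>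
    (AE x in Leb k. (\<forall>i<k. x i \<in> E) --> pts k x \<notin> A)"
begin

sublocale prob_space \<nu> by (rule prob)

lemma E_props: "E \<in> sets borel" "bounded E" using E by (simp_all add: compact_imp_closed compact_imp_bounded)

lemma AE_LebI:
 assumes P: "{g. P g} \<in> sets borel" and ae: "\<And>k. emeasure \<nu> (kconfigs E k) > 0 ==> AE x in Leb k. (\<forall>i<k. x i \<in> E) --> P (pts k x)"
 shows "AE g in \<nu>. P g"
proof -
 have nP: "{g. \<not> P g} \<in> sets borel" using sets.compl_sets[OF P] by (simp add: Compl_eq_Diff_UNIV[symmetric] Collect_neg_eq)
 have "AE g in \<nu>. g \<notin> kconfigs E k \<inter> {g. \<not> P g}" for k
 proof (rule AE_not_in)
  have "emeasure \<nu> (kconfigs E k \<inter> {g. \<not> P g}) = 0"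
  proof (cases "emeasure \<nu> (kconfigs E k) > 0")
   case True
   show ?thesis by (rule null[OF nP]) (use ae[OF True] in simp)
  next
   case False
   then show ?thesis
    using emeasure_mono[of "kconfigs E k \<inter> {g. \<not> P g}" "kconfigs E k" \<nu>] kconfigs_borel[OF E_props(1), of k] by (simp add: zero_less_iff_neq_zero)
  qed
  then show "kconfigs E k \<inter> {g. \<not> P g} \<in> null_sets \<nu>"
   using nP kconfigs_borel[OF E_props(1), of k] by (simp add: null_sets_def sets.Int)
 qed
 then have "AE g in \<nu>. \<forall>k. g \<notin> kconfigs E k \<inter> {g. \<not> P g}" by (subst AE_all_countable) blast
 then show ?thesis using configs unfolding configs_eq_UN[OF E_props] by eventually_elim blast
qed

lemma AE_LebD:
 assumes P: "{g. P g} \<in> sets borel" and ae: "AE g in \<nu>. P g" and k: "emeasure \<nu> (kconfigs E k) > 0"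
 shows "AE x in Leb k. (\<forall>i<k. x i \<in> E) --> P (pts k x)"
proof -
 have nP: "{g. \<not> P g} \<in> sets borel" using sets.compl_sets[OF P] by (simp add: Compl_eq_Diff_UNIV[symmetric] Collect_neg_eq)
 have "emeasure \<nu> (kconfigs E k \<inter> {g. \<not> P g}) = 0"
  using AE_iff_null_sets[of "kconfigs E k \<inter> {g. \<not> P g}" \<nu>] ae nP kconfigs_borel[OF E_props(1), of k]
  by (auto simp: null_sets_def elim!: eventually_mono)
 from null'[OF nP k this] show ?thesis by simp
qed

abbreviation "D \<equiv> pre_dom E \<nu>"
abbreviation "Q \<equiv> pre_form E \<nu>"

lemma lipschitz_measurable: assumes "lipschitz_components E u" shows "u \<in> borel_measurable (completion \<nu>)"
proof (rule borel_measurable_completionI)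
 show "cutoff E u \<in> borel_measurable \<nu>" using cutoff_borel[OF E(1) assms] by simp
 show "AE x in \<nu>. u x = cutoff E u x" using configs by eventually_elim (simp add: cutoff_def)
qed

lemma D_iff: "u \<in> D \<longleftrightarrow> (\<exists>c. \<forall>g\<in>configs E. \<bar>u g\<bar> \<le> c) \<and> lipschitz_components E u \<and> Q u < \<infinity>"
 by (simp add: pre_dom_def lipschitz_components_def)

lemma D_l2: assumes u: "u \<in> D" shows "u \<in> l2_space \<nu>"
proof -
 obtain c where c: "\<And>g. g \<in> configs E ==> \<bar>u g\<bar> \<le> c" using u D_iff by blast
 have ae: "AE x in \<nu>. \<bar>u x\<bar> \<le> c" using configs by eventually_elim (rule c)
 show ?thesis by (rule bounded_l2[OF _ ae]) (use lipschitz_measurable u D_iff in blast)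
qed

lemma constant_components:
 assumes c: "\<And>k. \<exists>c. \<forall>g\<in>kconfigs E k. w g = c"
 shows "lipschitz_components E w" "Q w = 0"
proof -
 have L: "lipschitz_wrt d_config (kconfigs E k) 0 w" for k using c[of k] unfolding lipschitz_wrt_def by fastforce
 then show lc: "lipschitz_components E w" unfolding lipschitz_components_def by blast
 note sf = square_field_props[OF E lc]
 have "AE v in \<nu>. square_field E w w v = 0"
 proof (rule AE_LebI)
  have "{v \<in> space borel. square_field E w w v = 0} \<in> sets borel" using sf(1) by measurable
  then show "{v. square_field E w w v = 0} \<in> sets borel" by simp
  fix k
  have "weak_gradient k (interior E) (w \<circ> pts k) (%_ _. 0)"
   by (rule lipschitz_power.weak_gradient_constant[OF lipschitz_power_pts[OF E(1) L] refl])
  from sf(2)[OF this] show "AE x in Leb k. (\<forall>i<k. x i \<in> E) --> square_field E w w (pts k x) = 0" by simp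
 qed
 then have "(\<integral>\<^sup>+ g. ennreal (square_field E w w g) \<partial>\<nu>) = (\<integral>\<^sup>+ g. 0 \<partial>\<nu>)" by (intro nn_integral_cong_AE) (auto elim!: eventually_mono)
 then show "Q w = 0" by (simp add: pre_form_def)
qed

lemma constant_components_D:
 assumes "\<And>k. \<exists>c. \<forall>g\<in>kconfigs E k. w g = c" and "\<And>g. \<bar>w g\<bar> \<le> C" shows "w \<in> D"
 unfolding D_iff using constant_components[OF assms(1)] assms(2) by auto

lemma sq_sum_interpolation:
 fixes a b d :: real assumes "d > 0" shows "(a + b)\<^sup>2 \<le> (1 + d) * a\<^sup>2 + (1 + 1 / d) * b\<^sup>2"
proof -
 have "(1 + d) * a\<^sup>2 + (1 + 1 / d) * b\<^sup>2 - (a + b)\<^sup>2 = (d * a - b)\<^sup>2 / d" using assms by (simp add: power2_eq_square field_simps)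
 moreover have "\<dots> \<ge> 0" using assms by simp
 ultimately show ?thesis by linarith
qed

text \<open>The inequality holds pointwise for gradients on the labelled powers. Equivalence with
  Lebesgue measure carries it to the configuration measure, where it can be integrated.\<close>

lemma Q_diff:
 assumes u: "lipschitz_components E u" and v: "lipschitz_components E v" and d: "d > 0"
 shows "Q (%x. u x - v x) \<le> ennreal (1 + d) * Q u + ennreal (1 + 1 / d) * Q v"
proof -
 let ?w = "%x. u x - v x"
 let ?sf = "%w. square_field E w w"
 \<comment> \<open>Nonnegativity is part of the claim since the chosen versions are nonnegative only
   almost everywhere, and \<open>ennreal\<close> would cut off negative values.\<close>
 let ?P = "%c. ?sf ?w c \<le> (1 + d) * ?sf u c + (1 + 1 / d) * ?sf v c \<and> 0 \<le> ?sf u c \<and> 0 \<le> ?sf v c"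
 note [measurable] = square_field_props(1)[OF E u] square_field_props(1)[OF E v] square_field_props(1)[OF E lipschitz_components_diff[OF u v]]
 have "AE c in \<nu>. ?P c"
 proof (rule AE_LebI)
  have "{c \<in> space borel. ?P c} \<in> sets borel"
   by measurable
  then show "{c. ?P c} \<in> sets borel"
   by simp
  fix k
  obtain g h where g: "weak_gradient k (interior E) (u \<circ> pts k) g" and h: "weak_gradient k (interior E) (v \<circ> pts k) h"
   using square_field_props(3)[OF E u] square_field_props(3)[OF E v] by blast
  have "weak_gradient k (interior E) (?w \<circ> pts k) (%x i. g x i - h x i)"
   using weak_gradient_diff[OF g h] by (simp add: comp_def)
  from square_field_props(2)[OF E lipschitz_components_diff[OF u v] this] square_field_props(2)[OF E u g] square_field_props(2)[OF E v h]
  show "AE x in Leb k. (\<forall>i<k. x i \<in> E) --> ?P (pts k x)"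
  proof eventually_elim
   case (elim x)
   show ?case
   proof
    assume x: "\<forall>i<k. x i \<in> E"
    have "(norm (g x i - h x i))\<^sup>2 \<le> (1 + d) * (norm (g x i))\<^sup>2 + (1 + 1 / d) * (norm (h x i))\<^sup>2" for i
     by (rule order_trans[OF power_mono[OF norm_triangle_ineq4 norm_ge_zero] sq_sum_interpolation[OF d]])
    then have "(\<Sum>i<k. (norm (g x i - h x i))\<^sup>2) \<le> (\<Sum>i<k. (1 + d) * (norm (g x i))\<^sup>2 + (1 + 1 / d) * (norm (h x i))\<^sup>2)" by (intro sum_mono)
    also have "\<dots> = (1 + d) * (\<Sum>i<k. (norm (g x i))\<^sup>2) + (1 + 1 / d) * (\<Sum>i<k. (norm (h x i))\<^sup>2)"
     by (simp only: sum.distrib sum_distrib_left)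
    finally show "?P (pts k x)"
     using elim x by (simp add: sum_nonneg)
   qed
  qed
 qed
 then have "AE c in \<nu>. ennreal (?sf ?w c) \<le> ennreal (1 + d) * ennreal (?sf u c) + ennreal (1 + 1 / d) * ennreal (?sf v c)"
 proof eventually_elim
  case (elim c)
  have "ennreal (?sf ?w c) \<le> ennreal ((1 + d) * ?sf u c + (1 + 1 / d) * ?sf v c)"
   using elim by (intro ennreal_leI) blast
  also have "\<dots> = ennreal (1 + d) * ennreal (?sf u c) + ennreal (1 + 1 / d) * ennreal (?sf v c)"
   using elim d by (subst ennreal_plus) (simp_all add: ennreal_mult)
  finally show ?case .
 qed
 then have "Q ?w \<le> (\<integral>\<^sup>+ c. ennreal (1 + d) * ennreal (?sf u c) + ennreal (1 + 1 / d) * ennreal (?sf v c) \<partial>\<nu>)"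
  unfolding pre_form_def by (rule nn_integral_mono_AE)
 also have "\<dots> = ennreal (1 + d) * Q u + ennreal (1 + 1 / d) * Q v"
  unfolding pre_form_def by (subst nn_integral_add) (simp_all add: nn_integral_cmult)
 finally show ?thesis .
qed

lemma quadratic: "quadratic_like \<nu> Q D"
 unfolding quadratic_like_def
proof (intro conjI ballI allI impI)
 show "D \<subseteq> l2_space \<nu>" using D_l2 by blast
 show "(%_. 0) \<in> D" by (rule constant_components_D[of _ 0]) auto
 show "Q (%_. 0) = 0" by (rule constant_components(2)) auto
 fix u assume u: "u \<in> D"
 then show "Q u < \<infinity>" by (simp add: D_iff)
 fix v assume v: "v \<in> D"
 have l: "lipschitz_components E u" "lipschitz_components E v" using u v by (simp_all add: D_iff)
 show "Q (%x. u x - v x) \<le> ennreal (1 + d) * Q u + ennreal (1 + 1 / d) * Q v" if "d > 0" for d by (rule Q_diff[OF l that])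
 have "Q (%x. u x - v x) \<le> ennreal (1 + 1) * Q u + ennreal (1 + 1 / 1) * Q v" by (rule Q_diff[OF l]) simp
 also have "\<dots> < \<infinity>" using u v by (simp add: D_iff ennreal_mult_less_top)
 finally have f: "Q (%x. u x - v x) < \<infinity>" .
 obtain c1 c2 where c: "\<forall>g\<in>configs E. \<bar>u g\<bar> \<le> c1" "\<forall>g\<in>configs E. \<bar>v g\<bar> \<le> c2" using u v by (auto simp: D_iff)
 have "\<forall>g\<in>configs E. \<bar>u g - v g\<bar> \<le> c1 + c2" using c by (auto dest!: bspec)
 then show "(%x. u x - v x) \<in> D" using f lipschitz_components_diff[OF l] unfolding D_iff by blast
qed

end

lemma (in conditioned) AE_comparable:
 assumes cac: "CAC' B \<mu> \<kappa>"
 shows "AE g in \<mu>. comparable (B r) (\<nu> r g)"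
proof -
 note Bp = exhaustion_sets[OF exh]
 have "AE g in \<mu>. \<forall>k \<in> charged_numbers B \<kappa> r g.
    absolutely_continuous (restr_k (\<nu> r g) (B r) k) (restr_k (poisson_config (B r)) (B r) k) \<and>
    absolutely_continuous (restr_k (poisson_config (B r)) (B r) k) (restr_k (\<nu> r g) (B r) k)"
  using cac unfolding CAC'_def by blast
 then show ?thesis
 proof eventually_elim
  case (elim g)
  note e = emeasure_restr_k[OF sets_cond Bp(1)]
  have iff: "emeasure (\<nu> r g) (kconfigs (B r) k \<inter> A) = 0 \<longleftrightarrow> (AE x in Leb k. (\<forall>i<k. x i \<in> B r) --> pts k x \<notin> A)"
   if k: "k \<in> charged_numbers B \<kappa> r g" and A: "A \<in> sets borel" for k A
  proof -
   have s: "A \<in> sets (restr_k (\<nu> r g) (B r) k)" "A \<in> sets (restr_k (poisson_config (B r)) (B r) k)"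
    using A by (simp_all add: restr_k_def emeasure_poisson(1))
   have "A \<in> null_sets (restr_k (\<nu> r g) (B r) k) \<longleftrightarrow> A \<in> null_sets (restr_k (poisson_config (B r)) (B r) k)"
    using elim k unfolding absolutely_continuous_def by blast
   then show ?thesis unfolding null_sets_def using s poisson_null_iff[OF Bp(1,2) A] e[OF A] by simp
  qed
  show ?case
  proof (rule comparable.intro)
   show "compact (B r)" "convex (B r)" by (rule Bp)+
   show "sets (\<nu> r g) = sets borel" by simp
   show "prob_space (\<nu> r g)" by (rule prob_cond)
   show "AE c in \<nu> r g. c \<in> configs (B r)" by (rule cond_configs)
   fix k and A :: "'a config set" assume A: "A \<in> sets borel"
   show "emeasure (\<nu> r g) (kconfigs (B r) k \<inter> A) = 0" if ae: "AE x in Leb k. (\<forall>i<k. x i \<in> B r) --> pts k x \<notin> A"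
   proof (cases "k \<in> charged_numbers B \<kappa> r g")
    case True then show ?thesis using iff A ae by blast
   next
    case False
    then have "emeasure (\<nu> r g) (kconfigs (B r) k) = 0" by (simp add: charged_numbers_def zero_less_iff_neq_zero)
    then show ?thesis using emeasure_mono[of "kconfigs (B r) k \<inter> A" "kconfigs (B r) k" "\<nu> r g"] kconfigs_borel[OF Bp(1)] by simp
   qed
   show "AE x in Leb k. (\<forall>i<k. x i \<in> B r) --> pts k x \<notin> A"
    if "emeasure (\<nu> r g) (kconfigs (B r) k) > 0" "emeasure (\<nu> r g) (kconfigs (B r) k \<inter> A) = 0"
    using iff[of k A] that A by (simp add: charged_numbers_def)
  qed
 qed
qed

section \<open>Versions of the point-wise gradient\<close>

lemma points_in_add_outside:
 assumes E: "E \<in> sets borel"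
 shows "points_in E (config_add g (restr (- E) c)) = points_in E g"
proof -
 have "cnt (restr (- E) c) {y} = 0" if "y \<in> E" for y
  using that E by (subst cnt_restr) auto
 then show ?thesis unfolding points_in_def by (auto simp: emeasure_config_add)
qed

lemma remove_point_add_outside:
 assumes E: "E \<in> sets borel" and y: "y \<in> E"
 shows "restr (- {y}) (config_add g (restr (- E) c)) = config_add (restr (- {y}) g) (restr (- E) c)"
proof (rule config_eqI)
 fix A :: "'a set" assume A: "A \<in> sets borel"
 have "- E \<inter> (- {y} \<inter> A) = - E \<inter> A" using y by auto
 then show "cnt (restr (- {y}) (config_add g (restr (- E) c))) A = cnt (config_add (restr (- {y}) g) (restr (- E) c)) A"
  using A E by (simp add: cnt_restr emeasure_config_add)
qed

lemma measurable_cfg_without: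
 "(%x. cfg ({..<k} - {i}) x) \<in> measurable (Leb k) (borel :: 'a::euclidean_space config measure)"
proof (rule measurable_configI)
 fix A :: "'a set" assume A [measurable]: "A \<in> sets borel"
 have "(%x. indicator A (x j) :: ennreal) \<in> borel_measurable (Leb k)" if "j \<in> {..<k} - {i}" for j
 proof -
  have "(%x. x j) \<in> borel_measurable (Leb k :: (nat => 'a) measure)"
   using measurable_component_singleton[of j "{..<k}" "%_. lborel :: 'a measure"] that by simp
  from measurable_compose[OF this borel_measurable_indicator[of A borel]] show ?thesis using A by simp
 qed
 then show "(%x. cnt (cfg ({..<k} - {i}) x) A) \<in> borel_measurable (Leb k)"
  using A by (simp add: cnt_cfg_finite borel_measurable_sum)
qed

lemma AE_Leb_1:
 fixes S :: "'a::euclidean_space set"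
 assumes S: "S \<in> sets borel" and ae: "AE x in Leb 1. x 0 \<notin> S" shows "emeasure lborel S = 0"
proof -
 have "cube 1 S \<in> null_sets (Leb 1)"
  using AE_iff_null_sets[of "cube 1 S" "Leb 1"] ae PiE_in_Leb[of 1 "%_. S"] S
  by (auto simp: PiE_iff elim!: eventually_mono)
 moreover have "emeasure (Leb 1) (cube 1 S) = emeasure lborel S" by (subst emeasure_Leb) (use S in simp_all)
 ultimately show ?thesis by (simp add: null_sets_def)
qed

context conditioned
begin

text \<open>For fixed surroundings two versions agree at Lebesgue-almost every position, but the
  actual point of a configuration is a single position. The claim therefore needs an average over
  that point given the others, which Fubini on the labelled power provides.\<close>

lemma gradient_versions_agree:
 assumes cac: "CAC' B \<mu> \<kappa>" and rr: "r \<le> r'" and D: "is_gradient_version B \<mu> r u D" and D': "is_gradient_version B \<mu> r' u D'"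
 shows "AE g in \<mu>. \<forall>x\<in>points_in (B r) g. D (restr (- {x}) g) x = D' (restr (- {x}) g) x"
proof -
 note Bp = exhaustion_sets[OF exh]
 note [measurable] = Bp(1)
 define N where "N = {p. snd p \<in> B r \<and> D (fst p) (snd p) \<noteq> D' (fst p) (snd p)}"
 have Dm [measurable]: "(%p. D (fst p) (snd p)) \<in> borel_measurable (borel \<Otimes>\<^sub>M borel)" "(%p. D' (fst p) (snd p)) \<in> borel_measurable (borel \<Otimes>\<^sub>M borel)"
  using D D' by (simp_all add: is_gradient_version_def case_prod_beta')
 have "{p \<in> space (borel \<Otimes>\<^sub>M borel). snd p \<in> B r \<and> D (fst p) (snd p) \<noteq> D' (fst p) (snd p)} \<in> sets (borel \<Otimes>\<^sub>M borel)" by measurable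
 then have N [measurable]: "N \<in> sets (borel \<Otimes>\<^sub>M borel)" by (simp add: N_def space_pair_measure)
 have N_sect: "{y. (n, y) \<in> N} \<in> sets borel" for n
  using sets_Pair1[OF N, of n] by (simp add: vimage_def)
 \<comment> \<open>The measure of the bad positions for a point added to \<open>n\<close>; it
   vanishes whenever both versions are weak gradients of the same function on
   \<open>B r\<close>.\<close>
 define q where "q n = (\<integral>\<^sup>+ y. indicator N (n, y) \<partial>lborel)" for n
 have \<psi>m [measurable]: "q \<in> borel_measurable borel"
  unfolding q_def[abs_def] by (rule lborel.borel_measurable_nn_integral) measurable
 have \<psi>N: "q n = emeasure lborel {y. (n, y) \<in> N}" for n
 proof -
  have "q n = (\<integral>\<^sup>+ y. indicator {y. (n, y) \<in> N} y \<partial>lborel)" unfolding q_def by (rule nn_integral_cong) (simp add: indicator_def)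
  then show ?thesis using N_sect[of n] by simp
 qed
 have \<psi>0: "q n = 0" if w: "weak_gradient 1 (interior (B r)) f (%y i. D n (y 0))" "weak_gradient 1 (interior (B r)) f (%y i. D' n (y 0))" for n f
 proof -
  have "AE y in Leb 1. y 0 \<notin> {y. (n, y) \<in> N}"
   using weak_gradient_unique[OF open_interior w refl] AE_Leb_interior[OF Bp(3,4)[of r], of 1]
   by eventually_elim (auto simp: N_def)
  then show ?thesis unfolding \<psi>N by (rule AE_Leb_1[OF N_sect])
 qed
 define Z where "Z = {g. (\<Sum>x\<in>points_in (B r) g. indicator N (restr (- {x}) g, x) :: ennreal) = 0}"
 \<comment> \<open>The intermediate event: after removal of any point in \<open>B r\<close> the bad
   positions form a null set. It follows from the definition of a gradient version, whereas
   \<open>Z\<close> says that the actual points avoid the bad positions.\<close>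
 define Z' where "Z' = {g. (\<Sum>x\<in>points_in (B r) g. q (fst (restr (- {x}) g, x))) = 0}"
 have "{g \<in> space borel. (\<Sum>x\<in>points_in (B r) g. indicator N (restr (- {x}) g, x) :: ennreal) = 0} \<in> sets borel"
  using measurable_point_sum[OF Bp(1,2), of "indicator N" r] N by measurable
 then have Zb: "Z \<in> sets borel" by (simp add: Z_def)
 have "(%p :: 'a config \<times> 'a. q (fst p)) \<in> borel_measurable (borel \<Otimes>\<^sub>M borel)" by measurable
 from measurable_point_sum[OF Bp(1,2) this, of r]
 have "{g \<in> space borel. (\<Sum>x\<in>points_in (B r) g. q (fst (restr (- {x}) g, x))) = 0} \<in> sets borel" by measurable
 then have Zb': "Z' \<in> sets borel" by (simp add: Z'_def)
 have fin: "finite (points_in (B r) g)" for g by (rule finite_points_in[OF Bp(2)])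
 have Z_iff: "g \<in> Z \<longleftrightarrow> (\<forall>x\<in>points_in (B r) g. (restr (- {x}) g, x) \<notin> N)" for g
  unfolding Z_def using fin[of g] by (auto simp: sum_eq_0_iff indicator_def)
 have Z'_iff: "g \<in> Z' \<longleftrightarrow> (\<forall>x\<in>points_in (B r) g. q (restr (- {x}) g) = 0)" for g
  unfolding Z'_def using fin[of g] by (simp add: sum_eq_0_iff)
 have BB: "B r \<subseteq> B r'" by (rule Bp(5)[OF rr])
 have wD: "AE g in \<mu>. \<forall>x \<in> points_in (B r) g.
    weak_gradient 1 (interior (B r)) (%y. point_variation u g x (y 0)) (%y i. D (restr (- {x}) g) (y 0))"
  using D by (simp add: is_gradient_version_def)
 have wD': "AE g in \<mu>. \<forall>x \<in> points_in (B r') g.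
    weak_gradient 1 (interior (B r')) (%y. point_variation u g x (y 0)) (%y i. D' (restr (- {x}) g) (y 0))"
  using D' by (simp add: is_gradient_version_def)
 have AEZ': "AE g in \<mu>. g \<in> Z'"
  using wD wD'
 proof eventually_elim
  case (elim g)
  show ?case unfolding Z'_iff
  proof
   fix x assume x: "x \<in> points_in (B r) g"
   then have x': "x \<in> points_in (B r') g" using BB by (auto simp: points_in_def)
   show "q (restr (- {x}) g) = 0"
    by (rule \<psi>0[OF elim(1)[rule_format, OF x] weak_gradient_mono[OF elim(2)[rule_format, OF x'] interior_mono[OF BB]]])
  qed
 qed
 have "AE g in \<mu>. g \<in> Z"
 proof (rule AE_condD)
  show "{g. g \<in> Z} \<in> sets borel" using Zb by simp
  show "AE v in \<mu>. AE h in \<nu> r v. config_add h (restr (- B r) v) \<in> Z"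
   using AE_comparable[OF cac, of r] AE_cond[OF AEZ', of r]
  proof eventually_elim
   case (elim v)
   interpret c: comparable "B r" "\<nu> r v" by (rule elim(1))
   let ?t = "restr (- B r) v"
   have mb: "{h. config_add h ?t \<in> S} \<in> sets borel" if "S \<in> sets borel" for S
    using measurable_sets[OF measurable_glue[of ?t] that] by (simp add: vimage_def)
   show ?case
   proof (rule c.AE_LebI)
    show "{h. config_add h ?t \<in> Z} \<in> sets borel" by (rule mb[OF Zb])
    fix k assume k: "0 < emeasure (\<nu> r v) (kconfigs (B r) k)"
    have ae': "AE x in Leb k. (\<forall>i<k. x i \<in> B r) --> config_add (pts k x) ?t \<in> Z'"
     by (rule c.AE_LebD[OF mb[OF Zb'] elim(2) k])
    define n where "n i x = config_add (cfg ({..<k} - {i}) x) ?t" for i and x :: "nat => 'a"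
    have \<omega>m [measurable]: "n i \<in> borel_measurable (Leb k)" for i
     unfolding n_def by (intro measurable_config_add measurable_cfg_without) simp
    have ai: "AE x in Leb k. \<not> ((n i x, x i) \<in> N \<and> q (n i x) = 0)" if i: "i < k" for i
    proof -
     have [measurable]: "(%x. x i) \<in> borel_measurable (Leb k :: (nat => 'a) measure)"
      using measurable_component_singleton[of i "{..<k}" "%_. lborel :: 'a measure"] i by simp
     \<comment> \<open>Coordinate \<open>i\<close> sits at a bad position although the bad positions
       are negligible. The surroundings \<open>n i x\<close> do not depend on \<open>x i\<close>, so
       the integral over that coordinate is 0.\<close>
     define T where "T = {x \<in> space (Leb k). (n i x, x i) \<in> N \<and> q (n i x) = 0}"
     have T [measurable]: "T \<in> sets (Leb k)" unfolding T_def by measurable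
     have "emeasure (Leb k) T = (\<integral>\<^sup>+ x. indicator T x \<partial>Leb k)" using T by simp
     also have "\<dots> = (\<integral>\<^sup>+ x. \<integral>\<^sup>+ y. indicator T (x(i := y)) \<partial>lborel \<partial>PiM ({..<k} - {i}) (%_. lborel))"
      by (rule Leb_split[OF i]) measurable
     also have "\<dots> = (\<integral>\<^sup>+ x. 0 \<partial>PiM ({..<k} - {i}) (%_. lborel :: 'a measure))"
     proof (rule nn_integral_cong)
      fix x :: "nat => 'a"
      have \<omega>i: "n i (x(i := y)) = n i x" for y unfolding n_def by (rule arg_cong2[OF cfg_cong refl]) simp
      show "(\<integral>\<^sup>+ y. indicator T (x(i := y)) \<partial>lborel) = 0"
      proof (cases "q (n i x) = 0")
       case True
       have "(\<integral>\<^sup>+ y. indicator T (x(i := y)) \<partial>lborel) \<le> (\<integral>\<^sup>+ y. indicator N (n i x, y) \<partial>lborel)"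
        by (intro nn_integral_mono) (auto simp: T_def \<omega>i indicator_def)
       then show ?thesis using True by (simp add: q_def)
      next
       case False
       then have "indicator T (x(i := y)) = (0 :: ennreal)" for y by (simp add: T_def \<omega>i)
       then show ?thesis by simp
      qed
     qed
     finally have "T \<in> null_sets (Leb k)" using T by (simp add: null_sets_def)
     then show ?thesis by (rule AE_I') (auto simp: T_def)
    qed
    have "AE x in Leb k. \<forall>i\<in>{..<k}. \<not> ((n i x, x i) \<in> N \<and> q (n i x) = 0)" by (intro AE_finite_allI ai) auto
    then show "AE x in Leb k. (\<forall>i<k. x i \<in> B r) --> config_add (pts k x) ?t \<in> Z"
     using ae' AE_Leb_distinct[of k]
    proof eventually_elim
     case (elim x)
     show ?case
     proof
      assume x: "\<forall>i<k. x i \<in> B r"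
      have pe: "points_in (B r) (config_add (pts k x) ?t) = x ` {..<k}"
       unfolding points_in_add_outside[OF Bp(1)] by (rule points_in_pts) (use x in blast)
      have rem: "restr (- {x i}) (config_add (pts k x) ?t) = n i x" if i: "i < k" for i
      proof -
       have "restr (- {x i}) (pts k x) = cfg ({..<k} - {i}) x" by (rule remove_point_pts[OF i]) (use elim(3) i in blast)
       then show ?thesis unfolding n_def using remove_point_add_outside[OF Bp(1), of "x i" r "pts k x" v] x i by simp
      qed
      have z': "config_add (pts k x) ?t \<in> Z'" using elim(2) x by blast
      show "config_add (pts k x) ?t \<in> Z" unfolding Z_iff pe
      proof
       fix y assume "y \<in> x ` {..<k}"
       then obtain i where i: "i < k" "y = x i" by auto
       have "q (n i x) = 0" using z' i unfolding Z'_iff pe by (auto simp: rem)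
       then show "(restr (- {y}) (config_add (pts k x) ?t), y) \<notin> N" unfolding i(2) rem[OF i(1)] using elim(1) i by auto
      qed
     qed
    qed
   qed
  qed
 qed
 then show ?thesis
  by eventually_elim (auto simp: Z_iff N_def points_in_def)
qed

lemma trunc_square_field_mono:
 assumes cac: "CAC' B \<mu> \<kappa>" and rr: "r \<le> r'"
  and D: "\<exists>D. is_gradient_version B \<mu> r u D" and D': "\<exists>D. is_gradient_version B \<mu> r' u D"
 shows "AE g in \<mu>. trunc_square_field B \<mu> r u g \<le> trunc_square_field B \<mu> r' u g"
 using gradient_versions_agree[OF cac rr someI_ex[OF D] someI_ex[OF D']]
proof eventually_elim
 case (elim g)
 note Bp = exhaustion_sets[OF exh]
 let ?D = "SOME D. is_gradient_version B \<mu> r u D" and ?D' = "SOME D. is_gradient_version B \<mu> r' u D"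
 have sub: "points_in (B r) g \<subseteq> points_in (B r') g" using Bp(5)[OF rr] by (auto simp: points_in_def)
 have "trunc_square_field B \<mu> r u g = (\<Sum>x\<in>points_in (B r) g. (norm (?D' (restr (- {x}) g) x))\<^sup>2)"
  unfolding trunc_square_field_def by (rule sum.cong) (simp_all add: elim)
 also have "\<dots> \<le> trunc_square_field B \<mu> r' u g"
  unfolding trunc_square_field_def by (rule sum_mono2[OF finite_points_in[OF Bp(2)] sub]) simp
 finally show ?case .
qed

end

section \<open>Representation of the truncated forms\<close>

text \<open>Borel-Cantelli by weights: multiplied by \<open>4^j\<close> the integrals
  \<open>16^-j\<close> are still summable, so almost everywhere the weighted terms tend to
  0.\<close>

lemma tendsto_0_of_nn_integral_sum:
 fixes h :: "nat => 'x => ennreal"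
 assumes h: "\<And>j. h j \<in> borel_measurable M" and b: "\<And>j. (\<integral>\<^sup>+ x. h j x \<partial>M) \<le> ennreal ((1 / 16) ^ j)"
 shows "AE x in M. \<forall>\<^sub>F j in sequentially. h j x \<le> ennreal ((1 / 4) ^ j)"
proof -
 have "(\<integral>\<^sup>+ x. (\<Sum>j. ennreal (4 ^ j) * h j x) \<partial>M) = (\<Sum>j. \<integral>\<^sup>+ x. ennreal (4 ^ j) * h j x \<partial>M)"
  using h by (intro nn_integral_suminf) measurable
 also have "\<dots> \<le> (\<Sum>j. ennreal ((1 / 4) ^ j))"
 proof (intro suminf_le summableI)
  fix j
  have "(\<integral>\<^sup>+ x. ennreal (4 ^ j) * h j x \<partial>M) = ennreal (4 ^ j) * (\<integral>\<^sup>+ x. h j x \<partial>M)" by (rule nn_integral_cmult[OF h])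
  also have "\<dots> \<le> ennreal (4 ^ j) * ennreal ((1 / 16) ^ j)" by (rule mult_left_mono[OF b]) simp
  also have "\<dots> = ennreal ((1 / 4) ^ j)" by (simp add: ennreal_mult[symmetric] power_mult_distrib[symmetric])
  finally show "(\<integral>\<^sup>+ x. ennreal (4 ^ j) * h j x \<partial>M) \<le> ennreal ((1 / 4) ^ j)" .
 qed
 also have "\<dots> < \<infinity>" by (subst suminf_ennreal2) (auto intro: summable_geometric)
 finally have fin: "(\<integral>\<^sup>+ x. (\<Sum>j. ennreal (4 ^ j) * h j x) \<partial>M) \<noteq> \<infinity>" by simp
 have "AE x in M. (\<Sum>j. ennreal (4 ^ j) * h j x) \<noteq> \<infinity>" by (rule nn_integral_PInf_AE[OF _ fin]) (use h in measurable)
 then show ?thesis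
 proof eventually_elim
  case (elim x)
  have ne: "ennreal (4 ^ j) * h j x \<noteq> \<infinity>" for j
   using elim sum_le_suminf[OF summableI, of "{j}" "%j. ennreal (4 ^ j) * h j x"] by (auto simp: top_unique)
  define f where "f j = enn2real (ennreal (4 ^ j) * h j x)" for j
  have fe: "ennreal (f j) = ennreal (4 ^ j) * h j x" for j using ne[of j] by (simp add: f_def less_top)
  have "summable f" by (rule summable_suminf_not_top) (use elim fe in \<open>simp_all add: f_def\<close>)
  then have "f \<longlonglongrightarrow> 0" by (rule summable_LIMSEQ_zero)
  then have "\<forall>\<^sub>F j in sequentially. f j < 1" by (rule order_tendstoD) simp
  then show ?case
  proof eventually_elim
   case (elim j)
   have "h j x = ennreal ((1 / 4) ^ j) * (ennreal (4 ^ j) * h j x)"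
    by (simp add: mult.assoc[symmetric] ennreal_mult[symmetric] power_mult_distrib[symmetric])
   also have "\<dots> \<le> ennreal ((1 / 4) ^ j) * 1"
    unfolding fe[symmetric] using elim by (intro mult_left_mono) (simp_all add: ennreal_le_1)
   finally show ?case by simp
  qed
 qed
qed

text \<open>The square root of the form obeys the triangle inequality and turns \<open>4^-j\<close>
  into the summable \<open>2^-j\<close>.\<close>

lemma (in quadratic_form) Cauchy_of_geometric:
 assumes un: "\<And>n. un n \<in> D" and ev: "\<forall>\<^sub>F j in sequentially. E (%x. un (Suc j) x - un j x) \<le> ennreal ((1 / 4) ^ j)"
 shows "form_Cauchy E un"
proof -
 obtain J where J: "\<And>j. J \<le> j ==> E (%x. un (Suc j) x - un j x) \<le> ennreal ((1 / 4) ^ j)"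
  using ev unfolding eventually_sequentially by blast
 have step: "s (%x. un (Suc j) x - un j x) \<le> (1 / 2) ^ j" if "J \<le> j" for j
 proof -
  have "enn2real (E (%x. un (Suc j) x - un j x)) \<le> (1 / 4) ^ j" using enn2real_mono[OF J[OF that]] by simp
  then have "sqrt (enn2real (E (%x. un (Suc j) x - un j x))) \<le> sqrt ((1 / 4) ^ j)" by simp
  also have "\<dots> = (1 / 2) ^ j" by (simp add: real_sqrt_power real_sqrt_divide)
  finally show ?thesis by (simp add: s_def)
 qed
 have far: "s (%x. un (j + i) x - un j x) \<le> 2 * (1 / 2) ^ j" if j: "J \<le> j" for i j
 proof -
  have "s (%x. un (j + i) x - un j x) \<le> 2 * (1 / 2) ^ j - 2 * (1 / 2) ^ (j + i)"
  proof (induction i)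
   case 0
   then show ?case by (simp add: s_0)
  next
   case (Suc i)
   have "s (%x. un (j + Suc i) x - un j x) \<le> s (%x. un (Suc (j + i)) x - un (j + i) x) + s (%x. un (j + i) x - un j x)"
    using s_tri[OF un un un, of "Suc (j + i)" j "j + i"] by simp
   also have "\<dots> \<le> (1 / 2) ^ (j + i) + (2 * (1 / 2) ^ j - 2 * (1 / 2) ^ (j + i))" using Suc step[of "j + i"] j by (intro add_mono) auto
   also have "\<dots> = 2 * (1 / 2) ^ j - 2 * (1 / 2) ^ (j + Suc i)" by simp
   finally show ?case .
  qed
  moreover have "0 \<le> 2 * (1 / 2 :: real) ^ (j + i)" by simp
  ultimately show ?thesis by linarith
 qed
 show ?thesis unfolding Cauchy_iff[OF un]
 proof (intro allI impI)
  fix e :: real assume e: "0 < e"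
  have "(%j. 4 * (1 / 2 :: real) ^ j) \<longlonglongrightarrow> 4 * 0" by (intro tendsto_mult tendsto_const LIMSEQ_power_zero) simp
  then have "\<forall>\<^sub>F j in sequentially. 4 * (1 / 2 :: real) ^ j < e" using e by (intro order_tendstoD(2)[of _ 0]) auto
  then obtain N' where N': "\<And>j. N' \<le> j ==> 4 * (1 / 2 :: real) ^ j < e" unfolding eventually_sequentially by blast
  let ?N = "max J N'"
  have "s (%x. un m x - un n x) < e" if "m \<ge> ?N" "n \<ge> ?N" for m n
  proof -
   have a: "s (%x. un m x - un ?N x) \<le> 2 * (1 / 2) ^ ?N" "s (%x. un n x - un ?N x) \<le> 2 * (1 / 2) ^ ?N"
    using far[of ?N "m - ?N"] far[of ?N "n - ?N"] that by simp_all
   have "s (%x. un m x - un n x) \<le> s (%x. un m x - un ?N x) + s (%x. un ?N x - un n x)" by (rule s_tri[OF un un un])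
   also have "s (%x. un ?N x - un n x) = s (%x. un n x - un ?N x)" by (rule s_minus_commute[OF un un])
   finally have "s (%x. un m x - un n x) \<le> 4 * (1 / 2) ^ ?N" using a by linarith
   then show ?thesis using N'[of ?N] by simp
  qed
  then show "\<exists>N. \<forall>m\<ge>N. \<forall>n\<ge>N. s (%x. un m x - un n x) < e" by blast
 qed
qed

lemma (in quadratic_form) E_tendsto:
 assumes un: "\<And>n. un n \<in> D" and u: "u \<in> D" and l: "(%n. E (%x. un n x - u x)) \<longlonglongrightarrow> 0"
 shows "(%n. E (un n)) \<longlonglongrightarrow> E u"
proof -
 have "(%n. s (%x. un n x - u x)) \<longlonglongrightarrow> 0" using l by (simp only: tendsto_0_iff[of "%n x. un n x - u x", OF D_diff[OF un u]])
 then have "(%n. s (un n) - s u) \<longlonglongrightarrow> 0"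
  by (rule Lim_null_comparison[rotated]) (use s_rev[OF un u] in \<open>simp add: eventually_sequentially\<close>)
 then have "(%n. s (un n)) \<longlonglongrightarrow> s u" by (rule LIM_zero_cancel)
 then have "(%n. ennreal ((s (un n))\<^sup>2)) \<longlonglongrightarrow> ennreal ((s u)\<^sup>2)" by (intro tendsto_ennrealI tendsto_power)
 then show ?thesis using E_eq[OF un] E_eq[OF u] by simp
qed

locale cored = conditioned +
 fixes C :: "nat => ('a config => real) set"
 assumes cac: "CAC' B \<mu> \<kappa>" and cc: "CC B \<mu> \<kappa>" and core: "core_system B \<mu> \<kappa> C"
begin

abbreviation "cform r \<eta> u \<equiv> cond_form (B r) (\<nu> r \<eta>) (cond_fun B r \<eta> u)"
abbreviation "Tr r \<equiv> trunc_pre_form B \<mu> \<kappa> r"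

lemma AE_closable: "AE g in \<mu>. closable_quadratic_form (\<nu> r g) (pre_form (B r) (\<nu> r g)) (pre_dom (B r) (\<nu> r g))"
proof -
 have "AE g in \<mu>. closable_form (\<nu> r g) (pre_form (B r) (\<nu> r g)) (pre_dom (B r) (\<nu> r g))"
  using cc unfolding CC_def by blast
 then show ?thesis using AE_comparable[OF cac, of r]
  by eventually_elim (simp add: closable_quadratic_form_def closable_quadratic_form_axioms_def quadratic_form_def comparable.quadratic)
qed

lemma core_props:
 assumes "u \<in> C r"
 shows "AE w in \<mu>. cond_fun B r w u \<in> cond_dom (B r) (\<nu> r w)"
  "(%w. cform r w u) \<in> borel_measurable (completion \<mu>)" "Tr r u < \<infinity>"
  "Tr r u = (\<integral>\<^sup>+ g. ennreal (trunc_square_field B \<mu> r u g) \<partial>completion \<mu>)"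
  "\<exists>D. is_gradient_version B \<mu> r u D" "u \<in> borel_measurable (completion \<mu>)" "\<exists>c. AE g in \<mu>. \<bar>u g\<bar> \<le> c"
 using core assms unfolding core_system_def class_saturated_def by blast+

lemma core_mono: "r \<le> r' ==> C r' \<subseteq> C r" using core unfolding core_system_def by blast

lemma core_linear: "linear_subspace (C r)" using core unfolding core_system_def by blast

lemma core_diff: assumes "u \<in> C r" "v \<in> C r" shows "(%x. u x - v x) \<in> C r"
proof -
 have add: "(%x. f x + g x) \<in> C r" if "f \<in> C r" "g \<in> C r" for f g
  using core_linear[of r] that unfolding linear_subspace_def by blast
 have "(%x. - 1 * v x) \<in> C r" using core_linear[of r] assms(2) unfolding linear_subspace_def by blast
 from add[OF assms(1) this] show ?thesis by simp
qed

lemma cond_fun_diff: "cond_fun B r g (%x. u x - v x) = (%x. cond_fun B r g u x - cond_fun B r g v x)"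
 by (simp add: cond_fun_def)

lemma core_l2: "u \<in> C r ==> u \<in> l2_space \<mu>"
 using core_props(6,7) bounded_l2 by blast

lemma integrated_quadratic:
 assumes m: "(%g. cform r g u) \<in> borel_measurable (completion \<mu>)" "(%g. cform r g v) \<in> borel_measurable (completion \<mu>)"
  and d: "AE g in \<mu>. cond_fun B r g u \<in> cond_dom (B r) (\<nu> r g)" "AE g in \<mu>. cond_fun B r g v \<in> cond_dom (B r) (\<nu> r g)" and e: "e > 0"
 shows "Tr r (%x. u x - v x) \<le> ennreal (1 + e) * Tr r u + ennreal (1 + 1 / e) * Tr r v"
proof -
 have "AE g in completion \<mu>. cform r g (%x. u x - v x) \<le> ennreal (1 + e) * cform r g u + ennreal (1 + 1 / e) * cform r g v"
  unfolding AE_completion_iff using AE_closable[of r] d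
 proof eventually_elim
  case (elim g)
  interpret q: closable_quadratic_form "\<nu> r g" "pre_form (B r) (\<nu> r g)" "pre_dom (B r) (\<nu> r g)" by (rule elim(1))
  show ?case unfolding cond_fun_diff cond_form_def
   by (rule q.cl.E_diff[OF elim(2)[unfolded cond_dom_def] elim(3)[unfolded cond_dom_def] e])
 qed
 then have "Tr r (%x. u x - v x) \<le> (\<integral>\<^sup>+ g. ennreal (1 + e) * cform r g u + ennreal (1 + 1 / e) * cform r g v \<partial>completion \<mu>)"
  unfolding trunc_pre_form_def by (rule nn_integral_mono_AE)
 also have "\<dots> = (\<integral>\<^sup>+ g. ennreal (1 + e) * cform r g u \<partial>completion \<mu>) + (\<integral>\<^sup>+ g. ennreal (1 + 1 / e) * cform r g v \<partial>completion \<mu>)"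
 proof (rule nn_integral_add)
  show "(%g. ennreal (1 + e) * cform r g u) \<in> borel_measurable (completion \<mu>)" using m(1) by measurable
  show "(%g. ennreal (1 + 1 / e) * cform r g v) \<in> borel_measurable (completion \<mu>)" using m(2) by measurable
 qed
 also have "\<dots> = ennreal (1 + e) * Tr r u + ennreal (1 + 1 / e) * Tr r v"
  unfolding trunc_pre_form_def using m by (simp only: nn_integral_cmult)
 finally show ?thesis .
qed

lemma core_quadratic: "quadratic_like \<mu> (Tr r) (C r)"
 unfolding quadratic_like_def
proof (intro conjI ballI allI impI)
 show "C r \<subseteq> l2_space \<mu>" using core_l2 by blast
 show z: "(%_. 0) \<in> C r" using core_linear unfolding linear_subspace_def by blast
 have "AE g in completion \<mu>. cform r g (%_. 0) = 0"
  unfolding AE_completion_iff using AE_closable[of r]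
 proof eventually_elim
  case (elim g)
  interpret q: closable_quadratic_form "\<nu> r g" "pre_form (B r) (\<nu> r g)" "pre_dom (B r) (\<nu> r g)" by (rule elim)
  show ?case using q.cl.E_0 by (simp add: cond_form_def cond_fun_def)
 qed
 then show "Tr r (%_. 0) = 0" unfolding trunc_pre_form_def using core_props(2)[OF z] by (simp add: nn_integral_0_iff_AE)
 fix u assume u: "u \<in> C r"
 show "Tr r u < \<infinity>" by (rule core_props(3)[OF u])
 fix v assume v: "v \<in> C r"
 show "(%x. u x - v x) \<in> C r" by (rule core_diff[OF u v])
 show "Tr r (%x. u x - v x) \<le> ennreal (1 + d) * Tr r u + ennreal (1 + 1 / d) * Tr r v" if "d > 0" for d
  by (rule integrated_quadratic[OF core_props(2)[OF u] core_props(2)[OF v] core_props(1)[OF u] core_props(1)[OF v] that])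
qed

lemma measurable_limit:
 fixes f :: "nat => 'a config => ennreal"
 assumes m: "\<And>j. f j \<in> borel_measurable (completion \<mu>)" and l: "AE c in \<mu>. (%j. f j c) \<longlonglongrightarrow> g c"
 shows "g \<in> borel_measurable (completion \<mu>)"
proof (rule measurable_completion_AE)
 show "(%c. liminf (%j. f j c)) \<in> borel_measurable (completion \<mu>)" using m by measurable
 show "AE c in \<mu>. g c = liminf (%j. f j c)"
  using l by eventually_elim (simp add: lim_imp_Liminf)
qed

text \<open>Along a fast subsequence, for almost every outer configuration the conditioned functions
  are Cauchy for the conditioned form and converge in L2; completeness of the closed conditioned
  form puts the limit in its domain. Fatou's lemma and the interpolation inequality then identify
  the limit of the truncated forms with the integral formula for \<open>u\<close> itself.\<close>

lemma representation:
 assumes u: "u \<in> l2_space \<mu>" and ap: "form_approx \<mu> (Tr r) (C r) un u"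
 shows "AE c in \<mu>. cond_fun B r c u \<in> cond_dom (B r) (\<nu> r c)"
  "(%c. cform r c u) \<in> borel_measurable (completion \<mu>)"
  "(%n. Tr r (un n)) \<longlonglongrightarrow> Tr r u" "Tr r u < \<infinity>"
proof -
 interpret core: quadratic_form \<mu> "Tr r" "C r" by (rule quadratic_form.intro[OF core_quadratic])
 have un: "\<And>n. un n \<in> C r" and ca: "form_Cauchy (Tr r) un" and l2: "(%n. l2_sq \<mu> (%x. un n x - u x)) \<longlonglongrightarrow> 0"
  using ap by (auto simp: form_approx_def)
 have um: "u \<in> borel_measurable (completion \<mu>)" using u by (simp add: l2_space_def)
 have "\<exists>N. \<forall>m\<ge>N. (\<forall>n\<ge>N. Tr r (%x. un m x - un n x) < ennreal ((1 / 16) ^ j)) \<and> l2_sq \<mu> (%x. un m x - u x) < ennreal ((1 / 16) ^ j)" for j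
 proof -
  have e: "(0 :: real) < (1 / 16) ^ j" by simp
  obtain N1 where N1: "\<forall>m\<ge>N1. \<forall>n\<ge>N1. Tr r (%x. un m x - un n x) < ennreal ((1 / 16) ^ j)"
   using ca e unfolding form_Cauchy_def by blast
  have "\<forall>\<^sub>F n in sequentially. l2_sq \<mu> (%x. un n x - u x) < ennreal ((1 / 16) ^ j)"
   by (rule order_tendstoD(2)[OF l2]) (simp add: e)
  then obtain N2 where N2: "\<forall>n\<ge>N2. l2_sq \<mu> (%x. un n x - u x) < ennreal ((1 / 16) ^ j)" unfolding eventually_sequentially by blast
  show ?thesis using N1 N2 by (intro exI[of _ "max N1 N2"]) auto
 qed
 then obtain N where N: "\<And>j m. N j \<le> m ==> (\<forall>n\<ge>N j. Tr r (%x. un m x - un n x) < ennreal ((1 / 16) ^ j)) \<and> l2_sq \<mu> (%x. un m x - u x) < ennreal ((1 / 16) ^ j)"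
  by metis
 \<comment> \<open>Adding up the thresholds makes \<open>h\<close> monotone while it stays above
   every \<open>N j\<close>.\<close>
 define h where "h j = j + (\<Sum>i\<le>j. N i)" for j
 have h: "j \<le> h j" "N j \<le> h j" "h j \<le> h (Suc j)" for j
  by (auto simp: h_def intro!: trans_le_add2 member_le_sum)
 define v where "v j = un (h j)" for j
 have vC: "v j \<in> C r" for j unfolding v_def by (rule un)
 have vT: "Tr r (%x. v (Suc j) x - v j x) \<le> ennreal ((1 / 16) ^ j)" for j
  unfolding v_def using N[of j "h (Suc j)"] h[of j] by (auto intro: less_imp_le)
 have vl: "l2_sq \<mu> (%x. v j x - u x) \<le> ennreal ((1 / 16) ^ j)" for j
  unfolding v_def using N[of j "h j"] h[of j] by (auto intro: less_imp_le)
 have "AE c in completion \<mu>. \<forall>\<^sub>F j in sequentially. cform r c (%x. v (Suc j) x - v j x) \<le> ennreal ((1 / 4) ^ j)"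
 proof (rule tendsto_0_of_nn_integral_sum)
  fix j
  show "(%c. cform r c (%x. v (Suc j) x - v j x)) \<in> borel_measurable (completion \<mu>)" by (rule core_props(2)[OF core_diff[OF vC vC]])
  show "(\<integral>\<^sup>+ c. cform r c (%x. v (Suc j) x - v j x) \<partial>completion \<mu>) \<le> ennreal ((1 / 16) ^ j)"
   using vT unfolding trunc_pre_form_def .
 qed
 then have ev1: "AE c in \<mu>. \<forall>\<^sub>F j in sequentially. cform r c (%x. v (Suc j) x - v j x) \<le> ennreal ((1 / 4) ^ j)"
  unfolding AE_completion_iff .
 have "\<exists>g. g \<in> borel_measurable borel \<and> (AE c in \<mu>. l2_sq (\<nu> r c) (cond_fun B r c (%x. v j x - u x)) = g c) \<and> (\<integral>\<^sup>+ c. g c \<partial>\<mu>) = l2_sq \<mu> (%x. v j x - u x)" for j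
 proof -
  have m: "(%x. v j x - u x) \<in> borel_measurable (completion \<mu>)" using core_props(6)[OF vC] um by (rule borel_measurable_diff)
  show ?thesis by (rule l2_disint[OF m, of r]) blast
 qed
 then have "\<forall>j. \<exists>g. g \<in> borel_measurable borel \<and> (AE c in \<mu>. l2_sq (\<nu> r c) (cond_fun B r c (%x. v j x - u x)) = g c) \<and> (\<integral>\<^sup>+ c. g c \<partial>\<mu>) = l2_sq \<mu> (%x. v j x - u x)" by blast
 from choice[OF this] obtain g where g: "\<And>j. g j \<in> borel_measurable borel" "\<And>j. AE c in \<mu>. l2_sq (\<nu> r c) (cond_fun B r c (%x. v j x - u x)) = g j c"
  "\<And>j. (\<integral>\<^sup>+ c. g j c \<partial>\<mu>) = l2_sq \<mu> (%x. v j x - u x)" by blast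
 have ev2: "AE c in \<mu>. \<forall>\<^sub>F j in sequentially. g j c \<le> ennreal ((1 / 4) ^ j)"
  by (rule tendsto_0_of_nn_integral_sum) (use g vl in simp_all)
 obtain g0 where g0: "g0 \<in> borel_measurable borel" "AE c in \<mu>. l2_sq (\<nu> r c) (cond_fun B r c u) = g0 c" "(\<integral>\<^sup>+ c. g0 c \<partial>\<mu>) = l2_sq \<mu> u"
  by (rule l2_disint[OF um, of r])
 have g0f: "AE c in \<mu>. g0 c \<noteq> \<infinity>"
  by (rule nn_integral_PInf_AE) (use g0 u in \<open>simp_all add: l2_space_def less_top\<close>)
 have AEd: "AE c in \<mu>. \<forall>n. cond_fun B r c (un n) \<in> cond_dom (B r) (\<nu> r c)"
  unfolding AE_all_countable using core_props(1)[OF un] by blast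
 have AEg: "AE c in \<mu>. \<forall>j. l2_sq (\<nu> r c) (cond_fun B r c (%x. v j x - u x)) = g j c"
  unfolding AE_all_countable using g(2) by blast
 have main: "AE c in \<mu>. cond_fun B r c u \<in> cond_dom (B r) (\<nu> r c) \<and> (%j. cform r c (v j)) \<longlonglongrightarrow> cform r c u \<and>
   (\<forall>m. cond_fun B r c (%x. u x - un m x) \<in> cond_dom (B r) (\<nu> r c) \<and> (%j. cform r c (%x. v j x - un m x)) \<longlonglongrightarrow> cform r c (%x. u x - un m x))"
  using AE_closable[of r] ev1 ev2 g0(2) g0f AEd AEg cond_fun_measurable[OF um, of r]
 proof eventually_elim
  case (elim c)
  interpret q: closable_quadratic_form "\<nu> r c" "pre_form (B r) (\<nu> r c)" "pre_dom (B r) (\<nu> r c)" by (rule elim(1))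
  let ?w = "%j. cond_fun B r c (v j)" and ?u = "cond_fun B r c u"
  have w: "?w j \<in> q.C" for j using elim(6) unfolding v_def cond_dom_def by blast
  have wca: "form_Cauchy q.EC ?w"
   by (rule q.cl.Cauchy_of_geometric[OF w]) (use elim(2) in \<open>simp only: cond_fun_diff cond_form_def\<close>)
  have ul: "?u \<in> l2_space (\<nu> r c)" using elim(4,5,8) by (simp add: l2_space_def less_top)
  have wl: "(%j. l2_sq (\<nu> r c) (%x. ?w j x - ?u x)) \<longlonglongrightarrow> 0"
  proof (rule tendsto_sandwich[OF _ _ tendsto_const])
   show "\<forall>\<^sub>F j in sequentially. l2_sq (\<nu> r c) (%x. ?w j x - ?u x) \<le> ennreal ((1 / 4) ^ j)"
    using elim(3) by eventually_elim (use elim(7) in \<open>simp only: cond_fun_diff\<close>)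
   have "(%j. ennreal ((1 / 4) ^ j)) \<longlonglongrightarrow> ennreal 0" by (intro tendsto_ennrealI LIMSEQ_power_zero) simp
   then show "(%j. ennreal ((1 / 4) ^ j)) \<longlonglongrightarrow> 0" by simp
  qed simp
  note cc = q.closure_complete[OF w wca ul wl]
  have d: "(%x. ?u x - cond_fun B r c (un m) x) \<in> q.C" for m
   using q.cl.D_diff[OF cc(1)] elim(6) unfolding cond_dom_def by blast
  have "(%j. q.EC (%x. ?w j x - cond_fun B r c (un m) x)) \<longlonglongrightarrow> q.EC (%x. ?u x - cond_fun B r c (un m) x)" for m
  proof (rule q.cl.E_tendsto[OF _ d])
   show "(%x. ?w j x - cond_fun B r c (un m) x) \<in> q.C" for j
    using q.cl.D_diff[OF w] elim(6) unfolding cond_dom_def by blast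
   show "(%j. q.EC (%x. ?w j x - cond_fun B r c (un m) x - (?u x - cond_fun B r c (un m) x))) \<longlonglongrightarrow> 0"
    using cc(2) by simp
  qed
  moreover have "(%j. q.EC (?w j)) \<longlonglongrightarrow> q.EC ?u" by (rule q.cl.E_tendsto[OF w cc])
  ultimately show ?case using cc(1) d unfolding cond_fun_diff cond_form_def cond_dom_def by blast
 qed
 show du: "AE c in \<mu>. cond_fun B r c u \<in> cond_dom (B r) (\<nu> r c)" using main by eventually_elim blast
 have limu: "AE c in \<mu>. (%j. cform r c (v j)) \<longlonglongrightarrow> cform r c u" using main by eventually_elim blast
 show mu: "(%c. cform r c u) \<in> borel_measurable (completion \<mu>)"
  by (rule measurable_limit[OF core_props(2)[OF vC] limu])
 have limd: "AE c in \<mu>. (%j. cform r c (%x. v j x - un m x)) \<longlonglongrightarrow> cform r c (%x. u x - un m x)" for m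
  using main by eventually_elim blast
 have md: "(%c. cform r c (%x. u x - un m x)) \<in> borel_measurable (completion \<mu>)" for m
  by (rule measurable_limit[OF core_props(2)[OF core_diff[OF vC un]] limd])
 have dd: "AE c in \<mu>. cond_fun B r c (%x. u x - un m x) \<in> cond_dom (B r) (\<nu> r c)" for m
  using main by eventually_elim blast
 \<comment> \<open>Applied twice: to \<open>v j - un m\<close>, where the Cauchy bound gives
   convergence in the integrated form, and to \<open>v j\<close>, where it gives one half of the
   value at \<open>u\<close>.\<close>
 have fatou: "Tr r w \<le> liminf (%j. Tr r (wn j))"
  if m: "\<And>j. (%c. cform r c (wn j)) \<in> borel_measurable (completion \<mu>)" and l: "AE c in \<mu>. (%j. cform r c (wn j)) \<longlonglongrightarrow> cform r c w" for w wn
 proof -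
  have "Tr r w = (\<integral>\<^sup>+ c. liminf (%j. cform r c (wn j)) \<partial>completion \<mu>)"
   unfolding trunc_pre_form_def
  proof (rule nn_integral_cong_AE, unfold AE_completion_iff)
   show "AE c in \<mu>. cform r c w = liminf (%j. cform r c (wn j))" using l by eventually_elim (simp add: lim_imp_Liminf)
  qed
  also have "\<dots> \<le> liminf (%j. Tr r (wn j))" unfolding trunc_pre_form_def by (rule nn_integral_liminf[OF m])
  finally show ?thesis .
 qed
 have T0: "(%m. Tr r (%x. u x - un m x)) \<longlonglongrightarrow> 0"
 proof (rule tendsto_0_ennrealI)
  fix e :: real assume e: "e > 0"
  obtain M where M: "\<And>m n. m \<ge> M ==> n \<ge> M ==> Tr r (%x. un m x - un n x) < ennreal e"
   using ca e unfolding form_Cauchy_def by blast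
  have "Tr r (%x. u x - un m x) \<le> ennreal e" if m: "m \<ge> M" for m
  proof -
   have "Tr r (%x. u x - un m x) \<le> liminf (%j. Tr r (%x. v j x - un m x))"
    by (rule fatou[OF core_props(2)[OF core_diff[OF vC un]] limd])
   also have "\<dots> \<le> liminf (%j :: nat. ennreal e)"
   proof (rule Liminf_mono)
    show "\<forall>\<^sub>F j in sequentially. Tr r (%x. v j x - un m x) \<le> ennreal e"
     using eventually_ge_at_top[of M]
    proof eventually_elim
     case (elim j)
     then have "M \<le> h j" using h(1)[of j] by simp
     from M[OF this m] show ?case unfolding v_def by (rule less_imp_le)
    qed
   qed
   also have "\<dots> = ennreal e" by (simp add: Liminf_const)
   finally show ?thesis .
  qed
  then show "\<exists>N. \<forall>n\<ge>N. Tr r (%x. u x - un n x) \<le> ennreal e" by blast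
 qed
 obtain l where l: "(%n. Tr r (un n)) \<longlonglongrightarrow> ennreal (l\<^sup>2)" using core.Cauchy_convergent[OF un ca] by metis
 have le: "Tr r u \<le> ennreal (l\<^sup>2)"
 proof -
  have "filterlim h sequentially sequentially"
   by (rule filterlim_at_top_mono[OF filterlim_ident]) (use h(1) in simp)
  from filterlim_compose[OF l this] have "(%j. Tr r (v j)) \<longlonglongrightarrow> ennreal (l\<^sup>2)" unfolding v_def .
  then have "liminf (%j. Tr r (v j)) = ennreal (l\<^sup>2)" by (intro lim_imp_Liminf) simp_all
  with fatou[OF core_props(2)[OF vC] limu] show ?thesis by simp
 qed
 then show fin: "Tr r u < \<infinity>" by (simp add: order_le_less_trans)
 define t where "t = enn2real (Tr r u)"
 have t: "Tr r u = ennreal t" "0 \<le> t" using fin by (simp_all add: t_def less_top)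
 \<comment> \<open>The other half: write \<open>un m\<close> as \<open>u - (u - un m)\<close> and
   use that the form of the second term tends to 0. Letting \<open>e\<close> tend to 0 leaves the
   bound by \<open>t\<close>.\<close>
 have bd: "l\<^sup>2 \<le> (1 + e) * t" if e: "e > 0" for e
 proof -
  have "Tr r (un m) \<le> ennreal (1 + e) * Tr r u + ennreal (1 + 1 / e) * Tr r (%x. u x - un m x)" for m
   using integrated_quadratic[OF mu md du dd e, of m] by simp
  moreover have "(%m. ennreal (1 + e) * Tr r u + ennreal (1 + 1 / e) * Tr r (%x. u x - un m x)) \<longlonglongrightarrow> ennreal (1 + e) * Tr r u + ennreal (1 + 1 / e) * 0"
   by (intro tendsto_add tendsto_const ennreal_tendsto_cmult T0) simp
  ultimately have "ennreal (l\<^sup>2) \<le> ennreal (1 + e) * Tr r u + ennreal (1 + 1 / e) * 0"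
   by (intro LIMSEQ_le[OF l]) blast+
  then have "ennreal (l\<^sup>2) \<le> ennreal ((1 + e) * t)" using e t by (simp add: ennreal_mult)
  then show ?thesis using e t by (subst (asm) ennreal_le_iff) simp_all
 qed
 have "l\<^sup>2 \<le> t"
 proof (rule field_le_epsilon)
  fix e :: real assume e: "0 < e"
  have "l\<^sup>2 \<le> (1 + e / (t + 1)) * t" using e t by (intro bd) simp
  also have "\<dots> = t + e * (t / (t + 1))" by (simp add: algebra_simps)
  also have "\<dots> \<le> t + e * 1" using e t by (intro add_left_mono mult_left_mono) simp_all
  finally show "l\<^sup>2 \<le> t + e" by simp
 qed
 then have "Tr r u = ennreal (l\<^sup>2)" using le t by (simp add: antisym ennreal_leI)
 then show "(%n. Tr r (un n)) \<longlonglongrightarrow> Tr r u" using l by simp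
qed

text \<open>All approximating sequences have limit \<open>Tr r u\<close> by
  \<open>representation\<close>, so the value described by \<open>THE\<close> is the integral of the
  closed conditioned forms on the entire domain.\<close>

lemma trunc_dom_props:
 assumes u: "u \<in> trunc_dom B \<mu> \<kappa> C r"
 shows "trunc_form B \<mu> \<kappa> C r u = Tr r u" "AE g in \<mu>. cond_fun B r g u \<in> cond_dom (B r) (\<nu> r g)"
  "(%g. cform r g u) \<in> borel_measurable (completion \<mu>)"
proof -
 have ul: "u \<in> l2_space \<mu>" using u by (simp add: trunc_dom_def closure_dom_def)
 obtain un where un: "form_approx \<mu> (Tr r) (C r) un u" using u unfolding trunc_dom_def closure_dom_def by blast
 show "AE g in \<mu>. cond_fun B r g u \<in> cond_dom (B r) (\<nu> r g)" "(%g. cform r g u) \<in> borel_measurable (completion \<mu>)"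
  using representation(1,2)[OF ul un] by blast+
 show "trunc_form B \<mu> \<kappa> C r u = Tr r u" unfolding trunc_form_def closure_form_def
 proof (rule the_equality)
  show "\<exists>un. form_approx \<mu> (Tr r) (C r) un u \<and> (%n. Tr r (un n)) \<longlonglongrightarrow> Tr r u" using un representation(3)[OF ul un] by blast
  fix l assume "\<exists>un. form_approx \<mu> (Tr r) (C r) un u \<and> (%n. Tr r (un n)) \<longlonglongrightarrow> l"
  then obtain vn where "form_approx \<mu> (Tr r) (C r) vn u" "(%n. Tr r (vn n)) \<longlonglongrightarrow> l" by blast
  then show "l = Tr r u" using representation(3)[OF ul] LIMSEQ_unique by blast
 qed
qed

lemma core_form_mono: assumes "r \<le> r'" "u \<in> C r'" shows "Tr r u \<le> Tr r' u"
proof -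
 have u: "u \<in> C r" using core_mono[OF assms(1)] assms(2) by blast
 have "AE g in completion \<mu>. ennreal (trunc_square_field B \<mu> r u g) \<le> ennreal (trunc_square_field B \<mu> r' u g)"
  unfolding AE_completion_iff using trunc_square_field_mono[OF cac assms(1) core_props(5)[OF u] core_props(5)[OF assms(2)]]
  by eventually_elim (rule ennreal_leI)
 then show ?thesis unfolding core_props(4)[OF u] core_props(4)[OF assms(2)] by (rule nn_integral_mono_AE)
qed

text \<open>On the cores the form increases with the ball, so an approximating sequence for the
  larger ball is one for the smaller ball as well, and the inequality passes to the limits.\<close>

lemma trunc_form_mono:
 assumes rr: "r \<le> r'" and u: "u \<in> trunc_dom B \<mu> \<kappa> C r" "u \<in> trunc_dom B \<mu> \<kappa> C r'"
 shows "trunc_form B \<mu> \<kappa> C r u \<le> trunc_form B \<mu> \<kappa> C r' u"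
proof -
 have ul: "u \<in> l2_space \<mu>" using u by (simp add: trunc_dom_def closure_dom_def)
 obtain un where un: "form_approx \<mu> (Tr r') (C r') un u" using u(2) unfolding trunc_dom_def closure_dom_def by blast
 have unC: "un n \<in> C r'" for n using un by (simp add: form_approx_def)
 have "form_Cauchy (Tr r) un" unfolding form_Cauchy_def
 proof (intro allI impI)
  fix e :: real assume "0 < e"
  then obtain N where N: "\<forall>m\<ge>N. \<forall>n\<ge>N. Tr r' (%x. un m x - un n x) < ennreal e"
   using un unfolding form_approx_def form_Cauchy_def by blast
  then show "\<exists>N. \<forall>m\<ge>N. \<forall>n\<ge>N. Tr r (%x. un m x - un n x) < ennreal e"
   using core_form_mono[OF rr core_diff[OF unC unC]] by (meson order_le_less_trans)
 qed
 then have un': "form_approx \<mu> (Tr r) (C r) un u"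
  using un core_mono[OF rr] unfolding form_approx_def by blast
 have "Tr r u \<le> Tr r' u"
  by (rule LIMSEQ_le[OF representation(3)[OF ul un'] representation(3)[OF ul un]]) (use core_form_mono[OF rr unC] in blast)
 then show ?thesis by (simp only: trunc_dom_props(1)[OF u(1)] trunc_dom_props(1)[OF u(2)])
qed

text \<open>Monotonicity makes the limit a supremum, hence each truncated form vanishes along with
  it.\<close>

lemma trunc_form_zero:
 assumes u: "u \<in> limit_dom B \<mu> \<kappa> C" and z: "limit_form B \<mu> \<kappa> C u = 0"
 shows "Tr r u = 0"
proof -
 have d: "u \<in> trunc_dom B \<mu> \<kappa> C r" for r using u by (simp add: limit_dom_def)
 have inc: "incseq (%r. trunc_form B \<mu> \<kappa> C r u)" unfolding incseq_def using trunc_form_mono d by blast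
 have "(%r. trunc_form B \<mu> \<kappa> C r u) \<longlonglongrightarrow> (SUP r. trunc_form B \<mu> \<kappa> C r u)" by (rule LIMSEQ_SUP[OF inc])
 moreover from limI[OF this] have "(SUP r. trunc_form B \<mu> \<kappa> C r u) = 0" using z by (simp add: limit_form_def)
 ultimately have "trunc_form B \<mu> \<kappa> C r u \<le> 0" using SUP_upper[of r UNIV "%r. trunc_form B \<mu> \<kappa> C r u"] by simp
 then show ?thesis using trunc_dom_props(1)[OF d[of r]] by simp
qed

end

section \<open>Irreducibility and tail triviality\<close>

text \<open>The constant is the supremum of the thresholds \<open>t\<close> that \<open>u\<close>
  exceeds almost surely; just above it the zero-one alternative forces the opposite
  inequality.\<close>

lemma (in prob_space) zero_one_constant:
 fixes u :: "'a => real"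
 assumes zo: "\<And>t. (AE x in M. t < u x) \<or> (AE x in M. \<not> t < u x)"
 shows "\<exists>c. AE x in M. u x = c"
proof -
 define T where "T = {t. AE x in M. t < u x}"
 have down: "s \<in> T" if "t \<in> T" "s \<le> t" for s t using that unfolding T_def by (auto elim!: eventually_mono)
 have "\<exists>n :: nat. - real n \<in> T"
 proof (rule ccontr)
  assume "\<not> ?thesis"
  then have "AE x in M. \<not> - real n < u x" for n :: nat using zo[of "- real n"] by (auto simp: T_def)
  then have "AE x in M. \<forall>n :: nat. \<not> - real n < u x" by (subst AE_all_countable) blast
  then have "AE x in M. False" by eventually_elim (metis minus_less_iff reals_Archimedean2)
  then show False by simp
 qed
 then have ne: "T \<noteq> {}" by blast
 have "\<exists>n :: nat. real n \<notin> T"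
 proof (rule ccontr)
  assume "\<not> ?thesis"
  then have "AE x in M. real n < u x" for n :: nat by (auto simp: T_def)
  then have "AE x in M. \<forall>n :: nat. real n < u x" by (subst AE_all_countable) blast
  then have "AE x in M. False" by eventually_elim (metis less_asym reals_Archimedean2)
  then show False by simp
 qed
 then obtain n0 :: nat where n0: "real n0 \<notin> T" by blast
 have bdd: "bdd_above T" 
 proof (rule bdd_aboveI[of _ "real n0"])
  fix t assume "t \<in> T"
  then show "t \<le> real n0" using down[of t "real n0"] n0 by (cases "real n0 \<le> t") auto
 qed
 define c where "c = Sup T"
 have "AE x in M. \<bar>u x - c\<bar> \<le> 1 / real (Suc n)" for n
 proof -
  have "c - 1 / real (Suc n) < Sup T" by (simp add: c_def)
  then obtain t where "t \<in> T" "c - 1 / real (Suc n) < t" using less_cSupD[OF ne] by blast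
  then have l: "AE x in M. c - 1 / real (Suc n) < u x" using down[of t "c - 1 / real (Suc n)"] by (simp add: T_def)
  have "c + 1 / real (Suc n) \<notin> T"
  proof
   assume "c + 1 / real (Suc n) \<in> T"
   from cSup_upper[OF this bdd] have "1 / real (Suc n) \<le> 0" by (simp add: c_def)
   then show False by (simp add: field_simps)
  qed
  then have "AE x in M. \<not> c + 1 / real (Suc n) < u x" using zo[of "c + 1 / real (Suc n)"] by (auto simp: T_def)
  with l show ?thesis by eventually_elim linarith
 qed
 then have "AE x in M. \<forall>n. \<bar>u x - c\<bar> \<le> 1 / real (Suc n)" by (subst AE_all_countable) blast
 then have "AE x in M. u x = c"
 proof eventually_elim
  case (elim x)
  show ?case
  proof (rule ccontr)
   assume "u x \<noteq> c"
   then have "0 < \<bar>u x - c\<bar>" by simp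
   then obtain n where "inverse (real (Suc n)) < \<bar>u x - c\<bar>" using reals_Archimedean by blast
   then show False using elim[rule_format, of n] by (simp add: inverse_eq_divide)
  qed
 qed
 then show ?thesis ..
qed

context conditioned
begin

lemma AE_cond_iff_kernel:
 assumes so: "AE g in \<kappa> r c. restr (- B r) g = restr (- B r) c" and S: "S \<in> sets borel"
 shows "(AE w in \<nu> r c. config_add w (restr (- B r) c) \<in> S) \<longleftrightarrow> (AE g in \<kappa> r c. g \<in> S)"
proof -
 have S': "- S \<in> sets borel" using S by auto
 let ?T = "{w. config_add w (restr (- B r) c) \<in> - S}"
 have T: "?T \<in> sets borel" using measurable_sets[OF measurable_glue[of "restr (- B r) c"] S'] by (simp add: vimage_def)
 have "(AE w in \<nu> r c. config_add w (restr (- B r) c) \<in> S) \<longleftrightarrow> emeasure (\<nu> r c) ?T = 0"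
  using AE_iff_null_sets[of ?T "\<nu> r c"] T by (simp add: null_sets_def)
 also have "\<dots> \<longleftrightarrow> emeasure (\<kappa> r c) (- S) = 0" by (simp only: emeasure_cond[OF so S'])
 also have "\<dots> \<longleftrightarrow> (AE g in \<kappa> r c. g \<in> S)"
  using AE_iff_null_sets[of "- S" "\<kappa> r c"] S' by (simp add: null_sets_def)
 finally show ?thesis .
qed

text \<open>Kernel-almost every configuration lies in the rigid set and has the outer part of
  \<open>w\<close>. Any one such configuration fixes the number of points for all the
  others.\<close>

lemma AE_kernel_rigid:
 assumes "number_rigid \<mu>"
 shows "AE w in \<mu>. \<exists>k :: nat. AE c in \<kappa> r w. cnt c (B r) = of_nat k"
proof -
 note Bp = exhaustion_sets[OF exh]
 obtain v where v: "v \<in> sets \<mu>" "emeasure \<mu> v = 1"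
  and eq: "\<And>c w. c \<in> v ==> w \<in> v ==> restr (- B r) c = restr (- B r) w ==> cnt c (B r) = cnt w (B r)"
  using assms Bp(1,2)[of r] unfolding number_rigid_def by metis
 have "AE c in \<mu>. c \<in> v" by (rule AE_prob_1) (simp add: v measure_def)
 from AE_kernel[OF this, of r] AE_same_outside[of r] show ?thesis
 proof eventually_elim
  case (elim w)
  have "\<exists>\<gamma>0. \<gamma>0 \<in> v \<and> restr (- B r) \<gamma>0 = restr (- B r) w"
  proof (rule ccontr)
   assume n: "\<not> ?thesis"
   have "AE c in \<kappa> r w. False" using elim by eventually_elim (use n in blast)
   then show False using prob_space.AE_False[OF prob_kernel] by blast
  qed
  then obtain \<gamma>0 where g: "\<gamma>0 \<in> v" "restr (- B r) \<gamma>0 = restr (- B r) w" by blast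
  obtain k x where "restr (B r) \<gamma>0 = pts k x" and k: "cnt \<gamma>0 (B r) = of_nat k"
   using restr_finite_pts[OF Bp(1) cnt_bounded_finite[OF Bp(2)], of r \<gamma>0] by metis
  have "AE c in \<kappa> r w. cnt c (B r) = of_nat k"
   using elim by eventually_elim (use eq[OF g(1)] g(2) k in metis)
  then show ?case by blast
 qed
qed

text \<open>Given the outside, a level set of \<open>u\<close> has probability 0 or 1. It therefore
  equals an event of each outer algebra up to a null set, and tail triviality decides its
  measure.\<close>

lemma conditionally_constant_is_constant:
 assumes tt: "tail_trivial B \<mu>" and u [measurable]: "u \<in> borel_measurable borel"
  and const: "\<And>r. AE v in \<mu>. \<exists>c :: real. AE w in \<kappa> r v. u w = c"
 shows "\<exists>c. AE w in \<mu>. u w = c"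
proof (rule zero_one_constant)
 fix t :: real
 let ?A = "{w. t < u w}"
 have "{w \<in> space borel. t < u w} \<in> sets borel" by measurable
 then have A: "?A \<in> sets borel" by simp
 have zo: "AE v in \<mu>. emeasure (\<kappa> r v) ?A = 0 \<or> emeasure (\<kappa> r v) (- ?A) = 0" for r
  using const[of r]
 proof eventually_elim
  case (elim v)
  then obtain c where c: "AE w in \<kappa> r v. u w = c" by blast
  show ?case
  proof (cases "t < c")
   case True
   have "AE w in \<kappa> r v. w \<notin> - ?A" using c by eventually_elim (use True in simp)
   then show ?thesis using AE_iff_null_sets[of "- ?A" "\<kappa> r v"] sets.compl_sets[OF A] by (simp add: null_sets_def Compl_eq_Diff_UNIV)
  next
   case False
   have "AE w in \<kappa> r v. w \<notin> ?A" using c by eventually_elim (use False in simp)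
   then show ?thesis using AE_iff_null_sets[of ?A "\<kappa> r v"] A by (simp add: null_sets_def)
  qed
 qed
 define S where "S r = {v. emeasure (\<kappa> r v) ?A \<noteq> 0}" for r
 have S: "S r \<in> sets (outside_algebra B r)" for r
 proof -
  have "{v \<in> space (outside_algebra B r). emeasure (\<kappa> r v) ?A \<noteq> 0} \<in> sets (outside_algebra B r)"
   using kernel_emeasure_measurable[OF A, of r] by measurable
  then show ?thesis by (simp add: S_def)
 qed
 have S': "- S r \<in> sets (outside_algebra B r)" for r using sets.compl_sets[OF S[of r]] by (simp add: Compl_eq_Diff_UNIV)
 have A': "- ?A \<in> sets borel" using A by (rule borel_comp)
 have AS: "AE w in \<mu>. w \<in> ?A \<longleftrightarrow> w \<in> S r" for r
 proof -
  have Sb: "S r \<in> sets borel" "- S r \<in> sets borel" using S S' outside_sub by blast+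
  have "emeasure \<mu> (?A \<inter> - S r) = (\<integral>\<^sup>+ v. emeasure (\<kappa> r v) ?A * indicator (- S r) v \<partial>\<mu>)" by (rule kernel_outside_int[OF A S'])
  also have "\<dots> = (\<integral>\<^sup>+ v. 0 \<partial>\<mu>)" by (rule nn_integral_cong) (simp add: S_def indicator_def)
  finally have 1: "?A \<inter> - S r \<in> null_sets \<mu>" using A Sb by (simp add: null_sets_def)
  have "emeasure \<mu> (- ?A \<inter> S r) = (\<integral>\<^sup>+ v. emeasure (\<kappa> r v) (- ?A) * indicator (S r) v \<partial>\<mu>)" by (rule kernel_outside_int[OF A' S])
  also have "\<dots> = (\<integral>\<^sup>+ v. 0 \<partial>\<mu>)"
   by (rule nn_integral_cong_AE) (use zo[of r] in eventually_elim, auto simp: S_def indicator_def)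
  finally have 2: "- ?A \<inter> S r \<in> null_sets \<mu>" using A' Sb by (simp add: null_sets_def)
  show ?thesis using AE_not_in[OF 1] AE_not_in[OF 2] by eventually_elim blast
 qed
 define Slim where "Slim = (\<Inter>s. \<Union>r\<in>{s..}. S r)"
 have "Slim \<in> sets (outside_algebra B m)" for m
 proof -
  have "Slim = (\<Inter>s. \<Union>r\<in>{max s m..}. S r)" unfolding Slim_def
  proof (intro set_eqI iffI INT_I)
   fix w s assume g: "w \<in> (\<Inter>s. \<Union>r\<in>{s..}. S r)"
   have "w \<in> (\<Union>r\<in>{max s m..}. S r)" by (rule INT_D[OF g UNIV_I])
   then show "w \<in> (\<Union>r\<in>{max s m..}. S r)" .
  next
   fix w s assume g: "w \<in> (\<Inter>s. \<Union>r\<in>{max s m..}. S r)"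
   have "w \<in> (\<Union>r\<in>{max s m..}. S r)" by (rule INT_D[OF g UNIV_I])
   then show "w \<in> (\<Union>r\<in>{s..}. S r)" by auto
  qed
  also have "\<dots> \<in> sets (outside_algebra B m)"
  proof (rule sets.countable_INT)
   show "range (%s. \<Union>r\<in>{max s m..}. S r) \<subseteq> sets (outside_algebra B m)"
   proof (rule image_subsetI)
    fix s
    have "S r \<in> sets (outside_algebra B m)" if "r \<in> {max s m..}" for r
     using outside_mono[of m r] S[of r] that by auto
    then show "(\<Union>r\<in>{max s m..}. S r) \<in> sets (outside_algebra B m)" by (intro sets.countable_UN') auto
   qed
  qed simp
  finally show ?thesis .
 qed
 note Slim = this
 then have "Slim \<in> (\<Inter>r. sets (outside_algebra B r))" by (rule INT_I)
 then have tail: "emeasure \<mu> Slim = 0 \<or> emeasure \<mu> Slim = 1" by (rule tt[unfolded tail_trivial_def, THEN bspec])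
 have Sb: "Slim \<in> sets \<mu>" using subsetD[OF outside_sub Slim[of 0]] by simp
 have "AE w in \<mu>. \<forall>r. w \<in> ?A \<longleftrightarrow> w \<in> S r" by (subst AE_all_countable) (use AS in blast)
 then have AI: "AE w in \<mu>. w \<in> ?A \<longleftrightarrow> w \<in> Slim" by eventually_elim (auto simp: Slim_def)
 from tail show "(AE w in \<mu>. t < u w) \<or> (AE w in \<mu>. \<not> t < u w)"
 proof
  assume "emeasure \<mu> Slim = 0"
  then have "AE w in \<mu>. w \<notin> Slim" using Sb by (intro AE_not_in) (simp add: null_sets_def)
  then have "AE w in \<mu>. \<not> t < u w" using AI by eventually_elim simp
  then show ?thesis ..
 next
  assume "emeasure \<mu> Slim = 1"
  then have "AE w in \<mu>. w \<in> Slim" by (intro AE_prob_1) (simp add: measure_def)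
  then have "AE w in \<mu>. t < u w" using AI by eventually_elim simp
  then show ?thesis ..
 qed
qed

end

context cored
begin

text \<open>(CI) yields a constant on each particle number separately, possibly a different one each
  time. Rigidity leaves a single particle number under the kernel, hence a single constant.\<close>

lemma AE_kernel_constant:
 assumes ci: "CI B \<mu> \<kappa>" and nr: "number_rigid \<mu>" and u: "u \<in> trunc_dom B \<mu> \<kappa> C r" and z: "Tr r u = 0"
  and u': "u' \<in> borel_measurable borel" "AE g in \<mu>. u g = u' g"
 shows "AE w in \<mu>. \<exists>c. AE g in \<kappa> r w. u' g = c"
proof -
 note Bp = exhaustion_sets[OF exh]
 have "AE w in completion \<mu>. cform r w u = 0"
  using z trunc_dom_props(3)[OF u] unfolding trunc_pre_form_def by (simp add: nn_integral_0_iff_AE)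
 then have c0: "AE w in \<mu>. cform r w u = 0" unfolding AE_completion_iff .
 have ci': "AE w in \<mu>. \<forall>k \<in> charged_numbers B \<kappa> r w. \<forall>u \<in> cond_dom (B r) (\<nu> r w).
    cond_form (B r) (\<nu> r w) u = 0 --> (\<exists>c. AE g in restr_k (\<nu> r w) (B r) k. u g = c)"
  using ci unfolding CI_def by blast
 show ?thesis using c0 ci' trunc_dom_props(2)[OF u] AE_kernel_rigid[OF nr, of r] AE_same_outside[of r] AE_cond[OF u'(2), of r]
 proof eventually_elim
  case (elim w)
  let ?h = "restr (- B r) w"
  interpret n: prob_space "\<nu> r w" by (rule prob_cond)
  obtain k :: nat where k: "AE g in \<kappa> r w. cnt g (B r) = of_nat k" using elim(4) by blast
  have "{g \<in> space borel. cnt g (B r) = of_nat k} \<in> sets borel" using measurable_cnt[OF Bp(1)[of r]] by measurable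
  then have kb: "{g. cnt g (B r) = of_nat k} \<in> sets borel" by simp
  have "AE v in \<nu> r w. config_add v ?h \<in> {g. cnt g (B r) = of_nat k}"
   by (subst AE_cond_iff_kernel[OF elim(5) kb]) (use k in simp)
  then have ak: "AE v in \<nu> r w. v \<in> kconfigs (B r) k"
   using cond_configs[of r w]
  proof eventually_elim
   case (elim v)
   then show ?case using Bp(1)[of r] by (simp add: kconfigs_def emeasure_config_add cnt_restr)
  qed
  have "emeasure (\<nu> r w) (kconfigs (B r) k) = 1"
   by (rule n.emeasure_eq_1_AE[OF _ ak]) (simp add: kconfigs_borel)
  then have "k \<in> charged_numbers B \<kappa> r w" by (simp add: charged_numbers_def)
  then obtain c where c: "AE v in restr_k (\<nu> r w) (B r) k. cond_fun B r w u v = c"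
   using elim(1,2,3) by blast
  have "AE v in \<nu> r w. 0 < (indicator (kconfigs (B r) k) v :: ennreal) --> cond_fun B r w u v = c"
   using c unfolding restr_k_def by (subst (asm) AE_density) (auto simp: kconfigs_borel intro!: borel_measurable_indicator)
  then have "AE v in \<nu> r w. config_add v ?h \<in> {g. u' g = c}"
   using ak elim(6) by eventually_elim (simp add: cond_fun_def)
  moreover have "{g \<in> space borel. u' g = c} \<in> sets borel" using u'(1) by measurable
  ultimately have "AE g in \<kappa> r w. g \<in> {g. u' g = c}"
   by (subst AE_cond_iff_kernel[OF elim(5), symmetric]) simp_all
  then show ?case by auto
 qed
qed

lemma irreducible_of_tail_trivial:
 assumes tt: "tail_trivial B \<mu>" and ci: "CI B \<mu> \<kappa>" and nr: "number_rigid \<mu>" and F: "F \<subseteq> limit_dom B \<mu> \<kappa> C"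
 shows "irreducible_form \<mu> (limit_form B \<mu> \<kappa> C) F"
 unfolding irreducible_form_def
proof (intro ballI impI)
 fix u assume "u \<in> F" and z: "limit_form B \<mu> \<kappa> C u = 0"
 then have ul: "u \<in> limit_dom B \<mu> \<kappa> C" using F by blast
 have d: "u \<in> trunc_dom B \<mu> \<kappa> C r" for r using ul by (simp add: limit_dom_def)
 have "u \<in> borel_measurable (completion \<mu>)" using d[of 0] by (simp add: trunc_dom_def closure_dom_def l2_space_def)
 then obtain u' where u': "u' \<in> borel_measurable \<mu>" "AE g in \<mu>. u g = u' g" using completion_ex_borel_measurable_real by blast
 have ub: "u' \<in> borel_measurable borel" using u'(1) by simp
 obtain c where c: "AE g in \<mu>. u' g = c"
  using conditionally_constant_is_constant[OF tt ub AE_kernel_constant[OF ci nr d trunc_form_zero[OF ul z] ub u'(2)]] by blast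
 have "AE g in \<mu>. u g = c" using u'(2) c by eventually_elim simp
 then show "\<exists>c. AE g in \<mu>. u g = c" ..
qed

lemma finite_distance_of_irreducible:
 assumes lip: "lip_b B \<mu> \<subseteq> F" and F: "F \<subseteq> limit_dom B \<mu> \<kappa> C" and irr: "irreducible_form \<mu> (limit_form B \<mu> \<kappa> C) F"
 shows "positive_sets_finite_distance B \<mu>"
proof (rule positive_sets_finite_distanceI)
 note Bp = exhaustion_sets[OF exh]
 fix p assume p: "p \<in> sets borel" "emeasure \<mu> p > 0"
 obtain V where V: "V \<in> sets borel" "emeasure \<mu> V > 0" "\<And>v. v \<in> V ==> \<exists>h\<in>p. dbar_config B v h < \<infinity>"
  "\<And>v \<gamma>'. dbar_config B v \<gamma>' < \<infinity> ==> v \<in> V \<longleftrightarrow> \<gamma>' \<in> V"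
  by (rule exists_dist_saturation[OF exh finite_measure_axioms sets_\<mu> p]) blast
 define u :: "'a config => real" where "u = indicator V"
 have uV: "u v = u \<gamma>'" if "dbar_config B v \<gamma>' < \<infinity>" for v \<gamma>' using V(4)[OF that] by (simp add: u_def indicator_def)
 \<comment> \<open>Pairs at infinite distance impose no constraint, and \<open>uV\<close> gives
   equal values at finite distance, so the constant 0 works.\<close>
 have "lipschitz_wrt (dbar_config B) UNIV 0 u"
  unfolding lipschitz_wrt_def using uV by (auto simp: less_top)
 moreover have "u \<in> borel_measurable (completion \<mu>)" unfolding u_def using V(1) by (intro measurable_completion) simp
 moreover have "\<forall>v. \<bar>u v\<bar> \<le> 1" by (simp add: u_def indicator_def)
 ultimately have "u \<in> lip_b B \<mu>" unfolding lip_b_def by blast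
 then have uF: "u \<in> F" and ul: "u \<in> limit_dom B \<mu> \<kappa> C" using lip F by blast+
 have "trunc_form B \<mu> \<kappa> C r u = 0" for r
 proof -
  have d: "u \<in> trunc_dom B \<mu> \<kappa> C r" using ul by (simp add: limit_dom_def)
  have "AE h in completion \<mu>. cform r h u = 0"
   unfolding AE_completion_iff using AE_closable[of r] AE_comparable[OF cac, of r]
  proof eventually_elim
   case (elim h)
   interpret q: closable_quadratic_form "\<nu> r h" "pre_form (B r) (\<nu> r h)" "pre_dom (B r) (\<nu> r h)" by (rule elim(1))
   let ?w = "cond_fun B r h u"
   have "\<exists>c. \<forall>v\<in>kconfigs (B r) k. ?w v = c" for k
   proof (cases "kconfigs (B r) k = {}")
    case False
    then obtain \<gamma>0 where g0: "\<gamma>0 \<in> kconfigs (B r) k" by blast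
    have "?w v = ?w \<gamma>0" if g: "v \<in> kconfigs (B r) k" for v
     unfolding cond_fun_def
    proof (rule uV, rule dbar_config_finite_same_outside[OF exh])
     have out: "cnt t (- B r \<inter> A) = 0" if "t \<in> kconfigs (B r) k" for t A
      using emeasure_mono[of "- B r \<inter> A" "- B r" "meas_of t"] that by (simp add: kconfigs_def configs_def)
     show "restr (- B r) (config_add v (restr (- B r) h)) = restr (- B r) (config_add \<gamma>0 (restr (- B r) h))"
     proof (rule config_eqI)
      fix A :: "'a set" assume A: "A \<in> sets borel"
      have m: "- B r \<inter> A \<in> sets borel" using A by (intro sets.Int) simp_all
      show "cnt (restr (- B r) (config_add v (restr (- B r) h))) A = cnt (restr (- B r) (config_add \<gamma>0 (restr (- B r) h))) A"
       using A by (simp add: cnt_restr emeasure_config_add[OF m] out[OF g] out[OF g0])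
     qed
     show "cnt (config_add v (restr (- B r) h)) (B r) = cnt (config_add \<gamma>0 (restr (- B r) h)) (B r)"
      using g g0 by (simp add: emeasure_config_add kconfigs_def)
    qed
    then show ?thesis by blast
   qed simp
   note const = this
   \<comment> \<open>Bounded and constant on components, the conditioned function lies in the
     pre-domain; there the closed form agrees with the pre-form, which is 0.\<close>
   have w: "?w \<in> pre_dom (B r) (\<nu> r h)"
    by (rule comparable.constant_components_D[OF elim(2) const, of 1]) (simp add: cond_fun_def u_def indicator_def)
   show ?case unfolding cond_form_def using q.D_closure(2)[OF w] comparable.constant_components(2)[OF elim(2) const] by simp
  qed
  then have "Tr r u = (\<integral>\<^sup>+ h. 0 \<partial>completion \<mu>)" unfolding trunc_pre_form_def by (rule nn_integral_cong_AE)
  then show ?thesis by (simp add: trunc_dom_props(1)[OF d])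
 qed
 then have "limit_form B \<mu> \<kappa> C u = 0" by (simp add: limit_form_def)
 then obtain c where c: "AE v in \<mu>. u v = c" using irr uF unfolding irreducible_form_def by blast
 have c1: "c = 1"
 proof (rule ccontr)
  assume "c \<noteq> 1"
  then have "AE v in \<mu>. v \<notin> V" using c by (auto simp: u_def elim!: eventually_mono)
  then show False using AE_iff_null_sets[of V \<mu>] V(1,2) by (simp add: null_sets_def)
 qed
 show "AE v in \<mu>. \<exists>h\<in>p. dbar_config B v h < \<infinity>"
  using c
 proof eventually_elim
  case (elim v)
  then have "v \<in> V" using c1 by (simp add: u_def indicator_def split: if_splits)
  then show ?case by (rule V(3))
 qed
qed

end

theorem theorem1:
  fixes B :: "nat \<Rightarrow> 'a::euclidean_space set" and \<mu> :: "'a config measure"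
  assumes "exhaustion B" and "prob_space \<mu>" and "sets \<mu> = sets borel"
  shows "(positive_sets_finite_distance B \<mu> \<longrightarrow> tail_trivial B \<mu>) \<and>
    (number_rigid \<mu> \<longrightarrow> tail_trivial B \<mu> \<longrightarrow> positive_sets_finite_distance B \<mu>) \<and>
    (\<forall>\<kappa> C F.
       cond_prob_kernels B \<mu> \<kappa> \<longrightarrow> CAC' B \<mu> \<kappa> \<longrightarrow> CC B \<mu> \<kappa> \<longrightarrow> core_system B \<mu> \<kappa> C \<longrightarrow>
       closed_markovian_subspace \<mu> (limit_form B \<mu> \<kappa> C) (limit_dom B \<mu> \<kappa> C) F \<longrightarrow>
       (CI B \<mu> \<kappa> \<longrightarrow> quasi_regular_dirichlet_form \<mu> (limit_form B \<mu> \<kappa> C) F \<longrightarrow> number_rigid \<mu> \<longrightarrow>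
          positive_sets_finite_distance B \<mu> \<longrightarrow> irreducible_form \<mu> (limit_form B \<mu> \<kappa> C) F) \<and>
       (rademacher B \<mu> \<kappa> C F \<longrightarrow>
          irreducible_form \<mu> (limit_form B \<mu> \<kappa> C) F \<longrightarrow> positive_sets_finite_distance B \<mu>))"
proof (intro conjI impI allI)
  show "tail_trivial B \<mu>" if "positive_sets_finite_distance B \<mu>"
    by (rule tail_trivial_of_finite_distance[OF assms(2,3) that])
  show "positive_sets_finite_distance B \<mu>" if "number_rigid \<mu>" "tail_trivial B \<mu>"
    by (rule finite_distance_of_tail_trivial[OF assms that])
  fix \<kappa> C F
  assume a: "cond_prob_kernels B \<mu> \<kappa>" "CAC' B \<mu> \<kappa>" "CC B \<mu> \<kappa>" "core_system B \<mu> \<kappa> C"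
    and F: "closed_markovian_subspace \<mu> (limit_form B \<mu> \<kappa> C) (limit_dom B \<mu> \<kappa> C) F"
  interpret cored B \<mu> \<kappa> C by (intro cored.intro conditioned.intro cored_axioms.intro assms a)
  have FD: "F \<subseteq> limit_dom B \<mu> \<kappa> C" using F by (simp add: closed_markovian_subspace_def)
  \<comment> \<open>Positive sets at finite distance enter through tail triviality, which the first
    part extracts from them.\<close>
  show "irreducible_form \<mu> (limit_form B \<mu> \<kappa> C) F"
    if "CI B \<mu> \<kappa>" "number_rigid \<mu>" "positive_sets_finite_distance B \<mu>"
    by (rule irreducible_of_tail_trivial[OF tail_trivial_of_finite_distance[OF assms(2,3) that(3)] that(1,2) FD])
  show "positive_sets_finite_distance B \<mu>"
    if "rademacher B \<mu> \<kappa> C F" "irreducible_form \<mu> (limit_form B \<mu> \<kappa> C) F"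
    using that by (intro finite_distance_of_irreducible[OF _ FD]) (simp_all add: rademacher_def)
qed

end
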